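(* Let $Q=(0,1)\times(0,T]$ with $T=1$. Let the data $b,f,g_L,g_R,\phi,\beta$ satisfy the standing assumptions listed in the context. Let $y$ be the solution of problem (Y) of the context, and let $Y$ be the solution of the finite difference scheme (D) of the context on the tensor-product Shishkin mesh $\bar Q^{N,M}$. Then there is a constant $C$, depending on the data but independent of $\varepsilon$, $N$ and $M$, such that $$\|y-Y\|_{\bar Q^{N,M}}:=\max_{(x_i,t_j)\in\bar Q^{N,M}}|y(x_i,t_j)-Y(x_i,t_j)|\le C\left(N^{-2}\max\{\ln^2 N,\ \ln M\}+M^{-1}\ln^2 M\right).$$
   Context: Function spaces. $C^{n+\gamma}(\bar Q)$ ($\gamma>0$) is the set of functions $z$ such that $\partial^{i+j}z/\partial x^i\partial t^j$ is Hölder continuous of degree $\gamma$ on $\bar Q$ for all $0\le i+2j\le n$. Standing assumptions. $0<\varepsilon\le 1$ is the singular perturbation parameter. $f,b\in C^{4+\gamma}(\bar Q)$, $g_L,g_R\in C^2[0,T]$, $\phi\in C^4[0,1]$. $b(x,t)>\beta>0$ on $\bar Q$ for a constant $\beta$, and $b_x(0,0)=0$. $\phi(0^+)\ne g_L(0)$ and $\phi(1^-)=g_R(0)$. At $(1,0)$ the following compatibility conditions hold for the values of $\varepsilon$ considered: $$\varepsilon(g_R'(0)-\phi''(1))+b(1,0)g_R(0)=f(1,0),$$ $$\varepsilon(g_R''(0)-\phi''''(1))+b(1,0)(g_R'(0)+\phi''(1))+b_t(1,0)g_R(0)+2b_x(1,0)\phi'(1)+b_{xx}(1,0)\phi(1)=(f_t+f_{xx})(1,0).$$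 Continuous problem. $Lz:=\varepsilon(z_t-z_{xx})+b(x,t)z$. The underlying problem is $Lu=f$ in $Q$, $u(0,t)=g_L(t)$, $u(1,t)=g_R(t)$ for $t\ge0$, $u(x,0)=\phi(x)$ for $0<x<1$. Put $A_0:=g_L(0)-\phi(0^+)$ and $$z_0(x,t):=e^{-b(0,0)t/\varepsilon}\,\mathrm{erfc}\!\left(\frac{x}{2\sqrt t}\right),\qquad \mathrm{erfc}(z)=\frac{2}{\sqrt\pi}\int_z^\infty e^{-s^2}ds,$$ with $z_0(x,0)=0$ for $x>0$. The function $y=u-A_0z_0$ is continuous on $\bar Q$ and solves problem (Y): $$Ly=f-A_0\,(b(x,t)-b(0,0))\,z_0(x,t)\ \text{ in }Q,$$ $$y(0,t)=g_L(t)-A_0e^{-b(0,0)t/\varepsilon},\quad y(1,t)=g_R(t)-A_0z_0(1,t)\ (t\ge0),\quad y(x,0)=\phi(x)\ (0<x<1).$$ Mesh. $\bar Q^{N,M}=\omega_x^N\times\omega_t^M$, with $N$ divisible by 4 and $M$ even. The space mesh $\omega_x^N=\{x_i\}_{i=0}^N$ is piecewise uniform on $[0,\sigma]\cup[\sigma,1-\sigma]\cup[1-\sigma,1]$ with $N/4,N/2,N/4$ mesh intervals respectively, where $\sigma=\min\{0.25,\,2\sqrt{\varepsilon/\beta}\,\ln N\}$. The time mesh $\omega_t^M=\{t_j\}_{j=0}^M$ is piecewise uniform on $[0,\tau]\cup[\tau,1]$ with $M/2$ mesh intervals in each part, where $\tau=\min\{0.5,\,(\varepsilon/\beta)\ln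 M\}$. $Q^{N,M}:=\bar Q^{N,M}\cap Q$ and $\partial Q^{N,M}:=\bar Q^{N,M}\setminus Q^{N,M}$. Scheme (D). With $h_i=x_i-x_{i-1}$, $\hbar_i=(h_{i+1}+h_i)/2$, $k_j=t_j-t_{j-1}$, $D_x^-Y(x_i,t_j)=(Y(x_i,t_j)-Y(x_{i-1},t_j))/h_i$, $D_x^+Y(x_i,t_j)=D_x^-Y(x_{i+1},t_j)$, $D_t^-Y(x_i,t_j)=(Y(x_i,t_j)-Y(x_i,t_{j-1}))/k_j$, $\delta_x^2Y(x_i,t_j)=(D_x^+-D_x^-)Y(x_i,t_j)/\hbar_i$: $$(\varepsilon D_t^--\varepsilon\delta_x^2+b(x_i,t_j))Y(x_i,t_j)=\big(f-A_0(b-b(0,0))z_0\big)(x_i,t_j),\quad (x_i,t_j)\in Q^{N,M},$$ $$Y(x_i,t_j)=y(x_i,t_j),\quad (x_i,t_j)\in\partial Q^{N,M}.$$ *)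

theory Defs
  imports "HOL-Analysis.Analysis"
begin

text \<open>Functions of two variables are curried, space variable first. Only their values on the closed
  unit square matter, so derivatives are taken within \<open>{0..1}\<close>: they are one-sided at the end points
  and the usual ones elsewhere.\<close>

definition Q :: "(real \<times> real) set"
  where "Q = {0<..<1} \<times> {0<..1}"

definition Qbar :: "(real \<times> real) set"
  where "Qbar = {0..1} \<times> {0..1}"

definition deriv01 :: "(real \<Rightarrow> real) \<Rightarrow> real \<Rightarrow> real"
  where "deriv01 z s = vector_derivative z (at s within {0..1})"

definition Dx :: "(real \<Rightarrow> real \<Rightarrow> real) \<Rightarrow> real \<Rightarrow> real \<Rightarrow> real"
  where "Dx z x t = deriv01 (\<lambda>s. z s t) x"

definition Dt :: "(real \<Rightarrow> real \<Rightarrow> real) \<Rightarrow> real \<Rightarrow> real \<Rightarrow> real"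
  where "Dt z x t = deriv01 (\<lambda>s. z x s) t"

definition x_differentiable_on :: "(real \<Rightarrow> real \<Rightarrow> real) \<Rightarrow> (real \<times> real) set \<Rightarrow> bool"
  where "x_differentiable_on z A \<longleftrightarrow>
    (\<forall>(x, t) \<in> A. (\<lambda>s. z s t) differentiable (at x within {0..1}))"

definition t_differentiable_on :: "(real \<Rightarrow> real \<Rightarrow> real) \<Rightarrow> (real \<times> real) set \<Rightarrow> bool"
  where "t_differentiable_on z A \<longleftrightarrow>
    (\<forall>(x, t) \<in> A. (\<lambda>s. z x s) differentiable (at t within {0..1}))"

definition partial :: "nat \<Rightarrow> nat \<Rightarrow> (real \<Rightarrow> real \<Rightarrow> real) \<Rightarrow> real \<Rightarrow> real \<Rightarrow> real"
  where "partial i j z = (Dx ^^ i) ((Dt ^^ j) z)"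

text \<open>As is standard for spaces with the weighting \<open>i + 2 * j\<close>, Hoelder continuity refers to the
  parabolic distance. On the bounded set \<open>Qbar\<close> it follows from Hoelder continuity of the same degree
  with respect to the Euclidean distance.\<close>

definition parabolic_dist :: "real \<times> real \<Rightarrow> real \<times> real \<Rightarrow> real"
  where "parabolic_dist p q = sqrt ((fst p - fst q)\<^sup>2 + \<bar>snd p - snd q\<bar>)"

definition hoelder_on :: "real \<Rightarrow> (real \<times> real) set \<Rightarrow> (real \<Rightarrow> real \<Rightarrow> real) \<Rightarrow> bool"
  where "hoelder_on \<gamma> A z \<longleftrightarrow>
    (\<exists>K. \<forall>p\<in>A. \<forall>q\<in>A.
      \<bar>z (fst p) (snd p) - z (fst q) (snd q)\<bar> \<le> K * parabolic_dist p q powr \<gamma>)"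

definition C_hoelder :: "nat \<Rightarrow> real \<Rightarrow> (real \<Rightarrow> real \<Rightarrow> real) set"
  where "C_hoelder n \<gamma> = {z.
    (\<forall>j. 2 * Suc j \<le> n \<longrightarrow> t_differentiable_on (partial 0 j z) Qbar) \<and>
    (\<forall>i j. Suc i + 2 * j \<le> n \<longrightarrow> x_differentiable_on (partial i j z) Qbar) \<and>
    (\<forall>i j. i + 2 * j \<le> n \<longrightarrow> hoelder_on \<gamma> Qbar (partial i j z))}"

definition Ck :: "nat \<Rightarrow> (real \<Rightarrow> real) set"
  where "Ck k = {z.
    (\<forall>i<k. (deriv01 ^^ i) z differentiable_on {0..1}) \<and>
    (\<forall>i\<le>k. continuous_on {0..1} ((deriv01 ^^ i) z))}"

definition erfc :: "real \<Rightarrow> real"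
  where "erfc z = 2 / sqrt pi * integral {z..} (\<lambda>s. exp (- s\<^sup>2))"

definition compatible ::
    "(real \<Rightarrow> real \<Rightarrow> real) \<Rightarrow> (real \<Rightarrow> real \<Rightarrow> real) \<Rightarrow> (real \<Rightarrow> real) \<Rightarrow> (real \<Rightarrow> real) \<Rightarrow> real \<Rightarrow> bool"
  where "compatible b f gR \<phi> \<epsilon> \<longleftrightarrow>
    \<epsilon> * (deriv01 gR 0 - (deriv01 ^^ 2) \<phi> 1) + b 1 0 * gR 0 = f 1 0 \<and>
    \<epsilon> * ((deriv01 ^^ 2) gR 0 - (deriv01 ^^ 4) \<phi> 1) + b 1 0 * (deriv01 gR 0 + (deriv01 ^^ 2) \<phi> 1)
      + Dt b 1 0 * gR 0 + 2 * Dx b 1 0 * deriv01 \<phi> 1 + (Dx ^^ 2) b 1 0 * \<phi> 1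
      = Dt f 1 0 + (Dx ^^ 2) f 1 0"

definition A0 :: "(real \<Rightarrow> real) \<Rightarrow> (real \<Rightarrow> real) \<Rightarrow> real"
  where "A0 gL \<phi> = gL 0 - Lim (at_right 0) \<phi>"

text \<open>The value of \<open>z0\<close> at the corner \<open>(0, 0)\<close>, where the function is discontinuous, is never used.\<close>

definition z0 :: "(real \<Rightarrow> real \<Rightarrow> real) \<Rightarrow> real \<Rightarrow> real \<Rightarrow> real \<Rightarrow> real"
  where "z0 b \<epsilon> x t =
    (if t = 0 then 0 else exp (- b 0 0 * t / \<epsilon>) * erfc (x / (2 * sqrt t)))"

definition L :: "(real \<Rightarrow> real \<Rightarrow> real) \<Rightarrow> real \<Rightarrow> (real \<Rightarrow> real \<Rightarrow> real) \<Rightarrow> real \<Rightarrow> real \<Rightarrow> real"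
  where "L b \<epsilon> z x t = \<epsilon> * (Dt z x t - (Dx ^^ 2) z x t) + b x t * z x t"

definition rhs_Y ::
    "(real \<Rightarrow> real \<Rightarrow> real) \<Rightarrow> (real \<Rightarrow> real \<Rightarrow> real) \<Rightarrow> (real \<Rightarrow> real) \<Rightarrow> (real \<Rightarrow> real) \<Rightarrow> real
      \<Rightarrow> real \<Rightarrow> real \<Rightarrow> real"
  where "rhs_Y b f gL \<phi> \<epsilon> x t = f x t - A0 gL \<phi> * (b x t - b 0 0) * z0 b \<epsilon> x t"

definition solves_Y ::
    "(real \<Rightarrow> real \<Rightarrow> real) \<Rightarrow> (real \<Rightarrow> real \<Rightarrow> real) \<Rightarrow> (real \<Rightarrow> real) \<Rightarrow> (real \<Rightarrow> real) \<Rightarrow> (real \<Rightarrow> real)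
      \<Rightarrow> real \<Rightarrow> (real \<Rightarrow> real \<Rightarrow> real) \<Rightarrow> bool"
  where "solves_Y b f gL gR \<phi> \<epsilon> y \<longleftrightarrow>
    continuous_on Qbar (\<lambda>(x, t). y x t) \<and>
    t_differentiable_on y Q \<and> x_differentiable_on y Q \<and> x_differentiable_on (Dx y) Q \<and>
    (\<forall>(x, t) \<in> Q. L b \<epsilon> y x t = rhs_Y b f gL \<phi> \<epsilon> x t) \<and>
    (\<forall>t\<in>{0..1}. y 0 t = gL t - A0 gL \<phi> * exp (- b 0 0 * t / \<epsilon>)) \<and>
    (\<forall>t\<in>{0..1}. y 1 t = gR t - A0 gL \<phi> * z0 b \<epsilon> 1 t) \<and>
    (\<forall>x\<in>{0<..<1}. y x 0 = \<phi> x)"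

definition sigma :: "real \<Rightarrow> real \<Rightarrow> nat \<Rightarrow> real"
  where "sigma \<beta> \<epsilon> N = min (1 / 4) (2 * sqrt (\<epsilon> / \<beta>) * ln (real N))"

definition tau :: "real \<Rightarrow> real \<Rightarrow> nat \<Rightarrow> real"
  where "tau \<beta> \<epsilon> M = min (1 / 2) (\<epsilon> / \<beta> * ln (real M))"

definition xmesh :: "real \<Rightarrow> real \<Rightarrow> nat \<Rightarrow> nat \<Rightarrow> real"
  where "xmesh \<beta> \<epsilon> N i = (let \<sigma> = sigma \<beta> \<epsilon> N; n = real N in
    if i \<le> N div 4 then real i * (\<sigma> / (n / 4))
    else if i \<le> 3 * (N div 4) then \<sigma> + (real i - n / 4) * ((1 - 2 * \<sigma>) / (n / 2))
    else (1 - \<sigma>) + (real i - 3 * n / 4) * (\<sigma> / (n / 4)))"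

definition tmesh :: "real \<Rightarrow> real \<Rightarrow> nat \<Rightarrow> nat \<Rightarrow> real"
  where "tmesh \<beta> \<epsilon> M j = (let \<tau> = tau \<beta> \<epsilon> M; m = real M in
    if j \<le> M div 2 then real j * (\<tau> / (m / 2))
    else \<tau> + (real j - m / 2) * ((1 - \<tau>) / (m / 2)))"

text \<open>Mesh functions are indexed by the pair \<open>(i, j)\<close> of node numbers; \<open>X\<close> and \<open>S\<close> are the node
  sequences in space and time. The backward differences are used only for \<open>i > 0\<close> and \<open>j > 0\<close>.\<close>

definition dx_minus :: "(nat \<Rightarrow> real) \<Rightarrow> (nat \<Rightarrow> nat \<Rightarrow> real) \<Rightarrow> nat \<Rightarrow> nat \<Rightarrow> real"
  where "dx_minus X Y i j = (Y i j - Y (i - 1) j) / (X i - X (i - 1))"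

definition dx_plus :: "(nat \<Rightarrow> real) \<Rightarrow> (nat \<Rightarrow> nat \<Rightarrow> real) \<Rightarrow> nat \<Rightarrow> nat \<Rightarrow> real"
  where "dx_plus X Y i j = dx_minus X Y (i + 1) j"

definition dt_minus :: "(nat \<Rightarrow> real) \<Rightarrow> (nat \<Rightarrow> nat \<Rightarrow> real) \<Rightarrow> nat \<Rightarrow> nat \<Rightarrow> real"
  where "dt_minus S Y i j = (Y i j - Y i (j - 1)) / (S j - S (j - 1))"

definition delta2 :: "(nat \<Rightarrow> real) \<Rightarrow> (nat \<Rightarrow> nat \<Rightarrow> real) \<Rightarrow> nat \<Rightarrow> nat \<Rightarrow> real"
  where "delta2 X Y i j = (dx_plus X Y i j - dx_minus X Y i j) /
    (((X (i + 1) - X i) + (X i - X (i - 1))) / 2)"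

definition solves_D ::
    "(real \<Rightarrow> real \<Rightarrow> real) \<Rightarrow> (real \<Rightarrow> real \<Rightarrow> real) \<Rightarrow> (real \<Rightarrow> real) \<Rightarrow> (real \<Rightarrow> real) \<Rightarrow> real \<Rightarrow> real
      \<Rightarrow> nat \<Rightarrow> nat \<Rightarrow> (real \<Rightarrow> real \<Rightarrow> real) \<Rightarrow> (nat \<Rightarrow> nat \<Rightarrow> real) \<Rightarrow> bool"
  where "solves_D b f gL \<phi> \<beta> \<epsilon> N M y Y \<longleftrightarrow>
    (let X = xmesh \<beta> \<epsilon> N; S = tmesh \<beta> \<epsilon> M in
      \<forall>i\<le>N. \<forall>j\<le>M.
        if (X i, S j) \<in> Q
        then \<epsilon> * dt_minus S Y i j - \<epsilon> * delta2 X Y i j + b (X i) (S j) * Y i j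
               = rhs_Y b f gL \<phi> \<epsilon> (X i) (S j)
        else Y i j = y (X i) (S j))"

end

theory Submission
  imports Defs
begin

text \<open>Scaling \<open>x\<close> by \<open>sqrt \<epsilon>\<close> and \<open>t\<close> by \<open>\<epsilon>\<close> turns the operator into \<open>u\<^sub>t - u\<^sub>x\<^sub>x + b u\<close> on a rectangle
  whose sides grow like \<open>1 / sqrt \<epsilon>\<close> and \<open>1 / \<epsilon>\<close>. No regularity theory is used: the maximum principle
  is applied to finite differences of the given classical solution, and derivatives are recovered from
  them by dyadic telescoping.

  At the corner \<open>(0, 0)\<close> an explicit solution \<open>S\<close> of the heat equation, damped by \<open>exp (- c t)\<close>, removes
  the first-order incompatibility. First and second time differences of \<open>R = y - S\<close> with step \<open>r\<close> are
  \<open>O(r)\<close> and \<open>O(r\<^sup>2)\<close> times the weight \<open>\<epsilon> + exp (- \<beta> t)\<close>; through the equation this controls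
  second space differences of \<open>R\<^sub>x\<^sub>x\<close>. Away from the lateral boundary, space differences of order at
  most four are bounded by a smooth part and two exponential layers. The truncation error is thus
  bounded, up to a factor \<open>1 + 1 / (x\<^sup>2 + t)\<close>, except at the transition points of the space mesh.
  In the discrete maximum principle the barrier \<open>(t + h\<^sup>2) / (x\<^sup>2 + 6 (t + h\<^sup>2))\<close> absorbs the singular
  factor, and a concave piecewise linear barrier with kinks at the transition points absorbs the
  first-order term there.\<close>

subsection \<open>Calculus of one variable\<close>

text \<open>The obstacle is that \<open>solves_Y\<close> gives only second space derivatives inside
  \<open>Q\<close> and mere continuity up to the boundary, so higher derivatives cannot be compared
  with barriers. Differences can: they solve the same equation up to lower order terms. Two margins
  make the estimates uniform. Because \<open>Dx b 0 0 = 0\<close>, the factor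
  \<open>b - b 0 0\<close> is of order \<open>x\<^sup>2 + t\<close> at the corner and offsets one
  power of the \<open>1 / (x\<^sup>2 + t)\<close> produced by differentiating \<open>z0\<close>: one
  time or two space derivatives of the source stay bounded, a second time derivative leaves a single
  such factor. By compactness \<open>b\<close> exceeds \<open>\<beta>\<close> by a fixed
  \<open>\<eta>\<close>, so in scaled variables \<open>exp (- \<beta> * t)\<close> and
  \<open>exp (- sqrt \<beta> * x)\<close> are strict supersolutions; \<open>tau\<close> and
  \<open>sigma\<close>, unless capped, are the places where these have fallen to
  \<open>1 / M\<close> and \<open>1 / N\<^sup>2\<close>. Uniformity in \<open>\<epsilon>\<close>,
  \<open>N\<close> and \<open>M\<close> is visible in the syntax: the constants of the scaled
  problem are terms in \<open>\<beta>\<close>, \<open>\<eta>\<close>, \<open>\<kappa>\<close>,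
  \<open>C\<close> and \<open>K\<close> alone.\<close>

lemma abs_diff_le_deriv:
  fixes g :: "real \<Rightarrow> real"
  assumes "p \<le> q" "continuous_on {p..q} g"
    and d: "\<And>s. p < s \<Longrightarrow> s < q \<Longrightarrow> (g has_real_derivative g' s) (at s)"
    and b: "\<And>s. p < s \<Longrightarrow> s < q \<Longrightarrow> \<bar>g' s\<bar> \<le> A"
  shows "\<bar>g q - g p\<bar> \<le> A * (q - p)"
proof (cases "p = q")
  case False
  then have "p < q" using assms by simp
  then obtain z where z: "p < z" "z < q" "g q - g p = (q - p) * g' z"
    using mvt[of p q g "\<lambda>s v. g' s * v"] assms(2) d
    by (auto simp: has_field_derivative_def mult.commute[of "q - p"])
  then have "\<bar>g q - g p\<bar> = (q - p) * \<bar>g' z\<bar>"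
    using \<open>p < q\<close> by (simp add: abs_mult)
  also have "\<dots> \<le> (q - p) * A"
    using b[of z] z \<open>p < q\<close> by (intro mult_left_mono) auto
  finally show ?thesis by (simp add: mult.commute)
qed auto

text \<open>A mean value argument in place of integrating the bound on \<open>g'\<close>: on
  \<open>{0..h}\<close> that bound is at most \<open>A * h ^ n\<close>. The factor
  \<open>1 / (n + 1)\<close> is given away, and in return \<open>g'\<close> need not be
  integrable.\<close>

lemma abs_le_power_deriv:
  fixes g :: "real \<Rightarrow> real"
  assumes "0 \<le> h" "continuous_on {0..h} g" "g 0 = 0" "0 \<le> A"
    and d: "\<And>s. 0 < s \<Longrightarrow> s < h \<Longrightarrow> (g has_real_derivative g' s) (at s)"
    and b: "\<And>s. 0 < s \<Longrightarrow> s < h \<Longrightarrow> \<bar>g' s\<bar> \<le> A * s ^ n"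
  shows "\<bar>g h\<bar> \<le> A * h ^ Suc n"
proof -
  have "\<bar>g h - g 0\<bar> \<le> A * h ^ n * (h - 0)"
  proof (rule abs_diff_le_deriv[where g' = g'])
    fix s assume s: "0 < s" "s < h"
    show "\<bar>g' s\<bar> \<le> A * h ^ n"
      using b[OF s] mult_left_mono[OF power_mono[of s h n] assms(4)] s by simp
  qed (use assms in auto)
  then show ?thesis using assms(3) by (simp add: mult_ac)
qed

lemma continuous_on_shift:
  fixes g :: "real \<Rightarrow> real"
  assumes "continuous_on {x - h..x + h} g"
  shows "continuous_on {0..h} (\<lambda>s. g (x + s))" "continuous_on {0..h} (\<lambda>s. g (x - s))"
  by (rule continuous_on_compose2[OF assms]; fastforce intro!: continuous_intros)+

lemma deriv_shift:
  fixes g :: "real \<Rightarrow> real"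
  assumes "(g has_real_derivative D) (at (x + s))"
  shows "((\<lambda>s. g (x + s)) has_real_derivative D) (at s)"
  using DERIV_shift[of g D s x] assms by (simp add: add.commute)

lemma deriv_reflect:
  fixes g :: "real \<Rightarrow> real"
  assumes "(g has_real_derivative D) (at (x - s))"
  shows "((\<lambda>s. g (x - s)) has_real_derivative - D) (at s)"
proof -
  have "((\<lambda>s. x - s) has_real_derivative -1) (at s)"
    by (auto intro!: derivative_eq_intros)
  from DERIV_chain2[OF assms this] show ?thesis by simp
qed

lemma continuous_on_deriv:
  fixes g :: "real \<Rightarrow> real"
  assumes "\<And>s. a \<le> s \<Longrightarrow> s \<le> b \<Longrightarrow> (g has_real_derivative g' s) (at s)"
  shows "continuous_on {a..b} g"
  using assms by (intro continuous_at_imp_continuous_on ballI) (auto intro: DERIV_isCont)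

text \<open>The even part \<open>g (x + s) + g (x - s) - 2 * g x - s\<^sup>2 * D\<close> vanishes at
  \<open>s = 0\<close> together with its first derivative, and its second derivative is the quantity
  in the last hypothesis; two applications of \<open>abs_le_power_deriv\<close> finish. With
  \<open>n = 2\<close> and \<open>D = g2 x\<close> this is the fourth-order truncation estimate,
  obtained from a second difference of \<open>g2\<close> without third or fourth
  derivatives.\<close>

lemma second_difference_truncation:
  fixes g :: "real \<Rightarrow> real"
  assumes "0 \<le> h" "continuous_on {x - h..x + h} g" "0 \<le> A"
    and d1: "\<And>s. x - h < s \<Longrightarrow> s < x + h \<Longrightarrow> (g has_real_derivative g1 s) (at s)"
    and d2: "\<And>s. x - h < s \<Longrightarrow> s < x + h \<Longrightarrow> (g1 has_real_derivative g2 s) (at s)"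
    and b: "\<And>s. 0 < s \<Longrightarrow> s < h \<Longrightarrow> \<bar>g2 (x + s) + g2 (x - s) - 2 * D\<bar> \<le> A * s ^ n"
  shows "\<bar>g (x + h) - 2 * g x + g (x - h) - h\<^sup>2 * D\<bar> \<le> A * h ^ (n + 2)"
proof -
  have one: "\<bar>g1 (x + s) - g1 (x - s) - 2 * s * D\<bar> \<le> A * s ^ Suc n" if s: "0 < s" "s < h" for s
  proof (rule abs_le_power_deriv[where g = "\<lambda>s. g1 (x + s) - g1 (x - s) - 2 * s * D"
        and g' = "\<lambda>s. g2 (x + s) + g2 (x - s) - 2 * D"])
    have "continuous_on {x - s..x + s} g1"
      using s by (intro continuous_on_deriv[where g' = g2] d2) auto
    note c = continuous_on_shift[OF this]
    show "continuous_on {0..s} (\<lambda>s. g1 (x + s) - g1 (x - s) - 2 * s * D)"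
      by (intro c continuous_on_diff continuous_on_mult continuous_on_const continuous_on_id)
  next
    fix v assume v: "0 < v" "v < s"
    show "((\<lambda>s. g1 (x + s) - g1 (x - s) - 2 * s * D) has_real_derivative
        g2 (x + v) + g2 (x - v) - 2 * D) (at v)"
      by (rule derivative_eq_intros deriv_shift[where g = g1] deriv_reflect[where g = g1] d2 refl |
          use v s in simp)+
    show "\<bar>g2 (x + v) + g2 (x - v) - 2 * D\<bar> \<le> A * v ^ n" using b v s by auto
  qed (use s assms in auto)
  have "\<bar>g (x + h) + g (x - h) - 2 * g x - h\<^sup>2 * D\<bar> \<le> A * h ^ Suc (Suc n)"
  proof (rule abs_le_power_deriv[where g = "\<lambda>s. g (x + s) + g (x - s) - 2 * g x - s\<^sup>2 * D"
        and g' = "\<lambda>s. g1 (x + s) - g1 (x - s) - 2 * s * D"])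
    show "continuous_on {0..h} (\<lambda>s. g (x + s) + g (x - s) - 2 * g x - s\<^sup>2 * D)"
      by (intro continuous_on_shift[OF assms(2)] continuous_on_add continuous_on_diff continuous_on_mult
          continuous_on_power continuous_on_const continuous_on_id)
    fix v assume v: "0 < v" "v < h"
    show "((\<lambda>s. g (x + s) + g (x - s) - 2 * g x - s\<^sup>2 * D) has_real_derivative
        g1 (x + v) - g1 (x - v) - 2 * v * D) (at v)"
      by (rule derivative_eq_intros deriv_shift[where g = g] deriv_reflect[where g = g] d1 refl |
          use v in simp)+
    show "\<bar>g1 (x + v) - g1 (x - v) - 2 * v * D\<bar> \<le> A * v ^ Suc n" using one v by auto
  qed (use assms in auto)
  then show ?thesis by (simp add: algebra_simps)
qed

lemma second_difference_bound:
  fixes g :: "real \<Rightarrow> real"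
  assumes "0 \<le> h" "continuous_on {x - h..x + h} g" "0 \<le> A"
    and d1: "\<And>s. x - h < s \<Longrightarrow> s < x + h \<Longrightarrow> (g has_real_derivative g1 s) (at s)"
    and d2: "\<And>s. x - h < s \<Longrightarrow> s < x + h \<Longrightarrow> (g1 has_real_derivative g2 s) (at s)"
    and b: "\<And>s. x - h < s \<Longrightarrow> s < x + h \<Longrightarrow> \<bar>g2 s\<bar> \<le> A"
  shows "\<bar>g (x + h) - 2 * g x + g (x - h)\<bar> \<le> 2 * A * h\<^sup>2"
proof -
  have "\<bar>g (x + h) - 2 * g x + g (x - h) - h\<^sup>2 * 0\<bar> \<le> 2 * A * h ^ (0 + 2)"
  proof (rule second_difference_truncation[OF assms(1,2) _ d1 d2])
    fix s assume "0 < s" "s < h"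
    then show "\<bar>g2 (x + s) + g2 (x - s) - 2 * 0\<bar> \<le> 2 * A * s ^ 0"
      using b[of "x + s"] b[of "x - s"] by auto
  qed (use assms in auto)
  then show ?thesis by (simp add: power2_eq_square)
qed

lemma central_difference_tendsto:
  fixes g :: "real \<Rightarrow> real"
  assumes "(g has_real_derivative D) (at x)"
  shows "((\<lambda>s. (g (x + s) - g (x - s)) / (2 * s)) \<longlongrightarrow> D) (at_right 0)"
proof -
  have "((\<lambda>s. g (x + s) - g (x - s)) has_real_derivative 2 * D) (at 0)"
    by (rule derivative_eq_intros deriv_shift[where g = g] deriv_reflect[where g = g] refl |
        use assms in simp)+
  then have "((\<lambda>s. (g (x + s) - g (x - s)) / s) \<longlongrightarrow> 2 * D) (at 0)"
    by (simp add: DERIV_def)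
  then have "((\<lambda>s. (g (x + s) - g (x - s)) / s / 2) \<longlongrightarrow> 2 * D / 2) (at_right 0)"
    by (intro tendsto_divide tendsto_const) (auto intro: tendsto_mono[OF at_le])
  then show ?thesis by (simp add: mult.commute)
qed

lemma second_difference_tendsto:
  fixes g :: "real \<Rightarrow> real"
  assumes "0 < \<delta>"
    and d1: "\<And>s. \<bar>s - x\<bar> < \<delta> \<Longrightarrow> (g has_real_derivative g1 s) (at s)"
    and d2: "(g1 has_real_derivative D) (at x)"
  shows "((\<lambda>s. (g (x + s) - 2 * g x + g (x - s)) / s\<^sup>2) \<longlongrightarrow> D) (at_right 0)"
proof -
  have "((\<lambda>s. (g (x + s) - 2 * g x + g (x - s)) / s\<^sup>2) \<longlongrightarrow> D) (at_right 0)"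
  proof (rule lhopital_right_0[where f' = "\<lambda>s. g1 (x + s) - g1 (x - s)" and g' = "\<lambda>s. 2 * s"])
    have "isCont g x" using d1[of x] assms(1) by (auto intro: DERIV_isCont)
    then have "((\<lambda>s. g (x + s) - 2 * g x + g (x - s)) \<longlongrightarrow> g (x + 0) - 2 * g x + g (x - 0)) (at 0)"
      by (intro tendsto_intros isCont_tendsto_compose[of _ g]) (auto intro!: tendsto_eq_intros)
    then show "((\<lambda>s. g (x + s) - 2 * g x + g (x - s)) \<longlongrightarrow> 0) (at_right 0)"
      by (auto intro: tendsto_mono[OF at_le])
    show "((\<lambda>s::real. s\<^sup>2) \<longlongrightarrow> 0) (at_right 0)" by (auto intro!: tendsto_eq_intros)
    show "\<forall>\<^sub>F s in at_right 0. (s::real)\<^sup>2 \<noteq> 0" "\<forall>\<^sub>F s in at_right 0. 2 * (s::real) \<noteq> 0"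
      by (auto simp: eventually_at_filter)
    show "\<forall>\<^sub>F s in at_right 0. ((\<lambda>s. g (x + s) - 2 * g x + g (x - s)) has_real_derivative
        g1 (x + s) - g1 (x - s)) (at s)"
      unfolding eventually_at_right_field
    proof (intro exI[of _ \<delta>] conjI allI impI)
      fix s assume s: "0 < s" "s < \<delta>"
      show "((\<lambda>s. g (x + s) - 2 * g x + g (x - s)) has_real_derivative
          g1 (x + s) - g1 (x - s)) (at s)"
        by (rule derivative_eq_intros deriv_shift[where g = g] deriv_reflect[where g = g] d1 refl |
            use s in simp)+
    qed (use assms in auto)
    show "\<forall>\<^sub>F s in at_right 0. ((\<lambda>s::real. s\<^sup>2) has_real_derivative 2 * s) (at s)"
      by (intro always_eventually allI) (auto intro!: derivative_eq_intros)
    show "((\<lambda>s. (g1 (x + s) - g1 (x - s)) / (2 * s)) \<longlongrightarrow> D) (at_right 0)"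
      by (rule central_difference_tendsto[OF d2])
  qed
  then show ?thesis .
qed

text \<open>An inequality of Landau type. Somewhere on an interval of length 1/4 the derivative
  equals a difference quotient, hence is at most \<open>2 * A / (1/4) = 8 * A\<close>; moving from
  there to \<open>x\<close> costs at most another \<open>A\<close>.\<close>

lemma deriv_interpolation:
  fixes g :: "real \<Rightarrow> real"
  assumes "1 \<le> q - p" "p < x" "x < q"
    and d1: "\<And>s. p < s \<Longrightarrow> s < q \<Longrightarrow> (g has_real_derivative g1 s) (at s)"
    and d2: "\<And>s. p < s \<Longrightarrow> s < q \<Longrightarrow> (g1 has_real_derivative g2 s) (at s)"
    and b0: "\<And>s. p < s \<Longrightarrow> s < q \<Longrightarrow> \<bar>g s\<bar> \<le> A"
    and b2: "\<And>s. p < s \<Longrightarrow> s < q \<Longrightarrow> \<bar>g2 s\<bar> \<le> A"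
  shows "\<bar>g1 x\<bar> \<le> 9 * A"
proof -
  \<comment> \<open>Since \<open>q - p\<close> is at least 1, a quarter unit fits on one side of
    \<open>x\<close> at least.\<close>
  obtain u v where uv: "p < u" "v < q" "v = u + 1/4" "u \<le> x" "x \<le> v"
  proof (cases "x + 1/4 < q")
    case True
    then show ?thesis using assms by (intro that[of x "x + 1/4"]) auto
  next
    case False
    then show ?thesis using assms by (intro that[of "x - 1/4" x]) auto
  qed
  obtain z where z: "u < z" "z < v" "g v - g u = (v - u) * g1 z"
    using MVT2[of u v g g1] d1 uv by auto
  have "\<bar>g1 z\<bar> \<le> 8 * A"
    using z(3) b0[of u] b0[of v] uv by (auto simp: abs_if split: if_splits)
  moreover have "\<bar>g1 x - g1 z\<bar> \<le> A"
  proof -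
    have A: "0 \<le> A" using b0[of x] assms(2,3) by linarith
    have c: "continuous_on {u..v} g1"
      using uv by (intro continuous_on_deriv[where g' = g2] d2) auto
    have "\<bar>g1 q' - g1 p'\<bar> \<le> A * (q' - p')" if "p' \<le> q'" "u \<le> p'" "q' \<le> v" for p' q'
      using that uv by (intro abs_diff_le_deriv[where g' = g2] continuous_on_subset[OF c] d2 b2) auto
    from this[of x z] this[of z x] have "\<bar>g1 x - g1 z\<bar> \<le> A * \<bar>x - z\<bar>"
      using uv z by (cases "x \<le> z") (auto simp: abs_minus_commute)
    also have "\<dots> \<le> A * 1" using uv z A by (intro mult_left_mono) auto
    finally show ?thesis by simp
  qed
  ultimately show ?thesis by linarith
qed

text \<open>Meant for difference quotients with steps \<open>h / 2 ^ n\<close> and limit a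
  derivative: control of what halving the step does to the quotient replaces a Taylor expansion of
  higher order.\<close>

lemma geometric_telescoping:
  fixes s :: "nat \<Rightarrow> real"
  assumes "0 \<le> q" "q < 1" "\<And>n. \<bar>s n - s (Suc n)\<bar> \<le> A * q ^ n" "s \<longlonglongrightarrow> l"
  shows "\<bar>s 0 - l\<bar> \<le> A / (1 - q)"
proof -
  have A: "0 \<le> A" using assms(3)[of 0] by simp
  have "\<bar>s 0 - s n\<bar> \<le> A / (1 - q)" for n
  proof -
    have "\<bar>s 0 - s n\<bar> \<le> (\<Sum>i<n. A * q ^ i)"
    proof (induction n)
      case (Suc n)
      then show ?case using assms(3)[of n] by simp
    qed simp
    also have "\<dots> = A * ((1 - q ^ n) / (1 - q))"
      using assms by (simp add: sum_distrib_left[symmetric] sum_gp_strict)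
    also have "\<dots> \<le> A * (1 / (1 - q))"
      using assms A by (intro mult_left_mono divide_right_mono) auto
    finally show ?thesis by simp
  qed
  moreover have "(\<lambda>n. \<bar>s 0 - s n\<bar>) \<longlonglongrightarrow> \<bar>s 0 - l\<bar>"
    by (intro tendsto_intros assms)
  ultimately show ?thesis by (intro LIMSEQ_le_const2) auto
qed

lemma tendsto_dyadic:
  assumes "(F \<longlongrightarrow> l) (at_right (0::real))" "0 < h"
  shows "(\<lambda>n. F (h / 2 ^ n)) \<longlonglongrightarrow> l"
proof (rule filterlim_compose[OF assms(1)])
  have "(\<lambda>n. h * (1 / 2) ^ n) \<longlonglongrightarrow> h * 0"
    by (intro tendsto_intros LIMSEQ_power_zero) auto
  then have "(\<lambda>n. h / 2 ^ n) \<longlonglongrightarrow> 0" by (simp add: power_one_over)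
  then show "filterlim (\<lambda>n. h / 2 ^ n) (at_right 0) sequentially"
    using assms(2) by (auto simp: filterlim_at)
qed

subsection \<open>Forward differences\<close>

fun fd :: "real \<Rightarrow> nat \<Rightarrow> (real \<Rightarrow> real) \<Rightarrow> real \<Rightarrow> real" where
  "fd r 0 g x = g x"
| "fd r (Suc m) g x = fd r m g (x + r) - fd r m g x"

lemma fd_Suc_inner: "fd r (Suc m) g x = fd r m (\<lambda>y. g (y + r) - g y) x"
proof (induction m arbitrary: x)
  case (Suc m)
  show ?case unfolding fd.simps(2)[of r "Suc m"] fd.simps(2)[of r m "\<lambda>y. g (y + r) - g y"] Suc.IH ..
qed simp

lemma fd_add: "fd r m (\<lambda>y. g y + h y) x = fd r m g x + fd r m h x"
  by (induction m arbitrary: x) auto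

lemma fd_diff: "fd r m (\<lambda>y. g y - h y) x = fd r m g x - fd r m h x"
  by (induction m arbitrary: x) auto

lemma fd_cong:
  assumes "\<And>i. i \<le> m \<Longrightarrow> g (x + real i * r) = h (x + real i * r)"
  shows "fd r m g x = fd r m h x"
  using assms
proof (induction m arbitrary: x)
  case (Suc m)
  have "fd r m g (x + r) = fd r m h (x + r)"
    using Suc.prems[of "Suc _"] by (intro Suc.IH) (auto simp: algebra_simps)
  moreover have "fd r m g x = fd r m h x"
    using Suc.prems by (intro Suc.IH) auto
  ultimately show ?case by simp
qed (use assms[of 0] in auto)

text \<open>Induction on the order: the functions \<open>D i (s + r) - D i s\<close> again form a
  chain of derivatives, on an interval shorter by \<open>r\<close>, and the mean value theorem
  bounds the last of them by \<open>A * r\<close>.\<close>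

lemma fd_deriv_bound:
  fixes D :: "nat \<Rightarrow> real \<Rightarrow> real"
  assumes "0 \<le> r" "p \<le> x" "x + real m * r \<le> q"
    and "\<And>i s. i < m \<Longrightarrow> p \<le> s \<Longrightarrow> s \<le> q \<Longrightarrow> (D i has_real_derivative D (Suc i) s) (at s within {p..q})"
    and "\<And>s. p \<le> s \<Longrightarrow> s \<le> q \<Longrightarrow> \<bar>D m s\<bar> \<le> A"
  shows "\<bar>fd r m (D 0) x\<bar> \<le> A * r ^ m"
  using assms
proof (induction m arbitrary: D q A)
  case 0
  then show ?case by simp
next
  case (Suc m)
  let ?E = "\<lambda>i s. D i (s + r) - D i s"
  have "\<bar>fd r m (?E 0) x\<bar> \<le> (A * r) * r ^ m"
  proof (rule Suc.IH[of "q - r"])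
    show "x + real m * r \<le> q - r" using Suc.prems(3) by (simp add: algebra_simps)
    fix i s assume i: "i < m" and s: "p \<le> s" "s \<le> q - r"
    have "(D i has_real_derivative D (Suc i) (s + r)) (at (s + r) within (\<lambda>s. s + r) ` {p..q - r})"
      by (rule DERIV_subset[OF Suc.prems(4)]) (use i s Suc.prems(1) in auto)
    moreover have "((\<lambda>s. s + r) has_real_derivative 1) (at s within {p..q - r})"
      by (auto intro!: derivative_eq_intros)
    ultimately have "((\<lambda>s. D i (s + r)) has_real_derivative D (Suc i) (s + r)) (at s within {p..q - r})"
      using DERIV_image_chain[of "D i" "D (Suc i) (s + r)" "\<lambda>s. s + r" s "{p..q - r}" 1]
      by (simp add: o_def)
    moreover have "(D i has_real_derivative D (Suc i) s) (at s within {p..q - r})"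
      by (rule DERIV_subset[OF Suc.prems(4)]) (use i s Suc.prems(1) in auto)
    ultimately show "(?E i has_real_derivative ?E (Suc i) s) (at s within {p..q - r})"
      using DERIV_diff by fastforce
  next
    fix s assume s: "p \<le> s" "s \<le> q - r"
    have "\<bar>D m (s + r) - D m s\<bar> \<le> A * ((s + r) - s)"
    proof (rule abs_diff_le_deriv[where g' = "D (Suc m)"])
      show "continuous_on {s..s + r} (D m)"
        by (rule continuous_on_subset[of "{p..q}"])
          (use Suc.prems(1,4) s in \<open>auto intro!: DERIV_continuous_on[where D = "D (Suc m)"]\<close>)
      fix v assume v: "s < v" "v < s + r"
      show "(D m has_real_derivative D (Suc m) v) (at v)"
        using Suc.prems(4)[of m v] v s at_within_Icc_at[of p v q] by auto
      show "\<bar>D (Suc m) v\<bar> \<le> A" using Suc.prems(5)[of v] v s by auto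
    qed (use Suc.prems in auto)
    then show "\<bar>?E m s\<bar> \<le> A * r" by simp
  qed (use Suc.prems in auto)
  then show ?case unfolding fd_Suc_inner by (simp add: mult_ac)
qed

text \<open>The Leibniz rule for differences. By \<open>g (y + r) * h (y + r) - g y * h y = (g (y +
  r) - g y) * h (y + r) + g y * (h (y + r) - h y)\<close>, every difference that falls on
  \<open>g\<close> shifts \<open>h\<close> by \<open>r\<close>; Pascal's rule collects the
  terms.\<close>

lemma fd_mult:
  "fd r m (\<lambda>y. g y * h y) x =
    (\<Sum>i\<le>m. real (m choose i) * fd r i g x * fd r (m - i) h (x + real i * r))"
proof (induction m arbitrary: g h x)
  case (Suc m)
  define T where "T j = fd r j g x * fd r (Suc m - j) h (x + real j * r)" for j
  have sh: "fd r j (\<lambda>y. h (y + r)) y = fd r j h (y + r)" for j y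
    by (induction j arbitrary: y) auto
  have "fd r (Suc m) (\<lambda>y. g y * h y) x = fd r m (\<lambda>y. g (y + r) * h (y + r) - g y * h y) x"
    by (rule fd_Suc_inner)
  also have "(\<lambda>y. g (y + r) * h (y + r) - g y * h y)
      = (\<lambda>y. (g (y + r) - g y) * h (y + r) + g y * (h (y + r) - h y))"
    by (simp add: algebra_simps)
  also have "fd r m \<dots> x
      = fd r m (\<lambda>y. (g (y + r) - g y) * h (y + r)) x + fd r m (\<lambda>y. g y * (h (y + r) - h y)) x"
    by (rule fd_add)
  also have "fd r m (\<lambda>y. (g (y + r) - g y) * h (y + r)) x
      = (\<Sum>i\<le>m. real (m choose i) * T (Suc i))"
    unfolding Suc.IH[of "\<lambda>y. g (y + r) - g y" "\<lambda>y. h (y + r)"] sh fd_Suc_inner[symmetric] T_def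
    by (intro sum.cong refl) (simp del: fd.simps add: distrib_right add.assoc add.commute[of r])
  also have "fd r m (\<lambda>y. g y * (h (y + r) - h y)) x = (\<Sum>i\<le>m. real (m choose i) * T i)"
    unfolding Suc.IH[of g "\<lambda>y. h (y + r) - h y"] fd_Suc_inner[symmetric] T_def
    by (intro sum.cong refl) (simp del: fd.simps add: Suc_diff_le)
  also have "(\<Sum>i\<le>m. real (m choose i) * T i) = (\<Sum>i\<le>Suc m. real (m choose i) * T i)"
    by (simp add: binomial_eq_0)
  also have "\<dots> = T 0 + (\<Sum>i\<le>m. real (m choose Suc i) * T (Suc i))"
    by (subst sum.atMost_Suc_shift) simp
  also have "(\<Sum>i\<le>m. real (m choose i) * T (Suc i)) +
      (T 0 + (\<Sum>i\<le>m. real (m choose Suc i) * T (Suc i)))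
    = T 0 + (\<Sum>i\<le>m. real (Suc m choose Suc i) * T (Suc i))"
    by (simp add: sum.distrib distrib_right)
  also have "\<dots> = (\<Sum>i\<le>Suc m. real (Suc m choose i) * T i)"
    by (subst sum.atMost_Suc_shift) simp
  finally show ?case unfolding T_def by (simp only: mult.assoc)
qed simp

subsection \<open>The complementary error function and the heat kernel\<close>

lemma exp_neg_square_integrable: "(\<lambda>s::real. exp (- s\<^sup>2)) integrable_on {z..}"
proof (rule measurable_bounded_by_integrable_imp_integrable)
  show "(\<lambda>s::real. exp (- s\<^sup>2)) \<in> borel_measurable (lebesgue_on {z..})"
    by (intro continuous_imp_measurable_on_sets_lebesgue continuous_intros) auto
  show "(\<lambda>s::real. exp (1/4) * exp (- 1 * s)) integrable_on {z..}"
    by (rule has_integral_integrable,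
        rule has_integral_mult_right[OF has_integral_exp_minus_to_infinity]) simp
  fix s :: real
  have "0 \<le> (s - 1/2)\<^sup>2" by simp
  then have "- s\<^sup>2 \<le> 1/4 + - 1 * s" by (simp add: power2_eq_square algebra_simps)
  then show "norm (exp (- s\<^sup>2)) \<le> exp (1/4) * exp (- 1 * s)"
    unfolding exp_add[symmetric] by simp
qed auto

lemma erfc_deriv: "(erfc has_real_derivative - (2 / sqrt pi) * exp (- z\<^sup>2)) (at z)"
proof -
  let ?g = "\<lambda>s::real. exp (- s\<^sup>2)"
  define a where "a = z - 1"
  have split: "integral {y..} ?g = integral {a..} ?g - integral {a..y} ?g" if "a \<le> y" for y
  proof -
    have "{a..} = {a..y} \<union> {y..}" "{a..y} \<inter> {y..} = {y}" using that by auto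
    moreover have "?g integrable_on {a..y}"
      by (intro integrable_continuous_real continuous_intros)
    ultimately show ?thesis
      using integral_Un[of ?g "{a..y}" "{y..}"] exp_neg_square_integrable by simp
  qed
  have "((\<lambda>y. integral {a..y} ?g) has_real_derivative ?g z) (at z)"
  proof -
    have "((\<lambda>y. integral {a..y} ?g) has_real_derivative ?g z) (at z within {a..z + 1})"
      by (intro integral_has_real_derivative continuous_intros) (auto simp: a_def)
    then show ?thesis using at_within_Icc_at[of a z "z + 1"] by (simp add: a_def)
  qed
  then have "((\<lambda>y. 2 / sqrt pi * (integral {a..} ?g - integral {a..y} ?g)) has_real_derivative
      2 / sqrt pi * (0 - ?g z)) (at z)"
    by (intro DERIV_cmult DERIV_diff DERIV_const)
  then have "(erfc has_real_derivative 2 / sqrt pi * (0 - ?g z)) (at z)"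
  proof (rule has_field_derivative_transform_within_open[of _ _ _ "{a<..}"])
    fix y assume "y \<in> {a<..}"
    then show "2 / sqrt pi * (integral {a..} ?g - integral {a..y} ?g) = erfc y"
      by (simp add: erfc_def split[of y])
  qed (auto simp: a_def)
  then show ?thesis by simp
qed

lemma erfc_nonneg: "0 \<le> erfc z"
  unfolding erfc_def by (intro mult_nonneg_nonneg integral_nonneg exp_neg_square_integrable) auto

lemma erfc_strict_antimono: "y < z \<Longrightarrow> erfc z < erfc y"
  by (rule DERIV_neg_imp_decreasing) (auto intro!: exI erfc_deriv)

lemma erfc_0_pos: "0 < erfc 0"
  using erfc_strict_antimono[of 0 1] erfc_nonneg[of 1] by simp

text \<open>Beyond 1/2 the integrand lies below \<open>exp (z - z\<^sup>2 - s)\<close>, because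
  \<open>(s - z) * (s + z - 1)\<close> is nonnegative, and this majorant integrates to
  \<open>exp (- z\<^sup>2)\<close>. Up to 1/2 the Gaussian is bounded away from zero.\<close>

lemma erfc_bound: "\<exists>C\<ge>0. \<forall>z\<ge>0. erfc z \<le> C * exp (- z\<^sup>2)"
proof -
  define C where "C = max (2 / sqrt pi) (erfc 0 * exp (1/4))"
  have "erfc z \<le> C * exp (- z\<^sup>2)" if z: "0 \<le> z" for z
  proof (cases "z \<le> 1/2")
    case True
    have "z\<^sup>2 \<le> 1/4" using power_mono[OF True z, of 2] by (simp add: power2_eq_square)
    have "erfc z \<le> erfc 0" using erfc_strict_antimono[of 0 z] z by (cases "z = 0") auto
    also have "\<dots> \<le> (erfc 0 * exp (1/4)) * exp (- z\<^sup>2)"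
      using erfc_0_pos \<open>z\<^sup>2 \<le> 1/4\<close> by (simp add: mult.assoc exp_add[symmetric])
    also have "\<dots> \<le> C * exp (- z\<^sup>2)" by (simp add: C_def)
    finally show ?thesis .
  next
    case False
    have i: "((\<lambda>s. exp (z - z\<^sup>2) * exp (- 1 * s)) has_integral exp (z - z\<^sup>2) * (exp (- 1 * z) / 1)) {z..}"
      by (intro has_integral_mult_right has_integral_exp_minus_to_infinity) auto
    have "integral {z..} (\<lambda>s. exp (- s\<^sup>2)) \<le> integral {z..} (\<lambda>s. exp (z - z\<^sup>2) * exp (- 1 * s))"
    proof (rule integral_le[OF exp_neg_square_integrable has_integral_integrable[OF i]])
      fix s assume "s \<in> {z..}"
      then have "0 \<le> (s - z) * (s + z - 1)" using False by auto
      then have "- s\<^sup>2 \<le> (z - z\<^sup>2) + - 1 * s" by (simp add: power2_eq_square algebra_simps)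
      then show "exp (- s\<^sup>2) \<le> exp (z - z\<^sup>2) * exp (- 1 * s)" unfolding exp_add[symmetric] by simp
    qed
    also have "\<dots> = exp (- z\<^sup>2)"
      using integral_unique[OF i] by (simp add: exp_add[symmetric])
    finally have "erfc z \<le> 2 / sqrt pi * exp (- z\<^sup>2)"
      unfolding erfc_def by (intro mult_left_mono) auto
    also have "\<dots> \<le> C * exp (- z\<^sup>2)" by (intro mult_right_mono) (auto simp: C_def)
    finally show ?thesis .
  qed
  moreover have "0 \<le> C" by (auto simp: C_def le_max_iff_disj)
  ultimately show ?thesis by blast
qed

text \<open>Apply \<open>u \<le> exp u\<close> to \<open>u = \<kappa> * w / n\<close> with
  \<open>w = 2 + v\<^sup>2\<close>, which dominates \<open>1 + v\<close>, and raise to the power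
  \<open>n\<close>.\<close>

lemma power_times_exp_neg_bound:
  assumes "0 < \<kappa>"
  shows "\<exists>C\<ge>0. \<forall>v\<ge>0. (1 + v) ^ n * exp (- \<kappa> * v\<^sup>2) \<le> (C::real)"
proof (cases "n = 0")
  case True
  then show ?thesis using assms by (intro exI[of _ 1]) auto
next
  case False
  define C where "C = (real n / \<kappa>) ^ n * exp (2 * \<kappa>)"
  have "(1 + v) ^ n * exp (- \<kappa> * v\<^sup>2) \<le> C" if v: "0 \<le> v" for v
  proof -
    define w where "w = 2 + v\<^sup>2"
    have "0 \<le> (v - 1/2)\<^sup>2" by simp
    then have vw: "1 + v \<le> w" by (simp add: w_def power2_eq_square algebra_simps)
    have w0: "0 < w" using vw v by simp
    have "\<kappa> * w / real n \<le> exp (\<kappa> * w / real n)"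
      using exp_ge_add_one_self[of "\<kappa> * w / real n"] by linarith
    then have "(\<kappa> * w / real n) ^ n \<le> exp (\<kappa> * w / real n) ^ n"
      using assms w0 by (intro power_mono) auto
    also have "\<dots> = exp (\<kappa> * w)" using False by (simp add: exp_of_nat_mult[symmetric])
    finally have "w ^ n \<le> (real n / \<kappa>) ^ n * exp (\<kappa> * w)"
      using assms False by (simp add: power_mult_distrib power_divide field_simps)
    then have "w ^ n * exp (- \<kappa> * v\<^sup>2) \<le> (real n / \<kappa>) ^ n * exp (\<kappa> * w) * exp (- \<kappa> * v\<^sup>2)"
      by (intro mult_right_mono) auto
    also have "\<dots> = C" by (simp add: C_def w_def mult.assoc exp_add[symmetric] algebra_simps)
    finally have "w ^ n * exp (- \<kappa> * v\<^sup>2) \<le> C" .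
    moreover have "(1 + v) ^ n * exp (- \<kappa> * v\<^sup>2) \<le> w ^ n * exp (- \<kappa> * v\<^sup>2)"
      using vw v by (intro mult_right_mono power_mono) auto
    ultimately show ?thesis by linarith
  qed
  moreover have "0 \<le> C" using assms by (simp add: C_def)
  ultimately show ?thesis by blast
qed

text \<open>Twice the fundamental solution of the heat equation; with this normalisation
  \<open>- hk x t\<close> is the space derivative of \<open>erfc (x / (2 * sqrt t))\<close>.\<close>

definition hk :: "real \<Rightarrow> real \<Rightarrow> real"
  where "hk x t = exp (- x\<^sup>2 / (4 * t)) / sqrt (pi * t)"

text \<open>\<open>th n\<close> is the \<open>n\<close>-th spatial derivative of \<open>erfc (x / (2 * sqrt t))\<close>, which solves the heat
  equation. \<open>zeta\<close> solves the heat equation with boundary values \<open>t * erfc 0\<close> and initial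
  values \<open>0\<close>.\<close>

definition th :: "nat \<Rightarrow> real \<Rightarrow> real \<Rightarrow> real"
  where "th n x t = (if n = 0 then erfc (x / (2 * sqrt t))
    else if n = 1 then - hk x t
    else if n = 2 then x / (2 * t) * hk x t
    else if n = 3 then (1 / (2 * t) - x\<^sup>2 / (4 * t\<^sup>2)) * hk x t
    else (x ^ 3 / (8 * t ^ 3) - 3 * x / (4 * t\<^sup>2)) * hk x t)"

definition zeta :: "real \<Rightarrow> real \<Rightarrow> real"
  where "zeta x t = (if t = 0 then 0 else (t + x\<^sup>2 / 2) * th 0 x t - x * t * hk x t)"

definition zeta1 :: "real \<Rightarrow> real \<Rightarrow> real"
  where "zeta1 x t = x * th 0 x t - 2 * t * hk x t"

lemma hk_x:
  assumes "0 < t"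
  shows "((\<lambda>x. hk x t) has_real_derivative - (x / (2 * t)) * hk x t) (at x)"
  unfolding hk_def using assms by (auto intro!: derivative_eq_intros simp: field_simps)

lemma hk_t:
  assumes "0 < t"
  shows "((\<lambda>t. hk x t) has_real_derivative (x\<^sup>2 / (4 * t\<^sup>2) - 1 / (2 * t)) * hk x t) (at t)"
proof -
  have "((\<lambda>t. exp (- x\<^sup>2 / (4 * t))) has_real_derivative exp (- x\<^sup>2 / (4 * t)) * (x\<^sup>2 / (4 * t\<^sup>2))) (at t)"
    using assms by (auto intro!: derivative_eq_intros simp: field_simps power2_eq_square)
  moreover have "((\<lambda>t. inverse (sqrt (pi * t))) has_real_derivative
      - (1 / (2 * t)) * inverse (sqrt (pi * t))) (at t)"
  proof -
    have "((\<lambda>t. sqrt (pi * t)) has_real_derivative inverse (sqrt (pi * t)) / 2 * pi) (at t)"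
    proof -
      have "0 < pi * t" using assms by simp
      then show ?thesis by (auto intro!: derivative_eq_intros)
    qed
    from DERIV_inverse'[OF this]
    have "((\<lambda>t. inverse (sqrt (pi * t))) has_real_derivative
      - (inverse (sqrt (pi * t)) * (inverse (sqrt (pi * t)) / 2 * pi) * inverse (sqrt (pi * t)))) (at t)"
      using assms by simp
    moreover have "inverse (sqrt (pi * t)) * inverse (sqrt (pi * t)) = inverse (pi * t)"
      using assms by (simp flip: inverse_mult_distrib)
    then have "inverse (sqrt (pi * t)) * (inverse (sqrt (pi * t)) / 2 * pi) = 1 / (2 * t)"
      using assms by (simp add: field_simps)
    ultimately show ?thesis by (simp add: mult.commute)
  qed
  ultimately have "((\<lambda>t. exp (- x\<^sup>2 / (4 * t)) * inverse (sqrt (pi * t))) has_real_derivative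
     exp (- x\<^sup>2 / (4 * t)) * (x\<^sup>2 / (4 * t\<^sup>2)) * inverse (sqrt (pi * t)) +
     - (1 / (2 * t)) * inverse (sqrt (pi * t)) * exp (- x\<^sup>2 / (4 * t))) (at t)"
    by (rule DERIV_mult)
  then show ?thesis unfolding hk_def divide_inverse[of _ "sqrt _"]
    by (simp add: algebra_simps)
qed

lemma th_0_arg_square: "0 < t \<Longrightarrow> (x / (2 * sqrt t))\<^sup>2 = x\<^sup>2 / (4 * t)"
  by (simp add: power_divide power_mult_distrib)

lemma th_x:
  assumes "0 < t" "n < 4"
  shows "((\<lambda>x. th n x t) has_real_derivative th (Suc n) x t) (at x)"
proof -
  have "((\<lambda>x. erfc (x / (2 * sqrt t))) has_real_derivative
      - (2 / sqrt pi) * exp (- (x / (2 * sqrt t))\<^sup>2) * (1 / (2 * sqrt t))) (at x)"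
    by (intro DERIV_chain2[OF erfc_deriv] DERIV_cdivide DERIV_ident)
  moreover have "- (2 / sqrt pi) * exp (- (x / (2 * sqrt t))\<^sup>2) * (1 / (2 * sqrt t)) = - hk x t"
    unfolding th_0_arg_square[OF assms(1)] hk_def using assms by (simp add: real_sqrt_mult)
  ultimately have 0: "((\<lambda>x. erfc (x / (2 * sqrt t))) has_real_derivative - hk x t) (at x)"
    by simp
  have 1: "((\<lambda>x. - hk x t) has_real_derivative x / (2 * t) * hk x t) (at x)"
    using assms by (auto intro!: derivative_eq_intros hk_x)
  have 2: "((\<lambda>x. x / (2 * t) * hk x t) has_real_derivative
      (1 / (2 * t) - x\<^sup>2 / (4 * t\<^sup>2)) * hk x t) (at x)"
    using assms by (auto intro!: derivative_eq_intros hk_x simp: power2_eq_square field_simps)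
  have 3: "((\<lambda>x. (1 / (2 * t) - x\<^sup>2 / (4 * t\<^sup>2)) * hk x t) has_real_derivative
      (x ^ 3 / (8 * t ^ 3) - 3 * x / (4 * t\<^sup>2)) * hk x t) (at x)"
    using assms by (auto intro!: derivative_eq_intros hk_x
        simp: power2_eq_square power3_eq_cube field_simps)
  have "n = 0 \<or> n = 1 \<or> n = 2 \<or> n = 3" using assms by auto
  then show ?thesis using 0 1 2 3 by (auto simp: th_def)
qed

lemma th_t:
  assumes "0 < t"
  shows "((\<lambda>t. th 0 x t) has_real_derivative th 2 x t) (at t)"
    and "((\<lambda>t. th 2 x t) has_real_derivative th 4 x t) (at t)"
proof -
  have sq: "((\<lambda>t. x / (2 * sqrt t)) has_real_derivative - (x / (4 * t * sqrt t))) (at t)"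
  proof -
    have "((\<lambda>t. x / (2 * sqrt t)) has_real_derivative
        - (x * (2 * (inverse (sqrt t) / 2))) / (2 * sqrt t * (2 * sqrt t))) (at t)"
      using assms by (auto intro!: derivative_eq_intros simp: divide_simps)
    moreover have "2 * sqrt t * (2 * sqrt t) = 4 * t" using assms by (simp add: mult_ac)
    moreover have "- (x * (2 * (inverse (sqrt t) / 2))) / (4 * t) = - (x / (4 * t * sqrt t))"
      using assms by (simp add: divide_simps)
    ultimately show ?thesis by (simp only:)
  qed
  have "((\<lambda>t. erfc (x / (2 * sqrt t))) has_real_derivative
      - (2 / sqrt pi) * exp (- (x / (2 * sqrt t))\<^sup>2) * - (x / (4 * t * sqrt t))) (at t)"
    by (rule DERIV_chain2[OF erfc_deriv sq])
  moreover have "- (2 / sqrt pi) * exp (- (x / (2 * sqrt t))\<^sup>2) * - (x / (4 * t * sqrt t)) = th 2 x t"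
    unfolding th_0_arg_square[OF assms(1)] th_def hk_def using assms by (simp add: real_sqrt_mult)
  ultimately show "((\<lambda>t. th 0 x t) has_real_derivative th 2 x t) (at t)"
    by (simp add: th_def)
  show "((\<lambda>t. th 2 x t) has_real_derivative th 4 x t) (at t)"
    unfolding th_def using assms
    by (auto intro!: derivative_eq_intros hk_t simp: power2_eq_square power3_eq_cube field_simps)
qed

lemma zeta_x:
  assumes "0 < t"
  shows "((\<lambda>x. zeta x t) has_real_derivative zeta1 x t) (at x)"
    and "((\<lambda>x. zeta1 x t) has_real_derivative th 0 x t) (at x)"
  using assms th_x[OF assms, of 0]
  unfolding zeta_def zeta1_def
  by (auto intro!: derivative_eq_intros hk_x simp: th_def[of "Suc 0"] power2_eq_square field_simps)

lemma zeta_t: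
  assumes "0 < t"
  shows "((\<lambda>t. zeta x t) has_real_derivative th 0 x t) (at t)"
proof -
  have "((\<lambda>t. (t + x\<^sup>2 / 2) * th 0 x t - x * t * hk x t) has_real_derivative th 0 x t) (at t)"
    using assms
    by (auto intro!: derivative_eq_intros hk_t th_t
        simp: th_def[of 2] power2_eq_square field_simps)
  then show ?thesis
    by (rule has_field_derivative_transform_within_open[of _ _ _ "{0<..}"])
      (use assms in \<open>auto simp: zeta_def\<close>)
qed

text \<open>In the similarity variable \<open>v = x / sqrt t\<close> each function is a power of
  \<open>sqrt t\<close> times a function bounded by a polynomial in \<open>v\<close> times
  \<open>exp (- (v\<^sup>2 / 4))\<close>. Replacing \<open>sqrt t\<close> by
  \<open>sqrt (x\<^sup>2 + t)\<close> in the denominator costs a power of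
  \<open>sqrt (1 + v\<^sup>2)\<close>. Lowering the Gaussian rate from 1/4 to
  \<open>\<kappa>\<close> absorbs both.\<close>

lemma th_bound:
  assumes "\<kappa> < 1/4"
  shows "\<exists>C\<ge>0. \<forall>x\<ge>0. \<forall>t>0.
    (\<forall>n\<le>4. \<bar>th n x t\<bar> \<le> C * exp (- \<kappa> * x\<^sup>2 / t) / sqrt (x\<^sup>2 + t) ^ n) \<and>
    \<bar>zeta x t\<bar> \<le> C * exp (- \<kappa> * x\<^sup>2 / t) * t \<and>
    \<bar>zeta1 x t\<bar> \<le> C * exp (- \<kappa> * x\<^sup>2 / t) * sqrt t"
proof -
  \<comment> \<open>The exponent 7 is the worst case \<open>n = 4\<close>: a cubic polynomial in
    \<open>v\<close> times the fourth power of \<open>sqrt (1 + v\<^sup>2)\<close>.\<close>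
  obtain A where A: "0 \<le> A" "\<And>v. 0 \<le> v \<Longrightarrow> (1 + v) ^ 7 * exp (- (1/4 - \<kappa>) * v\<^sup>2) \<le> A"
    using power_times_exp_neg_bound[of "1/4 - \<kappa>" 7] assms by auto
  obtain B where B: "0 \<le> B" "\<And>z. 0 \<le> z \<Longrightarrow> erfc z \<le> B * exp (- z\<^sup>2)"
    using erfc_bound by auto
  define C where "C = (2 * B + 4) * A"
  have main: "\<bar>p\<bar> * exp (- (v\<^sup>2 / 4)) \<le> k * A * exp (- \<kappa> * v\<^sup>2)"
    if "0 \<le> v" "\<bar>p\<bar> \<le> k * (1 + v) ^ 7" for p k v
  proof -
    have "0 \<le> k * (1 + v) ^ 7" using that by linarith
    then have k: "0 \<le> k" using that by (simp add: zero_le_mult_iff)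
    have "\<bar>p\<bar> * exp (- (v\<^sup>2 / 4)) \<le> k * (1 + v) ^ 7 * exp (- (v\<^sup>2 / 4))"
      using that by (intro mult_right_mono) auto
    also have "\<dots> = k * ((1 + v) ^ 7 * exp (- (1/4 - \<kappa>) * v\<^sup>2)) * exp (- \<kappa> * v\<^sup>2)"
      by (simp add: mult.assoc exp_add[symmetric] algebra_simps)
    also have "\<dots> \<le> k * A * exp (- \<kappa> * v\<^sup>2)"
      using A(2)[OF that(1)] k by (intro mult_right_mono mult_left_mono) auto
    finally show ?thesis .
  qed
  have pi1: "1 / sqrt pi \<le> 1" using pi_gt3 by (simp add: real_le_rsqrt)
  {
    fix x t :: real assume x: "0 \<le> x" and t: "0 < t"
    define s where "s = sqrt t"
    define v where "v = x / s"
    define e where "e = exp (- (v\<^sup>2 / 4))"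
    define q where "q = sqrt (1 + v\<^sup>2)"
    have s: "0 < s" "t = s\<^sup>2" using t by (auto simp: s_def)
    have v: "0 \<le> v" "x = v * s" using x s by (auto simp: v_def)
    have ev: "- x\<^sup>2 / (4 * t) = - (v\<^sup>2 / 4)" "- \<kappa> * x\<^sup>2 / t = - \<kappa> * v\<^sup>2"
      using s by (auto simp: v(2) s(2) power_mult_distrib field_simps)
    define H where "H = hk x t"
    have hk: "H = (1 / sqrt pi) * e / s"
      unfolding H_def hk_def ev e_def using s by (simp add: real_sqrt_mult)
    have q: "sqrt (x\<^sup>2 + t) = s * q"
    proof -
      have "x\<^sup>2 + t = s\<^sup>2 * (1 + v\<^sup>2)" by (simp add: v(2) s(2) power_mult_distrib algebra_simps)
      then show ?thesis using s by (simp add: real_sqrt_mult q_def)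
    qed
    have q1: "1 \<le> q" "q \<le> 1 + v"
      using v by (auto simp: q_def intro!: real_le_lsqrt simp: power2_eq_square algebra_simps)
    have q2: "q\<^sup>2 = 1 + v\<^sup>2" by (simp add: q_def)
    have th0: "th 0 x t \<le> B * e"
    proof -
      have "x / (2 * sqrt t) = v / 2" by (simp add: v_def s_def)
      then have "th 0 x t = erfc (v / 2)" by (simp only: th_def if_True simp_thms)
      then show ?thesis using B(2)[of "v / 2"] v(1) by (simp add: e_def power_divide)
    qed
    have th0': "0 \<le> th 0 x t" by (simp add: th_def erfc_nonneg)
    have e0: "0 \<le> e" by (simp add: e_def)
    have E: "\<bar>p\<bar> * e \<le> C * exp (- \<kappa> * v\<^sup>2)" if "\<bar>p\<bar> \<le> (2 * B + 4) * (1 + v) ^ 7" for p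
      using main[OF v(1) that] by (simp add: C_def e_def)
    have pw: "(1 + v) ^ i \<le> (1 + v) ^ 7" if "i \<le> 7" for i
      using that v by (intro power_increasing) auto
    have vp: "v ^ i \<le> (1 + v) ^ i" for i
      using v by (intro power_mono) auto
    have one7: "1 \<le> (1 + v) ^ 7" using v by (intro one_le_power) auto
    have prod: "0 \<le> a \<Longrightarrow> a \<le> k * (1 + v) ^ i \<Longrightarrow> k \<le> 2 * B + 4 \<Longrightarrow> i \<le> 7 \<Longrightarrow> 0 \<le> k \<Longrightarrow>
        a \<le> (2 * B + 4) * (1 + v) ^ 7" for a k i
      using mult_mono[of k "2 * B + 4" "(1 + v) ^ i" "(1 + v) ^ 7"] pw[of i] B(1) v(1) by auto
    have n: "\<bar>th n x t\<bar> * sqrt (x\<^sup>2 + t) ^ n \<le> C * exp (- \<kappa> * v\<^sup>2)" if "n \<le> 4" for n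
    proof -
      consider "n = 0" | "n = 1" | "n = 2" | "n = 3" | "n = 4" using \<open>n \<le> 4\<close> by linarith
      then show ?thesis
      proof cases
        case 1
        have "th 0 x t \<le> B * e" by (rule th0)
        also have "\<dots> = \<bar>B\<bar> * e" using B by simp
        also have "\<dots> \<le> C * exp (- \<kappa> * v\<^sup>2)"
          by (rule E, rule prod[of _ B 0]) (use B in auto)
        finally show ?thesis using 1 th0' by simp
      next
        case 2
        have "\<bar>th n x t\<bar> * sqrt (x\<^sup>2 + t) ^ n = \<bar>1 / sqrt pi * q\<bar> * e"
        proof -
          have "th n x t = - (1 / sqrt pi * e / s)" by (simp add: 2 th_def H_def[symmetric] hk)
          then show ?thesis using s(1) q1 e0 by (simp add: q 2 abs_mult)
        qed
        also have "\<dots> \<le> C * exp (- \<kappa> * v\<^sup>2)"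
        proof (rule E, rule prod[of _ 1 1])
          have "1 / sqrt pi * q \<le> 1 * (1 + v)" using pi1 q1 v by (intro mult_mono) auto
          then show "\<bar>1 / sqrt pi * q\<bar> \<le> 1 * (1 + v) ^ 1" using q1 by simp
        qed (use B in auto)
        finally show ?thesis .
      next
        case 3
        have "\<bar>th n x t\<bar> * sqrt (x\<^sup>2 + t) ^ n = \<bar>1 / sqrt pi * (v * q\<^sup>2 / 2)\<bar> * e"
        proof -
          have "th n x t = 1 / sqrt pi * (v / 2) * e / s\<^sup>2"
          proof -
            have "th n x t = x / (2 * t) * H" by (simp add: 3 th_def H_def)
            then show ?thesis using s(1) by (simp add: hk v(2) s(2) field_simps power2_eq_square)
          qed
          then show ?thesis using s(1) q1 e0 v(1) by (simp add: q 3 abs_mult power_mult_distrib)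
        qed
        also have "\<dots> \<le> C * exp (- \<kappa> * v\<^sup>2)"
        proof (rule E, rule prod[of _ 1 3])
          have "v * q\<^sup>2 \<le> (1 + v) * (1 + v)\<^sup>2"
            using q1 v(1) by (intro mult_mono power_mono) auto
          moreover have "0 \<le> v * q\<^sup>2" using v(1) by simp
          ultimately have "v * q\<^sup>2 / 2 \<le> (1 + v) * (1 + v)\<^sup>2" by linarith
          then have "1 / sqrt pi * (v * q\<^sup>2 / 2) \<le> 1 * ((1 + v) * (1 + v)\<^sup>2)"
            using pi1 q1 v by (intro mult_mono) auto
          then show "\<bar>1 / sqrt pi * (v * q\<^sup>2 / 2)\<bar> \<le> 1 * (1 + v) ^ 3"
            using q1 v by (simp add: power3_eq_cube power2_eq_square mult_ac)
        qed (use B in auto)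
        finally show ?thesis .
      next
        case 4
        have "\<bar>th n x t\<bar> * sqrt (x\<^sup>2 + t) ^ n = \<bar>1 / sqrt pi * ((1/2 - v\<^sup>2/4) * q ^ 3)\<bar> * e"
        proof -
          have "th n x t = 1 / sqrt pi * (1/2 - v\<^sup>2/4) * e / s ^ 3"
          proof -
            have "th n x t = (1 / (2 * t) - x\<^sup>2 / (4 * t\<^sup>2)) * H" by (simp add: 4 th_def H_def)
            then show ?thesis using s(1)
              by (simp add: hk v(2) s(2) field_simps power2_eq_square power3_eq_cube)
          qed
          then show ?thesis using s(1) q1 e0 by (simp add: q 4 abs_mult power_mult_distrib)
        qed
        also have "\<dots> \<le> C * exp (- \<kappa> * v\<^sup>2)"
        proof (rule E, rule prod[of _ 1 5])
          have a: "\<bar>1/2 - v\<^sup>2/4\<bar> \<le> (1 + v)\<^sup>2"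
            using v by (simp add: abs_le_iff power2_eq_square algebra_simps)
          have "\<bar>1 / sqrt pi * ((1/2 - v\<^sup>2/4) * q ^ 3)\<bar> = 1 / sqrt pi * (\<bar>1/2 - v\<^sup>2/4\<bar> * q ^ 3)"
            using q1 by (simp add: abs_mult)
          also have "\<dots> \<le> 1 * ((1 + v)\<^sup>2 * (1 + v) ^ 3)"
            using pi1 q1 v a by (intro mult_mono power_mono) auto
          finally show "\<bar>1 / sqrt pi * ((1/2 - v\<^sup>2/4) * q ^ 3)\<bar> \<le> 1 * (1 + v) ^ 5"
            by (simp add: power_add[symmetric])
        qed (use B in auto)
        finally show ?thesis .
      next
        case 5
        have "\<bar>th n x t\<bar> * sqrt (x\<^sup>2 + t) ^ n = \<bar>1 / sqrt pi * ((v ^ 3 / 8 - 3 * v / 4) * q ^ 4)\<bar> * e"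
        proof -
          have "th n x t = 1 / sqrt pi * (v ^ 3 / 8 - 3 * v / 4) * e / s ^ 4"
          proof -
            have "th n x t = (x ^ 3 / (8 * t ^ 3) - 3 * x / (4 * t\<^sup>2)) * H" by (simp add: 5 th_def H_def)
            then show ?thesis using s(1)
              by (simp add: hk v(2) s(2) field_simps power2_eq_square power3_eq_cube power4_eq_xxxx)
          qed
          then show ?thesis using s(1) q1 e0 by (simp add: q 5 abs_mult power_mult_distrib)
        qed
        also have "\<dots> \<le> C * exp (- \<kappa> * v\<^sup>2)"
        proof (rule E, rule prod[of _ 1 7])
          have "v ^ 3 \<le> (1 + v) ^ 3" "v \<le> (1 + v) ^ 3" "0 \<le> v ^ 3"
            using vp[of 3] self_le_power[of "1 + v" 3] v by auto
          then have a: "\<bar>v ^ 3 / 8 - 3 * v / 4\<bar> \<le> (1 + v) ^ 3" using v by linarith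
          have "\<bar>1 / sqrt pi * ((v ^ 3 / 8 - 3 * v / 4) * q ^ 4)\<bar> = 1 / sqrt pi * (\<bar>v ^ 3 / 8 - 3 * v / 4\<bar> * q ^ 4)"
            using q1 by (simp add: abs_mult)
          also have "\<dots> \<le> 1 * ((1 + v) ^ 3 * (1 + v) ^ 4)"
            using pi1 q1 v a by (intro mult_mono power_mono) auto
          finally show "\<bar>1 / sqrt pi * ((v ^ 3 / 8 - 3 * v / 4) * q ^ 4)\<bar> \<le> 1 * (1 + v) ^ 7"
            by (simp add: power_add[symmetric])
        qed (use B in auto)
        finally show ?thesis .
      qed
    qed
    have n': "\<bar>th n x t\<bar> \<le> C * exp (- \<kappa> * x\<^sup>2 / t) / sqrt (x\<^sup>2 + t) ^ n" if "n \<le> 4" for n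
    proof -
      have "0 < sqrt (x\<^sup>2 + t) ^ n" using t by (auto intro!: zero_less_power add_nonneg_pos)
      then show ?thesis using n[OF that] unfolding ev by (simp add: pos_le_divide_eq)
    qed
    have z: "\<bar>zeta x t\<bar> \<le> C * exp (- \<kappa> * x\<^sup>2 / t) * t"
    proof -
      have "zeta x t = t * ((1 + v\<^sup>2 / 2) * th 0 x t - v * (1 / sqrt pi) * e)"
      proof -
        have "zeta x t = (t + x\<^sup>2 / 2) * th 0 x t - x * t * H" using t by (simp add: zeta_def H_def)
        moreover have "x\<^sup>2 = v\<^sup>2 * t" "x * t * H = t * (v * (1 / sqrt pi) * e)"
          using s(1) by (simp_all add: hk v(2) s(2) power_mult_distrib)
        ultimately show ?thesis by (simp add: algebra_simps)
      qed
      also have "\<bar>\<dots>\<bar> \<le> t * (\<bar>(1 + v\<^sup>2 / 2) * B + v\<bar> * e)"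
      proof -
        have "(1 + v\<^sup>2 / 2) * th 0 x t \<le> (1 + v\<^sup>2 / 2) * (B * e)"
          using th0 by (intro mult_left_mono) auto
        moreover have "0 \<le> (1 + v\<^sup>2 / 2) * th 0 x t" using th0' by (intro mult_nonneg_nonneg) auto
        moreover have "v * (1 / sqrt pi) * e \<le> v * 1 * e"
          using v pi1 e0 by (intro mult_right_mono mult_left_mono) auto
        moreover have "0 \<le> v * (1 / sqrt pi) * e" using v e0 by auto
        ultimately have "\<bar>(1 + v\<^sup>2 / 2) * th 0 x t - v * (1 / sqrt pi) * e\<bar> \<le> ((1 + v\<^sup>2 / 2) * B + v) * e"
          by (auto simp: algebra_simps)
        also have "\<dots> \<le> \<bar>(1 + v\<^sup>2 / 2) * B + v\<bar> * e" using e0 by (intro mult_right_mono abs_ge_self)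
        finally show ?thesis using t by (simp add: abs_mult)
      qed
      also have "\<dots> \<le> t * (C * exp (- \<kappa> * v\<^sup>2))"
      proof (intro mult_left_mono E, rule prod[of _ "B + 1" 2])
        have "1 + v\<^sup>2 / 2 \<le> (1 + v)\<^sup>2" "v \<le> (1 + v)\<^sup>2"
          using v by (auto simp: power2_eq_square algebra_simps)
        then have "(1 + v\<^sup>2 / 2) * B + v \<le> (1 + v)\<^sup>2 * B + (1 + v)\<^sup>2"
          using B by (intro add_mono mult_right_mono) auto
        moreover have "0 \<le> (1 + v\<^sup>2 / 2) * B + v" using B v by auto
        ultimately show "\<bar>(1 + v\<^sup>2 / 2) * B + v\<bar> \<le> (B + 1) * (1 + v)\<^sup>2" by (simp add: algebra_simps)
      qed (use B t in auto)
      finally show ?thesis unfolding ev by (simp add: mult_ac)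
    qed
    have z1: "\<bar>zeta1 x t\<bar> \<le> C * exp (- \<kappa> * x\<^sup>2 / t) * sqrt t"
    proof -
      have "zeta1 x t = s * (v * th 0 x t - 2 * (1 / sqrt pi) * e)"
      proof -
        have "zeta1 x t = x * th 0 x t - 2 * t * H" by (simp add: zeta1_def H_def)
        moreover have "2 * t * H = s * (2 * (1 / sqrt pi) * e)"
          using s(1) by (simp add: hk s(2) power2_eq_square)
        moreover have "x * th 0 x t = s * (v * th 0 x t)" by (simp only: v(2) mult_ac)
        ultimately show ?thesis by (simp add: algebra_simps)
      qed
      also have "\<bar>\<dots>\<bar> \<le> s * (\<bar>v * B + 2\<bar> * e)"
      proof -
        have "v * th 0 x t \<le> v * (B * e)" using th0 v by (intro mult_left_mono) auto
        moreover have "0 \<le> v * th 0 x t" using th0' v by (intro mult_nonneg_nonneg) auto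
        moreover have "2 * (1 / sqrt pi) * e \<le> 2 * 1 * e"
          using pi1 e0 by (intro mult_right_mono mult_left_mono) auto
        moreover have "0 \<le> 2 * (1 / sqrt pi) * e" using e0 by auto
        ultimately have "\<bar>v * th 0 x t - 2 * (1 / sqrt pi) * e\<bar> \<le> (v * B + 2) * e"
          by (auto simp: algebra_simps)
        also have "\<dots> \<le> \<bar>v * B + 2\<bar> * e" using e0 by (intro mult_right_mono abs_ge_self)
        finally show ?thesis using s by (simp add: abs_mult)
      qed
      also have "\<dots> \<le> s * (C * exp (- \<kappa> * v\<^sup>2))"
      proof (intro mult_left_mono E, rule prod[of _ "B + 2" 1])
        show "\<bar>v * B + 2\<bar> \<le> (B + 2) * (1 + v) ^ 1" using B v by (simp add: algebra_simps)
      qed (use B s in auto)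
      finally show ?thesis unfolding ev s_def[symmetric] by (simp add: mult_ac)
    qed
    note n' z z1
  }
  moreover have "0 \<le> C" using A B by (simp add: C_def)
  ultimately show ?thesis by blast
qed

subsection \<open>Classical functions on a rectangle and the maximum principle\<close>

text \<open>The time derivative is only required from the left: this is all that the maximum principle
  needs, it includes the final time, and it is stable under restriction in time.\<close>

definition reg ::
    "(real \<Rightarrow> real \<Rightarrow> real) \<Rightarrow> (real \<Rightarrow> real \<Rightarrow> real) \<Rightarrow> (real \<Rightarrow> real \<Rightarrow> real) \<Rightarrow> (real \<Rightarrow> real \<Rightarrow> real)
      \<Rightarrow> real \<Rightarrow> real \<Rightarrow> real \<Rightarrow> real \<Rightarrow> bool"
  where "reg u ut ux uxx x0 x1 t0 t1 \<longleftrightarrow>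
    continuous_on ({x0..x1} \<times> {t0..t1}) (\<lambda>(x, t). u x t) \<and>
    (\<forall>x t. x0 < x \<longrightarrow> x < x1 \<longrightarrow> t0 < t \<longrightarrow> t \<le> t1 \<longrightarrow>
      (u x has_real_derivative ut x t) (at_left t) \<and>
      ((\<lambda>s. u s t) has_real_derivative ux x t) (at x) \<and>
      ((\<lambda>s. ux s t) has_real_derivative uxx x t) (at x))"

lemma regD:
  assumes "reg u ut ux uxx x0 x1 t0 t1"
  shows "continuous_on ({x0..x1} \<times> {t0..t1}) (\<lambda>(x, t). u x t)"
    and "x0 < x \<Longrightarrow> x < x1 \<Longrightarrow> t0 < t \<Longrightarrow> t \<le> t1 \<Longrightarrow> (u x has_real_derivative ut x t) (at_left t)"
    and "x0 < x \<Longrightarrow> x < x1 \<Longrightarrow> t0 < t \<Longrightarrow> t \<le> t1 \<Longrightarrow> ((\<lambda>s. u s t) has_real_derivative ux x t) (at x)"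
    and "x0 < x \<Longrightarrow> x < x1 \<Longrightarrow> t0 < t \<Longrightarrow> t \<le> t1 \<Longrightarrow> ((\<lambda>s. ux s t) has_real_derivative uxx x t) (at x)"
  using assms unfolding reg_def by auto

lemma continuous_on_slice_x:
  fixes u :: "real \<Rightarrow> real \<Rightarrow> real"
  assumes "continuous_on ({x0..x1} \<times> {t0..t1}) (\<lambda>(x, t). u x t)" "t0 \<le> t" "t \<le> t1" "x0 \<le> p" "q \<le> x1"
  shows "continuous_on {p..q} (\<lambda>x. u x t)"
proof -
  have "continuous_on {p..q} (\<lambda>x. (\<lambda>(x, t). u x t) (x, t))"
    by (rule continuous_on_compose2[OF assms(1)]) (use assms in \<open>auto intro!: continuous_intros\<close>)
  then show ?thesis by simp
qed

lemma continuous_on_slice_t: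
  fixes u :: "real \<Rightarrow> real \<Rightarrow> real"
  assumes "continuous_on ({x0..x1} \<times> {t0..t1}) (\<lambda>(x, t). u x t)" "x0 \<le> x" "x \<le> x1" "t0 \<le> p" "q \<le> t1"
  shows "continuous_on {p..q} (\<lambda>t. u x t)"
proof -
  have "continuous_on {p..q} (\<lambda>t. (\<lambda>(x, t). u x t) (x, t))"
    by (rule continuous_on_compose2[OF assms(1)]) (use assms in \<open>auto intro!: continuous_intros\<close>)
  then show ?thesis by simp
qed

lemma reg_add:
  assumes "reg u ut ux uxx x0 x1 t0 t1" "reg v vt vx vxx x0 x1 t0 t1"
  shows "reg (\<lambda>x t. u x t + v x t) (\<lambda>x t. ut x t + vt x t) (\<lambda>x t. ux x t + vx x t)
    (\<lambda>x t. uxx x t + vxx x t) x0 x1 t0 t1"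
  using assms unfolding reg_def
  by (auto intro!: DERIV_add continuous_on_add simp: case_prod_beta)

lemma reg_diff:
  assumes "reg u ut ux uxx x0 x1 t0 t1" "reg v vt vx vxx x0 x1 t0 t1"
  shows "reg (\<lambda>x t. u x t - v x t) (\<lambda>x t. ut x t - vt x t) (\<lambda>x t. ux x t - vx x t)
    (\<lambda>x t. uxx x t - vxx x t) x0 x1 t0 t1"
  using assms unfolding reg_def
  by (auto intro!: DERIV_diff continuous_on_diff simp: case_prod_beta)

lemma reg_cmult:
  assumes "reg u ut ux uxx x0 x1 t0 t1"
  shows "reg (\<lambda>x t. k * u x t) (\<lambda>x t. k * ut x t) (\<lambda>x t. k * ux x t) (\<lambda>x t. k * uxx x t) x0 x1 t0 t1"
  using assms unfolding reg_def
  by (auto intro!: DERIV_cmult continuous_on_mult_left simp: case_prod_beta)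

lemma reg_subset:
  assumes "reg u ut ux uxx x0 x1 t0 t1" "x0 \<le> y0" "y1 \<le> x1" "t0 \<le> s0" "s1 \<le> t1"
  shows "reg u ut ux uxx y0 y1 s0 s1"
  using assms unfolding reg_def
  by (auto intro: continuous_on_subset[of "{x0..x1} \<times> {t0..t1}"])

lemma reg_shift_x:
  assumes "reg u ut ux uxx x0 x1 t0 t1"
  shows "reg (\<lambda>x t. u (x + r) t) (\<lambda>x t. ut (x + r) t) (\<lambda>x t. ux (x + r) t) (\<lambda>x t. uxx (x + r) t)
    (x0 - r) (x1 - r) t0 t1"
  unfolding reg_def
proof (intro conjI allI impI)
  have "continuous_on ({x0 - r..x1 - r} \<times> {t0..t1}) (\<lambda>p. (\<lambda>(x, t). u x t) (fst p + r, snd p))"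
    by (rule continuous_on_compose2[OF regD(1)[OF assms]]) (auto intro!: continuous_intros)
  then show "continuous_on ({x0 - r..x1 - r} \<times> {t0..t1}) (\<lambda>(x, t). u (x + r) t)"
    by (simp add: case_prod_beta)
  fix x t assume "x0 - r < x" "x < x1 - r" "t0 < t" "t \<le> t1"
  then show "(u (x + r) has_real_derivative ut (x + r) t) (at_left t)"
    "((\<lambda>s. u (s + r) t) has_real_derivative ux (x + r) t) (at x)"
    "((\<lambda>s. ux (s + r) t) has_real_derivative uxx (x + r) t) (at x)"
    using regD(2-4)[OF assms, of "x + r" t] by (auto simp: DERIV_shift)
qed

lemma reg_shift_t:
  assumes "reg u ut ux uxx x0 x1 t0 t1"
  shows "reg (\<lambda>x t. u x (t - r)) (\<lambda>x t. ut x (t - r)) (\<lambda>x t. ux x (t - r)) (\<lambda>x t. uxx x (t - r))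
    x0 x1 (t0 + r) (t1 + r)"
  unfolding reg_def
proof (intro conjI allI impI)
  have "continuous_on ({x0..x1} \<times> {t0 + r..t1 + r}) (\<lambda>p. (\<lambda>(x, t). u x t) (fst p, snd p - r))"
    by (rule continuous_on_compose2[OF regD(1)[OF assms]]) (auto intro!: continuous_intros)
  then show "continuous_on ({x0..x1} \<times> {t0 + r..t1 + r}) (\<lambda>(x, t). u x (t - r))"
    by (simp add: case_prod_beta)
  fix x t assume a: "x0 < x" "x < x1" "t0 + r < t" "t \<le> t1 + r"
  then show "((\<lambda>s. u s (t - r)) has_real_derivative ux x (t - r)) (at x)"
    "((\<lambda>s. ux s (t - r)) has_real_derivative uxx x (t - r)) (at x)"
    using regD(3,4)[OF assms, of x "t - r"] by auto
  have "(\<lambda>s. s - r) ` {..<t} = {..<t - r}"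
    by (auto simp: image_iff intro!: bexI[of _ "_ + r"])
  then have "(u x has_real_derivative ut x (t - r)) (at (t - r) within (\<lambda>s. s - r) ` {..<t})"
    using regD(2)[OF assms, of x "t - r"] a by simp
  moreover have "((\<lambda>s. s - r) has_real_derivative 1) (at_left t)"
    by (auto intro!: derivative_eq_intros)
  ultimately show "((\<lambda>s. u x (s - r)) has_real_derivative ut x (t - r)) (at_left t)"
    using DERIV_image_chain[of "u x" "ut x (t - r)" "\<lambda>s. s - r" t "{..<t}" 1] by (simp add: o_def)
qed

lemma regI_smooth:
  assumes "continuous_on ({x0..x1} \<times> {t0..t1}) (\<lambda>(x, t). u x t)"
    and "\<And>x t. x0 < x \<Longrightarrow> x < x1 \<Longrightarrow> t0 < t \<Longrightarrow> t \<le> t1 \<Longrightarrow> (u x has_real_derivative ut x t) (at t)"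
    and "\<And>x t. x0 < x \<Longrightarrow> x < x1 \<Longrightarrow> t0 < t \<Longrightarrow> t \<le> t1 \<Longrightarrow> ((\<lambda>s. u s t) has_real_derivative ux x t) (at x)"
    and "\<And>x t. x0 < x \<Longrightarrow> x < x1 \<Longrightarrow> t0 < t \<Longrightarrow> t \<le> t1 \<Longrightarrow> ((\<lambda>s. ux s t) has_real_derivative uxx x t) (at x)"
  shows "reg u ut ux uxx x0 x1 t0 t1"
  using assms unfolding reg_def by (auto intro: has_field_derivative_at_within)

lemma left_deriv_nonpos_at_min:
  fixes g :: "real \<Rightarrow> real"
  assumes "(g has_real_derivative D) (at_left t)" "a < t"
    and "\<And>s. a < s \<Longrightarrow> s < t \<Longrightarrow> g t \<le> g s"
  shows "D \<le> 0"
proof (rule tendsto_upperbound)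
  show "((\<lambda>s. (g s - g t) / (s - t)) \<longlongrightarrow> D) (at_left t)"
    using assms(1) by (simp add: has_field_derivative_iff)
  show "\<forall>\<^sub>F s in at_left t. (g s - g t) / (s - t) \<le> 0"
    unfolding eventually_at_left_field using assms(2,3)
    by (intro exI[of _ a]) (auto intro!: divide_nonneg_neg)
qed (simp add: trivial_limit_at_left_real)

text \<open>At a negative minimum, which lies inside or at the final time, the left time derivative
  is nonpositive, the second space derivative is nonnegative, and \<open>c * w\<close> is strictly
  negative. Strict positivity of \<open>c\<close> replaces the usual perturbation of
  \<open>w\<close>.\<close>

theorem max_principle:
  assumes r: "reg w wt wx wxx x0 x1 t0 t1" and "x0 \<le> x1" "t0 \<le> t1"
    and L: "\<And>x t. x0 < x \<Longrightarrow> x < x1 \<Longrightarrow> t0 < t \<Longrightarrow> t \<le> t1 \<Longrightarrow> 0 \<le> wt x t - wxx x t + c x t * w x t"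
    and c: "\<And>x t. x0 < x \<Longrightarrow> x < x1 \<Longrightarrow> t0 < t \<Longrightarrow> t \<le> t1 \<Longrightarrow> 0 < c x t"
    and bd: "\<And>x t. x0 \<le> x \<Longrightarrow> x \<le> x1 \<Longrightarrow> t0 \<le> t \<Longrightarrow> t \<le> t1 \<Longrightarrow> x = x0 \<or> x = x1 \<or> t = t0 \<Longrightarrow> 0 \<le> w x t"
    and xt: "x0 \<le> x" "x \<le> x1" "t0 \<le> t" "t \<le> t1"
  shows "0 \<le> w x t"
proof -
  have "\<exists>p\<in>{x0..x1} \<times> {t0..t1}. \<forall>q\<in>{x0..x1} \<times> {t0..t1}. (\<lambda>(x, t). w x t) p \<le> (\<lambda>(x, t). w x t) q"
    by (rule continuous_attains_inf[OF _ _ regD(1)[OF r]]) (use assms in \<open>auto intro: compact_Times\<close>)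
  then obtain y s where ys: "x0 \<le> y" "y \<le> x1" "t0 \<le> s" "s \<le> t1"
    and min: "\<And>x t. x0 \<le> x \<Longrightarrow> x \<le> x1 \<Longrightarrow> t0 \<le> t \<Longrightarrow> t \<le> t1 \<Longrightarrow> w y s \<le> w x t"
    by force
  have "0 \<le> w y s"
  proof (rule ccontr)
    assume neg: "\<not> 0 \<le> w y s"
    then have int: "x0 < y" "y < x1" "t0 < s"
      using bd[of y s] ys by (auto simp: order_le_less)
    have "wt y s \<le> 0"
      by (rule left_deriv_nonpos_at_min[OF regD(2)[OF r, of y s], of t0])
        (use int ys in \<open>auto intro!: min\<close>)
    moreover have "0 \<le> wxx y s"
    proof (rule tendsto_lowerbound)
      let ?d = "min (y - x0) (x1 - y)"
      show "((\<lambda>h. (w (y + h) s - 2 * w y s + w (y - h) s) / h\<^sup>2) \<longlongrightarrow> wxx y s) (at_right 0)"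
      proof (rule second_difference_tendsto[of ?d y _ "\<lambda>x. wx x s"])
        show "((\<lambda>x. wx x s) has_real_derivative wxx y s) (at y)"
          by (rule regD(4)[OF r]) (use int ys in auto)
        fix v assume "\<bar>v - y\<bar> < ?d"
        then show "((\<lambda>x. w x s) has_real_derivative wx v s) (at v)"
          by (intro regD(3)[OF r]) (use int ys in auto)
      qed (use int in auto)
      have "0 \<le> (w (y + h) s - 2 * w y s + w (y - h) s) / h\<^sup>2" if "0 < h" "h < ?d" for h
        using min[of "y + h" s] min[of "y - h" s] that ys by (intro divide_nonneg_nonneg) auto
      then show "\<forall>\<^sub>F h in at_right 0. 0 \<le> (w (y + h) s - 2 * w y s + w (y - h) s) / h\<^sup>2"
        unfolding eventually_at_right_field using int by (intro exI[of _ ?d]) auto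
    qed simp
    moreover have "c y s * w y s < 0" using c[of y s] int ys neg by (simp add: mult_pos_neg)
    ultimately show False using L[of y s] int ys by linarith
  qed
  then show ?thesis using min[OF xt] by linarith
qed

theorem comparison:
  assumes u: "reg u ut ux uxx x0 x1 t0 t1" and P: "reg P Pt Px Pxx x0 x1 t0 t1"
    and "x0 \<le> x1" "t0 \<le> t1"
    and L: "\<And>x t. x0 < x \<Longrightarrow> x < x1 \<Longrightarrow> t0 < t \<Longrightarrow> t \<le> t1 \<Longrightarrow>
      \<bar>ut x t - uxx x t + c x t * u x t\<bar> \<le> Pt x t - Pxx x t + c x t * P x t"
    and c: "\<And>x t. x0 < x \<Longrightarrow> x < x1 \<Longrightarrow> t0 < t \<Longrightarrow> t \<le> t1 \<Longrightarrow> 0 < c x t"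
    and bd: "\<And>x t. x0 \<le> x \<Longrightarrow> x \<le> x1 \<Longrightarrow> t0 \<le> t \<Longrightarrow> t \<le> t1 \<Longrightarrow> x = x0 \<or> x = x1 \<or> t = t0 \<Longrightarrow>
      \<bar>u x t\<bar> \<le> P x t"
    and xt: "x0 \<le> x" "x \<le> x1" "t0 \<le> t" "t \<le> t1"
  shows "\<bar>u x t\<bar> \<le> P x t"
proof -
  have "0 \<le> P x t - u x t"
  proof (rule max_principle[OF reg_diff[OF P u] assms(3,4) _ c _ xt])
    fix x t assume "x0 < x" "x < x1" "t0 < t" "t \<le> t1"
    from L[OF this] show "0 \<le> Pt x t - ut x t - (Pxx x t - uxx x t) + c x t * (P x t - u x t)"
      by (simp add: abs_le_iff algebra_simps)
  qed (use bd in \<open>fastforce simp: abs_le_iff\<close>)+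
  moreover have "0 \<le> P x t + u x t"
  proof (rule max_principle[OF reg_add[OF P u] assms(3,4) _ c _ xt])
    fix x t assume "x0 < x" "x < x1" "t0 < t" "t \<le> t1"
    from L[OF this] show "0 \<le> Pt x t + ut x t - (Pxx x t + uxx x t) + c x t * (P x t + u x t)"
      by (simp add: abs_le_iff algebra_simps)
  qed (use bd in \<open>fastforce simp: abs_le_iff\<close>)+
  ultimately show ?thesis by (simp add: abs_le_iff)
qed

subsection \<open>The singular functions\<close>

text \<open>The spatial derivatives of \<open>zeta\<close>. The index shift by 2 expresses that the
  second derivative of \<open>zeta\<close> is \<open>th 0\<close>; this gain of two orders is why
  removing a multiple of \<open>zeta\<close> leaves a milder singularity than \<open>z0\<close>
  has.\<close>

definition zt :: "nat \<Rightarrow> real \<Rightarrow> real \<Rightarrow> real"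
  where "zt n x t = (if n = 0 then zeta x t else if n = 1 then zeta1 x t else th (n - 2) x t)"

text \<open>\<open>n\<close>-th spatial derivative of \<open>exp (- c * t) * (p * erfc (x / (2 * sqrt t)) + q * zeta x t)\<close>.
  The value \<open>0\<close> at \<open>t = 0\<close> is the continuous extension away from the corner.\<close>

definition W :: "real \<Rightarrow> real \<Rightarrow> real \<Rightarrow> nat \<Rightarrow> real \<Rightarrow> real \<Rightarrow> real"
  where "W c p q n x t = (if t = 0 then 0 else exp (- c * t) * (p * th n x t + q * zt n x t))"

lemma zt_x:
  assumes "0 < t" "n < 4"
  shows "((\<lambda>x. zt n x t) has_real_derivative zt (Suc n) x t) (at x)"
proof -
  consider "n = 0" | "n = 1" | "n = 2" | "n = 3" using assms by linarith
  then show ?thesis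
    by cases (use zeta_x[OF assms(1)] th_x[OF assms(1)] in \<open>auto simp: zt_def numeral_eq_Suc\<close>)
qed

lemma W_x:
  assumes "0 < t" "n < 4"
  shows "((\<lambda>x. W c p q n x t) has_real_derivative W c p q (Suc n) x t) (at x)"
  unfolding W_def using assms by (auto intro!: derivative_eq_intros th_x zt_x)

lemma W_transform:
  assumes "0 < t" "((\<lambda>t. exp (- c * t) * (p * th n x t + q * zt n x t)) has_real_derivative D) (at t)"
  shows "((\<lambda>t. W c p q n x t) has_real_derivative D) (at t)"
  by (rule has_field_derivative_transform_within_open[OF assms(2), of "{0<..}"])
    (use assms(1) in \<open>auto simp: W_def\<close>)

lemma W_t:
  assumes "0 < t"
  shows "((\<lambda>t. W c p q 0 x t) has_real_derivative W c p q 2 x t - c * W c p q 0 x t) (at t)"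
    and "((\<lambda>t. W c p q 2 x t) has_real_derivative W c p q 4 x t - c * W c p q 2 x t) (at t)"
proof -
  have "((\<lambda>t. exp (- c * t) * (p * th 0 x t + q * zeta x t)) has_real_derivative
      exp (- c * t) * (p * th 2 x t + q * th 0 x t) - c * (exp (- c * t) * (p * th 0 x t + q * zeta x t))) (at t)"
    using assms by (auto intro!: derivative_eq_intros th_t zeta_t simp: algebra_simps)
  then show "((\<lambda>t. W c p q 0 x t) has_real_derivative W c p q 2 x t - c * W c p q 0 x t) (at t)"
    using assms by (intro W_transform) (auto simp: W_def zt_def)
  have "((\<lambda>t. exp (- c * t) * (p * th 2 x t + q * th 0 x t)) has_real_derivative
      exp (- c * t) * (p * th 4 x t + q * th 2 x t) - c * (exp (- c * t) * (p * th 2 x t + q * th 0 x t))) (at t)"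
    using assms by (auto intro!: derivative_eq_intros th_t simp: algebra_simps)
  then show "((\<lambda>t. W c p q 2 x t) has_real_derivative W c p q 4 x t - c * W c p q 2 x t) (at t)"
    using assms by (intro W_transform) (auto simp: W_def zt_def)
qed

lemma exp_neg_le_inverse: "0 < w \<Longrightarrow> exp (- w) \<le> 1 / (w::real)"
proof -
  assume w: "0 < w"
  have "w \<le> exp w" using exp_ge_add_one_self[of w] by linarith
  then show ?thesis using w by (simp add: exp_minus field_simps)
qed

lemma exp_neg_le_inverse_square: "0 < w \<Longrightarrow> exp (- w) \<le> 4 / (w::real)\<^sup>2"
proof -
  assume w: "0 < w"
  have "exp (- w) = exp (- (w / 2)) * exp (- (w / 2))" by (simp add: exp_add[symmetric])
  also have "\<dots> \<le> 1 / (w / 2) * (1 / (w / 2))"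
    using w exp_neg_le_inverse[of "w / 2"] by (intro mult_mono) auto
  finally show ?thesis by (simp add: power2_eq_square)
qed

lemma continuous_on_vanishing_initially:
  fixes F :: "real \<Rightarrow> real \<Rightarrow> real"
  assumes "continuous_on (A \<times> {0<..}) (\<lambda>(x, t). F x t)"
    and "\<And>x. x \<in> A \<Longrightarrow> F x 0 = 0"
    and "\<And>x t. x \<in> A \<Longrightarrow> 0 < t \<Longrightarrow> \<bar>F x t\<bar> \<le> M * t"
  shows "continuous_on (A \<times> {0..}) (\<lambda>(x, t). F x t)"
  unfolding continuous_on_eq_continuous_within
proof
  fix p assume "p \<in> A \<times> {0::real..}"
  then obtain x t where p: "p = (x, t)" "x \<in> A" "0 \<le> t" by auto
  show "continuous (at p within A \<times> {0..}) (\<lambda>(x, t). F x t)"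
  proof (cases "t = 0")
    case True
    have "((\<lambda>q. M * snd q) \<longlongrightarrow> M * snd p) (at p within A \<times> {0..})"
      by (intro tendsto_intros)
    then have "((\<lambda>q. M * snd q) \<longlongrightarrow> 0) (at p within A \<times> {0..})" using True p by simp
    moreover have "\<forall>\<^sub>F q in at p within A \<times> {0..}. norm ((\<lambda>(x, t). F x t) q) \<le> M * snd q"
      unfolding eventually_at_filter using assms(2,3)
      by (intro always_eventually) (force simp: order_le_less)
    ultimately have "((\<lambda>(x, t). F x t) \<longlongrightarrow> 0) (at p within A \<times> {0..})"
      by (rule Lim_null_comparison[rotated])
    then show ?thesis using True p assms(2) by (simp add: continuous_within)
  next
    case False
    have "open {q::real \<times> real. 0 < snd q}"
      by (intro open_Collect_less continuous_intros)
    moreover have "p \<in> {q. 0 < snd q}" using False p by simp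
    ultimately have "at p within A \<times> {0..} = at p within A \<times> {0<..}"
      by (intro at_within_nhd[of p "{q. 0 < snd q}"]) auto
    then show ?thesis using assms(1) p False by (simp add: continuous_on_eq_continuous_within)
  qed
qed

text \<open>The value of \<open>\<kappa>\<close> is forced from two sides: it lies below 1/4 because
  \<open>\<beta> < c\<close>, as \<open>th_bound\<close> requires, and it satisfies
  \<open>2 * sqrt (c * \<kappa>) = sqrt \<beta>\<close>, the rate of the lateral layers.\<close>

locale kernel_bounds =
  fixes c \<beta> \<eta> \<kappa> C :: real
  assumes beta_pos: "0 < \<beta>" and eta_pos: "0 < \<eta>" and c_ge: "\<beta> + \<eta> \<le> c"
    and kappa: "\<kappa> = \<beta> / (4 * c)"
    and C_nonneg: "0 \<le> C"
    and th_le: "\<And>x t n. 0 \<le> x \<Longrightarrow> 0 < t \<Longrightarrow> n \<le> 4 \<Longrightarrow>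
      \<bar>th n x t\<bar> \<le> C * exp (- \<kappa> * x\<^sup>2 / t) / sqrt (x\<^sup>2 + t) ^ n"
    and zeta_le: "\<And>x t. 0 \<le> x \<Longrightarrow> 0 < t \<Longrightarrow> \<bar>zeta x t\<bar> \<le> C * exp (- \<kappa> * x\<^sup>2 / t) * t"
    and zeta1_le: "\<And>x t. 0 \<le> x \<Longrightarrow> 0 < t \<Longrightarrow> \<bar>zeta1 x t\<bar> \<le> C * exp (- \<kappa> * x\<^sup>2 / t) * sqrt t"
begin

lemma c_pos: "0 < c" using beta_pos eta_pos c_ge by linarith

lemma kappa_pos: "0 < \<kappa>" using beta_pos c_pos by (simp add: kappa)

definition CW where "CW = C * (1 + 1 / \<eta>)"

lemma CW: "0 \<le> CW" "C \<le> CW"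
proof -
  show "0 \<le> CW" unfolding CW_def using C_nonneg eta_pos by (intro mult_nonneg_nonneg) auto
  show "C \<le> CW" unfolding CW_def using mult_left_mono[of 1 "1 + 1 / \<eta>" C] C_nonneg eta_pos by simp
qed

text \<open>The gap \<open>\<eta>\<close> between the decay rates \<open>c\<close> and
  \<open>\<beta>\<close> pays for linear growth in \<open>t\<close>.\<close>

lemma exp_c_le: "0 \<le> t \<Longrightarrow> exp (- c * t) * (1 + t) \<le> (1 + 1 / \<eta>) * exp (- \<beta> * t)"
proof -
  assume t: "0 \<le> t"
  have "exp (- \<eta> * t) * t \<le> 1 / \<eta>"
  proof (cases "t = 0")
    case False
    then have "exp (- (\<eta> * t)) * t \<le> 1 / (\<eta> * t) * t"
      using t eta_pos by (intro mult_right_mono exp_neg_le_inverse) auto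
    then show ?thesis using False t by simp
  qed (use eta_pos in auto)
  moreover have "exp (- \<eta> * t) \<le> 1" using t eta_pos by simp
  moreover have "exp (- \<eta> * t) * (1 + t) = exp (- \<eta> * t) + exp (- \<eta> * t) * t"
    by (simp only: distrib_left mult_1_right)
  ultimately have e: "exp (- \<eta> * t) * (1 + t) \<le> 1 + 1 / \<eta>" by linarith
  have "- c * t \<le> - \<eta> * t + - \<beta> * t"
    using mult_right_mono[OF c_ge t] by (simp add: algebra_simps)
  then have "exp (- c * t) \<le> exp (- \<eta> * t) * exp (- \<beta> * t)" unfolding exp_add[symmetric] by simp
  then have "exp (- c * t) * (1 + t) \<le> exp (- \<eta> * t) * exp (- \<beta> * t) * (1 + t)"
    using t by (intro mult_right_mono) auto
  also have "\<dots> = (exp (- \<eta> * t) * (1 + t)) * exp (- \<beta> * t)" by (simp add: mult_ac)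
  also have "\<dots> \<le> (1 + 1 / \<eta>) * exp (- \<beta> * t)" using e by (intro mult_right_mono) auto
  finally show ?thesis .
qed

text \<open>The arithmetic-geometric mean inequality for \<open>c * t\<close> and
  \<open>\<kappa> * x\<^sup>2 / t\<close>: decay in time, joined with the Gaussian, becomes
  exponential decay in space.\<close>

lemma exp_c_le_layer:
  assumes "0 \<le> x" "0 < t"
  shows "exp (- c * t) * exp (- \<kappa> * x\<^sup>2 / t) \<le> exp (- sqrt \<beta> * x)"
proof -
  have "0 \<le> (sqrt c * sqrt t - sqrt \<kappa> * x / sqrt t)\<^sup>2" by simp
  also have "\<dots> = c * t + \<kappa> * x\<^sup>2 / t - 2 * (sqrt c * sqrt \<kappa>) * x"
  proof -
    have "(sqrt c * sqrt t - sqrt \<kappa> * x / sqrt t)\<^sup>2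
        = (sqrt c * sqrt t)\<^sup>2 + (sqrt \<kappa> * x / sqrt t)\<^sup>2 - 2 * (sqrt c * sqrt \<kappa>) * x * (sqrt t / sqrt t)"
      by (simp add: power2_diff)
    then show ?thesis
      using assms c_pos kappa_pos by (simp add: power_mult_distrib power_divide)
  qed
  also have "sqrt c * sqrt \<kappa> = sqrt \<beta> / 2"
  proof -
    have "c * \<kappa> = \<beta> / 4" using c_pos by (simp add: kappa)
    then have "sqrt c * sqrt \<kappa> = sqrt (\<beta> / 4)" by (simp only: real_sqrt_mult[symmetric])
    then show ?thesis by (simp add: real_sqrt_divide)
  qed
  finally show ?thesis unfolding exp_add[symmetric] by simp
qed

lemma W_le:
  assumes "0 \<le> x" "0 < t" "n \<le> 4" "\<bar>zt n x t\<bar> \<le> C * exp (- \<kappa> * x\<^sup>2 / t) * Y"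
  shows "\<bar>W c p q n x t\<bar> \<le> exp (- c * t) * exp (- \<kappa> * x\<^sup>2 / t) * (C * (\<bar>p\<bar> / sqrt (x\<^sup>2 + t) ^ n + \<bar>q\<bar> * Y))"
proof -
  have "\<bar>p * th n x t + q * zt n x t\<bar> \<le> \<bar>p\<bar> * \<bar>th n x t\<bar> + \<bar>q\<bar> * \<bar>zt n x t\<bar>"
    by (rule order_trans[OF abs_triangle_ineq]) (simp add: abs_mult)
  also have "\<dots> \<le> \<bar>p\<bar> * (C * exp (- \<kappa> * x\<^sup>2 / t) / sqrt (x\<^sup>2 + t) ^ n) + \<bar>q\<bar> * (C * exp (- \<kappa> * x\<^sup>2 / t) * Y)"
    using assms th_le by (intro add_mono mult_left_mono) auto
  also have "\<dots> = exp (- \<kappa> * x\<^sup>2 / t) * (C * (\<bar>p\<bar> / sqrt (x\<^sup>2 + t) ^ n + \<bar>q\<bar> * Y))"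
    by (simp add: field_simps)
  finally show ?thesis
    using assms by (simp add: W_def abs_mult mult.assoc)
qed

text \<open>The bound on the bracket may lose a factor \<open>1 + t\<close>, since passing from the
  rate \<open>c\<close> to \<open>\<beta>\<close> absorbs it. All later estimates of
  \<open>W\<close> that decay in time go through this form.\<close>

lemma W_le':
  assumes "0 \<le> x" "0 < t" "n \<le> 4" "\<bar>zt n x t\<bar> \<le> C * exp (- \<kappa> * x\<^sup>2 / t) * Y"
    and "\<bar>p\<bar> / sqrt (x\<^sup>2 + t) ^ n + \<bar>q\<bar> * Y \<le> (1 + t) * V"
  shows "\<bar>W c p q n x t\<bar> \<le> CW * V * exp (- \<beta> * t) * exp (- \<kappa> * x\<^sup>2 / t)"
proof -
  have "0 \<le> C * exp (- \<kappa> * x\<^sup>2 / t) * Y" using assms(4) by linarith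
  \<comment> \<open>No sign is assumed for \<open>V\<close> and \<open>Y\<close>. For
    \<open>C > 0\<close> the bound on \<open>zt\<close> forces \<open>Y\<close> to be nonnegative;
    for \<open>C = 0\<close> the product \<open>C * V\<close> vanishes anyway.\<close>
  have "0 \<le> (1 + t) * V \<or> C = 0"
  proof (cases "C = 0")
    case False
    then have "0 < C * exp (- \<kappa> * x\<^sup>2 / t)" using C_nonneg by simp
    then have "0 \<le> Y" using \<open>0 \<le> C * exp (- \<kappa> * x\<^sup>2 / t) * Y\<close> by (simp add: zero_le_mult_iff)
    then have "0 \<le> \<bar>p\<bar> / sqrt (x\<^sup>2 + t) ^ n + \<bar>q\<bar> * Y" using assms by simp
    then show ?thesis using assms(5) by linarith
  qed simp
  then have CV: "0 \<le> C * V" using assms(2) C_nonneg by (auto simp: zero_le_mult_iff)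
  have "\<bar>W c p q n x t\<bar> \<le> exp (- c * t) * exp (- \<kappa> * x\<^sup>2 / t) * (C * ((1 + t) * V))"
    by (rule order_trans[OF W_le[OF assms(1-4)]])
      (use assms C_nonneg in \<open>intro mult_left_mono, auto\<close>)
  also have "\<dots> = (exp (- c * t) * (1 + t)) * (C * V * exp (- \<kappa> * x\<^sup>2 / t))" by (simp add: mult_ac)
  also have "\<dots> \<le> ((1 + 1 / \<eta>) * exp (- \<beta> * t)) * (C * V * exp (- \<kappa> * x\<^sup>2 / t))"
    using CV assms by (intro mult_right_mono exp_c_le) auto
  also have "\<dots> = CW * V * exp (- \<beta> * t) * exp (- \<kappa> * x\<^sup>2 / t)" by (simp add: CW_def mult_ac)
  finally show ?thesis .
qed

lemma drop_gauss: "0 \<le> A \<Longrightarrow> 0 < t \<Longrightarrow> A * exp (- \<kappa> * x\<^sup>2 / t) \<le> A"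
  using kappa_pos by (simp add: mult_left_le)

lemma zt_le:
  assumes "0 \<le> x" "0 < t"
  shows "\<bar>zt 0 x t\<bar> \<le> C * exp (- \<kappa> * x\<^sup>2 / t) * t"
    "\<bar>zt 1 x t\<bar> \<le> C * exp (- \<kappa> * x\<^sup>2 / t) * sqrt t"
    "2 \<le> n \<Longrightarrow> n \<le> 6 \<Longrightarrow> \<bar>zt n x t\<bar> \<le> C * exp (- \<kappa> * x\<^sup>2 / t) * (1 / sqrt (x\<^sup>2 + t) ^ (n - 2))"
  using zeta_le[OF assms] zeta1_le[OF assms] th_le[OF assms, of "n - 2"] by (auto simp: zt_def)

lemma W0_gauss:
  assumes "0 \<le> x" "0 < t"
  shows "\<bar>W c p q 0 x t\<bar> \<le> CW * (\<bar>p\<bar> + \<bar>q\<bar>) * exp (- \<beta> * t) * exp (- \<kappa> * x\<^sup>2 / t)"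
  by (rule W_le'[OF assms _ zt_le(1)[OF assms]]) (use assms in \<open>auto simp: algebra_simps\<close>)

lemma W0:
  assumes "0 \<le> x" "0 \<le> t"
  shows "\<bar>W c p q 0 x t\<bar> \<le> CW * (\<bar>p\<bar> + \<bar>q\<bar>) * exp (- \<beta> * t)"
proof (cases "t = 0")
  case False
  then show ?thesis
    using order_trans[OF W0_gauss drop_gauss] assms CW by simp
qed (use CW in \<open>auto simp: W_def\<close>)

lemma W1:
  assumes "0 \<le> x" "0 < t"
  shows "\<bar>W c p q 1 x t\<bar> \<le> CW * (\<bar>p\<bar> + \<bar>q\<bar>) * exp (- \<beta> * t) * (1 + 1 / sqrt (x\<^sup>2 + t))"
proof -
  have t1: "sqrt t \<le> 1 + t" using assms by (intro real_le_lsqrt) (auto simp: power2_eq_square algebra_simps)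
  have s: "0 < sqrt (x\<^sup>2 + t)" using assms by (auto intro: add_nonneg_pos)
  have "\<bar>W c p q 1 x t\<bar> \<le> CW * ((\<bar>p\<bar> + \<bar>q\<bar>) * (1 + 1 / sqrt (x\<^sup>2 + t))) * exp (- \<beta> * t) * exp (- \<kappa> * x\<^sup>2 / t)"
  proof (rule W_le'[OF assms _ zt_le(2)[OF assms]])
    have "\<bar>p\<bar> / sqrt (x\<^sup>2 + t) ^ 1 \<le> (1 + t) * (\<bar>p\<bar> * (1 + 1 / sqrt (x\<^sup>2 + t)))"
      using mult_mono[of 1 "1 + t" "\<bar>p\<bar> / sqrt (x\<^sup>2 + t)" "\<bar>p\<bar> * (1 + 1 / sqrt (x\<^sup>2 + t))"] assms s
      by (simp add: distrib_left)
    moreover have "\<bar>q\<bar> * sqrt t \<le> (1 + t) * (\<bar>q\<bar> * (1 + 1 / sqrt (x\<^sup>2 + t)))"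
      using mult_mono[of "sqrt t" "1 + t" "\<bar>q\<bar>" "\<bar>q\<bar> * (1 + 1 / sqrt (x\<^sup>2 + t))"] assms s t1
      by (simp add: distrib_left mult.commute)
    ultimately show "\<bar>p\<bar> / sqrt (x\<^sup>2 + t) ^ 1 + \<bar>q\<bar> * sqrt t
        \<le> (1 + t) * ((\<bar>p\<bar> + \<bar>q\<bar>) * (1 + 1 / sqrt (x\<^sup>2 + t)))"
      by (simp add: distrib_left distrib_right add_divide_distrib)
  qed simp
  also have "\<dots> \<le> CW * ((\<bar>p\<bar> + \<bar>q\<bar>) * (1 + 1 / sqrt (x\<^sup>2 + t))) * exp (- \<beta> * t)"
    using CW s by (intro drop_gauss mult_nonneg_nonneg assms(2)) auto
  finally show ?thesis by (simp add: mult_ac)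
qed

lemma W_ge2:
  assumes "0 \<le> x" "0 < t" "2 \<le> n" "n \<le> 4"
    and "\<bar>p\<bar> / sqrt (x\<^sup>2 + t) ^ n + \<bar>q\<bar> / sqrt (x\<^sup>2 + t) ^ (n - 2) \<le> V"
  shows "\<bar>W c p q n x t\<bar> \<le> CW * V * exp (- \<beta> * t) * exp (- \<kappa> * x\<^sup>2 / t)"
    and "\<bar>W c p q n x t\<bar> \<le> CW * V * exp (- \<beta> * t)"
proof -
  have "0 \<le> \<bar>p\<bar> / sqrt (x\<^sup>2 + t) ^ n + \<bar>q\<bar> / sqrt (x\<^sup>2 + t) ^ (n - 2)" using assms by auto
  then have V: "0 \<le> V" using assms(5) by linarith
  show 1: "\<bar>W c p q n x t\<bar> \<le> CW * V * exp (- \<beta> * t) * exp (- \<kappa> * x\<^sup>2 / t)"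
  proof (rule W_le'[OF assms(1,2,4) zt_le(3)[OF assms(1,2,3)]])
    show "\<bar>p\<bar> / sqrt (x\<^sup>2 + t) ^ n + \<bar>q\<bar> * (1 / sqrt (x\<^sup>2 + t) ^ (n - 2)) \<le> (1 + t) * V"
      using assms(5) mult_right_mono[of 1 "1 + t" V] V assms(2) by simp
  qed (use assms in auto)
  show "\<bar>W c p q n x t\<bar> \<le> CW * V * exp (- \<beta> * t)"
    by (rule order_trans[OF 1 drop_gauss]) (use CW V assms in auto)
qed

lemma sqrt_pow: "0 < t \<Longrightarrow> sqrt (x\<^sup>2 + t) ^ 2 = x\<^sup>2 + t" "0 < t \<Longrightarrow> sqrt (x\<^sup>2 + t) ^ 4 = (x\<^sup>2 + t)\<^sup>2"
proof -
  show 2: "0 < t \<Longrightarrow> sqrt (x\<^sup>2 + t) ^ 2 = x\<^sup>2 + t" by simp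
  have "sqrt (x\<^sup>2 + t) ^ 4 = (sqrt (x\<^sup>2 + t) ^ 2)\<^sup>2" by (simp add: power_mult[symmetric])
  then show "0 < t \<Longrightarrow> sqrt (x\<^sup>2 + t) ^ 4 = (x\<^sup>2 + t)\<^sup>2" using 2 by simp
qed

text \<open>The second estimate, like its analogue in \<open>W4\<close>, isolates the part with
  \<open>zeta\<close>: it is better by one power of \<open>x\<^sup>2 + t\<close>, since two
  derivatives of \<open>zeta\<close> are used up before the error function is
  differentiated.\<close>

lemma W2:
  assumes "0 \<le> x" "0 < t"
  shows "\<bar>W c p q 2 x t\<bar> \<le> CW * (\<bar>p\<bar> + \<bar>q\<bar>) * exp (- \<beta> * t) * (1 + 1 / (x\<^sup>2 + t))"
    and "\<bar>W c 0 q 2 x t\<bar> \<le> CW * \<bar>q\<bar> * exp (- \<beta> * t)"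
proof -
  have s: "0 < x\<^sup>2 + t" using assms by (auto intro: add_nonneg_pos)
  have "\<bar>W c p q 2 x t\<bar> \<le> CW * ((\<bar>p\<bar> + \<bar>q\<bar>) * (1 + 1 / (x\<^sup>2 + t))) * exp (- \<beta> * t)"
    by (rule W_ge2(2)) (use assms s in \<open>auto simp: field_simps\<close>)
  then show "\<bar>W c p q 2 x t\<bar> \<le> CW * (\<bar>p\<bar> + \<bar>q\<bar>) * exp (- \<beta> * t) * (1 + 1 / (x\<^sup>2 + t))"
    by (simp add: mult_ac)
  show "\<bar>W c 0 q 2 x t\<bar> \<le> CW * \<bar>q\<bar> * exp (- \<beta> * t)"
    by (rule W_ge2(2)) (use assms in auto)
qed

lemma W4:
  assumes "0 \<le> x" "0 < t"
  shows "\<bar>W c p q 4 x t\<bar> \<le> CW * (\<bar>p\<bar> + \<bar>q\<bar>) * exp (- \<beta> * t) * (1 + 1 / (x\<^sup>2 + t)\<^sup>2)"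
    and "\<bar>W c 0 q 4 x t\<bar> \<le> CW * \<bar>q\<bar> * exp (- \<beta> * t) / (x\<^sup>2 + t)"
proof -
  have s: "0 < x\<^sup>2 + t" using assms by (auto intro: add_nonneg_pos)
  have "1 / (x\<^sup>2 + t) \<le> 1 + 1 / (x\<^sup>2 + t)\<^sup>2"
  proof -
    have "y \<le> 1 + y\<^sup>2" for y :: real
    proof -
      have "0 \<le> (y - 1 / 2)\<^sup>2" by simp
      then show ?thesis by (simp add: power2_eq_square algebra_simps)
    qed
    from this[of "1 / (x\<^sup>2 + t)"] show ?thesis by (simp add: power_one_over)
  qed
  then have "\<bar>q\<bar> * (1 / (x\<^sup>2 + t)) \<le> \<bar>q\<bar> * (1 + 1 / (x\<^sup>2 + t)\<^sup>2)" by (intro mult_left_mono) auto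
  moreover have "\<bar>p\<bar> * (1 / (x\<^sup>2 + t)\<^sup>2) \<le> \<bar>p\<bar> * (1 + 1 / (x\<^sup>2 + t)\<^sup>2)" by (intro mult_left_mono) auto
  ultimately have "\<bar>p\<bar> / sqrt (x\<^sup>2 + t) ^ 4 + \<bar>q\<bar> / sqrt (x\<^sup>2 + t) ^ (4 - 2) \<le> (\<bar>p\<bar> + \<bar>q\<bar>) * (1 + 1 / (x\<^sup>2 + t)\<^sup>2)"
    using assms by (simp add: sqrt_pow distrib_right)
  then have "\<bar>W c p q 4 x t\<bar> \<le> CW * ((\<bar>p\<bar> + \<bar>q\<bar>) * (1 + 1 / (x\<^sup>2 + t)\<^sup>2)) * exp (- \<beta> * t)"
    by (intro W_ge2(2)) (use assms in auto)
  then show "\<bar>W c p q 4 x t\<bar> \<le> CW * (\<bar>p\<bar> + \<bar>q\<bar>) * exp (- \<beta> * t) * (1 + 1 / (x\<^sup>2 + t)\<^sup>2)"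
    by (simp add: mult_ac)
  have "\<bar>W c 0 q 4 x t\<bar> \<le> CW * (\<bar>q\<bar> / (x\<^sup>2 + t)) * exp (- \<beta> * t)"
    by (rule W_ge2(2)) (use assms in \<open>auto simp: sqrt_pow\<close>)
  then show "\<bar>W c 0 q 4 x t\<bar> \<le> CW * \<bar>q\<bar> * exp (- \<beta> * t) / (x\<^sup>2 + t)"
    by (simp add: mult_ac)
qed

lemma W_away:
  assumes "a \<le> x" "0 < a" "0 \<le> t" "n \<le> 4"
  shows "\<bar>W c p q n x t\<bar> \<le> CW * (\<bar>p\<bar> + \<bar>q\<bar>) * (1 + 1 / a) ^ 4"
proof (cases "t = 0")
  case False
  then have t: "0 < t" using assms by simp
  define s where "s = sqrt (x\<^sup>2 + t)"
  have "a \<le> s" unfolding s_def using assms t by (intro real_le_rsqrt) (simp add: add_increasing2 power_mono)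
  have inv: "1 / s ^ i \<le> (1 + 1 / a) ^ 4" if "i \<le> 4" for i
  proof -
    have "1 / s \<le> 1 / a" using \<open>a \<le> s\<close> assms by (simp add: frac_le)
    then have "(1 / s) ^ i \<le> (1 + 1 / a) ^ i" using \<open>a \<le> s\<close> assms by (intro power_mono) auto
    also have "\<dots> \<le> (1 + 1 / a) ^ 4" using that assms by (intro power_increasing) auto
    finally show ?thesis by (simp add: power_one_over)
  qed
  have one: "1 \<le> (1 + 1 / a) ^ 4" using assms by (intro one_le_power) auto
  have "0 \<le> x" using assms by linarith
  have e: "exp (- \<beta> * t) \<le> 1" using beta_pos t by simp
  have "\<bar>W c p q n x t\<bar> \<le> CW * ((\<bar>p\<bar> + \<bar>q\<bar>) * (1 + 1 / a) ^ 4) * exp (- \<beta> * t)"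
  proof -
    consider "n = 0" | "n = 1" | "2 \<le> n" by linarith
    then show ?thesis
    proof cases
      case 1
      have "CW * (\<bar>p\<bar> + \<bar>q\<bar>) * exp (- \<beta> * t) \<le> CW * ((\<bar>p\<bar> + \<bar>q\<bar>) * (1 + 1 / a) ^ 4) * exp (- \<beta> * t)"
        using one CW mult_left_mono[OF one, of "\<bar>p\<bar> + \<bar>q\<bar>"] by (intro mult_right_mono mult_left_mono) auto
      then show ?thesis using W0[OF \<open>0 \<le> x\<close> assms(3), of p q] 1 by simp
    next
      case 2
      have "1 + 1 / s \<le> (1 + 1 / a) ^ 4"
      proof -
        have "1 / s \<le> 1 / a" using \<open>a \<le> s\<close> assms by (simp add: frac_le)
        moreover have "(1 + 1 / a) ^ 1 \<le> (1 + 1 / a) ^ 4" using assms by (intro power_increasing) auto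
        ultimately show ?thesis by simp
      qed
      then have "CW * (\<bar>p\<bar> + \<bar>q\<bar>) * exp (- \<beta> * t) * (1 + 1 / s) \<le> CW * (\<bar>p\<bar> + \<bar>q\<bar>) * exp (- \<beta> * t) * (1 + 1 / a) ^ 4"
        using CW by (intro mult_left_mono) auto
      then show ?thesis using W1[OF \<open>0 \<le> x\<close> t, of p q] 2 by (simp add: s_def mult_ac)
    next
      case 3
      have "\<bar>p\<bar> * (1 / s ^ n) + \<bar>q\<bar> * (1 / s ^ (n - 2)) \<le> \<bar>p\<bar> * (1 + 1 / a) ^ 4 + \<bar>q\<bar> * (1 + 1 / a) ^ 4"
        using inv[of n] inv[of "n - 2"] assms by (intro add_mono mult_left_mono) auto
      then show ?thesis
        by (intro W_ge2(2)) (use \<open>0 \<le> x\<close> t assms 3 in \<open>auto simp: s_def distrib_right\<close>)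
    qed
  qed
  also have "\<dots> \<le> CW * ((\<bar>p\<bar> + \<bar>q\<bar>) * (1 + 1 / a) ^ 4) * 1"
    using e CW one by (intro mult_left_mono) auto
  finally show ?thesis by (simp add: mult_ac)
qed (use CW assms in \<open>auto simp: W_def\<close>)

text \<open>Here \<open>exp (- c * t)\<close> is spent on decay in space instead of decay in time.
  The error function part has no growth in \<open>t\<close> that would also have to be paid
  for.\<close>

lemma W_layer:
  assumes "a \<le> x" "0 < a" "0 \<le> t" "n \<le> 4"
  shows "\<bar>W c p 0 n x t\<bar> \<le> C * \<bar>p\<bar> * (1 + 1 / a) ^ 4 * exp (- sqrt \<beta> * x)"
proof (cases "t = 0")
  case False
  then have t: "0 < t" using assms by simp
  have "0 \<le> x" using assms by linarith
  define s where "s = sqrt (x\<^sup>2 + t)"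
  have "a \<le> s" unfolding s_def using assms t by (intro real_le_rsqrt) (simp add: add_increasing2 power_mono)
  then have "1 / s \<le> 1 / a" using assms by (simp add: frac_le)
  then have "(1 / s) ^ n \<le> (1 + 1 / a) ^ n" using \<open>a \<le> s\<close> assms by (intro power_mono) auto
  also have "\<dots> \<le> (1 + 1 / a) ^ 4" using assms by (intro power_increasing) auto
  finally have inv: "1 / s ^ n \<le> (1 + 1 / a) ^ 4" by (simp add: power_one_over)
  have "\<bar>W c p 0 n x t\<bar> = exp (- c * t) * (\<bar>p\<bar> * \<bar>th n x t\<bar>)"
    using False by (simp add: W_def abs_mult)
  also have "\<dots> \<le> exp (- c * t) * (\<bar>p\<bar> * (C * exp (- \<kappa> * x\<^sup>2 / t) / s ^ n))"
    unfolding s_def using \<open>0 \<le> x\<close> t assms by (intro mult_left_mono th_le) auto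
  also have "\<dots> = (exp (- c * t) * exp (- \<kappa> * x\<^sup>2 / t)) * (C * \<bar>p\<bar> * (1 / s ^ n))" by (simp add: mult_ac)
  also have "\<dots> \<le> exp (- sqrt \<beta> * x) * (C * \<bar>p\<bar> * (1 + 1 / a) ^ 4)"
    using inv exp_c_le_layer[OF \<open>0 \<le> x\<close> t] C_nonneg \<open>a \<le> s\<close> assms
    by (intro mult_mono mult_left_mono mult_nonneg_nonneg) auto
  finally show ?thesis by (simp add: mult_ac)
qed (use C_nonneg assms in \<open>auto simp: W_def\<close>)

lemma W_reg:
  assumes "p = 0 \<and> x0 = 0 \<or> 0 < x0"
  shows "reg (W c p q 0) (\<lambda>x t. W c p q 2 x t - c * W c p q 0 x t) (W c p q 1) (W c p q 2) x0 x1 0 t1"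
proof (rule regI_smooth)
  have "continuous_on (UNIV \<times> {0<..}) (\<lambda>u. exp (- c * snd u) *
      (p * erfc (fst u / (2 * sqrt (snd u))) + q * ((snd u + (fst u)\<^sup>2 / 2) * erfc (fst u / (2 * sqrt (snd u)))
        - fst u * snd u * (exp (- (fst u)\<^sup>2 / (4 * snd u)) / sqrt (pi * snd u)))))"
  proof -
    have e: "continuous_on UNIV erfc"
      by (intro continuous_at_imp_continuous_on ballI DERIV_isCont[OF erfc_deriv])
    have "continuous_on (UNIV \<times> {0<..}) (\<lambda>u::real \<times> real. erfc (fst u / (2 * sqrt (snd u))))"
      by (rule continuous_on_compose2[OF e]) (auto intro!: continuous_intros)
    then show ?thesis by (intro continuous_intros) auto
  qed
  then have "continuous_on (UNIV \<times> {0<..}) (\<lambda>(x, t). W c p q 0 x t)"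
    by (rule continuous_on_eq) (auto simp: W_def zt_def zeta_def th_def hk_def)
  then have c: "continuous_on ({x0..x1} \<times> {0<..}) (\<lambda>(x, t). W c p q 0 x t)"
    by (rule continuous_on_subset) auto
  have "continuous_on ({x0..x1} \<times> {0..}) (\<lambda>(x, t). W c p q 0 x t)"
  proof (rule continuous_on_vanishing_initially[OF c, where M = "C * (\<bar>p\<bar> / (\<kappa> * x0\<^sup>2) + \<bar>q\<bar>)"])
    fix x t assume x: "x \<in> {x0..x1}" and t: "(0::real) < t"
    have "0 \<le> x" using x assms by auto
    have "\<bar>W c p q 0 x t\<bar> \<le> exp (- c * t) * exp (- \<kappa> * x\<^sup>2 / t) * (C * (\<bar>p\<bar> / sqrt (x\<^sup>2 + t) ^ 0 + \<bar>q\<bar> * t))"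
      by (rule W_le[OF \<open>0 \<le> x\<close> t _ zt_le(1)[OF \<open>0 \<le> x\<close> t]]) simp
    also have "\<dots> \<le> 1 * exp (- \<kappa> * x\<^sup>2 / t) * (C * (\<bar>p\<bar> / sqrt (x\<^sup>2 + t) ^ 0 + \<bar>q\<bar> * t))"
      using c_pos t C_nonneg by (intro mult_right_mono) auto
    also have "\<dots> = C * (\<bar>p\<bar> * exp (- \<kappa> * x\<^sup>2 / t)) + C * \<bar>q\<bar> * t * exp (- \<kappa> * x\<^sup>2 / t)"
      by (simp add: algebra_simps)
    also have "\<dots> \<le> C * (\<bar>p\<bar> / (\<kappa> * x0\<^sup>2) * t) + C * \<bar>q\<bar> * t"
    proof (intro add_mono mult_left_mono)
      show "\<bar>p\<bar> * exp (- \<kappa> * x\<^sup>2 / t) \<le> \<bar>p\<bar> / (\<kappa> * x0\<^sup>2) * t"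
      proof (cases "p = 0")
        case False
        then have x0: "0 < x0" using assms by auto
        have "exp (- (\<kappa> * x\<^sup>2 / t)) \<le> 1 / (\<kappa> * x\<^sup>2 / t)"
          using kappa_pos x x0 t by (intro exp_neg_le_inverse) auto
        also have "\<dots> \<le> 1 / (\<kappa> * x0\<^sup>2 / t)"
          using kappa_pos x x0 t by (intro divide_left_mono divide_right_mono mult_left_mono power_mono) auto
        finally have "\<bar>p\<bar> * exp (- (\<kappa> * x\<^sup>2 / t)) \<le> \<bar>p\<bar> * (1 / (\<kappa> * x0\<^sup>2 / t))"
          by (intro mult_left_mono) auto
        then show ?thesis by simp
      qed simp
      show "C * \<bar>q\<bar> * t * exp (- \<kappa> * x\<^sup>2 / t) \<le> C * \<bar>q\<bar> * t"
        using C_nonneg t by (intro drop_gauss) auto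
    qed (use C_nonneg in auto)
    finally show "\<bar>W c p q 0 x t\<bar> \<le> C * (\<bar>p\<bar> / (\<kappa> * x0\<^sup>2) + \<bar>q\<bar>) * t"
      by (simp add: algebra_simps)
  qed (auto simp: W_def)
  then show "continuous_on ({x0..x1} \<times> {0..t1}) (\<lambda>(x, t). W c p q 0 x t)"
    by (rule continuous_on_subset) auto
next
  fix x t assume "x0 < x" "x < x1" "(0::real) < t" "t \<le> t1"
  then show "(W c p q 0 x has_real_derivative W c p q 2 x t - c * W c p q 0 x t) (at t)"
    "((\<lambda>s. W c p q 0 s t) has_real_derivative W c p q 1 x t) (at x)"
    "((\<lambda>s. W c p q 1 s t) has_real_derivative W c p q 2 x t) (at x)"
    using W_t(1)[of t c p q x] W_x[of t 0 c p q x] W_x[of t 1 c p q x] by (auto simp: numeral_2_eq_2)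
qed

end

subsection \<open>The scaled problem: time regularity\<close>

lemma W_add: "W c p q n x t = W c p 0 n x t + W c 0 q n x t"
  by (simp add: W_def algebra_simps)

lemma taylor2:
  fixes g :: "real \<Rightarrow> real"
  assumes "0 \<le> t" "t \<le> T" "0 \<le> A"
    and d1: "\<And>s. 0 \<le> s \<Longrightarrow> s \<le> T \<Longrightarrow> (g has_real_derivative g1 s) (at s within {0..T})"
    and d2: "\<And>s. 0 \<le> s \<Longrightarrow> s \<le> T \<Longrightarrow> (g1 has_real_derivative g2 s) (at s within {0..T})"
    and b: "\<And>s. 0 \<le> s \<Longrightarrow> s \<le> T \<Longrightarrow> \<bar>g2 s\<bar> \<le> A"
  shows "\<bar>g t - g 0 - t * g1 0\<bar> \<le> A * t\<^sup>2"
proof -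
  have d1': "(g has_real_derivative g1 s) (at s)" and d2': "(g1 has_real_derivative g2 s) (at s)"
    if "0 < s" "s < T" for s
    using d1[of s] d2[of s] at_within_Icc_at[of 0 s T] that by auto
  have c1: "continuous_on {0..T} g1" and c0: "continuous_on {0..T} g"
    using DERIV_continuous_on[of "{0..T}" g1 g2] DERIV_continuous_on[of "{0..T}" g g1] d1 d2 by auto
  have one: "\<bar>g1 s - g1 0\<bar> \<le> A * s ^ 1" if "0 \<le> s" "s \<le> T" for s
    using abs_diff_le_deriv[of 0 s g1 g2 A] that d2' b continuous_on_subset[OF c1, of "{0..s}"] by auto
  have "\<bar>g t - g 0 - t * g1 0\<bar> \<le> A * t ^ Suc 1"
  proof (rule abs_le_power_deriv[where g = "\<lambda>s. g s - g 0 - s * g1 0" and g' = "\<lambda>s. g1 s - g1 0"])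
    show "continuous_on {0..t} (\<lambda>s. g s - g 0 - s * g1 0)"
      using assms(2) by (intro continuous_intros continuous_on_subset[OF c0]) auto
    fix s assume s: "0 < s" "s < t"
    then show "((\<lambda>s. g s - g 0 - s * g1 0) has_real_derivative g1 s - g1 0) (at s)"
      using assms(2) by (auto intro!: derivative_eq_intros d1')
    show "\<bar>g1 s - g1 0\<bar> \<le> A * s ^ 1" using one s assms(2) by auto
  qed (use assms in auto)
  then show ?thesis by (simp add: power2_eq_square)
qed

text \<open>Used with \<open>v = b - c\<close> and \<open>s = x\<^sup>2 + t\<close>: this is where
  the vanishing of \<open>Dx b\<close> at the corner removes one power of the singularity.\<close>

lemma singular_weight_bounds:
  fixes v s K :: real
  assumes "0 < s" "\<bar>v\<bar> \<le> K" "\<bar>v\<bar> \<le> K * s"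
  shows "\<bar>v\<bar> * (1 + 1 / s) \<le> 2 * K" and "\<bar>v\<bar> * (1 + 1 / s\<^sup>2) \<le> K * (1 + 1 / s)"
proof -
  have 1: "\<bar>v\<bar> * (1 / s) \<le> K" using assms by (simp add: field_simps)
  show "\<bar>v\<bar> * (1 + 1 / s) \<le> 2 * K" using 1 assms(2) by (simp add: distrib_left)
  have "\<bar>v\<bar> * (1 / s) * (1 / s) \<le> K * (1 / s)" using 1 assms(1) by (intro mult_right_mono) auto
  then show "\<bar>v\<bar> * (1 + 1 / s\<^sup>2) \<le> K * (1 + 1 / s)"
    using assms(2) by (simp add: distrib_left power2_eq_square)
qed

text \<open>The barrier \<open>t / (x\<^sup>2 + 6 * t)\<close> for sources with the singularity \<open>1 / (x\<^sup>2 + t)\<close>.\<close>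

lemma corner_barrier:
  fixes x t :: real
  assumes "0 < t"
  shows "((\<lambda>t. t / (x\<^sup>2 + 6 * t)) has_real_derivative x\<^sup>2 / (x\<^sup>2 + 6 * t)\<^sup>2) (at t)"
    and "((\<lambda>x. t / (x\<^sup>2 + 6 * t)) has_real_derivative - (2 * x * t / (x\<^sup>2 + 6 * t)\<^sup>2)) (at x)"
    and "((\<lambda>x. - (2 * x * t / (x\<^sup>2 + 6 * t)\<^sup>2)) has_real_derivative
      t * (6 * x\<^sup>2 - 12 * t) / (x\<^sup>2 + 6 * t) ^ 3) (at x)"
    and "1 / (24 * (x\<^sup>2 + t)) \<le> x\<^sup>2 / (x\<^sup>2 + 6 * t)\<^sup>2 - t * (6 * x\<^sup>2 - 12 * t) / (x\<^sup>2 + 6 * t) ^ 3"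
    and "0 \<le> t / (x\<^sup>2 + 6 * t)" "t / (x\<^sup>2 + 6 * t) \<le> 1"
proof -
  have p: "0 < x\<^sup>2 + 6 * t" using assms by (auto intro: add_nonneg_pos)
  then have p0: "x\<^sup>2 + 6 * t \<noteq> 0" by simp
  show "((\<lambda>t. t / (x\<^sup>2 + 6 * t)) has_real_derivative x\<^sup>2 / (x\<^sup>2 + 6 * t)\<^sup>2) (at t)"
    using p0 by (auto intro!: derivative_eq_intros simp: power2_eq_square)
  show "((\<lambda>x. t / (x\<^sup>2 + 6 * t)) has_real_derivative - (2 * x * t / (x\<^sup>2 + 6 * t)\<^sup>2)) (at x)"
    using p0 by (auto intro!: derivative_eq_intros simp: power2_eq_square)
  show "((\<lambda>x. - (2 * x * t / (x\<^sup>2 + 6 * t)\<^sup>2)) has_real_derivative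
      t * (6 * x\<^sup>2 - 12 * t) / (x\<^sup>2 + 6 * t) ^ 3) (at x)"
  proof -
    define P where "P = x\<^sup>2 + 6 * t"
    have "((\<lambda>x. - (2 * x * t / (x\<^sup>2 + 6 * t)\<^sup>2)) has_real_derivative
        - ((2 * t * P\<^sup>2 - 2 * x * t * (2 * P * (2 * x))) / (P\<^sup>2 * P\<^sup>2))) (at x)"
      using p0 by (auto intro!: derivative_eq_intros simp: P_def)
    moreover have "- ((2 * t * P\<^sup>2 - 2 * x * t * (2 * P * (2 * x))) / (P\<^sup>2 * P\<^sup>2))
        = t * (6 * x\<^sup>2 - 12 * t) / P ^ 3"
    proof -
      have "2 * t * P\<^sup>2 - 2 * x * t * (2 * P * (2 * x)) = - (t * (6 * x\<^sup>2 - 12 * t)) * P"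
        by (simp add: P_def power2_eq_square algebra_simps)
      then show ?thesis
        using p by (simp add: P_def[symmetric] power2_eq_square power3_eq_cube)
    qed
    ultimately show ?thesis by (simp add: P_def)
  qed
  have "x\<^sup>2 / (x\<^sup>2 + 6 * t)\<^sup>2 - t * (6 * x\<^sup>2 - 12 * t) / (x\<^sup>2 + 6 * t) ^ 3
      = (x ^ 4 + 12 * t\<^sup>2) / (x\<^sup>2 + 6 * t) ^ 3"
  proof -
    define P where "P = x\<^sup>2 + 6 * t"
    have "x\<^sup>2 / P\<^sup>2 = (x\<^sup>2 * P) / P ^ 3"
      using p0 by (simp add: P_def[symmetric] power2_eq_square power3_eq_cube)
    then have "x\<^sup>2 / P\<^sup>2 - t * (6 * x\<^sup>2 - 12 * t) / P ^ 3 = (x\<^sup>2 * P - t * (6 * x\<^sup>2 - 12 * t)) / P ^ 3"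
      by (simp only: diff_divide_distrib)
    also have "x\<^sup>2 * P - t * (6 * x\<^sup>2 - 12 * t) = x ^ 4 + 12 * t\<^sup>2"
      by (simp add: P_def power2_eq_square power4_eq_xxxx algebra_simps)
    finally show ?thesis by (simp only: P_def)
  qed
  moreover have "1 / (24 * (x\<^sup>2 + t)) \<le> 1 / (4 * (x\<^sup>2 + 6 * t))"
    using assms by (intro divide_left_mono mult_pos_pos) (auto intro: add_nonneg_pos)
  moreover have "1 / (4 * (x\<^sup>2 + 6 * t)) \<le> (x ^ 4 + 12 * t\<^sup>2) / (x\<^sup>2 + 6 * t) ^ 3"
  proof -
    have "0 \<le> 3 * (x\<^sup>2 - 2 * t)\<^sup>2" by simp
    then have "(x\<^sup>2 + 6 * t)\<^sup>2 / (4 * (x\<^sup>2 + 6 * t) ^ 3) \<le> (4 * (x ^ 4 + 12 * t\<^sup>2)) / (4 * (x\<^sup>2 + 6 * t) ^ 3)"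
      using p by (intro divide_right_mono)
        (auto simp: power2_eq_square power4_eq_xxxx algebra_simps)
    moreover have "(x\<^sup>2 + 6 * t)\<^sup>2 / (4 * (x\<^sup>2 + 6 * t) ^ 3) = 1 / (4 * (x\<^sup>2 + 6 * t))"
      using p0 by (simp add: power2_eq_square power3_eq_cube)
    moreover have "(4 * (x ^ 4 + 12 * t\<^sup>2)) / (4 * (x\<^sup>2 + 6 * t) ^ 3) = (x ^ 4 + 12 * t\<^sup>2) / (x\<^sup>2 + 6 * t) ^ 3"
      by (rule mult_divide_mult_cancel_left) simp
    ultimately show ?thesis by (simp only:)
  qed
  ultimately show "1 / (24 * (x\<^sup>2 + t)) \<le> x\<^sup>2 / (x\<^sup>2 + 6 * t)\<^sup>2 - t * (6 * x\<^sup>2 - 12 * t) / (x\<^sup>2 + 6 * t) ^ 3"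
    by linarith
  show "0 \<le> t / (x\<^sup>2 + 6 * t)" "t / (x\<^sup>2 + 6 * t) \<le> 1"
    using p assms by (auto simp: divide_le_eq_1)
qed

text \<open>Here \<open>d\<close> stands for \<open>sqrt \<epsilon>\<close>, and
  \<open>bX n\<close>, \<open>fX n\<close>, \<open>ph n\<close> are the space derivatives of order
  \<open>n\<close>. One number \<open>K\<close> bounds all data, so later constants do not see
  \<open>d\<close>. Each space derivative of the data gains \<open>d\<close>; for time derivatives
  \<open>d\<^sup>2\<close> is recorded for both orders. \<open>a1_eq\<close> chooses the multiple of
  \<open>zeta\<close> that repairs the mismatch of first time derivatives at \<open>(0, 0)\<close>;
  \<open>match\<close> states continuity at both corners and the first compatibility condition at
  the right one.\<close>

locale scaled_problem = kernel_bounds c \<beta> \<eta> \<kappa> C for c \<beta> \<eta> \<kappa> C :: real +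
  fixes K d X Th :: real
    and b bt btt :: "real \<Rightarrow> real \<Rightarrow> real" and bX :: "nat \<Rightarrow> real \<Rightarrow> real \<Rightarrow> real"
    and f ft ftt :: "real \<Rightarrow> real \<Rightarrow> real" and fX :: "nat \<Rightarrow> real \<Rightarrow> real \<Rightarrow> real"
    and ph :: "nat \<Rightarrow> real \<Rightarrow> real"
    and gL gL1 gL2 gR gR1 gR2 :: "real \<Rightarrow> real"
    and a0 a1 :: real
    and y yt yx yxx :: "real \<Rightarrow> real \<Rightarrow> real"
  assumes K: "1 \<le> K" "1 \<le> K * \<beta>" "1 \<le> K * \<eta>"
    and d: "0 < d" "d \<le> 1" and X_def: "X = 1 / d" and Th_def: "Th = 1 / d\<^sup>2"
    and b_ge: "\<And>x t. 0 \<le> x \<Longrightarrow> x \<le> X \<Longrightarrow> 0 \<le> t \<Longrightarrow> t \<le> Th \<Longrightarrow> \<beta> + \<eta> \<le> b x t"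
    and bX0: "bX 0 = b" and fX0: "fX 0 = f"
    and bX_le: "\<And>n x t. n \<le> 4 \<Longrightarrow> 0 \<le> x \<Longrightarrow> x \<le> X \<Longrightarrow> 0 \<le> t \<Longrightarrow> t \<le> Th \<Longrightarrow> \<bar>bX n x t\<bar> \<le> K * d ^ n"
    and fX_le: "\<And>n x t. n \<le> 4 \<Longrightarrow> 0 \<le> x \<Longrightarrow> x \<le> X \<Longrightarrow> 0 \<le> t \<Longrightarrow> t \<le> Th \<Longrightarrow> \<bar>fX n x t\<bar> \<le> K * d ^ n"
    and bX_x: "\<And>n x t. n < 4 \<Longrightarrow> 0 \<le> x \<Longrightarrow> x \<le> X \<Longrightarrow> 0 \<le> t \<Longrightarrow> t \<le> Th \<Longrightarrow>
      ((\<lambda>x. bX n x t) has_real_derivative bX (Suc n) x t) (at x within {0..X})"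
    and fX_x: "\<And>n x t. n < 4 \<Longrightarrow> 0 \<le> x \<Longrightarrow> x \<le> X \<Longrightarrow> 0 \<le> t \<Longrightarrow> t \<le> Th \<Longrightarrow>
      ((\<lambda>x. fX n x t) has_real_derivative fX (Suc n) x t) (at x within {0..X})"
    and b_t: "\<And>x t. 0 \<le> x \<Longrightarrow> x \<le> X \<Longrightarrow> 0 \<le> t \<Longrightarrow> t \<le> Th \<Longrightarrow> (b x has_real_derivative bt x t) (at t within {0..Th})"
    and bt_t: "\<And>x t. 0 \<le> x \<Longrightarrow> x \<le> X \<Longrightarrow> 0 \<le> t \<Longrightarrow> t \<le> Th \<Longrightarrow> (bt x has_real_derivative btt x t) (at t within {0..Th})"
    and f_t: "\<And>x t. 0 \<le> x \<Longrightarrow> x \<le> X \<Longrightarrow> 0 \<le> t \<Longrightarrow> t \<le> Th \<Longrightarrow> (f x has_real_derivative ft x t) (at t within {0..Th})"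
    and ft_t: "\<And>x t. 0 \<le> x \<Longrightarrow> x \<le> X \<Longrightarrow> 0 \<le> t \<Longrightarrow> t \<le> Th \<Longrightarrow> (ft x has_real_derivative ftt x t) (at t within {0..Th})"
    and bft_le: "\<And>x t. 0 \<le> x \<Longrightarrow> x \<le> X \<Longrightarrow> 0 \<le> t \<Longrightarrow> t \<le> Th \<Longrightarrow>
      \<bar>bt x t\<bar> \<le> K * d\<^sup>2 \<and> \<bar>btt x t\<bar> \<le> K * d\<^sup>2 \<and> \<bar>ft x t\<bar> \<le> K * d\<^sup>2 \<and> \<bar>ftt x t\<bar> \<le> K * d\<^sup>2"
    and b_corner: "\<And>x t. 0 \<le> x \<Longrightarrow> x \<le> X \<Longrightarrow> 0 \<le> t \<Longrightarrow> t \<le> Th \<Longrightarrow> \<bar>b x t - c\<bar> \<le> K * (x\<^sup>2 + t)"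
    and bX1_corner: "\<And>x t. 0 \<le> x \<Longrightarrow> x \<le> X \<Longrightarrow> 0 \<le> t \<Longrightarrow> t \<le> Th \<Longrightarrow> \<bar>bX 1 x t\<bar> \<le> K * (x + t)"
    and c_eq: "b 0 0 = c"
    and ph_le: "\<And>n x. n \<le> 4 \<Longrightarrow> 0 \<le> x \<Longrightarrow> x \<le> X \<Longrightarrow> \<bar>ph n x\<bar> \<le> K * d ^ n"
    and ph_x: "\<And>n x. n < 4 \<Longrightarrow> 0 \<le> x \<Longrightarrow> x \<le> X \<Longrightarrow> (ph n has_real_derivative ph (Suc n) x) (at x within {0..X})"
    and g_le: "\<And>t. 0 \<le> t \<Longrightarrow> t \<le> Th \<Longrightarrow> \<bar>gL t\<bar> \<le> K \<and> \<bar>gR t\<bar> \<le> K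
      \<and> \<bar>gL1 t\<bar> \<le> K * d\<^sup>2 \<and> \<bar>gL2 t\<bar> \<le> K * d\<^sup>2 \<and> \<bar>gR1 t\<bar> \<le> K * d\<^sup>2 \<and> \<bar>gR2 t\<bar> \<le> K * d\<^sup>2"
    and gL_t: "\<And>t. 0 \<le> t \<Longrightarrow> t \<le> Th \<Longrightarrow> (gL has_real_derivative gL1 t) (at t within {0..Th})"
    and gL1_t: "\<And>t. 0 \<le> t \<Longrightarrow> t \<le> Th \<Longrightarrow> (gL1 has_real_derivative gL2 t) (at t within {0..Th})"
    and gR_t: "\<And>t. 0 \<le> t \<Longrightarrow> t \<le> Th \<Longrightarrow> (gR has_real_derivative gR1 t) (at t within {0..Th})"
    and gR1_t: "\<And>t. 0 \<le> t \<Longrightarrow> t \<le> Th \<Longrightarrow> (gR1 has_real_derivative gR2 t) (at t within {0..Th})"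
    and a_le: "\<bar>a0\<bar> \<le> K" "\<bar>a1\<bar> \<le> K" "\<bar>a1 * erfc 0\<bar> \<le> K"
    and a1_eq: "a1 * erfc 0 = gL1 0 + c * a0 - (ph 2 0 + f 0 0 - b 0 0 * ph 0 0)"
    and match: "gL 0 - a0 = ph 0 0" "gR 0 = ph 0 X" "gR1 0 = ph 2 X + f X 0 - b X 0 * ph 0 X"
    and y_reg: "reg y yt yx yxx 0 X 0 Th"
    and y_eq: "\<And>x t. 0 < x \<Longrightarrow> x < X \<Longrightarrow> 0 < t \<Longrightarrow> t \<le> Th \<Longrightarrow>
      yt x t - yxx x t + b x t * y x t = f x t - (b x t - c) * W c a0 0 0 x t"
    and y_left: "\<And>t. 0 \<le> t \<Longrightarrow> t \<le> Th \<Longrightarrow> y 0 t = gL t - a0 * exp (- c * t)"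
    and y_right: "\<And>t. 0 \<le> t \<Longrightarrow> t \<le> Th \<Longrightarrow> y X t = gR t - W c a0 0 0 X t"
    and y_init: "\<And>x. 0 \<le> x \<Longrightarrow> x \<le> X \<Longrightarrow> y x 0 = ph 0 x"
begin

lemma X_ge: "1 \<le> X" and Th_ge: "1 \<le> Th"
  using d by (auto simp: X_def Th_def power_le_one)

lemma d2: "0 < d\<^sup>2" "d\<^sup>2 \<le> 1" using d by (auto simp: power_le_one)

lemma dn: "d ^ n \<le> 1" using d by (simp add: power_le_one)

lemma K_pos: "0 < K" and K2: "K \<le> K\<^sup>2"
  using K(1) by (auto simp: power2_eq_square)

lemma inv_K: "1 / K \<le> \<beta>" "1 / K \<le> \<eta>" "1 / \<eta> \<le> K"
  using K K_pos eta_pos by (auto simp: field_simps)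

lemma b_le: "0 \<le> x \<Longrightarrow> x \<le> X \<Longrightarrow> 0 \<le> t \<Longrightarrow> t \<le> Th \<Longrightarrow> \<bar>b x t\<bar> \<le> K \<and> 0 < b x t"
  using bX_le[of 0 x t] b_ge[of x t] beta_pos eta_pos by (simp add: bX0)

lemma f_le: "0 \<le> x \<Longrightarrow> x \<le> X \<Longrightarrow> 0 \<le> t \<Longrightarrow> t \<le> Th \<Longrightarrow> \<bar>f x t\<bar> \<le> K"
  using fX_le[of 0 x t] by (simp add: fX0)

lemma c_le: "c \<le> K" using b_le[of 0 0] X_ge Th_ge c_eq by auto

lemma bc_le: "0 \<le> x \<Longrightarrow> x \<le> X \<Longrightarrow> 0 \<le> t \<Longrightarrow> t \<le> Th \<Longrightarrow> \<bar>b x t - c\<bar> \<le> K"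
  using b_le[of x t] c_le c_pos by auto

definition Z where "Z n x t = W c a0 a1 n x t"
definition Zt where "Zt x t = Z 2 x t - c * Z 0 x t"
definition Ztt where "Ztt x t = (Z 4 x t - c * Z 2 x t) - c * Zt x t"
definition R where "R x t = y x t - W c 0 a1 0 x t"
definition Rt where "Rt x t = yt x t - (W c 0 a1 2 x t - c * W c 0 a1 0 x t)"
definition Rx where "Rx x t = yx x t - W c 0 a1 1 x t"
definition Rxx where "Rxx x t = yxx x t - W c 0 a1 2 x t"
text \<open>The operator maps \<open>W\<close> to \<open>(b - c) * W\<close>, so removing the
  \<open>a1\<close> part from \<open>y\<close> adds its share to the source: \<open>R\<close> omits
  only the part with \<open>a1\<close>, but \<open>G\<close> contains the full singular function
  \<open>Z\<close>.\<close>

definition G where "G x t = f x t - (b x t - c) * Z 0 x t"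
definition Gt where "Gt x t = ft x t - bt x t * Z 0 x t - (b x t - c) * Zt x t"
definition Gtt where "Gtt x t = ftt x t - btt x t * Z 0 x t - 2 * bt x t * Zt x t - (b x t - c) * Ztt x t"
text \<open>The exponential is the initial layer. The summand \<open>d\<^sup>2\<close> reflects the
  slow variation of smooth data in scaled time; it has to stay visible because coarse time steps
  \<open>k\<close> are long in scaled time and only \<open>k * d\<^sup>2\<close> is small.\<close>

definition wgt where "wgt t = d\<^sup>2 + exp (- \<beta> * t)"

definition KZ where "KZ = CW * (2 * K)"
definition KZ1 where "KZ1 = KZ * (1 + K)"
definition KZ2 where "KZ2 = KZ * (1 + 4 * K + K\<^sup>2)"

lemma KZ: "0 \<le> KZ" "0 \<le> KZ1" "0 \<le> KZ2" using CW K_pos by (auto simp: KZ_def KZ1_def KZ2_def)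

lemma KZ_ge: "CW * (\<bar>a0\<bar> + \<bar>a1\<bar>) \<le> KZ" "CW * \<bar>a1\<bar> \<le> KZ"
  unfolding KZ_def using CW a_le K_pos by (auto intro!: mult_left_mono)

lemma wgt_pos: "0 < wgt t" using d2 by (auto simp: wgt_def intro: add_pos_pos)

lemma wgt_le: "0 \<le> t \<Longrightarrow> wgt t \<le> 2" using d2 beta_pos add_mono[of "d\<^sup>2" 1 "exp (- \<beta> * t)" 1] by (simp add: wgt_def)

lemma wgt_mono: "s \<le> t \<Longrightarrow> wgt t \<le> wgt s" using beta_pos by (simp add: wgt_def)

lemma wgt_shift: "0 \<le> r \<Longrightarrow> wgt (t - r) \<le> exp (\<beta> * r) * wgt t"
proof -
  assume r: "0 \<le> r"
  have "exp (- \<beta> * (t - r)) = exp (\<beta> * r) * exp (- \<beta> * t)"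
    by (simp add: exp_add[symmetric] algebra_simps)
  moreover have "1 * d\<^sup>2 \<le> exp (\<beta> * r) * d\<^sup>2" using r beta_pos by (intro mult_right_mono) auto
  ultimately show ?thesis by (simp add: wgt_def distrib_left)
qed

lemma Z_le:
  assumes "0 \<le> x" "0 \<le> t"
  shows "\<bar>Z 0 x t\<bar> \<le> KZ * exp (- \<beta> * t)"
  unfolding Z_def by (rule order_trans[OF W0[OF assms] mult_right_mono[OF KZ_ge(1)]]) simp

lemma Z_gauss:
  assumes "0 \<le> x" "0 < t"
  shows "\<bar>Z 0 x t\<bar> \<le> KZ * exp (- \<kappa> * x\<^sup>2 / t)"
proof -
  have "\<bar>Z 0 x t\<bar> \<le> CW * (\<bar>a0\<bar> + \<bar>a1\<bar>) * exp (- \<beta> * t) * exp (- \<kappa> * x\<^sup>2 / t)"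
    unfolding Z_def by (rule W0_gauss[OF assms])
  also have "\<dots> \<le> KZ * 1 * exp (- \<kappa> * x\<^sup>2 / t)"
    using KZ_ge KZ beta_pos assms CW by (intro mult_right_mono mult_mono) auto
  finally show ?thesis by simp
qed

lemma Z2_le:
  assumes "0 \<le> x" "0 < t"
  shows "\<bar>Z 2 x t\<bar> \<le> KZ * (exp (- \<beta> * t) * (1 + 1 / (x\<^sup>2 + t)))"
proof -
  have s: "0 < x\<^sup>2 + t" using assms by (auto intro: add_nonneg_pos)
  show ?thesis unfolding Z_def
    by (rule order_trans[OF W2(1)[OF assms, unfolded mult.assoc[of _ "exp (- \<beta> * t)"]]
          mult_right_mono[OF KZ_ge(1)]])
      (use s in \<open>auto intro!: mult_nonneg_nonneg\<close>)
qed

lemma Zt_le: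
  assumes "0 \<le> x" "0 < t"
  shows "\<bar>Zt x t\<bar> \<le> KZ1 * (exp (- \<beta> * t) * (1 + 1 / (x\<^sup>2 + t)))"
proof -
  have s: "0 < x\<^sup>2 + t" using assms by (auto intro: add_nonneg_pos)
  have "\<bar>c * Z 0 x t\<bar> \<le> K * (KZ * (exp (- \<beta> * t) * (1 + 1 / (x\<^sup>2 + t))))"
  proof -
    have "\<bar>Z 0 x t\<bar> \<le> KZ * (exp (- \<beta> * t) * 1)" using Z_le[of x t] assms by simp
    also have "\<dots> \<le> KZ * (exp (- \<beta> * t) * (1 + 1 / (x\<^sup>2 + t)))"
      using KZ s by (intro mult_left_mono) auto
    finally show ?thesis using c_le c_pos unfolding abs_mult by (intro mult_mono) auto
  qed
  then have "\<bar>Zt x t\<bar> \<le> KZ * (exp (- \<beta> * t) * (1 + 1 / (x\<^sup>2 + t))) + K * (KZ * (exp (- \<beta> * t) * (1 + 1 / (x\<^sup>2 + t))))"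
    using Z2_le[OF assms] unfolding Zt_def by linarith
  then show ?thesis by (simp only: KZ1_def distrib_left distrib_right mult_ac mult_1_right mult_1_left)
qed

lemma Ztt_le:
  assumes "0 \<le> x" "0 < t"
  shows "\<bar>Ztt x t\<bar> \<le> KZ2 * (exp (- \<beta> * t) * (1 + 1 / (x\<^sup>2 + t)\<^sup>2))"
proof -
  have s: "0 < x\<^sup>2 + t" using assms by (auto intro: add_nonneg_pos)
  define e where "e = exp (- \<beta> * t)"
  define q where "q = 1 + 1 / (x\<^sup>2 + t)\<^sup>2"
  have e0: "0 \<le> e" by (simp add: e_def)
  have q1: "1 \<le> q" by (simp add: q_def)
  have q2: "1 + 1 / (x\<^sup>2 + t) \<le> 2 * q"
  proof -
    have "v \<le> 1 + v\<^sup>2" for v :: real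
    proof -
      have "0 \<le> (v - 1 / 2)\<^sup>2" by simp
      then show ?thesis by (simp add: power2_eq_square algebra_simps)
    qed
    from this[of "1 / (x\<^sup>2 + t)"] have "1 + 1 / (x\<^sup>2 + t) \<le> 1 + (1 + (1 / (x\<^sup>2 + t))\<^sup>2)"
      by (rule add_left_mono)
    also have "\<dots> \<le> 2 * (1 + (1 / (x\<^sup>2 + t))\<^sup>2)" by simp
    finally show ?thesis unfolding q_def by (simp only: power_one_over)
  qed
  have z4: "\<bar>Z 4 x t\<bar> \<le> KZ * (e * q)"
  proof -
    show ?thesis unfolding Z_def e_def q_def
      by (rule order_trans[OF W4(1)[OF assms, unfolded mult.assoc[of _ "exp (- \<beta> * t)"]]
            mult_right_mono[OF KZ_ge(1)]])
        (use s in \<open>auto intro!: mult_nonneg_nonneg\<close>)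
  qed
  have z2: "\<bar>Z 2 x t\<bar> \<le> KZ * (e * (2 * q))"
    by (rule order_trans[OF Z2_le[OF assms]]) (use q2 e0 KZ in \<open>auto simp: e_def intro!: mult_left_mono\<close>)
  have z0: "\<bar>Z 0 x t\<bar> \<le> KZ * (e * q)"
    by (rule order_trans[OF Z_le[of x t]]) (use q1 e0 KZ assms in \<open>auto simp: e_def intro!: mult_left_mono\<close>)
  have "\<bar>c * Z 2 x t\<bar> \<le> K * (KZ * (e * (2 * q)))"
    using z2 c_le c_pos unfolding abs_mult by (intro mult_mono) auto
  moreover have "\<bar>c\<^sup>2 * Z 0 x t\<bar> \<le> K\<^sup>2 * (KZ * (e * q))"
    using z0 c_le c_pos unfolding abs_mult by (intro mult_mono) (auto intro: power_mono)
  moreover have "Ztt x t = Z 4 x t - 2 * (c * Z 2 x t) + c\<^sup>2 * Z 0 x t"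
    by (simp add: Ztt_def Zt_def power2_eq_square algebra_simps)
  ultimately have "\<bar>Ztt x t\<bar> \<le> KZ * (e * q) + 2 * (K * (KZ * (e * (2 * q)))) + K\<^sup>2 * (KZ * (e * q))"
    using z4 by linarith
  also have "\<dots> = KZ2 * (e * q)" by (simp add: KZ2_def algebra_simps)
  finally show ?thesis by (simp add: e_def q_def)
qed

lemma Z_t:
  assumes "0 < t"
  shows "(Z 0 x has_real_derivative Zt x t) (at t)" "(Zt x has_real_derivative Ztt x t) (at t)"
  using W_t[OF assms, of c a0 a1 x] unfolding Z_def Zt_def Ztt_def
  by (auto intro!: derivative_eq_intros)

lemma Z_continuous:
  assumes "0 < x"
  shows "continuous_on {0..T} (Z 0 x)"
  unfolding Z_def[abs_def] using assms
  by (intro continuous_on_slice_t[OF regD(1)[OF W_reg[of a0 x a1 x T]]]) auto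

lemma G_t:
  assumes "0 \<le> x" "x \<le> X" "0 < t" "t \<le> Th"
  shows "(G x has_real_derivative Gt x t) (at t within {0..Th})"
    "(Gt x has_real_derivative Gtt x t) (at t within {0..Th})"
  using assms Z_t[OF assms(3), of x, THEN has_field_derivative_at_within, of "{0..Th}"]
  unfolding G_def Gt_def Gtt_def
  by (auto intro!: derivative_eq_intros b_t bt_t f_t ft_t)

definition CG1 where "CG1 = K + K * KZ + 2 * K * KZ1"
definition CG2 where "CG2 = K + K * KZ + 2 * K * KZ1 + K * KZ2"

lemma G_le:
  assumes "0 \<le> x" "x \<le> X" "0 \<le> t" "t \<le> Th"
  shows "\<bar>G x t\<bar> \<le> K + K * KZ"
proof -
  have "\<bar>Z 0 x t\<bar> \<le> KZ * 1"
    by (rule order_trans[OF Z_le mult_left_mono]) (use assms KZ beta_pos in auto)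
  then have "\<bar>(b x t - c) * Z 0 x t\<bar> \<le> K * KZ"
    unfolding abs_mult using bc_le[OF assms] by (intro mult_mono) auto
  then show ?thesis using f_le[OF assms] unfolding G_def by linarith
qed

text \<open>The only singular term is \<open>(b - c) * Zt\<close>, and its two factors compensate
  each other completely.\<close>

lemma Gt_le:
  assumes "0 \<le> x" "x \<le> X" "0 < t" "t \<le> Th"
  shows "\<bar>Gt x t\<bar> \<le> CG1 * wgt t"
proof -
  define e where "e = exp (- \<beta> * t)"
  have s: "0 < x\<^sup>2 + t" using assms by (auto intro: add_nonneg_pos)
  have e: "0 \<le> e" "wgt t = d\<^sup>2 + e" by (auto simp: e_def wgt_def)
  have t0: "0 \<le> t" using assms by simp
  have 1: "\<bar>ft x t\<bar> \<le> K * d\<^sup>2" using bft_le[OF assms(1,2) t0 assms(4)] by simp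
  have "\<bar>bt x t\<bar> \<le> K * 1"
    using bft_le[OF assms(1,2) t0 assms(4)] mult_left_mono[OF d2(2), of K] K_pos by linarith
  then have 2: "\<bar>bt x t * Z 0 x t\<bar> \<le> K * (KZ * e)"
    unfolding abs_mult e_def using Z_le[of x t] assms K_pos by (intro mult_mono) auto
  have "\<bar>b x t - c\<bar> * \<bar>Zt x t\<bar> \<le> \<bar>b x t - c\<bar> * (KZ1 * (e * (1 + 1 / (x\<^sup>2 + t))))"
    using Zt_le[of x t] assms by (intro mult_left_mono) (auto simp: e_def)
  also have "\<dots> = (\<bar>b x t - c\<bar> * (1 + 1 / (x\<^sup>2 + t))) * (KZ1 * e)" by (simp only: mult_ac)
  also have "\<dots> \<le> 2 * K * (KZ1 * e)"
    using singular_weight_bounds(1)[OF s bc_le[OF assms(1,2) t0 assms(4)] b_corner[OF assms(1,2) t0 assms(4)]] assms t0 e KZ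
    by (intro mult_right_mono) auto
  finally have 3: "\<bar>(b x t - c) * Zt x t\<bar> \<le> 2 * K * (KZ1 * e)" by (simp add: abs_mult)
  have "\<bar>Gt x t\<bar> \<le> K * d\<^sup>2 + K * (KZ * e) + 2 * K * (KZ1 * e)"
    using 1 2 3 unfolding Gt_def by linarith
  also have "\<dots> \<le> CG1 * (d\<^sup>2 + e)"
    using K_pos KZ e d2 by (simp add: CG1_def algebra_simps add_increasing)
  finally show ?thesis by (simp add: e)
qed

text \<open>\<open>Ztt\<close> has one power of the singularity more than \<open>b - c\<close> can
  offset. The surviving \<open>1 / (x\<^sup>2 + t)\<close> is left to the corner barrier.\<close>

lemma Gtt_le:
  assumes "0 \<le> x" "x \<le> X" "0 < t" "t \<le> Th"
  shows "\<bar>Gtt x t\<bar> \<le> CG2 * (d\<^sup>2 + exp (- \<beta> * t) * (1 + 1 / (x\<^sup>2 + t)))"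
proof -
  define e where "e = exp (- \<beta> * t)"
  define q where "q = 1 + 1 / (x\<^sup>2 + t)"
  have s: "0 < x\<^sup>2 + t" using assms by (auto intro: add_nonneg_pos)
  have e: "0 \<le> e" by (auto simp: e_def)
  have q: "1 \<le> q" using s by (simp add: q_def)
  have t0: "0 \<le> t" using assms by simp
  have 1: "\<bar>ftt x t\<bar> \<le> K * d\<^sup>2" using bft_le[OF assms(1,2) t0 assms(4)] by simp
  have bt: "\<bar>bt x t\<bar> \<le> K * 1" "\<bar>btt x t\<bar> \<le> K * 1"
    using bft_le[OF assms(1,2) t0 assms(4)] mult_left_mono[OF d2(2), of K] K_pos by linarith+
  have "\<bar>Z 0 x t\<bar> \<le> KZ * (e * q)"
    by (rule order_trans[OF Z_le]) (use assms KZ e q in \<open>auto simp: e_def intro!: mult_left_mono\<close>)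
  then have 2: "\<bar>btt x t * Z 0 x t\<bar> \<le> K * (KZ * (e * q))"
    unfolding abs_mult using bt K_pos by (intro mult_mono) auto
  have 3: "\<bar>bt x t * Zt x t\<bar> \<le> K * (KZ1 * (e * q))"
    unfolding abs_mult e_def q_def using bt Zt_le[of x t] assms K_pos by (intro mult_mono) auto
  have "\<bar>b x t - c\<bar> * \<bar>Ztt x t\<bar> \<le> \<bar>b x t - c\<bar> * (KZ2 * (e * (1 + 1 / (x\<^sup>2 + t)\<^sup>2)))"
    using Ztt_le[of x t] assms by (intro mult_left_mono) (auto simp: e_def)
  also have "\<dots> = (\<bar>b x t - c\<bar> * (1 + 1 / (x\<^sup>2 + t)\<^sup>2)) * (KZ2 * e)" by (simp only: mult_ac)
  also have "\<dots> \<le> K * q * (KZ2 * e)"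
    using singular_weight_bounds(2)[OF s bc_le[OF assms(1,2) t0 assms(4)] b_corner[OF assms(1,2) t0 assms(4)]] assms t0 e KZ
    by (intro mult_right_mono) (auto simp: q_def)
  finally have 4: "\<bar>(b x t - c) * Ztt x t\<bar> \<le> K * q * (KZ2 * e)" by (simp add: abs_mult)
  have "\<bar>Gtt x t\<bar> \<le> K * d\<^sup>2 + K * (KZ * (e * q)) + 2 * (K * (KZ1 * (e * q))) + K * q * (KZ2 * e)"
    using 1 2 3 4 unfolding Gtt_def by linarith
  also have "\<dots> \<le> CG2 * (d\<^sup>2 + e * q)"
    using K_pos KZ e d2 q by (simp add: CG2_def algebra_simps add_increasing)
  finally show ?thesis by (simp add: e_def q_def)
qed

lemma R_reg: "reg R Rt Rx Rxx 0 X 0 Th"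
  unfolding R_def[abs_def] Rt_def[abs_def] Rx_def[abs_def] Rxx_def[abs_def]
  by (intro reg_diff[OF y_reg W_reg]) auto

lemma R_eq:
  assumes "0 < x" "x < X" "0 < t" "t \<le> Th"
  shows "Rt x t - Rxx x t = G x t - b x t * R x t"
  using y_eq[OF assms] W_add[of c a0 a1 0 x t]
  by (simp add: Rt_def Rxx_def R_def G_def Z_def algebra_simps)

definition q0 where "q0 t = gL t - exp (- c * t) * (a0 + a1 * erfc 0 * t)"
definition q1 where "q1 t = gR t - Z 0 X t"

lemma R_left: "0 \<le> t \<Longrightarrow> t \<le> Th \<Longrightarrow> R 0 t = q0 t"
  by (auto simp: R_def q0_def y_left W_def zt_def zeta_def th_def algebra_simps)

lemma R_right: "0 \<le> t \<Longrightarrow> t \<le> Th \<Longrightarrow> R X t = q1 t"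
  using W_add[of c a0 a1 0 X t] by (simp add: R_def q1_def y_right Z_def)

lemma R_init: "0 \<le> x \<Longrightarrow> x \<le> X \<Longrightarrow> R x 0 = ph 0 x"
  by (simp add: R_def y_init W_def)

definition CR0 where "CR0 = 2 * K + KZ + K * (K + K * KZ)"

lemma CR0: "0 \<le> CR0" using K_pos KZ by (simp add: CR0_def)

lemma R_bound:
  assumes "0 \<le> x" "x \<le> X" "0 \<le> t" "t \<le> Th"
  shows "\<bar>R x t\<bar> \<le> CR0"
proof (rule comparison[OF R_reg, of "\<lambda>_ _. CR0" "\<lambda>_ _. 0" "\<lambda>_ _. 0" "\<lambda>_ _. 0" b])
  show "reg (\<lambda>_ _. CR0) (\<lambda>_ _. 0) (\<lambda>_ _. 0) (\<lambda>_ _. 0) 0 X 0 Th"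
    by (rule regI_smooth) (auto intro!: continuous_intros simp: case_prod_beta)
  fix x t assume a: "0 < x" "x < X" "0 < t" "t \<le> Th"
  have "K + K * KZ \<le> \<beta> * CR0"
  proof -
    have "1 * (K + K * KZ) \<le> (K * \<beta>) * (K + K * KZ)"
      using K KZ K_pos by (intro mult_right_mono) auto
    also have "\<dots> \<le> \<beta> * CR0"
      using beta_pos K_pos KZ by (simp add: CR0_def algebra_simps add_increasing)
    finally show ?thesis by simp
  qed
  also have "\<dots> \<le> b x t * CR0"
    using b_ge[of x t] eta_pos CR0 a by (intro mult_right_mono) auto
  finally show "\<bar>Rt x t - Rxx x t + b x t * R x t\<bar> \<le> 0 - 0 + b x t * CR0"
    using R_eq[OF a] G_le[of x t] a by auto
  show "0 < b x t" using b_le[of x t] a by auto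
next
  fix x t assume a: "0 \<le> x" "x \<le> X" "0 \<le> t" "t \<le> Th" "x = 0 \<or> x = X \<or> t = 0"
  have Z1: "\<bar>W c 0 a1 0 0 t\<bar> \<le> KZ" "\<bar>Z 0 X t\<bar> \<le> KZ"
  proof -
    have e: "exp (- \<beta> * t) \<le> 1" using beta_pos a by simp
    have "CW * \<bar>a1\<bar> * exp (- \<beta> * t) \<le> KZ * 1" using e KZ KZ_ge by (intro mult_mono) auto
    then show "\<bar>W c 0 a1 0 0 t\<bar> \<le> KZ" using W0[of 0 t 0 a1] a by simp
    show "\<bar>Z 0 X t\<bar> \<le> KZ" using Z_le[of X t] X_ge a mult_left_mono[OF e KZ(1)] by simp
  qed
  have K': "2 * K + KZ \<le> CR0" using K_pos KZ by (simp add: CR0_def)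
  consider "x = 0" | "x = X" | "t = 0" using a by auto
  then show "\<bar>R x t\<bar> \<le> CR0"
  proof cases
    case 1
    have "\<bar>a0 * exp (- c * t)\<bar> \<le> K * 1"
      unfolding abs_mult using a_le c_pos a K_pos by (intro mult_mono) auto
    moreover have "R x t = gL t - a0 * exp (- c * t) - W c 0 a1 0 0 t"
      using 1 a by (simp add: R_def y_left)
    moreover have "\<bar>gL t\<bar> \<le> K" using g_le[of t] a by simp
    ultimately show ?thesis using Z1 K' by linarith
  next
    case 2
    moreover have "\<bar>gR t\<bar> \<le> K" using g_le[of t] a by simp
    moreover have "R x t = gR t - Z 0 X t" using 2 R_right[OF a(3,4)] by (simp add: q1_def)
    ultimately show ?thesis using Z1 K' K_pos by linarith
  next
    case 3
    then show ?thesis using R_init[of x] ph_le[of 0 x] a K' K_pos KZ by simp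
  qed
qed (use assms X_ge Th_ge in auto)

end

lemma deriv_within_interior:
  assumes "(g has_real_derivative D) (at s within {0..T::real})" "0 < s" "s < T"
  shows "(g has_real_derivative D) (at s)"
  using assms at_within_Icc_at[of 0 s T] by simp

section \<open>Boundary data of the remainder and its expansion at the initial time\<close>

context scaled_problem
begin

definition CQ where "CQ = K + (1 + K) * (K ^ 3 + 2 * K\<^sup>2 + K) + 2 * KZ1 + 2 * KZ2"

lemma CQ: "0 \<le> CQ" using K_pos KZ by (simp add: CQ_def)

definition q0' where "q0' t = gL1 t + exp (- c * t) * (c * (a0 + a1 * erfc 0 * t) - a1 * erfc 0)"
definition q0'' where
  "q0'' t = gL2 t - exp (- c * t) * (c\<^sup>2 * (a0 + a1 * erfc 0 * t) - 2 * c * (a1 * erfc 0))"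

lemma q0_t:
  assumes "0 \<le> t" "t \<le> Th"
  shows "(q0 has_real_derivative q0' t) (at t within {0..Th})"
    "(q0' has_real_derivative q0'' t) (at t within {0..Th})"
  unfolding q0_def[abs_def] q0'_def[abs_def] q0''_def
  using assms by (auto intro!: derivative_eq_intros gL_t gL1_t simp: algebra_simps power2_eq_square)

lemma exp_c_linear_le:
  assumes "0 \<le> t" "\<bar>v\<bar> \<le> A * (1 + t)" "0 \<le> A"
  shows "\<bar>exp (- c * t) * v\<bar> \<le> (1 + K) * A * exp (- \<beta> * t)"
proof -
  have "\<bar>exp (- c * t) * v\<bar> \<le> exp (- c * t) * (A * (1 + t))"
    using assms by (simp add: abs_mult)
  also have "\<dots> = A * (exp (- c * t) * (1 + t))" by simp
  also have "\<dots> \<le> A * ((1 + 1 / \<eta>) * exp (- \<beta> * t))"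
    using assms by (intro mult_left_mono exp_c_le) auto
  also have "\<dots> \<le> A * ((1 + K) * exp (- \<beta> * t))"
    using assms inv_K by (intro mult_left_mono mult_right_mono) auto
  finally show ?thesis by (simp add: mult_ac)
qed

lemma q0_le:
  assumes "0 \<le> t" "t \<le> Th"
  shows "\<bar>q0' t\<bar> \<le> CQ * wgt t" "\<bar>q0'' t\<bar> \<le> CQ * wgt t"
proof -
  define e where "e = exp (- \<beta> * t)"
  define v where "v = a0 + a1 * erfc 0 * t"
  have e: "0 \<le> e" "wgt t = d\<^sup>2 + e" by (auto simp: e_def wgt_def)
  have "\<bar>a1 * erfc 0 * t\<bar> \<le> K * t" unfolding abs_mult[of _ t] using a_le assms by (intro mult_mono) auto
  then have v: "\<bar>v\<bar> \<le> K * (1 + t)" using a_le unfolding v_def distrib_left by linarith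
  have cv: "\<bar>c * v\<bar> \<le> K * (K * (1 + t))" unfolding abs_mult using c_le c_pos v by (intro mult_mono) auto
  have cv2: "\<bar>c\<^sup>2 * v\<bar> \<le> K\<^sup>2 * (K * (1 + t))"
    unfolding abs_mult using c_le c_pos v by (intro mult_mono) (auto intro: power_mono)
  have cE: "\<bar>c * (a1 * erfc 0)\<bar> \<le> K * K" unfolding abs_mult[of c] using c_le c_pos a_le by (intro mult_mono) auto
  define M where "M = K ^ 3 + 2 * K\<^sup>2 + K"
  have Kt: "0 \<le> K * t" "0 \<le> K\<^sup>2 * t" "0 \<le> K ^ 3 * t" using K_pos assms by auto
  have "\<bar>c * v - a1 * erfc 0\<bar> \<le> M * (1 + t)"
  proof -
    have "K * (K * (1 + t)) + K \<le> M * (1 + t)"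
      using K_pos Kt by (simp add: M_def algebra_simps power2_eq_square power3_eq_cube)
    then show ?thesis using cv a_le(3) by linarith
  qed
  then have 1: "\<bar>exp (- c * t) * (c * v - a1 * erfc 0)\<bar> \<le> (1 + K) * M * e"
    unfolding e_def using assms K_pos by (intro exp_c_linear_le) (auto simp: M_def)
  have "\<bar>c\<^sup>2 * v - 2 * c * (a1 * erfc 0)\<bar> \<le> M * (1 + t)"
  proof -
    have "K\<^sup>2 * (K * (1 + t)) + 2 * (K * K) \<le> M * (1 + t)"
      using K_pos Kt by (simp add: M_def algebra_simps power2_eq_square power3_eq_cube)
    then show ?thesis using cv2 cE by linarith
  qed
  then have 2: "\<bar>exp (- c * t) * (c\<^sup>2 * v - 2 * c * (a1 * erfc 0))\<bar> \<le> (1 + K) * M * e"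
    unfolding e_def using assms K_pos by (intro exp_c_linear_le) (auto simp: M_def)
  have 3: "K * d\<^sup>2 + (1 + K) * M * e \<le> CQ * (d\<^sup>2 + e)"
  proof -
    have "K * d\<^sup>2 + (1 + K) * M * e \<le> (K + (1 + K) * M) * (d\<^sup>2 + e)"
      using K_pos e d2 by (simp add: M_def algebra_simps)
    also have "\<dots> \<le> CQ * (d\<^sup>2 + e)"
      using e d2 KZ by (intro mult_right_mono) (auto simp: CQ_def M_def)
    finally show ?thesis .
  qed
  have g: "\<bar>gL1 t\<bar> \<le> K * d\<^sup>2" "\<bar>gL2 t\<bar> \<le> K * d\<^sup>2" using g_le[OF assms] by auto
  show "\<bar>q0' t\<bar> \<le> CQ * wgt t" unfolding q0'_def v_def[symmetric] e using 1 3 g by linarith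
  show "\<bar>q0'' t\<bar> \<le> CQ * wgt t" unfolding q0''_def v_def[symmetric] e using 2 3 g by linarith
qed

definition q1' where "q1' t = gR1 t - Zt X t"
definition q1'' where "q1'' t = gR2 t - Ztt X t"

lemma q1_t:
  assumes "0 < t" "t \<le> Th"
  shows "(q1 has_real_derivative q1' t) (at t within {0..Th})"
    "(q1' has_real_derivative q1'' t) (at t within {0..Th})"
  unfolding q1_def[abs_def] q1'_def[abs_def] q1''_def
  using assms Z_t[OF assms(1), of X, THEN has_field_derivative_at_within, of "{0..Th}"]
  by (auto intro!: derivative_eq_intros gR_t gR1_t)

lemma q1_le:
  assumes "0 < t" "t \<le> Th"
  shows "\<bar>q1' t\<bar> \<le> CQ * wgt t" "\<bar>q1'' t\<bar> \<le> CQ * wgt t"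
proof -
  define e where "e = exp (- \<beta> * t)"
  have e: "0 \<le> e" "wgt t = d\<^sup>2 + e" by (auto simp: e_def wgt_def)
  have "1 \<le> X\<^sup>2" using X_ge by simp
  then have X1: "1 \<le> X\<^sup>2 + t" using assms by linarith
  have i: "1 / (X\<^sup>2 + t) \<le> 1" "1 / (X\<^sup>2 + t)\<^sup>2 \<le> 1" using X1 by (auto simp: divide_le_eq_1)
  have "\<bar>Zt X t\<bar> \<le> KZ1 * (e * (1 + 1 / (X\<^sup>2 + t)))" unfolding e_def using X_ge assms by (intro Zt_le) auto
  also have "\<dots> \<le> KZ1 * (e * 2)" using i e KZ by (intro mult_left_mono) auto
  finally have 1: "\<bar>Zt X t\<bar> \<le> 2 * KZ1 * e" by simp
  have "\<bar>Ztt X t\<bar> \<le> KZ2 * (e * (1 + 1 / (X\<^sup>2 + t)\<^sup>2))" unfolding e_def using X_ge assms by (intro Ztt_le) auto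
  also have "\<dots> \<le> KZ2 * (e * 2)" using i e KZ by (intro mult_left_mono) auto
  finally have 2: "\<bar>Ztt X t\<bar> \<le> 2 * KZ2 * e" by simp
  have 3: "K * d\<^sup>2 + 2 * KZ1 * e + 2 * KZ2 * e \<le> CQ * (d\<^sup>2 + e)"
  proof -
    have "K * d\<^sup>2 + 2 * KZ1 * e + 2 * KZ2 * e \<le> (K + 2 * KZ1 + 2 * KZ2) * (d\<^sup>2 + e)"
      using K_pos e d2 KZ by (simp add: algebra_simps)
    also have "\<dots> \<le> CQ * (d\<^sup>2 + e)"
      using e d2 KZ K_pos by (intro mult_right_mono) (auto simp: CQ_def)
    finally show ?thesis .
  qed
  have p: "0 \<le> 2 * KZ1 * e" "0 \<le> 2 * KZ2 * e" using KZ e by auto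
  have g: "\<bar>gR1 t\<bar> \<le> K * d\<^sup>2" "\<bar>gR2 t\<bar> \<le> K * d\<^sup>2" using g_le[of t] assms by auto
  show "\<bar>q1' t\<bar> \<le> CQ * wgt t" unfolding q1'_def e using 1 3 g p by linarith
  show "\<bar>q1'' t\<bar> \<le> CQ * wgt t" unfolding q1''_def e using 2 3 g p by linarith
qed

lemma q_continuous: "continuous_on {0..Th} q0" "continuous_on {0..Th} q1"
proof -
  show "continuous_on {0..Th} q0" using q0_t by (intro DERIV_continuous_on[where D = q0']) auto
  have "continuous_on {0..Th} gR" using gR_t by (intro DERIV_continuous_on[where D = gR1]) auto
  then show "continuous_on {0..Th} q1"
    unfolding q1_def[abs_def] using X_ge by (intro continuous_on_diff Z_continuous) auto
qed

lemma time_diff1: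
  assumes "continuous_on {t - r..t} q" "0 \<le> r" "0 \<le> t - r" "t \<le> Th" "0 \<le> A"
    and "\<And>s. 0 < s \<Longrightarrow> s \<le> Th \<Longrightarrow> (q has_real_derivative q' s) (at s within {0..Th})"
    and "\<And>s. 0 < s \<Longrightarrow> s \<le> Th \<Longrightarrow> \<bar>q' s\<bar> \<le> A * wgt s"
  shows "\<bar>q t - q (t - r)\<bar> \<le> A * r * wgt (t - r)"
proof -
  have "\<bar>q t - q (t - r)\<bar> \<le> (A * wgt (t - r)) * (t - (t - r))"
  proof (rule abs_diff_le_deriv[where g' = q'])
    fix s assume s: "t - r < s" "s < t"
    show "(q has_real_derivative q' s) (at s)"
      using s assms by (intro deriv_within_interior[OF assms(6)]) auto
    show "\<bar>q' s\<bar> \<le> A * wgt (t - r)"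
      using assms(7)[of s] s assms mult_left_mono[OF wgt_mono[of "t - r" s], of A] by linarith
  qed (use assms in auto)
  then show ?thesis by (simp add: mult_ac)
qed

lemma time_diff2:
  assumes "continuous_on {t - 2 * r..t} q" "0 \<le> r" "0 \<le> t - 2 * r" "t \<le> Th" "0 \<le> A"
    and "\<And>s. 0 < s \<Longrightarrow> s \<le> Th \<Longrightarrow> (q has_real_derivative q' s) (at s within {0..Th})"
    and "\<And>s. 0 < s \<Longrightarrow> s \<le> Th \<Longrightarrow> (q' has_real_derivative q'' s) (at s within {0..Th})"
    and "\<And>s. t - 2 * r < s \<Longrightarrow> s < t \<Longrightarrow> \<bar>q'' s\<bar> \<le> A"
  shows "\<bar>q t - 2 * q (t - r) + q (t - 2 * r)\<bar> \<le> 2 * A * r\<^sup>2"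
proof -
  have "\<bar>q ((t - r) + r) - 2 * q (t - r) + q ((t - r) - r)\<bar> \<le> 2 * A * r\<^sup>2"
  proof (rule second_difference_bound[where ?g1.0 = q' and ?g2.0 = q''])
    fix s assume "t - r - r < s" "s < t - r + r"
    then have s: "t - 2 * r < s" "s < t" by auto
    show "(q has_real_derivative q' s) (at s)" "(q' has_real_derivative q'' s) (at s)"
      using s assms by (auto intro!: deriv_within_interior[OF assms(6)] deriv_within_interior[OF assms(7)])
    show "\<bar>q'' s\<bar> \<le> A" using assms(8) s by auto
  qed (use assms in auto)
  then show ?thesis by (simp add: algebra_simps)
qed

lemma b_time:
  assumes "0 \<le> x" "x \<le> X" "0 \<le> r" "0 \<le> t - r" "t \<le> Th"
  shows "\<bar>b x t - b x (t - r)\<bar> \<le> K * d\<^sup>2 * r" "\<bar>f x t - f x (t - r)\<bar> \<le> K * d\<^sup>2 * r"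
proof -
  have c: "continuous_on {0..Th} (b x)" "continuous_on {0..Th} (f x)"
    using DERIV_continuous_on[of "{0..Th}" "b x" "bt x"] DERIV_continuous_on[of "{0..Th}" "f x" "ft x"]
      b_t f_t assms by auto
  have "\<bar>b x t - b x (t - r)\<bar> \<le> K * d\<^sup>2 * (t - (t - r))"
    by (rule abs_diff_le_deriv[where g' = "bt x"])
      (use assms bft_le[of x] in \<open>auto intro!: continuous_on_subset[OF c(1)] deriv_within_interior[OF b_t]\<close>)
  then show "\<bar>b x t - b x (t - r)\<bar> \<le> K * d\<^sup>2 * r" by simp
  have "\<bar>f x t - f x (t - r)\<bar> \<le> K * d\<^sup>2 * (t - (t - r))"
    by (rule abs_diff_le_deriv[where g' = "ft x"])
      (use assms bft_le[of x] in \<open>auto intro!: continuous_on_subset[OF c(2)] deriv_within_interior[OF f_t]\<close>)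
  then show "\<bar>f x t - f x (t - r)\<bar> \<le> K * d\<^sup>2 * r" by simp
qed

lemma b_time2:
  assumes "0 \<le> x" "x \<le> X" "0 \<le> r" "0 \<le> t - 2 * r" "t \<le> Th"
  shows "\<bar>b x t - 2 * b x (t - r) + b x (t - 2 * r)\<bar> \<le> 2 * (K * d\<^sup>2) * r\<^sup>2"
proof (rule time_diff2[where q' = "bt x" and q'' = "btt x"])
  have "continuous_on {0..Th} (b x)" using b_t assms by (auto intro!: DERIV_continuous_on[where D = "bt x"])
  then show "continuous_on {t - 2 * r..t} (b x)" by (rule continuous_on_subset) (use assms in auto)
qed (use assms K_pos bft_le[of x] b_t bt_t in auto)

text \<open>The time derivative at \<open>t = 0\<close> that the equation dictates. Its own two
  space derivatives, \<open>y1x\<close> and \<open>y1xx\<close>, use the data up to the fourth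
  derivative of the initial values.\<close>

definition y1 where "y1 x = ph 2 x + f x 0 - b x 0 * ph 0 x"
definition y1x where "y1x x = ph 3 x + fX 1 x 0 - (bX 1 x 0 * ph 0 x + b x 0 * ph 1 x)"
definition y1xx where
  "y1xx x = ph 4 x + fX 2 x 0 - (bX 2 x 0 * ph 0 x + 2 * bX 1 x 0 * ph 1 x + b x 0 * ph 2 x)"

lemma bX_x_at: "n < 4 \<Longrightarrow> 0 < x \<Longrightarrow> x < X \<Longrightarrow> 0 \<le> t \<Longrightarrow> t \<le> Th \<Longrightarrow>
    ((\<lambda>x. bX n x t) has_real_derivative bX (Suc n) x t) (at x)"
  and fX_x_at: "n < 4 \<Longrightarrow> 0 < x \<Longrightarrow> x < X \<Longrightarrow> 0 \<le> t \<Longrightarrow> t \<le> Th \<Longrightarrow>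
    ((\<lambda>x. fX n x t) has_real_derivative fX (Suc n) x t) (at x)"
  and ph_x_at: "n < 4 \<Longrightarrow> 0 < x \<Longrightarrow> x < X \<Longrightarrow> (ph n has_real_derivative ph (Suc n) x) (at x)"
  by (rule deriv_within_interior[OF bX_x] deriv_within_interior[OF fX_x] deriv_within_interior[OF ph_x]; simp)+

lemma y1_x:
  assumes "0 < x" "x < X"
  shows "(y1 has_real_derivative y1x x) (at x)" "(y1x has_real_derivative y1xx x) (at x)"
proof -
  have b: "((\<lambda>x. b x 0) has_real_derivative bX 1 x 0) (at x)" "((\<lambda>x. bX 1 x 0) has_real_derivative bX 2 x 0) (at x)"
    "((\<lambda>x. f x 0) has_real_derivative fX 1 x 0) (at x)" "((\<lambda>x. fX 1 x 0) has_real_derivative fX 2 x 0) (at x)"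
    using bX_x_at[of 0 x 0] bX_x_at[of 1 x 0] fX_x_at[of 0 x 0] fX_x_at[of 1 x 0] assms Th_ge
    by (auto simp: bX0 fX0 numeral_2_eq_2)
  have p: "(ph 0 has_real_derivative ph 1 x) (at x)" "(ph 1 has_real_derivative ph 2 x) (at x)"
    "(ph 2 has_real_derivative ph 3 x) (at x)" "(ph 3 has_real_derivative ph 4 x) (at x)"
    using ph_x_at[of _ x] assms by (auto simp: numeral_eq_Suc)
  show "(y1 has_real_derivative y1x x) (at x)" "(y1x has_real_derivative y1xx x) (at x)"
    unfolding y1_def[abs_def] y1x_def[abs_def] y1xx_def
    by (auto intro!: derivative_eq_intros b[unfolded One_nat_def] p[unfolded One_nat_def] simp: algebra_simps)
qed

lemma y1_le:
  assumes "0 \<le> x" "x \<le> X"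
  shows "\<bar>y1 x\<bar> \<le> 2 * K + K\<^sup>2" "\<bar>y1xx x\<bar> \<le> 2 * K + 4 * K\<^sup>2"
proof -
  have Kd: "K * d ^ n \<le> K" for n using K_pos dn[of n] by (simp add: mult_left_le)
  have p: "\<bar>ph n x\<bar> \<le> K" "\<bar>bX n x 0\<bar> \<le> K" "\<bar>fX n x 0\<bar> \<le> K" if "n \<le> 4" for n
    using ph_le[of n x] bX_le[of n x 0] fX_le[of n x 0] Kd[of n] that assms Th_ge by auto
  have m: "\<bar>bX n x 0 * ph m x\<bar> \<le> K\<^sup>2" if "n \<le> 4" "m \<le> 4" for n m
    unfolding abs_mult power2_eq_square using p that K_pos by (intro mult_mono) auto
  show "\<bar>y1 x\<bar> \<le> 2 * K + K\<^sup>2"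
    using p(1)[of 2] p(3)[of 0] m[of 0 0] unfolding y1_def bX0 fX0 by linarith
  have "2 * bX 1 x 0 * ph 1 x = 2 * (bX 1 x 0 * ph 1 x)" by simp
  then show "\<bar>y1xx x\<bar> \<le> 2 * K + 4 * K\<^sup>2"
    using p(1)[of 4] p(3)[of 2] m[of 2 0] m[of 1 1] m[of 0 2] unfolding y1xx_def bX0 fX0 by linarith
qed

lemma V_reg: "reg (\<lambda>x t. ph 0 x + t * y1 x) (\<lambda>x t. y1 x) (\<lambda>x t. ph 1 x + t * y1x x)
    (\<lambda>x t. ph 2 x + t * y1xx x) 0 X 0 Th"
proof (rule regI_smooth)
  have pc: "continuous_on {0..X} (ph n)" if "n < 4" for n
    using ph_x that by (intro DERIV_continuous_on[where D = "ph (Suc n)"]) auto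
  have bc: "continuous_on {0..X} (\<lambda>x. b x 0)" "continuous_on {0..X} (\<lambda>x. f x 0)"
    using bX_x[of 0 _ 0] fX_x[of 0 _ 0] Th_ge unfolding bX0 fX0
    using DERIV_continuous_on[of "{0..X}" "\<lambda>x. b x 0" "\<lambda>x. bX (Suc 0) x 0"]
      DERIV_continuous_on[of "{0..X}" "\<lambda>x. f x 0" "\<lambda>x. fX (Suc 0) x 0"] by auto
  have c: "continuous_on {0..X} y1" "continuous_on {0..X} (ph 0)"
    unfolding y1_def[abs_def] by (intro continuous_on_add continuous_on_diff continuous_on_mult pc bc; simp)+
  have "continuous_on ({0..X} \<times> {0..Th}) (\<lambda>p. ph 0 (fst p) + snd p * y1 (fst p))"
    by (intro continuous_intros continuous_on_compose2[OF c(1)] continuous_on_compose2[OF c(2)]) auto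
  then show "continuous_on ({0..X} \<times> {0..Th}) (\<lambda>(x, t). ph 0 x + t * y1 x)"
    by (simp add: case_prod_beta)
  fix x t assume a: "0 < x" "x < X" "(0::real) < t" "t \<le> Th"
  have p: "(ph 0 has_real_derivative ph 1 x) (at x)" "(ph 1 has_real_derivative ph 2 x) (at x)"
    using ph_x_at[of _ x] a by (auto simp: numeral_eq_Suc)
  show "((\<lambda>t. ph 0 x + t * y1 x) has_real_derivative y1 x) (at t)"
    by (auto intro!: derivative_eq_intros)
  show "((\<lambda>s. ph 0 s + t * y1 s) has_real_derivative ph 1 x + t * y1x x) (at x)"
    "((\<lambda>s. ph 1 s + t * y1x s) has_real_derivative ph 2 x + t * y1xx x) (at x)"
    using a by (auto intro!: derivative_eq_intros p[unfolded One_nat_def] y1_x)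
qed

definition CS1 where
  "CS1 = K + K\<^sup>2 + K * KZ * (1 / \<kappa> + 1) + (2 * K + 4 * K\<^sup>2) + K * (2 * K + K\<^sup>2)"
definition C1 where "C1 = CS1 + 2 * CQ + K + 4 * KZ / \<kappa>\<^sup>2"

lemma C1: "0 \<le> CS1" "0 \<le> C1"
  using K_pos KZ CQ kappa_pos by (auto simp: CS1_def C1_def)

text \<open>A first-order expansion in time, proved by comparison with
  \<open>C1 * t\<^sup>2\<close>. The residual of the affine function is \<open>O(t)\<close>, and on
  both lateral sides value and slope agree at \<open>t = 0\<close>; at the left corner this holds
  only because the multiple of \<open>zeta\<close> has been removed.\<close>

lemma R_initial:
  assumes "0 \<le> x" "x \<le> X" "0 \<le> t" "t \<le> Th"
  shows "\<bar>R x t - (ph 0 x + t * y1 x)\<bar> \<le> C1 * t\<^sup>2"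
proof (rule comparison[OF reg_diff[OF R_reg V_reg], of "\<lambda>x t. C1 * t\<^sup>2" "\<lambda>x t. C1 * (2 * t)" "\<lambda>_ _. 0" "\<lambda>_ _. 0" b])
  show "reg (\<lambda>x t. C1 * t\<^sup>2) (\<lambda>x t. C1 * (2 * t)) (\<lambda>_ _. 0) (\<lambda>_ _. 0) 0 X 0 Th"
    by (rule regI_smooth) (auto intro!: continuous_intros derivative_eq_intros simp: case_prod_beta)
next
  fix x t assume a: "0 < x" "x < X" "0 < t" "t \<le> Th"
  have a': "0 \<le> x" "x \<le> X" "0 \<le> t" using a by auto
  show "0 < b x t" using b_le[of x t] a by auto
  have "Rt x t - y1 x - (Rxx x t - (ph 2 x + t * y1xx x)) + b x t * (R x t - (ph 0 x + t * y1 x))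
      = (f x t - f x 0) - (b x t - b x 0) * ph 0 x - (b x t - c) * Z 0 x t + t * y1xx x - t * (b x t * y1 x)"
    using R_eq[OF a] by (simp add: G_def y1_def algebra_simps)
  moreover have "\<bar>f x t - f x 0\<bar> \<le> K * t" "\<bar>b x t - b x 0\<bar> \<le> K * t"
  proof -
    have "K * d\<^sup>2 * t \<le> K * 1 * t" using d2 K_pos a by (intro mult_right_mono mult_left_mono) auto
    then show "\<bar>f x t - f x 0\<bar> \<le> K * t" "\<bar>b x t - b x 0\<bar> \<le> K * t"
      using b_time[of x t t] a by auto
  qed
  moreover have "\<bar>(b x t - b x 0) * ph 0 x\<bar> \<le> K * t * K"
    unfolding abs_mult using calculation(3) ph_le[of 0 x] a K_pos by (intro mult_mono) auto
  \<comment> \<open>\<open>b - c\<close> alone is not small in \<open>t\<close>. The Gaussian factor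
    of \<open>Z\<close> helps: \<open>x\<^sup>2 * exp (- \<kappa> * x\<^sup>2 / t)\<close> is at
    most \<open>t / \<kappa>\<close>.\<close>
  moreover have "\<bar>(b x t - c) * Z 0 x t\<bar> \<le> K * KZ * (1 / \<kappa> + 1) * t"
  proof -
    have g: "x\<^sup>2 * exp (- \<kappa> * x\<^sup>2 / t) \<le> t / \<kappa>"
    proof -
      have "exp (- (\<kappa> * x\<^sup>2 / t)) \<le> 1 / (\<kappa> * x\<^sup>2 / t)"
        using kappa_pos a by (intro exp_neg_le_inverse) auto
      then have "x\<^sup>2 * exp (- (\<kappa> * x\<^sup>2 / t)) \<le> x\<^sup>2 * (1 / (\<kappa> * x\<^sup>2 / t))" by (intro mult_left_mono) auto
      then show ?thesis using a by simp
    qed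
    have "exp (- \<kappa> * x\<^sup>2 / t) \<le> 1" using kappa_pos a by simp
    then have "t * exp (- \<kappa> * x\<^sup>2 / t) \<le> t" using a by (simp add: mult_left_le)
    then have "(x\<^sup>2 + t) * exp (- \<kappa> * x\<^sup>2 / t) \<le> (1 / \<kappa> + 1) * t" using g by (simp add: distrib_right)
    then have "K * KZ * ((x\<^sup>2 + t) * exp (- \<kappa> * x\<^sup>2 / t)) \<le> K * KZ * ((1 / \<kappa> + 1) * t)"
      using K_pos KZ by (intro mult_left_mono) auto
    moreover have "\<bar>(b x t - c) * Z 0 x t\<bar> \<le> (K * (x\<^sup>2 + t)) * (KZ * exp (- \<kappa> * x\<^sup>2 / t))"
      unfolding abs_mult using b_corner[of x t] Z_gauss[of x t] a K_pos by (intro mult_mono) auto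
    ultimately show ?thesis by (simp add: mult_ac)
  qed
  moreover have "\<bar>t * y1xx x\<bar> \<le> t * (2 * K + 4 * K\<^sup>2)"
    unfolding abs_mult using y1_le[of x] a by (intro mult_mono) auto
  moreover have "\<bar>t * (b x t * y1 x)\<bar> \<le> t * (K * (2 * K + K\<^sup>2))"
    unfolding abs_mult using y1_le[of x] b_le[of x t] a K_pos by (intro mult_mono) auto
  ultimately have "\<bar>Rt x t - y1 x - (Rxx x t - (ph 2 x + t * y1xx x)) + b x t * (R x t - (ph 0 x + t * y1 x))\<bar>
      \<le> K * t + K * t * K + K * KZ * (1 / \<kappa> + 1) * t + t * (2 * K + 4 * K\<^sup>2) + t * (K * (2 * K + K\<^sup>2))"
    by linarith
  also have "\<dots> = CS1 * t" by (simp add: CS1_def algebra_simps power2_eq_square)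
  also have "\<dots> \<le> C1 * t" using CQ K_pos KZ kappa_pos a by (intro mult_right_mono) (auto simp: C1_def)
  also have "\<dots> \<le> C1 * (2 * t) - 0 + b x t * (C1 * t\<^sup>2)"
  proof -
    have "0 \<le> b x t * (C1 * t\<^sup>2)" using b_le[of x t] a C1 by auto
    moreover have "0 \<le> C1 * t" using C1 a by auto
    ultimately show ?thesis by linarith
  qed
  finally show "\<bar>Rt x t - y1 x - (Rxx x t - (ph 2 x + t * y1xx x)) + b x t * (R x t - (ph 0 x + t * y1 x))\<bar>
      \<le> C1 * (2 * t) - 0 + b x t * (C1 * t\<^sup>2)" .
next
  fix x t assume a: "0 \<le> x" "x \<le> X" "0 \<le> t" "t \<le> Th" "x = 0 \<or> x = X \<or> t = 0"
  consider "x = 0" | "x = X" | "t = 0" using a by auto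
  then show "\<bar>R x t - (ph 0 x + t * y1 x)\<bar> \<le> C1 * t\<^sup>2"
  proof cases
    case 1
    have "\<bar>q0 t - q0 0 - t * q0' 0\<bar> \<le> (2 * CQ) * t\<^sup>2"
    proof (rule taylor2[where T = Th and ?g2.0 = q0''])
      fix s assume "0 \<le> s" "s \<le> Th"
      then show "\<bar>q0'' s\<bar> \<le> 2 * CQ"
        using q0_le(2)[of s] mult_left_mono[OF wgt_le[of s], of CQ] CQ by simp
    qed (use a q0_t CQ in auto)
    moreover have "q0 0 = ph 0 0" using match(1) by (simp add: q0_def)
    \<comment> \<open>The defining property of \<open>a1\<close>: the boundary slope equals the
      slope demanded by the equation.\<close>
    moreover have "q0' 0 = y1 0" using a1_eq by (simp add: q0'_def y1_def)
    ultimately have "\<bar>R x t - (ph 0 x + t * y1 x)\<bar> \<le> (2 * CQ) * t\<^sup>2"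
      using 1 R_left[OF a(3,4)] by (simp add: algebra_simps)
    also have "\<dots> \<le> C1 * t\<^sup>2"
      using C1(1) K_pos KZ kappa_pos by (intro mult_right_mono) (auto simp: C1_def)
    finally show ?thesis .
  next
    case 2
    have "\<bar>gR t - gR 0 - t * gR1 0\<bar> \<le> K * t\<^sup>2"
    proof (rule taylor2[where T = Th and ?g2.0 = gR2])
      fix s assume "0 \<le> s" "s \<le> Th"
      then show "\<bar>gR2 s\<bar> \<le> K"
        using g_le[of s] mult_left_mono[OF d2(2), of K] K_pos by linarith
    qed (use a gR_t gR1_t K_pos in auto)
    \<comment> \<open>At distance \<open>X \<ge> 1\<close> from the corner the Gaussian beats every
      power of \<open>t\<close>, so the singular function does not disturb the compatibility at the
      right corner.\<close>
    moreover have "\<bar>Z 0 X t\<bar> \<le> 4 * KZ / \<kappa>\<^sup>2 * t\<^sup>2"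
    proof (cases "t = 0")
      case False
      have "1 \<le> X ^ 4" using X_ge by simp
      have "exp (- (\<kappa> * X\<^sup>2 / t)) \<le> 4 / (\<kappa> * X\<^sup>2 / t)\<^sup>2"
        using kappa_pos X_ge a False by (intro exp_neg_le_inverse_square) auto
      also have "\<dots> = 4 / \<kappa>\<^sup>2 * t\<^sup>2 * (1 / X ^ 4)"
        by (simp add: power_divide power_mult_distrib power_mult[symmetric])
      also have "\<dots> \<le> 4 / \<kappa>\<^sup>2 * t\<^sup>2 * 1"
        using \<open>1 \<le> X ^ 4\<close> by (intro mult_left_mono) (auto simp: divide_le_eq_1)
      finally have "KZ * exp (- \<kappa> * X\<^sup>2 / t) \<le> KZ * (4 / \<kappa>\<^sup>2 * t\<^sup>2)"
        using KZ by (intro mult_left_mono) auto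
      also have "KZ * (4 / \<kappa>\<^sup>2 * t\<^sup>2) = 4 * KZ / \<kappa>\<^sup>2 * t\<^sup>2" by simp
      finally show ?thesis using order_trans[OF Z_gauss[of X t]] X_ge a False by simp
    qed (simp add: Z_def W_def)
    moreover have "R X t = gR t - Z 0 X t" using R_right[OF a(3,4)] by (simp add: q1_def)
    moreover have "gR 0 = ph 0 X" "gR1 0 = y1 X" using match by (auto simp: y1_def)
    ultimately have "\<bar>R x t - (ph 0 x + t * y1 x)\<bar> \<le> K * t\<^sup>2 + 4 * KZ / \<kappa>\<^sup>2 * t\<^sup>2"
      using 2 by (simp only: abs_le_iff) linarith
    also have "\<dots> = (K + 4 * KZ / \<kappa>\<^sup>2) * t\<^sup>2" by (simp only: distrib_right)
    also have "\<dots> \<le> C1 * t\<^sup>2"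
      using C1(1) CQ by (intro mult_right_mono) (auto simp: C1_def)
    finally show ?thesis .
  next
    case 3
    then show ?thesis using R_init[OF a(1,2)] by simp
  qed
qed (use assms X_ge Th_ge in auto)

end

section \<open>First and second time differences of the remainder\<close>

context scaled_problem
begin

lemma R_slices:
  "0 \<le> x \<Longrightarrow> x \<le> X \<Longrightarrow> 0 \<le> p \<Longrightarrow> q \<le> Th \<Longrightarrow> continuous_on {p..q} (R x)"
  "0 \<le> t \<Longrightarrow> t \<le> Th \<Longrightarrow> 0 \<le> p \<Longrightarrow> q \<le> X \<Longrightarrow> continuous_on {p..q} (\<lambda>x. R x t)"
  by (rule continuous_on_slice_t[OF regD(1)[OF R_reg]] continuous_on_slice_x[OF regD(1)[OF R_reg]]; simp)+

lemma lateral_diff1: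
  assumes "x = 0 \<or> x = X" "0 \<le> r" "0 \<le> t - r" "t \<le> Th"
  shows "\<bar>R x t - R x (t - r)\<bar> \<le> CQ * r * wgt (t - r)"
proof -
  have q: "\<bar>q t - q (t - r)\<bar> \<le> CQ * r * wgt (t - r)"
    if "q = q0 \<and> q' = q0' \<or> q = q1 \<and> q' = q1'" for q q'
    by (rule time_diff1[where q' = q'])
      (use that assms CQ q0_t q1_t q0_le q1_le in
        \<open>auto intro: continuous_on_subset[OF q_continuous(1)] continuous_on_subset[OF q_continuous(2)]\<close>)
  show ?thesis using assms q[of q0 q0'] q[of q1 q1'] R_left R_right by auto
qed

lemma lateral_diff2:
  assumes "x = 0 \<or> x = X" "0 \<le> r" "0 \<le> t - 2 * r" "t \<le> Th"
  shows "\<bar>R x t - 2 * R x (t - r) + R x (t - 2 * r)\<bar> \<le> 2 * (CQ * wgt (t - 2 * r)) * r\<^sup>2"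
proof -
  have m: "CQ * wgt s \<le> CQ * wgt (t - 2 * r)" if "t - 2 * r < s" for s
    using that CQ by (intro mult_left_mono wgt_mono) auto
  have q: "\<bar>q t - 2 * q (t - r) + q (t - 2 * r)\<bar> \<le> 2 * (CQ * wgt (t - 2 * r)) * r\<^sup>2"
    if "q = q0 \<and> q' = q0' \<and> q'' = q0'' \<or> q = q1 \<and> q' = q1' \<and> q'' = q1''" for q q' q''
  proof (rule time_diff2[where q' = q' and q'' = q''])
    show "continuous_on {t - 2 * r..t} q"
      using that assms continuous_on_subset[OF q_continuous(1)] continuous_on_subset[OF q_continuous(2)] by auto
    show "0 \<le> CQ * wgt (t - 2 * r)" using CQ wgt_pos[of "t - 2 * r"] by simp
    fix s assume s: "t - 2 * r < s" "s < t"
    then show "\<bar>q'' s\<bar> \<le> CQ * wgt (t - 2 * r)"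
      using that assms m[of s] q0_le(2)[of s] q1_le(2)[of s] by auto
  qed (use that assms q0_t q1_t in auto)
  show ?thesis using assms q[of q0 q0' q0''] q[of q1 q1' q1''] R_left R_right by auto
qed

definition C2 where "C2 = (2 * K + K\<^sup>2 + C1) + 2 * CR0 + CQ + K * (CG1 + K * CR0)"

lemma CG: "0 \<le> CG1" "0 \<le> CG2" using K_pos KZ by (auto simp: CG1_def CG2_def)

lemma C2: "0 \<le> C2" using K_pos C1 CR0 CQ CG by (simp add: C2_def)

lemma G_slice: "0 < x \<Longrightarrow> x \<le> X \<Longrightarrow> 0 \<le> p \<Longrightarrow> q \<le> Th \<Longrightarrow> continuous_on {p..q} (G x)"
proof -
  assume a: "0 < x" "x \<le> X" "0 \<le> p" "q \<le> Th"
  have "continuous_on {0..Th} (b x)" "continuous_on {0..Th} (f x)"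
    using DERIV_continuous_on[of "{0..Th}" "b x" "bt x"] DERIV_continuous_on[of "{0..Th}" "f x" "ft x"]
      b_t f_t a by auto
  then have "continuous_on {0..Th} (G x)"
    unfolding G_def[abs_def] using Z_continuous[OF a(1)]
    by (intro continuous_on_diff continuous_on_mult continuous_on_const) auto
  then show ?thesis by (rule continuous_on_subset) (use a in auto)
qed

text \<open>The difference solves the same equation with source
  \<open>G x t - G x (t - r) - (b x t - b x (t - r)) * R x (t - r)\<close>, all of order
  \<open>r * wgt (t - r)\<close>. Initial values on \<open>t = r\<close> come from
  \<open>R_initial\<close>, lateral ones from the boundary data.\<close>

lemma R_diff1:
  assumes "0 \<le> x" "x \<le> X" "0 < r" "r \<le> t" "t \<le> Th"
  shows "\<bar>R x t - R x (t - r)\<bar> \<le> C2 * r * wgt (t - r)"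
proof (rule comparison[where u = "\<lambda>x t. R x t - R x (t - r)" and ?x0.0 = 0 and ?x1.0 = X and ?t0.0 = r and ?t1.0 = Th
      and P = "\<lambda>x t. C2 * r * wgt (t - r)" and Pt = "\<lambda>x t. C2 * r * (- \<beta> * exp (- \<beta> * (t - r)))"
      and Px = "\<lambda>_ _. 0" and Pxx = "\<lambda>_ _. 0" and c = b])
  have "reg (\<lambda>x t. R x (t - r)) (\<lambda>x t. Rt x (t - r)) (\<lambda>x t. Rx x (t - r)) (\<lambda>x t. Rxx x (t - r)) 0 X r Th"
    by (rule reg_subset[OF reg_shift_t[OF R_reg, of r]]) (use assms in auto)
  then show "reg (\<lambda>x t. R x t - R x (t - r)) (\<lambda>x t. Rt x t - Rt x (t - r)) (\<lambda>x t. Rx x t - Rx x (t - r))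
      (\<lambda>x t. Rxx x t - Rxx x (t - r)) 0 X r Th"
    by (intro reg_diff reg_subset[OF R_reg]) (use assms in auto)
  show "reg (\<lambda>x t. C2 * r * wgt (t - r)) (\<lambda>x t. C2 * r * (- \<beta> * exp (- \<beta> * (t - r)))) (\<lambda>_ _. 0) (\<lambda>_ _. 0) 0 X r Th"
    unfolding wgt_def
    by (rule regI_smooth) (auto intro!: continuous_intros derivative_eq_intros simp: case_prod_beta)
next
  fix x t assume a: "0 < x" "x < X" "r < t" "t \<le> Th"
  show "0 < b x t" using b_le[of x t] a assms by auto
  let ?w = "wgt (t - r)"
  have w: "0 < ?w" by (rule wgt_pos)
  have "Rt x t - Rt x (t - r) - (Rxx x t - Rxx x (t - r)) + b x t * (R x t - R x (t - r))
      = (G x t - G x (t - r)) - (b x t - b x (t - r)) * R x (t - r)"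
    using R_eq[of x t] R_eq[of x "t - r"] a assms by (simp add: algebra_simps)
  moreover have "\<bar>G x t - G x (t - r)\<bar> \<le> CG1 * r * ?w"
    by (rule time_diff1[where q' = "Gt x"])
      (use a assms CG G_t Gt_le in \<open>auto intro!: G_slice\<close>)
  moreover have "\<bar>(b x t - b x (t - r)) * R x (t - r)\<bar> \<le> (K * d\<^sup>2 * r) * CR0"
    unfolding abs_mult using b_time(1)[of x r t] R_bound[of x "t - r"] a assms K_pos
    by (intro mult_mono) auto
  moreover have "(K * d\<^sup>2 * r) * CR0 \<le> K * CR0 * r * ?w"
  proof -
    have "(K * CR0 * r) * d\<^sup>2 \<le> (K * CR0 * r) * ?w"
      using K_pos CR0 assms by (intro mult_left_mono) (auto simp: wgt_def)
    then show ?thesis by (simp add: mult_ac)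
  qed
  ultimately have "\<bar>Rt x t - Rt x (t - r) - (Rxx x t - Rxx x (t - r)) + b x t * (R x t - R x (t - r))\<bar>
      \<le> CG1 * r * ?w + K * CR0 * r * ?w" by linarith
  also have "\<dots> = (CG1 + K * CR0) * (r * ?w)" by (simp add: algebra_simps)
  \<comment> \<open>\<open>1 / K\<close> is a common lower bound of \<open>b\<close> and
    \<open>b - \<beta>\<close>, the factors by which the operator multiplies the two summands of the
    weight.\<close>
  also have "\<dots> \<le> C2 * (1 / K) * (r * ?w)"
  proof (rule mult_right_mono)
    have "(CG1 + K * CR0) * K \<le> C2"
      using K_pos C1 CR0 CQ CG by (simp add: C2_def mult.commute)
    then show "CG1 + K * CR0 \<le> C2 * (1 / K)" using K_pos by (simp add: field_simps)
  qed (use w assms in auto)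
  also have "\<dots> = C2 * r * (1 / K * d\<^sup>2 + 1 / K * exp (- \<beta> * (t - r)))"
    by (simp add: wgt_def algebra_simps)
  also have "\<dots> \<le> C2 * r * (b x t * d\<^sup>2 + (b x t - \<beta>) * exp (- \<beta> * (t - r)))"
    using C2 assms b_ge[of x t] a inv_K beta_pos eta_pos
    by (intro mult_left_mono add_mono mult_right_mono) auto
  finally show "\<bar>Rt x t - Rt x (t - r) - (Rxx x t - Rxx x (t - r)) + b x t * (R x t - R x (t - r))\<bar>
      \<le> C2 * r * (- \<beta> * exp (- \<beta> * (t - r))) - 0 + b x t * (C2 * r * wgt (t - r))"
    by (simp add: wgt_def algebra_simps)
next
  fix x t assume a: "0 \<le> x" "x \<le> X" "r \<le> t" "t \<le> Th" "x = 0 \<or> x = X \<or> t = r"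
  show "\<bar>R x t - R x (t - r)\<bar> \<le> C2 * r * wgt (t - r)"
  proof (cases "t = r")
    case True
    have "\<bar>R x r - R x 0\<bar> \<le> C2 * r * 1"
    \<comment> \<open>The expansion is useful for small \<open>r\<close> only; for
      \<open>r > 1\<close> the bound \<open>2 * CR0\<close> is already of order
      \<open>r\<close>.\<close>
    proof (cases "r \<le> 1")
      case le: True
      have "\<bar>R x r - (ph 0 x + r * y1 x)\<bar> \<le> C1 * r\<^sup>2" using a assms by (intro R_initial) auto
      moreover have "R x 0 = ph 0 x" using a by (intro R_init)
      moreover have "\<bar>r * y1 x\<bar> \<le> r * (2 * K + K\<^sup>2)"
        unfolding abs_mult using y1_le[of x] a assms by (intro mult_mono) auto
      moreover have "C1 * r\<^sup>2 \<le> C1 * r"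
        using C1 le assms by (intro mult_left_mono) (auto simp: power2_eq_square mult_left_le)
      ultimately have "\<bar>R x r - R x 0\<bar> \<le> r * (2 * K + K\<^sup>2) + C1 * r" by linarith
      also have "\<dots> = (2 * K + K\<^sup>2 + C1) * r" by (simp add: algebra_simps)
      also have "\<dots> \<le> C2 * r"
        using assms CR0 CQ CG K_pos by (intro mult_right_mono) (auto simp: C2_def)
      finally show ?thesis by simp
    next
      case False
      have "\<bar>R x r - R x 0\<bar> \<le> 2 * CR0 * 1" using R_bound[of x r] R_bound[of x 0] a assms Th_ge by auto
      also have "\<dots> \<le> 2 * CR0 * r" using False CR0 by (intro mult_left_mono) auto
      also have "\<dots> \<le> C2 * r"
        using assms C1 CQ CG CR0 K_pos by (intro mult_right_mono) (auto simp: C2_def)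
      finally show ?thesis by simp
    qed
    also have "\<dots> \<le> C2 * r * wgt (t - r)"
      using True C2 assms by (intro mult_left_mono) (auto simp: wgt_def)
    finally show ?thesis using True by simp
  next
    case False
    then have "\<bar>R x t - R x (t - r)\<bar> \<le> CQ * r * wgt (t - r)"
      using a assms by (intro lateral_diff1) auto
    also have "\<dots> \<le> C2 * r * wgt (t - r)"
      using assms C1 CG CR0 K_pos wgt_pos[of "t - r"] by (intro mult_right_mono) (auto simp: C2_def)
    finally show ?thesis .
  qed
qed (use assms X_ge in auto)

definition CS3 where "CS3 = 12 * CG2 * exp (2 * \<beta>) + 2 * K * CR0 + 4 * K * C2"
definition A3 where "A3 = 24 * K * CS3 + 2 * CQ * exp (2 * \<beta>) + 18 * C1 * exp (3 * \<beta>)"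
definition C3 where "C3 = 2 * A3"

lemma A3: "0 \<le> CS3" "0 \<le> A3" "0 \<le> C3"
proof -
  show 1: "0 \<le> CS3" using CG K_pos CR0 C2 by (simp add: CS3_def)
  show "0 \<le> A3" using 1 CQ C1 K_pos by (simp add: A3_def)
  then show "0 \<le> C3" by (simp add: C3_def)
qed

text \<open>The part affine in time drops out of the second difference. The three remainders of
  \<open>R_initial\<close> contribute \<open>9 + 2 * 4 + 1 = 18\<close> times
  \<open>C1 * r\<^sup>2\<close>, as \<open>t \<le> 3 * r\<close>. Since then
  \<open>t \<le> 3\<close>, the weight is at least \<open>exp (- 3 * \<beta>)\<close>.\<close>

lemma R_diff2_initial:
  assumes "0 \<le> x" "x \<le> X" "0 < r" "r \<le> 1" "2 * r \<le> t" "t \<le> 3 * r" "t \<le> Th"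
  shows "\<bar>R x t - 2 * R x (t - r) + R x (t - 2 * r)\<bar> \<le> 18 * C1 * exp (3 * \<beta>) * r\<^sup>2 * wgt t"
proof -
  have "\<bar>R x s - (ph 0 x + s * y1 x)\<bar> \<le> C1 * s\<^sup>2" if "0 \<le> s" "s \<le> t" for s
    using that assms by (intro R_initial) auto
  from this[of t] this[of "t - r"] this[of "t - 2 * r"]
  have "\<bar>R x t - 2 * R x (t - r) + R x (t - 2 * r)\<bar> \<le> C1 * t\<^sup>2 + 2 * (C1 * (t - r)\<^sup>2) + C1 * (t - 2 * r)\<^sup>2"
    using assms by (auto simp: abs_le_iff algebra_simps)
  also have "\<dots> = C1 * (t\<^sup>2 + 2 * (t - r)\<^sup>2 + (t - 2 * r)\<^sup>2)" by (simp add: algebra_simps)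
  also have "\<dots> \<le> C1 * ((3 * r)\<^sup>2 + 2 * (2 * r)\<^sup>2 + (1 * r)\<^sup>2)"
    using assms C1 by (intro mult_left_mono add_mono power_mono) auto
  also have "\<dots> = 18 * C1 * r\<^sup>2 * 1" by (simp add: power2_eq_square)
  also have "\<dots> \<le> 18 * C1 * r\<^sup>2 * (exp (3 * \<beta>) * wgt t)"
  proof (intro mult_left_mono)
    have "3 * r \<le> 3" using assms by simp
    then have "\<beta> * t \<le> \<beta> * 3" using assms beta_pos by (intro mult_left_mono) linarith+
    then have "1 \<le> exp (3 * \<beta>) * exp (- \<beta> * t)" by (simp add: exp_add[symmetric])
    also have "\<dots> \<le> exp (3 * \<beta>) * wgt t" using d2 by (intro mult_left_mono) (auto simp: wgt_def)
    finally show "1 \<le> exp (3 * \<beta>) * wgt t" .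
  qed (use C1 in auto)
  finally show ?thesis by (simp add: mult_ac)
qed

text \<open>From \<open>3 * r \<le> t\<close> every time \<open>s\<close> in the stencil is at least
  \<open>t / 3\<close>, so the singular factor of \<open>Gtt\<close> at \<open>s\<close> is
  comparable with the one at \<open>t\<close>. This is why the comparison in \<open>R_diff2\<close>
  starts at \<open>3 * r\<close>; \<open>r \<le> 1\<close> does the same for the
  exponential.\<close>

lemma G_diff2:
  assumes "0 < x" "x < X" "0 < r" "r \<le> 1" "3 * r \<le> t" "t \<le> Th"
  shows "\<bar>G x t - 2 * G x (t - r) + G x (t - 2 * r)\<bar>
    \<le> 12 * CG2 * exp (2 * \<beta>) * r\<^sup>2 * (d\<^sup>2 + exp (- \<beta> * t) * (1 + 1 / (x\<^sup>2 + t)))"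
proof -
  define q where "q = 1 + 1 / (x\<^sup>2 + t)"
  define e where "e = exp (- \<beta> * t)"
  have s0: "0 < x\<^sup>2 + t" using assms by (auto intro: add_pos_pos)
  have q: "1 \<le> q" using s0 by (simp add: q_def)
  let ?A = "6 * CG2 * exp (2 * \<beta>) * (d\<^sup>2 + e * q)"
  have A: "0 \<le> ?A" using CG d2 q by (auto simp: e_def intro!: mult_nonneg_nonneg add_nonneg_nonneg)
  have "\<bar>G x t - 2 * G x (t - r) + G x (t - 2 * r)\<bar> \<le> 2 * ?A * r\<^sup>2"
  proof (rule time_diff2[where q' = "Gt x" and q'' = "Gtt x"])
    show "continuous_on {t - 2 * r..t} (G x)" using assms by (intro G_slice) auto
    fix s assume s: "t - 2 * r < s" "s < t"
    then have sp: "0 < s" "s \<le> Th" using assms by auto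
    have "\<bar>Gtt x s\<bar> \<le> CG2 * (d\<^sup>2 + exp (- \<beta> * s) * (1 + 1 / (x\<^sup>2 + s)))"
      using assms sp by (intro Gtt_le) auto
    also have "\<dots> \<le> CG2 * (6 * exp (2 * \<beta>) * d\<^sup>2 + (exp (2 * \<beta>) * e) * (6 * q))"
    proof (intro mult_left_mono add_mono mult_mono)
      have "1 * d\<^sup>2 \<le> (6 * exp (2 * \<beta>)) * d\<^sup>2"
        using beta_pos one_le_exp_iff[of "2 * \<beta>"] by (intro mult_right_mono) (auto intro: order_trans[of _ "exp (2 * \<beta>)"])
      then show "d\<^sup>2 \<le> 6 * exp (2 * \<beta>) * d\<^sup>2" by simp
      have "t - 2 \<le> s" using s assms by linarith
      then have "\<beta> * (t - 2) \<le> \<beta> * s" using beta_pos by (intro mult_left_mono) auto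
      then show "exp (- \<beta> * s) \<le> exp (2 * \<beta>) * e"
        by (simp add: e_def exp_add[symmetric] algebra_simps)
      have "x\<^sup>2 + t \<le> 3 * (x\<^sup>2 + s)" using s assms zero_le_power2[of x] by (simp only: distrib_left)
      then have "1 / (3 * (x\<^sup>2 + s)) \<le> 1 / (x\<^sup>2 + t)" using s0 by (intro divide_left_mono) (auto simp: zero_less_mult_iff)
      moreover have "1 / (3 * (x\<^sup>2 + s)) = 1 / (x\<^sup>2 + s) / 3"
        by (simp only: divide_divide_eq_left mult.commute)
      ultimately have "1 / (x\<^sup>2 + s) / 3 \<le> 1 / (x\<^sup>2 + t)" by (simp only:)
      moreover have "u / 3 \<le> v \<Longrightarrow> u \<le> 3 * v" for u v :: real by simp
      ultimately have "1 / (x\<^sup>2 + s) \<le> 3 * (1 / (x\<^sup>2 + t))" by blast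
      moreover have "u \<le> 3 * v \<Longrightarrow> 1 \<le> 1 + v \<Longrightarrow> 1 + u \<le> 6 * (1 + v)" for u v :: real by simp
      ultimately show "1 + 1 / (x\<^sup>2 + s) \<le> 6 * q" using q unfolding q_def by blast
      show "0 \<le> 1 + 1 / (x\<^sup>2 + s)" using sp by (intro add_nonneg_nonneg divide_nonneg_nonneg) auto
    qed (use CG in \<open>auto simp: e_def\<close>)
    also have "\<dots> = ?A" by (simp add: algebra_simps)
    finally show "\<bar>Gtt x s\<bar> \<le> ?A" .
  qed (use assms A G_t in auto)
  then show ?thesis by (simp add: e_def q_def mult_ac)
qed

text \<open>Up to \<open>3 * r\<close> the expansion at the initial time suffices. Afterwards the
  source still carries the factor \<open>1 / (x\<^sup>2 + t)\<close> of \<open>Gtt\<close>; adding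
  \<open>exp (- \<beta> * t)\<close> times the corner barrier to the weight absorbs it. As that
  barrier is at most 1, the final bound merely doubles.\<close>

lemma R_diff2:
  assumes "0 \<le> x" "x \<le> X" "0 < r" "r \<le> 1" "2 * r \<le> t" "t \<le> Th"
  shows "\<bar>R x t - 2 * R x (t - r) + R x (t - 2 * r)\<bar> \<le> C3 * r\<^sup>2 * wgt t"
proof (cases "t \<le> 3 * r")
  case True
  have "\<bar>R x t - 2 * R x (t - r) + R x (t - 2 * r)\<bar> \<le> 18 * C1 * exp (3 * \<beta>) * (r\<^sup>2 * wgt t)"
    using R_diff2_initial[OF assms(1-5) True assms(6)] by (simp add: mult.assoc)
  also have "\<dots> \<le> C3 * (r\<^sup>2 * wgt t)"
    using A3 CQ K_pos C1 wgt_pos[of t] by (intro mult_right_mono) (auto simp: C3_def A3_def)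
  finally show ?thesis by (simp add: mult.assoc)
next
  case False
  let ?B = "\<lambda>x t. t / (x\<^sup>2 + 6 * t)"
  let ?Bt = "\<lambda>x t. x\<^sup>2 / (x\<^sup>2 + 6 * t)\<^sup>2"
  let ?Bx = "\<lambda>x t. - (2 * x * t / (x\<^sup>2 + 6 * t)\<^sup>2)"
  let ?Bxx = "\<lambda>x t. t * (6 * x\<^sup>2 - 12 * t) / (x\<^sup>2 + 6 * t) ^ 3"
  let ?e = "\<lambda>t. exp (- \<beta> * t)"
  let ?A = "A3 * r\<^sup>2"
  have A: "0 \<le> ?A" using A3 by simp
  have "\<bar>R x t - 2 * R x (t - r) + R x (t - 2 * r)\<bar> \<le> ?A * (d\<^sup>2 + ?e t + ?e t * ?B x t)"
  proof (rule comparison[where u = "\<lambda>x t. R x t - 2 * R x (t - r) + R x (t - 2 * r)"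
        and ?x0.0 = 0 and ?x1.0 = X and ?t0.0 = "3 * r" and ?t1.0 = Th
        and P = "\<lambda>x t. ?A * (d\<^sup>2 + ?e t + ?e t * ?B x t)"
        and Pt = "\<lambda>x t. ?A * (- \<beta> * ?e t + (- \<beta> * ?e t * ?B x t + ?e t * ?Bt x t))"
        and Px = "\<lambda>x t. ?A * (?e t * ?Bx x t)" and Pxx = "\<lambda>x t. ?A * (?e t * ?Bxx x t)" and c = b])
    have s: "reg (\<lambda>x t. R x (t - k)) (\<lambda>x t. Rt x (t - k)) (\<lambda>x t. Rx x (t - k)) (\<lambda>x t. Rxx x (t - k)) 0 X (3 * r) Th"
      if "0 \<le> k" "k \<le> 3 * r" for k
      by (rule reg_subset[OF reg_shift_t[OF R_reg, of k]]) (use assms that in auto)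
    show "reg (\<lambda>x t. R x t - 2 * R x (t - r) + R x (t - 2 * r)) (\<lambda>x t. Rt x t - 2 * Rt x (t - r) + Rt x (t - 2 * r))
        (\<lambda>x t. Rx x t - 2 * Rx x (t - r) + Rx x (t - 2 * r)) (\<lambda>x t. Rxx x t - 2 * Rxx x (t - r) + Rxx x (t - 2 * r))
        0 X (3 * r) Th"
      by (intro reg_add reg_diff reg_cmult s reg_subset[OF R_reg]) (use assms in auto)
    show "reg (\<lambda>x t. ?A * (d\<^sup>2 + ?e t + ?e t * ?B x t))
        (\<lambda>x t. ?A * (- \<beta> * ?e t + (- \<beta> * ?e t * ?B x t + ?e t * ?Bt x t)))
        (\<lambda>x t. ?A * (?e t * ?Bx x t)) (\<lambda>x t. ?A * (?e t * ?Bxx x t)) 0 X (3 * r) Th"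
    proof (rule reg_cmult, rule regI_smooth)
      show "continuous_on ({0..X} \<times> {3 * r..Th}) (\<lambda>(x, t). d\<^sup>2 + ?e t + ?e t * ?B x t)"
        unfolding case_prod_beta using assms
        by (intro continuous_intros) (auto simp: add_nonneg_eq_0_iff)
      fix x t assume "0 < x" "x < X" "3 * r < t" "t \<le> Th"
      then have t: "0 < t" using assms by auto
      show "((\<lambda>t. d\<^sup>2 + ?e t + ?e t * ?B x t) has_real_derivative
          - \<beta> * ?e t + (- \<beta> * ?e t * ?B x t + ?e t * ?Bt x t)) (at t)"
      proof -
        have e': "(?e has_real_derivative - \<beta> * ?e t) (at t)" by (auto intro!: derivative_eq_intros)
        show ?thesis
          by (rule DERIV_cong[OF DERIV_add[OF DERIV_add[OF DERIV_const e'] DERIV_mult[OF e' corner_barrier(1)[OF t]]]])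
            (simp add: algebra_simps)
      qed
      show "((\<lambda>x. d\<^sup>2 + ?e t + ?e t * ?B x t) has_real_derivative ?e t * ?Bx x t) (at x)"
        by (rule DERIV_cong[OF DERIV_add[OF DERIV_const DERIV_cmult[OF corner_barrier(2)[OF t]]]]) simp
      show "((\<lambda>x. ?e t * ?Bx x t) has_real_derivative ?e t * ?Bxx x t) (at x)"
        by (rule DERIV_cmult[OF corner_barrier(3)[OF t]])
    qed
  next
    fix x t assume a: "0 < x" "x < X" "3 * r < t" "t \<le> Th"
    then have t: "0 < t" using assms by auto
    show "0 < b x t" using b_le[of x t] a assms by auto
    define q where "q = 1 + 1 / (x\<^sup>2 + t)"
    have s0: "0 < x\<^sup>2 + t" using t by (auto intro: add_nonneg_pos)
    have q: "1 \<le> q" using s0 by (simp add: q_def)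
    let ?w = "d\<^sup>2 + ?e t * q"
    have w: "0 < ?w" using d2 q by (auto intro: add_pos_nonneg)
    have dw: "d\<^sup>2 \<le> ?w" using q by auto
    let ?L = "Rt x t - 2 * Rt x (t - r) + Rt x (t - 2 * r) - (Rxx x t - 2 * Rxx x (t - r) + Rxx x (t - 2 * r))
        + b x t * (R x t - 2 * R x (t - r) + R x (t - 2 * r))"
    \<comment> \<open>A discrete Leibniz rule for \<open>b * R\<close>, arranged so that the second
      difference of \<open>R\<close> is multiplied by \<open>b\<close> at the latest time and every
      other term contains a difference of \<open>b\<close>, hence a factor
      \<open>d\<^sup>2\<close>.\<close>
    have "?L = (G x t - 2 * G x (t - r) + G x (t - 2 * r))
        - (b x t - 2 * b x (t - r) + b x (t - 2 * r)) * R x (t - 2 * r)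
        - 2 * ((b x t - b x (t - r)) * (R x (t - r) - R x (t - 2 * r)))"
      using R_eq[of x t] R_eq[of x "t - r"] R_eq[of x "t - 2 * r"] a assms by (simp add: algebra_simps)
    moreover have "\<bar>G x t - 2 * G x (t - r) + G x (t - 2 * r)\<bar> \<le> 12 * CG2 * exp (2 * \<beta>) * r\<^sup>2 * ?w"
      unfolding q_def using a assms by (intro G_diff2) auto
    moreover have "\<bar>(b x t - 2 * b x (t - r) + b x (t - 2 * r)) * R x (t - 2 * r)\<bar> \<le> 2 * K * CR0 * r\<^sup>2 * ?w"
    proof -
      have "\<bar>(b x t - 2 * b x (t - r) + b x (t - 2 * r)) * R x (t - 2 * r)\<bar> \<le> (2 * (K * d\<^sup>2) * r\<^sup>2) * CR0"
        unfolding abs_mult using a assms K_pos CR0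
        by (intro mult_mono b_time2 R_bound) auto
      also have "\<dots> = 2 * K * CR0 * r\<^sup>2 * d\<^sup>2" by simp
      also have "\<dots> \<le> 2 * K * CR0 * r\<^sup>2 * ?w" using dw K_pos CR0 by (intro mult_left_mono) auto
      finally show ?thesis .
    qed
    moreover have "\<bar>(b x t - b x (t - r)) * (R x (t - r) - R x (t - 2 * r))\<bar> \<le> 2 * K * C2 * r\<^sup>2 * ?w"
    proof -
      have "\<bar>R x (t - r) - R x (t - r - r)\<bar> \<le> C2 * r * wgt (t - r - r)"
        using a assms by (intro R_diff1) auto
      also have "\<dots> \<le> C2 * r * 2" using a assms C2 by (intro mult_left_mono wgt_le) auto
      finally have "\<bar>R x (t - r) - R x (t - 2 * r)\<bar> \<le> C2 * r * 2" by (simp add: algebra_simps)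
      then have "\<bar>(b x t - b x (t - r)) * (R x (t - r) - R x (t - 2 * r))\<bar> \<le> (K * d\<^sup>2 * r) * (C2 * r * 2)"
        unfolding abs_mult using a assms K_pos by (intro mult_mono b_time) auto
      also have "\<dots> = 2 * K * C2 * r\<^sup>2 * d\<^sup>2" by (simp add: power2_eq_square)
      also have "\<dots> \<le> 2 * K * C2 * r\<^sup>2 * ?w" using dw K_pos C2 by (intro mult_left_mono) auto
      finally show ?thesis .
    qed
    ultimately have "\<bar>?L\<bar> \<le> 12 * CG2 * exp (2 * \<beta>) * r\<^sup>2 * ?w + 2 * K * CR0 * r\<^sup>2 * ?w + 2 * (2 * K * C2 * r\<^sup>2 * ?w)"
      by linarith
    also have "\<dots> = CS3 * (r\<^sup>2 * ?w)" by (simp add: CS3_def algebra_simps)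
    \<comment> \<open>24 is the constant of \<open>corner_barrier\<close>, and \<open>1 / K\<close>
      the margin in the reaction term; their product serves all three summands of the
      barrier.\<close>
    also have "\<dots> \<le> A3 * (1 / (24 * K)) * (r\<^sup>2 * ?w)"
    proof (rule mult_right_mono)
      have "CS3 * (24 * K) \<le> A3" using CQ C1 by (simp add: A3_def)
      then show "CS3 \<le> A3 * (1 / (24 * K))" using K_pos by (simp add: field_simps)
    qed (use w in auto)
    also have "\<dots> = ?A * (1 / (24 * K) * d\<^sup>2 + 1 / (24 * K) * ?e t + ?e t * (1 / (24 * K) * (1 / (x\<^sup>2 + t))))"
      by (simp add: q_def algebra_simps)
    also have "\<dots> \<le> ?A * (b x t * d\<^sup>2 + (b x t - \<beta>) * ?e t + ?e t * (?Bt x t - ?Bxx x t + (b x t - \<beta>) * ?B x t))"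
    proof (intro mult_left_mono add_mono mult_right_mono)
      have "1 / (24 * K) \<le> 1 / K" using K_pos by (simp add: divide_simps)
      then show "1 / (24 * K) \<le> b x t" "1 / (24 * K) \<le> b x t - \<beta>"
        using b_ge[of x t] a t inv_K beta_pos eta_pos by auto
      have "1 / (24 * K) * (1 / (x\<^sup>2 + t)) = (1 / K) * (1 / (24 * (x\<^sup>2 + t)))" by simp
      also have "\<dots> \<le> 1 * (1 / (24 * (x\<^sup>2 + t)))"
        using K(1) s0 by (intro mult_right_mono) (auto simp: divide_le_eq_1)
      also have "\<dots> \<le> ?Bt x t - ?Bxx x t" using corner_barrier(4)[OF t, of x] by simp
      also have "\<dots> \<le> ?Bt x t - ?Bxx x t + (b x t - \<beta>) * ?B x t"
        using b_ge[of x t] a t eta_pos corner_barrier(5)[OF t, of x] by auto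
      finally show "1 / (24 * K) * (1 / (x\<^sup>2 + t)) \<le> ?Bt x t - ?Bxx x t + (b x t - \<beta>) * ?B x t" .
    qed (use A in auto)
    also have "\<dots> = ?A * (- \<beta> * ?e t + (- \<beta> * ?e t * ?B x t + ?e t * ?Bt x t)) - ?A * (?e t * ?Bxx x t)
        + b x t * (?A * (d\<^sup>2 + ?e t + ?e t * ?B x t))"
      by (simp only: algebra_simps)
    finally show "\<bar>?L\<bar> \<le> \<dots>" .
  next
    fix x t assume a: "0 \<le> x" "x \<le> X" "3 * r \<le> t" "t \<le> Th" "x = 0 \<or> x = X \<or> t = 3 * r"
    then have t: "0 < t" using assms by auto
    have low: "?A * wgt t \<le> ?A * (d\<^sup>2 + ?e t + ?e t * ?B x t)"
    proof (rule mult_left_mono)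
      have "0 \<le> ?e t * ?B x t" using corner_barrier(5)[OF t, of x] by (intro mult_nonneg_nonneg) auto
      then show "wgt t \<le> d\<^sup>2 + ?e t + ?e t * ?B x t" by (simp add: wgt_def)
    qed (rule A)
    show "\<bar>R x t - 2 * R x (t - r) + R x (t - 2 * r)\<bar> \<le> ?A * (d\<^sup>2 + ?e t + ?e t * ?B x t)"
    proof (cases "t = 3 * r")
      case True
      have "\<bar>R x t - 2 * R x (t - r) + R x (t - 2 * r)\<bar> \<le> 18 * C1 * exp (3 * \<beta>) * (r\<^sup>2 * wgt t)"
        using R_diff2_initial[of x r t] True a assms by (simp add: mult.assoc)
      also have "\<dots> \<le> A3 * (r\<^sup>2 * wgt t)"
        using A3 CQ K_pos C1 wgt_pos[of t] by (intro mult_right_mono) (auto simp: A3_def)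
      finally show ?thesis using low by (simp add: mult.assoc)
    next
      case False
      then have "\<bar>R x t - 2 * R x (t - r) + R x (t - 2 * r)\<bar> \<le> 2 * (CQ * wgt (t - 2 * r)) * r\<^sup>2"
        using a assms by (intro lateral_diff2) auto
      also have "\<dots> \<le> 2 * (CQ * (exp (2 * \<beta>) * wgt t)) * r\<^sup>2"
      proof (intro mult_left_mono mult_right_mono)
        have "wgt (t - 2 * r) \<le> exp (\<beta> * (2 * r)) * wgt t" using assms by (intro wgt_shift) auto
        also have "\<dots> \<le> exp (2 * \<beta>) * wgt t"
          using assms beta_pos wgt_pos[of t] by (intro mult_right_mono) (auto simp: mult_left_le)
        finally show "wgt (t - 2 * r) \<le> exp (2 * \<beta>) * wgt t" .
      qed (use CQ in auto)
      also have "\<dots> = 2 * CQ * exp (2 * \<beta>) * (r\<^sup>2 * wgt t)" by simp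
      also have "\<dots> \<le> A3 * (r\<^sup>2 * wgt t)"
        using A3 CQ K_pos C1 wgt_pos[of t] by (intro mult_right_mono) (auto simp: A3_def)
      finally show ?thesis using low by (simp add: mult.assoc)
    qed
  qed (use False assms X_ge in auto)
  also have "\<dots> \<le> ?A * (2 * wgt t)"
  proof -
    have t: "0 < t" using assms by auto
    have "?e t * ?B x t \<le> ?e t * 1" using corner_barrier(6)[OF t, of x] by (intro mult_left_mono) auto
    moreover have "0 \<le> d\<^sup>2" by simp
    moreover have "p \<le> e * 1 \<Longrightarrow> 0 \<le> D \<Longrightarrow> D + e + p \<le> 2 * (D + e)" for p e D :: real by simp
    ultimately have "d\<^sup>2 + ?e t + ?e t * ?B x t \<le> 2 * wgt t" unfolding wgt_def by blast
    then show ?thesis using A by (rule mult_left_mono)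
  qed
  also have "\<dots> = C3 * r\<^sup>2 * wgt t" by (simp add: C3_def)
  finally show ?thesis .
qed

end

subsection \<open>The scaled problem: space regularity and truncation errors\<close>

lemma left_quotient_limit:
  fixes g :: "real \<Rightarrow> real"
  assumes "(g has_real_derivative D) (at_left t)" "0 < k"
  shows "(\<lambda>n. (g t - g (t - k / 2 ^ n)) / (k / 2 ^ n)) \<longlonglongrightarrow> D"
proof -
  have "(\<lambda>n. t - k * (1 / 2) ^ n) \<longlonglongrightarrow> t - k * 0"
    by (intro tendsto_intros LIMSEQ_power_zero) auto
  then have "filterlim (\<lambda>n. t - k / 2 ^ n) (at_left t) sequentially"
    using assms(2) by (auto simp: filterlim_at power_one_over)
  moreover have "((\<lambda>s. (g s - g t) / (s - t)) \<longlongrightarrow> D) (at_left t)"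
    using assms(1) by (simp add: has_field_derivative_iff)
  ultimately have "(\<lambda>n. (g (t - k / 2 ^ n) - g t) / ((t - k / 2 ^ n) - t)) \<longlonglongrightarrow> D"
    by (rule filterlim_compose[rotated])
  moreover have "(g (t - k / 2 ^ n) - g t) / ((t - k / 2 ^ n) - t) = (g t - g (t - k / 2 ^ n)) / (k / 2 ^ n)" for n
    using minus_divide_divide[of "g t - g (t - k / 2 ^ n)" "k / 2 ^ n"] by simp
  ultimately show ?thesis by simp
qed

text \<open>Halving the step changes the backward quotient by a second difference divided by twice
  the new step, and these changes decay geometrically with ratio 1/2. First-order accuracy thus
  follows from second differences alone.\<close>

lemma left_difference_truncation:
  fixes g :: "real \<Rightarrow> real"
  assumes "(g has_real_derivative D) (at_left t)" "0 < k"
    and "\<And>r. 0 < r \<Longrightarrow> 2 * r \<le> k \<Longrightarrow> \<bar>g t - 2 * g (t - r) + g (t - 2 * r)\<bar> \<le> A * r\<^sup>2"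
  shows "\<bar>D - (g t - g (t - k)) / k\<bar> \<le> A * k"
proof -
  define s where "s n = (g t - g (t - k / 2 ^ n)) / (k / 2 ^ n)" for n :: nat
  have A: "0 \<le> A * (k / 4)"
  proof -
    have "0 \<le> A * (k / 2)\<^sup>2" using assms(3)[of "k / 2"] assms(2) by (intro order_trans[OF abs_ge_zero]) auto
    then show ?thesis using assms(2) by (simp add: zero_le_mult_iff)
  qed
  have "\<bar>s 0 - D\<bar> \<le> (A * (k / 4)) / (1 - 1 / 2)"
  proof (rule geometric_telescoping)
    fix n
    define h where "h = k / 2 ^ Suc n"
    have h: "0 < h" "k / 2 ^ n = 2 * h" "2 * h \<le> k"
      using assms(2) one_le_power[of "2::real" n] by (auto simp: h_def divide_le_eq)
    have "s n - s (Suc n) = - (g t - 2 * g (t - h) + g (t - 2 * h)) / (2 * h)"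
      unfolding s_def h(2) h_def[symmetric] using h(1) by (simp add: field_simps)
    then have "\<bar>s n - s (Suc n)\<bar> = \<bar>g t - 2 * g (t - h) + g (t - 2 * h)\<bar> / (2 * h)"
      using h(1) by (simp add: abs_divide)
    also have "\<dots> \<le> (A * h\<^sup>2) / (2 * h)"
      using assms(3)[of h] h by (intro divide_right_mono) auto
    also have "\<dots> = A * (k / 4) * (1 / 2) ^ n"
      using h(1) by (simp add: h_def power2_eq_square power_one_over field_simps)
    finally show "\<bar>s n - s (Suc n)\<bar> \<le> A * (k / 4) * (1 / 2) ^ n" .
    show "s \<longlonglongrightarrow> D" unfolding s_def by (rule left_quotient_limit[OF assms(1,2)])
  qed auto
  also have "\<dots> \<le> A * k" using A by simp
  finally show ?thesis by (simp add: s_def abs_minus_commute)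
qed

lemma nonuniform_second_difference_bound:
  fixes g :: "real \<Rightarrow> real"
  assumes "0 < h1" "0 < h2" "continuous_on {x - h1..x + h2} g"
    and d1: "\<And>s. x - h1 < s \<Longrightarrow> s < x + h2 \<Longrightarrow> (g has_real_derivative g1 s) (at s)"
    and d2: "\<And>s. x - h1 < s \<Longrightarrow> s < x + h2 \<Longrightarrow> (g1 has_real_derivative g2 s) (at s)"
    and b: "\<And>s. x - h1 < s \<Longrightarrow> s < x + h2 \<Longrightarrow> \<bar>g2 s\<bar> \<le> A"
  shows "\<bar>(g (x + h2) - g x) / h2 - (g x - g (x - h1)) / h1\<bar> \<le> A * (h1 + h2)"
proof -
  have A: "0 \<le> A" using b[of x] assms(1,2) by auto
  have mv: "\<exists>z. p < z \<and> z < q \<and> (g q - g p) / (q - p) = g1 z"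
    if pq: "p < q" "x - h1 \<le> p" "q \<le> x + h2" for p q
  proof -
    have "continuous_on {p..q} g" by (rule continuous_on_subset[OF assms(3)]) (use that in auto)
    moreover have "(g has_derivative (\<lambda>v. g1 s * v)) (at s)" if "p < s" "s < q" for s
      using d1[of s] that \<open>x - h1 \<le> p\<close> \<open>q \<le> x + h2\<close> by (simp add: has_field_derivative_def)
    ultimately obtain z where "p < z" "z < q" "g q - g p = g1 z * (q - p)"
      using mvt[OF pq(1), of g "\<lambda>s v. g1 s * v"] by blast
    then show ?thesis using that by (intro exI[of _ z]) auto
  qed
  obtain v where v: "x < v" "v < x + h2" "(g (x + h2) - g x) / h2 = g1 v"
    using mv[of x "x + h2"] assms by auto
  obtain u where u: "x - h1 < u" "u < x" "(g x - g (x - h1)) / h1 = g1 u"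
    using mv[of "x - h1" x] assms by auto
  have "\<bar>g1 v - g1 u\<bar> \<le> A * (v - u)"
    by (rule abs_diff_le_deriv[where g' = g2])
      (use u v b in \<open>auto intro!: continuous_on_deriv[where g' = g2] d2\<close>)
  also have "\<dots> \<le> A * (h1 + h2)" using u v A by (intro mult_left_mono) auto
  finally show ?thesis using u v by simp
qed

section \<open>Time derivative and second space derivative of the remainder\<close>

context scaled_problem
begin

lemma R_time_trunc:
  assumes "0 < x" "x < X" "0 < k" "k \<le> 1" "k \<le> t" "t \<le> Th"
  shows "\<bar>Rt x t - (R x t - R x (t - k)) / k\<bar> \<le> C3 * wgt t * k"
proof (rule left_difference_truncation)
  show "(R x has_real_derivative Rt x t) (at_left t)" using assms by (intro regD(2)[OF R_reg]) auto
  fix r assume "0 < r" "2 * r \<le> k"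
  then have "\<bar>R x t - 2 * R x (t - r) + R x (t - 2 * r)\<bar> \<le> C3 * r\<^sup>2 * wgt t"
    using assms by (intro R_diff2) auto
  then show "\<bar>R x t - 2 * R x (t - r) + R x (t - 2 * r)\<bar> \<le> C3 * wgt t * r\<^sup>2" by (simp add: mult_ac)
qed (use assms in auto)

definition C4 where "C4 = C2 * exp \<beta> + C3"

text \<open>The backward quotient with step \<open>min 1 t\<close> is bounded by
  \<open>R_diff1\<close>, its distance from the derivative by \<open>R_time_trunc\<close>.\<close>

lemma Rt_le:
  assumes "0 < x" "x < X" "0 < t" "t \<le> Th"
  shows "\<bar>Rt x t\<bar> \<le> C4 * wgt t"
proof -
  define k where "k = min 1 t"
  have k: "0 < k" "k \<le> 1" "k \<le> t" using assms by (auto simp: k_def)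
  have "\<bar>R x t - R x (t - k)\<bar> \<le> C2 * k * wgt (t - k)" using assms k by (intro R_diff1) auto
  then have "\<bar>(R x t - R x (t - k)) / k\<bar> \<le> C2 * wgt (t - k)" using k by (simp add: abs_divide field_simps)
  also have "\<dots> \<le> C2 * (exp \<beta> * wgt t)"
  proof (intro mult_left_mono C2)
    have "wgt (t - k) \<le> exp (\<beta> * k) * wgt t" using k by (intro wgt_shift) auto
    also have "\<dots> \<le> exp \<beta> * wgt t"
      using k beta_pos wgt_pos[of t] by (intro mult_right_mono) (auto simp: mult_left_le)
    finally show "wgt (t - k) \<le> exp \<beta> * wgt t" .
  qed
  finally have "\<bar>(R x t - R x (t - k)) / k\<bar> \<le> C2 * (exp \<beta> * wgt t)" .
  moreover have "C3 * wgt t * k \<le> C3 * wgt t * 1" using A3 k wgt_pos[of t] by (intro mult_left_mono) auto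
  ultimately have "\<bar>Rt x t\<bar> \<le> C2 * (exp \<beta> * wgt t) + C3 * wgt t"
    using R_time_trunc[OF assms(1,2) k assms(4)] by linarith
  then show ?thesis by (simp add: C4_def algebra_simps)
qed

lemma C4: "0 \<le> C4" using C2 A3 by (simp add: C4_def)

text \<open>The quotient over \<open>2 * k\<close> is the mean of the two quotients over
  \<open>k\<close>. Exchanging the three quotients for time derivatives costs 2, 2 and twice 4 times
  \<open>C3 * k\<close>. This makes \<open>Rt\<close> Lipschitz in time although no second time
  derivative is known to exist.\<close>

lemma Rt_diff:
  assumes "0 < x" "x < X" "0 < k" "k \<le> 1 / 2" "2 * k \<le> t" "t \<le> Th"
  shows "\<bar>Rt x t - Rt x (t - k)\<bar> \<le> 12 * C3 * k"
proof -
  let ?D1 = "(R x t - R x (t - k)) / k"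
  let ?D2 = "(R x t - R x (t - 2 * k)) / (2 * k)"
  let ?D3 = "(R x (t - k) - R x (t - k - k)) / k"
  have D: "2 * ?D2 = ?D1 + ?D3" using assms(3) by (simp add: field_simps)
  have w: "C3 * wgt s * j \<le> C3 * 2 * j" if "0 \<le> s" "0 < j" for s j
    using that A3 wgt_le[of s] by (intro mult_right_mono mult_left_mono) auto
  have "\<bar>Rt x t - ?D1\<bar> \<le> C3 * 2 * k"
    by (rule order_trans[OF R_time_trunc w]) (use assms in auto)
  moreover have "\<bar>Rt x t - ?D2\<bar> \<le> C3 * 2 * (2 * k)"
    by (rule order_trans[OF R_time_trunc w]) (use assms in auto)
  moreover have "\<bar>Rt x (t - k) - ?D3\<bar> \<le> C3 * 2 * k"
    by (rule order_trans[OF R_time_trunc w]) (use assms in auto)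
  ultimately show ?thesis using D by linarith
qed

definition C6 where "C6 = 12 * C3 + 2 * K * C2 + K * CR0 + 2 * CG1"

lemma C6: "0 \<le> C6" using A3 K_pos C2 CR0 CG by (simp add: C6_def)

lemma Rxx_diff:
  assumes "0 < x" "x < X" "0 < k" "k \<le> 1 / 2" "2 * k \<le> t" "t \<le> Th"
  shows "\<bar>Rxx x t - Rxx x (t - k)\<bar> \<le> C6 * k"
proof -
  have w: "wgt (t - k) \<le> 2" using assms by (intro wgt_le) auto
  have "\<bar>R x t - R x (t - k)\<bar> \<le> C2 * k * wgt (t - k)" using assms by (intro R_diff1) auto
  also have "\<dots> \<le> C2 * k * 2" using w C2 assms by (intro mult_left_mono) auto
  finally have "\<bar>b x t * (R x t - R x (t - k))\<bar> \<le> K * (C2 * k * 2)"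
    unfolding abs_mult using b_le[of x t] assms by (intro mult_mono) auto
  moreover have "\<bar>(b x t - b x (t - k)) * R x (t - k)\<bar> \<le> (K * d\<^sup>2 * k) * CR0"
    unfolding abs_mult using b_time(1)[of x k t] R_bound[of x "t - k"] assms K_pos by (intro mult_mono) auto
  moreover have "(K * d\<^sup>2 * k) * CR0 \<le> (K * 1 * k) * CR0"
    using d2 K_pos CR0 assms by (intro mult_right_mono mult_left_mono) auto
  moreover have "\<bar>G x t - G x (t - k)\<bar> \<le> CG1 * k * 2"
  proof -
    have "\<bar>G x t - G x (t - k)\<bar> \<le> CG1 * k * wgt (t - k)"
      by (rule time_diff1[where q' = "Gt x"]) (use assms CG G_t Gt_le in \<open>auto intro!: G_slice\<close>)
    also have "\<dots> \<le> CG1 * k * 2" using w CG assms by (intro mult_left_mono) auto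
    finally show ?thesis .
  qed
  moreover have "Rxx x t - Rxx x (t - k) = (Rt x t - Rt x (t - k)) + b x t * (R x t - R x (t - k))
      + (b x t - b x (t - k)) * R x (t - k) - (G x t - G x (t - k))"
    using R_eq[of x t] R_eq[of x "t - k"] assms by (simp add: algebra_simps)
  ultimately have "\<bar>Rxx x t - Rxx x (t - k)\<bar> \<le> 12 * C3 * k + K * (C2 * k * 2) + (K * 1 * k) * CR0 + CG1 * k * 2"
    using Rt_diff[OF assms] by linarith
  then show ?thesis by (simp add: C6_def algebra_simps)
qed

definition C5 where "C5 = 2 * C4 + K * CR0 + (K + K * KZ)"

lemma C5: "0 \<le> C5" using C4 K_pos CR0 KZ by (simp add: C5_def)

lemma Rxx_le:
  assumes "0 < x" "x < X" "0 < t" "t \<le> Th"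
  shows "\<bar>Rxx x t\<bar> \<le> C5"
proof -
  have "\<bar>Rt x t\<bar> \<le> C4 * 2"
    using Rt_le[OF assms] mult_left_mono[OF wgt_le[of t] C4] assms by linarith
  moreover have "\<bar>b x t * R x t\<bar> \<le> K * CR0"
    unfolding abs_mult using b_le[of x t] R_bound[of x t] assms K_pos by (intro mult_mono) auto
  moreover have "\<bar>G x t\<bar> \<le> K + K * KZ" using assms by (intro G_le) auto
  ultimately show ?thesis using R_eq[OF assms] unfolding C5_def by linarith
qed

definition C5x where "C5x = 9 * (CR0 + C5)"

lemma C5x: "0 \<le> C5x" using C5 CR0 by (simp add: C5x_def)

lemma Rx_le:
  assumes "0 < x" "x < X" "0 < t" "t \<le> Th"
  shows "\<bar>Rx x t\<bar> \<le> C5x"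
  unfolding C5x_def
proof (rule deriv_interpolation[where p = 0 and q = X and g = "\<lambda>x. R x t" and ?g1.0 = "\<lambda>x. Rx x t"
      and ?g2.0 = "\<lambda>x. Rxx x t"])
  fix s assume s: "0 < s" "s < X"
  show "((\<lambda>x. R x t) has_real_derivative Rx s t) (at s)" "((\<lambda>x. Rx x t) has_real_derivative Rxx s t) (at s)"
    using s assms by (auto intro!: regD(3)[OF R_reg] regD(4)[OF R_reg])
  show "\<bar>R s t\<bar> \<le> CR0 + C5" using R_bound[of s t] s assms C5 by auto
  show "\<bar>Rxx s t\<bar> \<le> CR0 + C5" using Rxx_le[of s t] s assms CR0 by auto
qed (use assms X_ge in auto)

text \<open>Nothing is known about derivatives of \<open>Rt\<close> in space. But the backward
  quotients \<open>z n / k n\<close> tend to \<open>Rt\<close> and do have two space derivatives,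
  the second bounded by \<open>C6\<close> through \<open>Rxx_diff\<close>; their second differences
  and Lipschitz bounds are uniform in \<open>n\<close> and pass to the limit.\<close>

lemma Rt_space:
  assumes "0 < t" "t \<le> Th"
  shows "0 < x - r \<Longrightarrow> x + r < X \<Longrightarrow> 0 < r \<Longrightarrow>
      \<bar>Rt (x + r) t + Rt (x - r) t - 2 * Rt x t\<bar> \<le> 2 * C6 * r\<^sup>2"
    and "0 < x \<Longrightarrow> x \<le> x' \<Longrightarrow> x' < X \<Longrightarrow> \<bar>Rt x' t - Rt x t\<bar> \<le> 9 * (2 * C2 + C6) * (x' - x)"
proof -
  define k0 where "k0 = min (1 / 2) (t / 2)"
  define k where "k n = k0 / 2 ^ n" for n :: nat
  have k0: "0 < k0" using assms by (simp add: k0_def)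
  have k: "0 < k n" "k n \<le> 1 / 2" "2 * k n \<le> t" for n
  proof -
    have "k n \<le> k0" using k0 one_le_power[of "2::real" n] by (simp add: k_def divide_le_eq)
    then show "k n \<le> 1 / 2" "2 * k n \<le> t" unfolding k0_def by auto
  qed (use k0 in \<open>auto simp: k_def\<close>)
  define z where "z n x = R x t - R x (t - k n)" for n x
  have zd: "((\<lambda>x. z n x) has_real_derivative Rx s t - Rx s (t - k n)) (at s)"
    "((\<lambda>s. Rx s t - Rx s (t - k n)) has_real_derivative Rxx s t - Rxx s (t - k n)) (at s)"
    if "0 < s" "s < X" for n s
    unfolding z_def using that assms k[of n]
    by (auto intro!: DERIV_diff regD(3)[OF R_reg] regD(4)[OF R_reg])
  have zc: "continuous_on {p..q} (z n)" if "0 \<le> p" "q \<le> X" for n p q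
    unfolding z_def[abs_def] using that assms k[of n] by (intro continuous_on_diff R_slices(2)) auto
  have z2: "\<bar>Rxx s t - Rxx s (t - k n)\<bar> \<le> C6 * k n" if "0 < s" "s < X" for n s
    using that assms k[of n] by (intro Rxx_diff) auto
  have z0: "\<bar>z n s\<bar> \<le> 2 * C2 * k n" if "0 < s" "s < X" for n s
  proof -
    have "\<bar>R s t - R s (t - k n)\<bar> \<le> C2 * k n * wgt (t - k n)"
      using that assms k[of n] by (intro R_diff1) auto
    also have "\<dots> \<le> C2 * k n * 2" using that assms k[of n] C2 by (intro mult_left_mono wgt_le) auto
    finally show ?thesis by (simp add: z_def mult_ac)
  qed
  have lim: "(\<lambda>n. z n s / k n) \<longlonglongrightarrow> Rt s t" if "0 < s" "s < X" for s
    unfolding z_def k_def using that assms k0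
    by (intro left_quotient_limit regD(2)[OF R_reg]) auto
  {
    assume r: "0 < x - r" "x + r < X" "0 < r"
    have "\<bar>z n (x + r) / k n + z n (x - r) / k n - 2 * (z n x / k n)\<bar> \<le> 2 * C6 * r\<^sup>2" for n
    proof -
      have "\<bar>z n (x + r) - 2 * z n x + z n (x - r)\<bar> \<le> 2 * (C6 * k n) * r\<^sup>2"
        by (rule second_difference_bound[OF _ zc _ zd z2]) (use r k[of n] C6 in auto)
      then have "\<bar>z n (x + r) - 2 * z n x + z n (x - r)\<bar> / k n \<le> (2 * (C6 * k n) * r\<^sup>2) / k n"
        using k[of n] by (intro divide_right_mono) auto
      moreover have "\<bar>z n (x + r) - 2 * z n x + z n (x - r)\<bar> / k n
          = \<bar>z n (x + r) / k n + z n (x - r) / k n - 2 * (z n x / k n)\<bar>"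
      proof -
        have "z n (x + r) / k n + z n (x - r) / k n - 2 * (z n x / k n)
            = (z n (x + r) - 2 * z n x + z n (x - r)) / k n"
          by (simp add: diff_divide_distrib add_divide_distrib)
        then show ?thesis using k[of n] by (simp add: abs_divide)
      qed
      ultimately show ?thesis using k[of n] by simp
    qed
    moreover have "(\<lambda>n. \<bar>z n (x + r) / k n + z n (x - r) / k n - 2 * (z n x / k n)\<bar>)
        \<longlonglongrightarrow> \<bar>Rt (x + r) t + Rt (x - r) t - 2 * Rt x t\<bar>"
      using r by (intro tendsto_intros lim) auto
    ultimately show "\<bar>Rt (x + r) t + Rt (x - r) t - 2 * Rt x t\<bar> \<le> 2 * C6 * r\<^sup>2"
      by (intro LIMSEQ_le_const2) auto
  }
  {
    assume x: "0 < x" "x \<le> x'" "x' < X"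
    have "\<bar>z n x' / k n - z n x / k n\<bar> \<le> 9 * (2 * C2 + C6) * (x' - x)" for n
    proof -
      \<comment> \<open>The first space derivative of the time difference comes from interpolation
        between its values and its second derivative, both of order \<open>k n\<close>.\<close>
      have zx: "\<bar>Rx s t - Rx s (t - k n)\<bar> \<le> 9 * ((2 * C2 + C6) * k n)" if "0 < s" "s < X" for s
        by (rule deriv_interpolation[OF _ _ _ zd]) (use that X_ge k[of n] C2 C6
          in \<open>auto simp: distrib_right intro: order_trans[OF z0] order_trans[OF z2]\<close>)
      have "\<bar>z n x' - z n x\<bar> \<le> 9 * ((2 * C2 + C6) * k n) * (x' - x)"
        by (rule abs_diff_le_deriv[OF _ zc zd(1) zx]) (use x in auto)
      then have "\<bar>z n x' - z n x\<bar> / k n \<le> 9 * ((2 * C2 + C6) * k n) * (x' - x) / k n"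
        using k[of n] by (intro divide_right_mono) auto
      moreover have "\<bar>z n x' - z n x\<bar> / k n = \<bar>z n x' / k n - z n x / k n\<bar>"
        using k[of n] by (simp add: diff_divide_distrib[symmetric] abs_divide)
      moreover have "9 * ((2 * C2 + C6) * k n) * (x' - x) / k n = 9 * (2 * C2 + C6) * (x' - x)"
        using k[of n] by simp
      ultimately show ?thesis by (simp only:)
    qed
    moreover have "(\<lambda>n. \<bar>z n x' / k n - z n x / k n\<bar>) \<longlonglongrightarrow> \<bar>Rt x' t - Rt x t\<bar>"
      using x by (intro tendsto_intros lim) auto
    ultimately show "\<bar>Rt x' t - Rt x t\<bar> \<le> 9 * (2 * C2 + C6) * (x' - x)"
      by (intro LIMSEQ_le_const2) auto
  }
qed

text \<open>The lower order part \<open>b R - G\<close> of \<open>R\<^sub>x\<^sub>x\<close> has two bounded space derivatives.\<close>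

definition H where "H x t = b x t * R x t - G x t"
definition Hx where "Hx x t = (bX 1 x t * R x t + b x t * Rx x t)
  - (fX 1 x t - (bX 1 x t * Z 0 x t + (b x t - c) * Z 1 x t))"
definition Hxx where "Hxx x t = (bX 2 x t * R x t + 2 * (bX 1 x t * Rx x t) + b x t * Rxx x t)
  - (fX 2 x t - (bX 2 x t * Z 0 x t + 2 * (bX 1 x t * Z 1 x t) + (b x t - c) * Z 2 x t))"
definition CH where "CH = K * CR0 + 2 * (K * C5x) + K * C5 + K + K * KZ + 2 * (K * KZ * (3 + K)) + 2 * K * KZ"

lemma CH: "0 \<le> CH" using K_pos CR0 C5x C5 KZ by (simp add: CH_def)

lemma H_x:
  assumes "0 < x" "x < X" "0 < t" "t \<le> Th"
  shows "((\<lambda>x. H x t) has_real_derivative Hx x t) (at x)"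
    "((\<lambda>x. Hx x t) has_real_derivative Hxx x t) (at x)"
proof -
  have b: "((\<lambda>x. b x t) has_real_derivative bX (Suc 0) x t) (at x)" "((\<lambda>x. bX (Suc 0) x t) has_real_derivative bX 2 x t) (at x)"
    "((\<lambda>x. f x t) has_real_derivative fX (Suc 0) x t) (at x)" "((\<lambda>x. fX (Suc 0) x t) has_real_derivative fX 2 x t) (at x)"
    using bX_x_at[of 0 x t] bX_x_at[of 1 x t] fX_x_at[of 0 x t] fX_x_at[of 1 x t] assms
    by (auto simp: bX0 fX0 numeral_2_eq_2)
  have r: "((\<lambda>x. R x t) has_real_derivative Rx x t) (at x)" "((\<lambda>x. Rx x t) has_real_derivative Rxx x t) (at x)"
    using assms by (auto intro!: regD(3)[OF R_reg] regD(4)[OF R_reg])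
  have z: "((\<lambda>x. Z 0 x t) has_real_derivative Z (Suc 0) x t) (at x)" "((\<lambda>x. Z (Suc 0) x t) has_real_derivative Z 2 x t) (at x)"
    unfolding Z_def using W_x[of t 0 c a0 a1 x] W_x[of t 1 c a0 a1 x] assms by (auto simp: numeral_2_eq_2)
  show "((\<lambda>x. H x t) has_real_derivative Hx x t) (at x)" "((\<lambda>x. Hx x t) has_real_derivative Hxx x t) (at x)"
    unfolding H_def G_def Hx_def Hxx_def
    by (auto intro!: derivative_eq_intros b r z simp: algebra_simps)
qed

text \<open>Delicate are only the terms with derivatives of \<open>Z\<close>: \<open>Z 1\<close>
  grows like \<open>1 / sqrt (x\<^sup>2 + t)\<close> and \<open>Z 2\<close> like
  \<open>1 / (x\<^sup>2 + t)\<close>, matched by the vanishing of \<open>bX 1\<close> and of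
  \<open>b - c\<close> at the corner. The growth in \<open>t\<close> of the bound
  \<open>bX1_corner\<close> is paid for by \<open>exp (- \<beta> * t)\<close>.\<close>

lemma H_le:
  assumes "0 < x" "x < X" "0 < t" "t \<le> Th"
  shows "\<bar>H x t\<bar> \<le> CH" "\<bar>Hxx x t\<bar> \<le> CH"
proof -
  have a: "0 \<le> x" "x \<le> X" "0 \<le> t" using assms by auto
  have Kd: "K * d ^ n \<le> K" for n using K_pos dn[of n] by (simp add: mult_left_le)
  have B: "\<bar>bX n x t\<bar> \<le> K" "\<bar>fX n x t\<bar> \<le> K" if "n \<le> 4" for n
    using bX_le[of n x t] fX_le[of n x t] Kd[of n] that assms by auto
  have m: "\<bar>u * v\<bar> \<le> K * A" if "\<bar>u\<bar> \<le> K" "\<bar>v\<bar> \<le> A" for u v A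
    unfolding abs_mult using that K_pos by (intro mult_mono) auto
  define e where "e = exp (- \<beta> * t)"
  define s where "s = x\<^sup>2 + t"
  have s: "0 < s" using assms by (auto simp: s_def intro: add_nonneg_pos)
  have e: "0 \<le> e" "e \<le> 1" using assms beta_pos by (auto simp: e_def)
  have te: "e * t \<le> K"
  proof -
    have "exp (- (\<beta> * t)) * t \<le> 1 / (\<beta> * t) * t"
      using beta_pos assms by (intro mult_right_mono exp_neg_le_inverse) auto
    also have "\<dots> \<le> K" using K assms beta_pos by (simp add: field_simps)
    finally show ?thesis by (simp add: e_def)
  qed
  have bR: "\<bar>b x t * R x t\<bar> \<le> K * CR0" by (rule m) (use b_le R_bound a assms in auto)
  have g: "\<bar>G x t\<bar> \<le> K + K * KZ" using a assms by (intro G_le) auto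
  show "\<bar>H x t\<bar> \<le> CH"
  proof -
    have "0 \<le> K * C5x" "0 \<le> K * C5" "0 \<le> K * KZ" "0 \<le> K * KZ * (3 + K)" using K_pos C5x C5 KZ by auto
    then show ?thesis using bR g unfolding H_def CH_def by linarith
  qed
  have 1: "\<bar>bX 2 x t * R x t\<bar> \<le> K * CR0" by (rule m) (use B R_bound a assms in auto)
  have 2: "\<bar>bX 1 x t * Rx x t\<bar> \<le> K * C5x" by (rule m) (use B Rx_le assms in auto)
  have 3: "\<bar>b x t * Rxx x t\<bar> \<le> K * C5" by (rule m) (use b_le Rxx_le a assms in auto)
  have "KZ * e \<le> KZ" using KZ e by (simp add: mult_left_le)
  then have z0: "\<bar>Z 0 x t\<bar> \<le> KZ" using Z_le[of x t] a unfolding e_def by linarith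
  have 4: "\<bar>bX 2 x t * Z 0 x t\<bar> \<le> K * KZ" by (rule m) (use B z0 in auto)
  have 5: "\<bar>bX 1 x t * Z 1 x t\<bar> \<le> K * KZ * (3 + K)"
  proof -
    have "\<bar>Z 1 x t\<bar> \<le> KZ * (e * (1 + 1 / sqrt s))"
      unfolding Z_def e_def s_def
      by (rule order_trans[OF W1[OF a(1) assms(3), unfolded mult.assoc[of _ "exp (- \<beta> * t)"]]
            mult_right_mono[OF KZ_ge(1)]])
        (use assms in \<open>auto intro!: mult_nonneg_nonneg add_nonneg_nonneg\<close>)
    then have "\<bar>bX 1 x t * Z 1 x t\<bar> \<le> \<bar>bX 1 x t\<bar> * (KZ * (e * (1 + 1 / sqrt s)))"
      unfolding abs_mult by (intro mult_left_mono) auto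
    also have "\<dots> = KZ * (e * \<bar>bX 1 x t\<bar> + e * (\<bar>bX 1 x t\<bar> / sqrt s))" by (simp add: algebra_simps)
    also have "\<dots> \<le> KZ * (1 * K + K * (2 + K))"
    proof (rule mult_left_mono[OF add_mono])
      show "e * \<bar>bX 1 x t\<bar> \<le> 1 * K" using B[of 1] e by (intro mult_mono) auto
      have "x \<le> sqrt s" using assms by (intro real_le_rsqrt) (auto simp: s_def)
      have "t \<le> (1 + t) * sqrt s"
      proof -
        have "sqrt t \<le> 1 + t" using assms by (intro real_le_lsqrt) (auto simp: power2_eq_square algebra_simps)
        then have "sqrt t * sqrt t \<le> (1 + t) * sqrt s" using assms s by (intro mult_mono) (auto simp: s_def)
        then show ?thesis using assms by simp
      qed
      then have "(x + t) / sqrt s \<le> 2 + t" using \<open>x \<le> sqrt s\<close> s by (simp add: pos_divide_le_eq distrib_right)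
      have "\<bar>bX 1 x t\<bar> / sqrt s \<le> (K * (x + t)) / sqrt s"
        using bX1_corner[of x t] a assms s by (intro divide_right_mono) auto
      also have "\<dots> = K * ((x + t) / sqrt s)" by simp
      also have "\<dots> \<le> K * (2 + t)" using \<open>(x + t) / sqrt s \<le> 2 + t\<close> K_pos by (intro mult_left_mono) auto
      finally have "e * (\<bar>bX 1 x t\<bar> / sqrt s) \<le> e * (K * (2 + t))" using e by (intro mult_left_mono) auto
      also have "\<dots> = K * (2 * e + e * t)" by (simp add: algebra_simps)
      also have "\<dots> \<le> K * (2 + K)" using te e K_pos by (intro mult_left_mono) auto
      finally show "e * (\<bar>bX 1 x t\<bar> / sqrt s) \<le> K * (2 + K)" .
    qed (rule KZ)
    also have "\<dots> = K * KZ * (3 + K)" by (simp add: algebra_simps)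
    finally show ?thesis .
  qed
  have 6: "\<bar>(b x t - c) * Z 2 x t\<bar> \<le> 2 * K * KZ"
  proof -
    have "\<bar>b x t - c\<bar> * \<bar>Z 2 x t\<bar> \<le> \<bar>b x t - c\<bar> * (KZ * (e * (1 + 1 / s)))"
      using Z2_le[of x t] a assms by (intro mult_left_mono) (auto simp: e_def s_def)
    also have "\<dots> = (\<bar>b x t - c\<bar> * (1 + 1 / s)) * (KZ * e)" by (simp only: mult_ac)
    also have "\<dots> \<le> (2 * K) * KZ"
      by (rule mult_mono[OF singular_weight_bounds(1)[OF s bc_le[OF a assms(4)] b_corner[OF a assms(4), folded s_def]]])
        (use e KZ K_pos in \<open>auto simp: mult_left_le\<close>)
    finally show ?thesis by (simp add: abs_mult)
  qed
  show "\<bar>Hxx x t\<bar> \<le> CH"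
    using 1 2 3 4 5 6 B(2)[of 2] unfolding Hxx_def CH_def by linarith
qed

definition C9 where "C9 = 18 * C2 + 9 * C6 + 9 * CH"

lemma C9: "0 \<le> C9" using C2 C6 CH by (simp add: C9_def)

text \<open>The equation reads \<open>Rxx = Rt + H\<close>. The first summand is the matter of
  \<open>Rt_space\<close>; the second has bounded derivatives, the first of them by
  interpolation.\<close>

lemma Rxx_space:
  assumes "0 < t" "t \<le> Th"
  shows "0 < x - r \<Longrightarrow> x + r < X \<Longrightarrow> 0 < r \<Longrightarrow>
      \<bar>Rxx (x + r) t + Rxx (x - r) t - 2 * Rxx x t\<bar> \<le> C9 * r\<^sup>2"
    and "0 < x \<Longrightarrow> x \<le> x' \<Longrightarrow> x' < X \<Longrightarrow> \<bar>Rxx x' t - Rxx x t\<bar> \<le> C9 * (x' - x)"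
proof -
  have eq: "Rxx x t = Rt x t + H x t" if "0 < x" "x < X" for x
    using R_eq[OF that assms] by (simp add: H_def)
  have Hc: "continuous_on {p..q} (\<lambda>x. H x t)" if "0 < p" "q < X" for p q
    using that assms by (intro continuous_on_deriv[where g' = "\<lambda>x. Hx x t"] H_x) auto
  have Hx_le: "\<bar>Hx x t\<bar> \<le> 9 * CH" if "0 < x" "x < X" for x
    by (rule deriv_interpolation[where p = 0 and q = X and g = "\<lambda>x. H x t" and ?g1.0 = "\<lambda>x. Hx x t"
          and ?g2.0 = "\<lambda>x. Hxx x t"])
      (use that assms X_ge H_x H_le in auto)
  {
    assume r: "0 < x - r" "x + r < X" "0 < r"
    have "\<bar>H (x + r) t - 2 * H x t + H (x - r) t\<bar> \<le> 2 * CH * r\<^sup>2"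
      by (rule second_difference_bound[where ?g1.0 = "\<lambda>x. Hx x t" and ?g2.0 = "\<lambda>x. Hxx x t"])
        (use r assms CH H_x H_le in \<open>auto intro!: Hc\<close>)
    then have "\<bar>Rxx (x + r) t + Rxx (x - r) t - 2 * Rxx x t\<bar> \<le> 2 * C6 * r\<^sup>2 + 2 * CH * r\<^sup>2"
      using Rt_space(1)[OF assms r] eq[of x] eq[of "x + r"] eq[of "x - r"] r by simp
    also have "\<dots> = (2 * C6 + 2 * CH) * r\<^sup>2" by (simp add: algebra_simps)
    also have "\<dots> \<le> C9 * r\<^sup>2" using C2 C6 CH by (intro mult_right_mono) (auto simp: C9_def)
    finally show "\<bar>Rxx (x + r) t + Rxx (x - r) t - 2 * Rxx x t\<bar> \<le> C9 * r\<^sup>2" .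
  }
  {
    assume x: "0 < x" "x \<le> x'" "x' < X"
    have "\<bar>H x' t - H x t\<bar> \<le> 9 * CH * (x' - x)"
      by (rule abs_diff_le_deriv[where g' = "\<lambda>x. Hx x t"])
        (use x assms H_x Hx_le in \<open>auto intro!: Hc\<close>)
    then have "\<bar>Rxx x' t - Rxx x t\<bar> \<le> 9 * (2 * C2 + C6) * (x' - x) + 9 * CH * (x' - x)"
      using Rt_space(2)[OF assms x] eq[of x] eq[of x'] x by simp
    also have "\<dots> = C9 * (x' - x)" by (simp add: C9_def algebra_simps)
    finally show "\<bar>Rxx x' t - Rxx x t\<bar> \<le> C9 * (x' - x)" .
  }
qed

lemma R_space_trunc:
  assumes "0 < t" "t \<le> Th" "0 < h" "0 \<le> x - h" "x + h \<le> X"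
  shows "\<bar>R (x + h) t - 2 * R x t + R (x - h) t - h\<^sup>2 * Rxx x t\<bar> \<le> C9 * h ^ 4"
proof -
  have "\<bar>R (x + h) t - 2 * R x t + R (x - h) t - h\<^sup>2 * Rxx x t\<bar> \<le> C9 * h ^ (2 + 2)"
  proof (rule second_difference_truncation[where g = "\<lambda>x. R x t" and ?g1.0 = "\<lambda>x. Rx x t" and ?g2.0 = "\<lambda>x. Rxx x t"])
    fix s assume s: "x - h < s" "s < x + h"
    show "((\<lambda>x. R x t) has_real_derivative Rx s t) (at s)" "((\<lambda>x. Rx x t) has_real_derivative Rxx s t) (at s)"
      using s assms by (auto intro!: regD(3)[OF R_reg] regD(4)[OF R_reg])
  next
    fix s assume s: "0 < s" "s < h"
    show "\<bar>Rxx (x + s) t + Rxx (x - s) t - 2 * Rxx x t\<bar> \<le> C9 * s\<^sup>2"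
      using s assms by (intro Rxx_space(1)) auto
  qed (use assms C9 R_slices(2) in auto)
  then show ?thesis by simp
qed

definition C10 where "C10 = CR0 + C5x + 2 * C5 + 2 * C9"

lemma C10: "0 \<le> C10" using CR0 C5x C5 C9 by (simp add: C10_def)

text \<open>Only two space derivatives are available. Orders three and four are therefore read as
  second differences of a first or second difference of \<open>R\<close>, whose second derivative is
  a first or second difference of \<open>Rxx\<close> and is bounded by
  \<open>Rxx_space\<close>.\<close>

lemma R_fd:
  assumes t: "0 < t" "t \<le> Th" and "0 < r" "0 < x" "x + real m * r < X" "m \<le> 4"
  shows "\<bar>fd r m (\<lambda>x. R x t) x\<bar> \<le> C10 * r ^ m"
proof -
  have d1: "((\<lambda>x. R x t) has_real_derivative Rx s t) (at s)" and d2: "((\<lambda>x. Rx x t) has_real_derivative Rxx s t) (at s)"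
    if "0 < s" "s < X" for s
    using that t by (auto intro!: regD(3)[OF R_reg] regD(4)[OF R_reg])
  have c: "continuous_on {p..q} (\<lambda>x. R x t)" if "0 < p" "q < X" for p q
    using that t by (intro R_slices(2)) auto
  consider "m = 0" | "m = 1" | "m = 2" | "m = 3" | "m = 4" using assms(6) by linarith
  then show ?thesis
  proof cases
    case 1
    then show ?thesis using R_bound[of x t] assms C5x C5 C9 by (auto simp: C10_def)
  next
    case 2
    have "\<bar>R (x + r) t - R x t\<bar> \<le> C5x * ((x + r) - x)"
      by (rule abs_diff_le_deriv[where g' = "\<lambda>x. Rx x t"]) (use 2 assms d1 Rx_le in \<open>auto intro!: c\<close>)
    also have "\<dots> \<le> C10 * r" using assms CR0 C5 C9 by (auto simp: C10_def intro!: mult_right_mono)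
    finally show ?thesis using 2 by simp
  next
    case 3
    have "\<bar>R (x + r + r) t - 2 * R (x + r) t + R (x + r - r) t\<bar> \<le> 2 * C5 * r\<^sup>2"
      by (rule second_difference_bound[where ?g1.0 = "\<lambda>x. Rx x t" and ?g2.0 = "\<lambda>x. Rxx x t"])
        (use 3 assms d1 d2 Rxx_le C5 in \<open>auto intro!: c\<close>)
    also have "\<dots> \<le> C10 * r\<^sup>2" using CR0 C5x C9 by (auto simp: C10_def intro!: mult_right_mono)
    finally show ?thesis using 3 by (simp add: numeral_2_eq_2 algebra_simps)
  next
    case 4
    let ?g = "\<lambda>x. R (x + r) t - R x t"
    have "\<bar>?g (x + r + r) - 2 * ?g (x + r) + ?g (x + r - r)\<bar> \<le> 2 * (C9 * r) * r\<^sup>2"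
    proof (rule second_difference_bound[where ?g1.0 = "\<lambda>x. Rx (x + r) t - Rx x t" and ?g2.0 = "\<lambda>x. Rxx (x + r) t - Rxx x t"])
      have "continuous_on {x + r - r..x + r + r} (\<lambda>x. R (x + r) t)"
        by (rule continuous_on_compose2[OF c[of "x + r" "x + 3 * r"]]) (use 4 assms in \<open>auto intro!: continuous_intros\<close>)
      then show "continuous_on {x + r - r..x + r + r} ?g"
        by (intro continuous_on_diff c) (use 4 assms in auto)
      fix s assume s: "x + r - r < s" "s < x + r + r"
      have s': "0 < s" "s + r < X" using s 4 assms by auto
      show "(?g has_real_derivative Rx (s + r) t - Rx s t) (at s)"
        "((\<lambda>x. Rx (x + r) t - Rx x t) has_real_derivative Rxx (s + r) t - Rxx s t) (at s)"
        using s' assms d1[of "s + r"] d2[of "s + r"] by (auto intro!: DERIV_diff d1 d2 simp: DERIV_shift)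
      show "\<bar>Rxx (s + r) t - Rxx s t\<bar> \<le> C9 * r" using Rxx_space(2)[OF t, of s "s + r"] s' assms by auto
    qed (use assms C9 in auto)
    also have "\<dots> = 2 * C9 * r ^ 3" by (simp add: power2_eq_square power3_eq_cube)
    also have "\<dots> \<le> C10 * r ^ 3" using CR0 C5x C5 assms by (auto simp: C10_def intro!: mult_right_mono)
    finally show ?thesis using 4 by (simp add: numeral_3_eq_3 algebra_simps)
  next
    case 5
    let ?g = "\<lambda>x. R (x + r) t - 2 * R x t + R (x - r) t"
    have "\<bar>?g (x + 2 * r + r) - 2 * ?g (x + 2 * r) + ?g (x + 2 * r - r)\<bar> \<le> 2 * (C9 * r\<^sup>2) * r\<^sup>2"
    proof (rule second_difference_bound[where ?g1.0 = "\<lambda>x. Rx (x + r) t - 2 * Rx x t + Rx (x - r) t"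
          and ?g2.0 = "\<lambda>x. Rxx (x + r) t - 2 * Rxx x t + Rxx (x - r) t"])
      have "continuous_on {x + 2 * r - r..x + 2 * r + r} (\<lambda>x. R (x + r) t)"
        by (rule continuous_on_compose2[OF c[of "x + r" "x + 4 * r"]]) (use 5 assms in \<open>auto intro!: continuous_intros\<close>)
      moreover have "continuous_on {x + 2 * r - r..x + 2 * r + r} (\<lambda>x. R (x - r) t)"
        by (rule continuous_on_compose2[OF c[of x "x + 2 * r"]]) (use 5 assms in \<open>auto intro!: continuous_intros\<close>)
      ultimately show "continuous_on {x + 2 * r - r..x + 2 * r + r} ?g"
        by (intro continuous_on_diff continuous_on_add continuous_on_mult continuous_on_const c) (use 5 assms in auto)
      fix s assume s: "x + 2 * r - r < s" "s < x + 2 * r + r"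
      have s': "0 < s - r" "s + r < X" using s 5 assms by auto
      have sh: "((\<lambda>x. R (x - r) t) has_real_derivative Rx (s - r) t) (at s)"
        "((\<lambda>x. Rx (x - r) t) has_real_derivative Rxx (s - r) t) (at s)"
        using d1[of "s - r"] d2[of "s - r"] s' assms DERIV_shift[of "\<lambda>x. R x t" _ s "- r"]
          DERIV_shift[of "\<lambda>x. Rx x t" _ s "- r"] by auto
      have sh': "((\<lambda>x. R (x + r) t) has_real_derivative Rx (s + r) t) (at s)"
        "((\<lambda>x. Rx (x + r) t) has_real_derivative Rxx (s + r) t) (at s)"
        using d1[of "s + r"] d2[of "s + r"] s' assms by (auto simp: DERIV_shift)
      show "(?g has_real_derivative Rx (s + r) t - 2 * Rx s t + Rx (s - r) t) (at s)"
        "((\<lambda>x. Rx (x + r) t - 2 * Rx x t + Rx (x - r) t) has_real_derivative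
          Rxx (s + r) t - 2 * Rxx s t + Rxx (s - r) t) (at s)"
        using s' assms by (intro DERIV_add DERIV_diff DERIV_cmult sh sh' d1 d2; simp)+
      show "\<bar>Rxx (s + r) t - 2 * Rxx s t + Rxx (s - r) t\<bar> \<le> C9 * r\<^sup>2"
        using Rxx_space(1)[OF t, of s r] s' assms by (simp add: algebra_simps)
    qed (use assms C9 in auto)
    also have "\<dots> = 2 * C9 * r ^ 4" by (simp add: power2_eq_square power4_eq_xxxx)
    also have "\<dots> \<le> C10 * r ^ 4" using CR0 C5x C5 assms by (auto simp: C10_def intro!: mult_right_mono)
    finally show ?thesis using 5 by (simp add: numeral_eq_Suc algebra_simps)
  qed
qed

end

section \<open>The explicit corner function and the truncation errors on uniform stencils\<close>

context scaled_problem
begin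

definition S where "S n x t = W c 0 a1 n x t"
definition St where "St x t = S 2 x t - c * S 0 x t"
definition Stt where "Stt x t = (S 4 x t - c * S 2 x t) - c * St x t"
definition KS where "KS = CW * K"
definition KS4 where "KS4 = KS * (1 + 2 * K + K\<^sup>2)"
definition CSt where "CSt = exp \<beta> * (2 * KS4 + 6 * (KS * (1 + K)))"

lemma KS: "0 \<le> KS" "0 \<le> KS4" "0 \<le> CSt" "CW * \<bar>a1\<bar> \<le> KS"
  using CW K_pos a_le by (auto simp: KS_def KS4_def CSt_def intro: mult_left_mono)

lemma S_le:
  assumes "0 \<le> x" "0 < t"
  shows "\<bar>S 0 x t\<bar> \<le> KS * exp (- \<beta> * t)" "\<bar>S 2 x t\<bar> \<le> KS * exp (- \<beta> * t)"
    "\<bar>S 4 x t\<bar> \<le> KS * exp (- \<beta> * t) / (x\<^sup>2 + t)"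
proof -
  have m: "CW * \<bar>a1\<bar> * exp (- \<beta> * t) \<le> KS * exp (- \<beta> * t)" using KS by (intro mult_right_mono) auto
  show "\<bar>S 0 x t\<bar> \<le> KS * exp (- \<beta> * t)" 
  proof -
    have "\<bar>W c 0 a1 0 x t\<bar> \<le> CW * \<bar>a1\<bar> * exp (- \<beta> * t)" using W0[of x t 0 a1] assms by simp
    then show ?thesis using m unfolding S_def by (rule order_trans)
  qed
  show "\<bar>S 2 x t\<bar> \<le> KS * exp (- \<beta> * t)" 
    unfolding S_def by (rule order_trans[OF W2(2)[OF assms] m])
  show "\<bar>S 4 x t\<bar> \<le> KS * exp (- \<beta> * t) / (x\<^sup>2 + t)"
    unfolding S_def by (rule order_trans[OF W4(2)[OF assms] divide_right_mono[OF m]]) (use assms in simp)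
qed

lemma S_t:
  assumes "0 < t"
  shows "(S 0 x has_real_derivative St x t) (at t)" "(St x has_real_derivative Stt x t) (at t)"
  using W_t[OF assms, of c 0 a1 x] unfolding S_def St_def Stt_def
  by (auto intro!: derivative_eq_intros)

lemma S_x: "0 < t \<Longrightarrow> n < 4 \<Longrightarrow> ((\<lambda>x. S n x t) has_real_derivative S (Suc n) x t) (at x)"
  unfolding S_def by (rule W_x)

lemma S_reg: "reg (S 0) St (S 1) (S 2) 0 T 0 T'"
  using W_reg[of 0 0 a1 T T'] unfolding S_def[abs_def] St_def[abs_def] by auto

lemma S_slices:
  "0 \<le> x \<Longrightarrow> 0 \<le> p \<Longrightarrow> continuous_on {p..q} (S 0 x)"
  "0 \<le> t \<Longrightarrow> 0 \<le> p \<Longrightarrow> continuous_on {p..q} (\<lambda>x. S 0 x t)"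
  by (rule continuous_on_slice_t[OF regD(1)[OF S_reg[of x q]]] continuous_on_slice_x[OF regD(1)[OF S_reg[of q t]]]; simp)+

lemma St_le:
  assumes "0 \<le> x" "0 < t"
  shows "\<bar>St x t\<bar> \<le> KS * (1 + K) * exp (- \<beta> * t)"
    "\<bar>Stt x t\<bar> \<le> KS4 * (exp (- \<beta> * t) * (1 + 1 / (x\<^sup>2 + t)))"
proof -
  define e where "e = exp (- \<beta> * t)"
  define v where "v = 1 / (x\<^sup>2 + t)"
  have v: "0 \<le> v" using assms by (simp add: v_def)
  have e: "0 \<le> e" by (simp add: e_def)
  have cm: "\<bar>c * u\<bar> \<le> K * A" if "\<bar>u\<bar> \<le> A" for u A
    unfolding abs_mult using that c_le c_pos by (intro mult_mono) auto
  have s: "\<bar>S 0 x t\<bar> \<le> KS * e" "\<bar>S 2 x t\<bar> \<le> KS * e" "\<bar>S 4 x t\<bar> \<le> KS * e * v"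
    using S_le[OF assms] by (auto simp: e_def v_def)
  show 1: "\<bar>St x t\<bar> \<le> KS * (1 + K) * exp (- \<beta> * t)"
    using s(2) cm[OF s(1)] unfolding St_def e_def[symmetric] by (simp add: abs_le_iff algebra_simps)
  have "\<bar>Stt x t\<bar> \<le> KS * e * v + K * (KS * e) + K * (KS * (1 + K) * e)"
    using s(3) cm[OF s(2)] cm[OF 1[folded e_def]] unfolding Stt_def by linarith
  also have "\<dots> \<le> KS * e * v + (1 + 2 * K + K\<^sup>2) * (KS * e) + (2 * K + K\<^sup>2) * (KS * e * v)"
    using KS e v K_pos by (simp add: algebra_simps power2_eq_square)
  also have "\<dots> = KS4 * (e * (1 + v))" by (simp add: KS4_def algebra_simps)
  finally show "\<bar>Stt x t\<bar> \<le> KS4 * (exp (- \<beta> * t) * (1 + 1 / (x\<^sup>2 + t)))" by (simp add: e_def v_def)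
qed

lemma S_time_mvt:
  assumes "0 < x" "0 < k" "k \<le> t"
  obtains z where "t - k < z" "z < t" "(S 0 x t - S 0 x (t - k)) / k = St x z"
proof -
  have "continuous_on {t - k..t} (S 0 x)" using assms by (intro S_slices) auto
  moreover have "(S 0 x has_derivative (\<lambda>v. St x s * v)) (at s)" if "t - k < s" "s < t" for s
    using S_t(1)[of s x] that assms by (simp add: has_field_derivative_def)
  ultimately obtain z where "t - k < z" "z < t" "S 0 x t - S 0 x (t - k) = St x z * (t - (t - k))"
    using mvt[of "t - k" t "S 0 x" "\<lambda>s v. St x s * v"] assms by auto
  then show thesis using assms by (intro that[of z]) auto
qed

text \<open>When \<open>3 * k \<le> x\<^sup>2 + t\<close>, the singular factor of \<open>Stt\<close>
  is comparable along the time step and the mean value theorem applies. Otherwise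
  \<open>k / (x\<^sup>2 + t)\<close> exceeds 1/3 and boundedness of \<open>St\<close> is
  enough.\<close>

lemma S_time_trunc:
  assumes "0 < x" "0 < k" "k \<le> 1" "k \<le> t"
  shows "\<bar>St x t - (S 0 x t - S 0 x (t - k)) / k\<bar> \<le> CSt * k * (exp (- \<beta> * t) * (1 + 1 / (x\<^sup>2 + t)))"
proof -
  obtain z where z: "t - k < z" "z < t" "(S 0 x t - S 0 x (t - k)) / k = St x z"
    by (rule S_time_mvt[OF assms(1,2,4)])
  have zp: "0 < z" using z assms by linarith
  define s where "s = x\<^sup>2 + t"
  define e where "e = exp (- \<beta> * t)"
  have s: "0 < s" using assms by (auto simp: s_def intro: add_nonneg_pos)
  have e: "0 \<le> e" by (simp add: e_def)
  have eb: "exp (- \<beta> * v) \<le> exp \<beta> * e" if "z \<le> v" for v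
  proof -
    have "\<beta> * t \<le> \<beta> * (1 + v)" using that z assms beta_pos by (intro mult_left_mono) auto
    then show ?thesis by (simp add: e_def exp_add[symmetric] algebra_simps)
  qed
  have "\<bar>St x t - St x z\<bar> \<le> CSt * k * (e * (1 + 1 / s))"
  proof (cases "3 * k \<le> s")
    case True
    let ?A = "KS4 * (exp \<beta> * e * (2 * (1 + 1 / s)))"
    have "\<bar>St x t - St x z\<bar> \<le> ?A * (t - z)"
    proof (rule abs_diff_le_deriv[where g' = "Stt x"])
      show "continuous_on {z..t} (St x)"
        by (rule continuous_on_deriv[where g' = "Stt x"]) (use zp S_t in auto)
      fix v assume v: "z < v" "v < t"
      show "(St x has_real_derivative Stt x v) (at v)" using v zp by (intro S_t) auto
      have "2 * s \<le> 3 * (x\<^sup>2 + v)" using True v z by (simp add: s_def)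
      then have "1 / (x\<^sup>2 + v) \<le> 3 / (2 * s)" using s v zp by (simp add: divide_simps add_nonneg_pos mult.commute)
      moreover have "p \<le> 3 / (2 * s) \<Longrightarrow> 1 + p \<le> 2 * (1 + 1 / s)" for p
        using s by (simp add: divide_simps) (simp add: algebra_simps)
      ultimately have q: "1 + 1 / (x\<^sup>2 + v) \<le> 2 * (1 + 1 / s)" by blast
      have "\<bar>Stt x v\<bar> \<le> KS4 * (exp (- \<beta> * v) * (1 + 1 / (x\<^sup>2 + v)))"
        using v zp assms by (intro St_le) auto
      also have "\<dots> \<le> ?A"
        using q eb[of v] KS v zp e s by (intro mult_left_mono mult_mono) auto
      finally show "\<bar>Stt x v\<bar> \<le> ?A" .
    qed (use z in auto)
    also have "\<dots> \<le> ?A * k" using z KS e s by (intro mult_left_mono) auto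
    also have "\<dots> = (exp \<beta> * (2 * KS4)) * (k * (e * (1 + 1 / s)))" by (simp add: mult_ac)
    also have "\<dots> \<le> CSt * (k * (e * (1 + 1 / s)))"
      using KS K_pos assms e s by (intro mult_right_mono) (auto simp: CSt_def)
    finally show ?thesis by (simp add: mult_ac)
  next
    case False
    have "\<bar>St x t\<bar> \<le> KS * (1 + K) * (exp \<beta> * e)" "\<bar>St x z\<bar> \<le> KS * (1 + K) * (exp \<beta> * e)"
      using order_trans[OF St_le(1) mult_left_mono[OF eb]] zp z assms KS K_pos by auto
    then have "\<bar>St x t - St x z\<bar> \<le> 2 * (KS * (1 + K) * (exp \<beta> * e)) * 1" by linarith
    also have "\<dots> \<le> 2 * (KS * (1 + K) * (exp \<beta> * e)) * (3 * k * (1 / s))"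
      using False s KS K_pos e by (intro mult_left_mono) (auto simp: divide_simps)
    also have "\<dots> = (exp \<beta> * (6 * (KS * (1 + K)))) * (k * (e * (1 / s)))" by (simp add: mult_ac)
    also have "\<dots> \<le> CSt * (k * (e * (1 + 1 / s)))"
      using KS K_pos assms e s by (intro mult_mono) (auto simp: CSt_def)
    finally show ?thesis by (simp add: mult_ac)
  qed
  then show ?thesis using z(3) by (simp add: s_def e_def)
qed

text \<open>The same dichotomy in space. If \<open>h\<^sup>2 \<le> t\<close> or
  \<open>2 * h \<le> x\<close>, then \<open>x\<^sup>2 + t\<close> is comparable over the stencil and
  the fourth derivative can be used. Otherwise \<open>x\<^sup>2 + t \<le> 5 * h\<^sup>2\<close>, and
  the bound \<open>3 * KS * h\<^sup>2\<close> from second derivatives already has the required size;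
  hence 15.\<close>

lemma S_space_trunc:
  assumes "0 < t" "0 < h" "0 \<le> x - h"
  shows "\<bar>S 0 (x + h) t - 2 * S 0 x t + S 0 (x - h) t - h\<^sup>2 * S 2 x t\<bar> \<le> 15 * KS * h ^ 4 / (x\<^sup>2 + t)"
proof -
  define s where "s = x\<^sup>2 + t"
  have s: "0 < s" using assms by (auto simp: s_def intro: add_nonneg_pos)
  have e: "exp (- \<beta> * t) \<le> 1" using assms beta_pos by simp
  have S2: "\<bar>S 2 v t\<bar> \<le> KS" if "0 \<le> v" for v
    by (rule order_trans[OF S_le(2)[OF that assms(1)]]) (use e KS in \<open>auto simp: mult_left_le\<close>)
  have c: "continuous_on {x - h..x + h} (\<lambda>x. S 0 x t)" using assms by (intro S_slices) auto
  have d: "((\<lambda>x. S 0 x t) has_real_derivative S 1 v t) (at v)" "((\<lambda>x. S 1 x t) has_real_derivative S 2 v t) (at v)"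
    "((\<lambda>x. S 2 x t) has_real_derivative S 3 v t) (at v)" "((\<lambda>x. S 3 x t) has_real_derivative S 4 v t) (at v)" for v
    using S_x[OF assms(1), of 0 v] S_x[OF assms(1), of 1 v] S_x[OF assms(1), of 2 v] S_x[OF assms(1), of 3 v]
    by (auto simp: numeral_eq_Suc)
  show ?thesis
  proof (cases "h\<^sup>2 \<le> t \<or> 2 * h \<le> x")
    case True
    let ?A = "4 * KS / s"
    have A: "0 \<le> ?A" using KS s by simp
    have S4: "\<bar>S 4 v t\<bar> \<le> ?A" if v: "x - h < v" "v < x + h" for v
    proof -
      have v0: "0 \<le> v" using v assms by linarith
      have "s \<le> 4 * (v\<^sup>2 + t)"
        using True
      proof
        assume "h\<^sup>2 \<le> t"
        have "x\<^sup>2 \<le> (v + h)\<^sup>2" using v assms by (intro power_mono) auto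
        moreover have "(v + h)\<^sup>2 \<le> 2 * v\<^sup>2 + 2 * h\<^sup>2"
          using zero_le_power2[of "v - h"] by (simp add: power2_diff power2_sum)
        ultimately have "x\<^sup>2 \<le> 2 * v\<^sup>2 + 2 * t" using \<open>h\<^sup>2 \<le> t\<close> by linarith
        then have "x\<^sup>2 + t \<le> 2 * v\<^sup>2 + 3 * t" by linarith
        also have "\<dots> \<le> 4 * v\<^sup>2 + 4 * t" using assms(1) by (intro add_mono mult_right_mono) auto
        finally show ?thesis unfolding s_def by simp
      next
        assume "2 * h \<le> x"
        then have "x\<^sup>2 \<le> (2 * v)\<^sup>2" using v assms by (intro power_mono) auto
        then show ?thesis using assms by (simp add: s_def power_mult_distrib)
      qed
      then have "1 / (4 * (v\<^sup>2 + t)) \<le> 1 / s" using s assms by (intro divide_left_mono) (auto simp: add_nonneg_pos)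
      moreover have "1 / (4 * (v\<^sup>2 + t)) = 1 / (v\<^sup>2 + t) / 4"
        by (simp only: divide_divide_eq_left mult.commute)
      ultimately have "1 / (v\<^sup>2 + t) / 4 \<le> 1 / s" by (simp only:)
      moreover have "p / 4 \<le> q \<Longrightarrow> p \<le> 4 * q" for p q :: real by simp
      ultimately have i: "1 / (v\<^sup>2 + t) \<le> 4 * (1 / s)" by blast
      have "\<bar>S 4 v t\<bar> \<le> KS * exp (- \<beta> * t) * (1 / (v\<^sup>2 + t))" using S_le(3)[OF v0 assms(1)] by simp
      also have "\<dots> \<le> KS * 1 * (4 * (1 / s))"
        using i e KS s assms by (intro mult_mono) (auto simp: add_nonneg_nonneg)
      finally show ?thesis by (simp add: mult.commute)
    qed
    have "\<bar>S 0 (x + h) t - 2 * S 0 x t + S 0 (x - h) t - h\<^sup>2 * S 2 x t\<bar> \<le> (2 * ?A) * h ^ (2 + 2)"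
    proof (rule second_difference_truncation[where ?g1.0 = "\<lambda>x. S 1 x t" and ?g2.0 = "\<lambda>x. S 2 x t"])
      fix v assume v: "0 < v" "v < h"
      have "\<bar>S 2 (x + v) t - 2 * S 2 x t + S 2 (x - v) t\<bar> \<le> 2 * ?A * v\<^sup>2"
        by (rule second_difference_bound[where ?g1.0 = "\<lambda>x. S 3 x t" and ?g2.0 = "\<lambda>x. S 4 x t"])
          (use v A S4 d in \<open>auto intro!: continuous_on_deriv[where g' = "\<lambda>x. S 3 x t"]\<close>)
      then show "\<bar>S 2 (x + v) t + S 2 (x - v) t - 2 * S 2 x t\<bar> \<le> 2 * ?A * v\<^sup>2" by (simp add: algebra_simps)
    qed (use assms c d A in auto)
    also have "\<dots> = 8 * (KS * h ^ 4 / s)" by simp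
    also have "\<dots> \<le> 15 * (KS * h ^ 4 / s)" using KS s by (intro mult_right_mono) auto
    finally show ?thesis by (simp add: s_def)
  next
    case False
    have "x\<^sup>2 \<le> (2 * h)\<^sup>2" using False assms by (intro power_mono) auto
    then have s5: "s \<le> 5 * h\<^sup>2" using False by (simp add: s_def power_mult_distrib)
    have "\<bar>S 0 (x + h) t - 2 * S 0 x t + S 0 (x - h) t\<bar> \<le> 2 * KS * h\<^sup>2"
      by (rule second_difference_bound[where ?g1.0 = "\<lambda>x. S 1 x t" and ?g2.0 = "\<lambda>x. S 2 x t"])
        (use assms c d KS S2 in auto)
    moreover have "\<bar>h\<^sup>2 * S 2 x t\<bar> \<le> h\<^sup>2 * KS" unfolding abs_mult using S2[of x] assms by (intro mult_mono) auto
    ultimately have "\<bar>S 0 (x + h) t - 2 * S 0 x t + S 0 (x - h) t - h\<^sup>2 * S 2 x t\<bar> \<le> 2 * KS * h\<^sup>2 + h\<^sup>2 * KS" by linarith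
    also have "\<dots> = 3 * KS * h\<^sup>2 * 1" by (simp add: algebra_simps)
    finally have "\<bar>S 0 (x + h) t - 2 * S 0 x t + S 0 (x - h) t - h\<^sup>2 * S 2 x t\<bar> \<le> 3 * KS * h\<^sup>2 * 1" .
    also have "\<dots> \<le> 3 * KS * h\<^sup>2 * (5 * h\<^sup>2 / s)" using s5 s KS by (intro mult_left_mono) auto
    also have "\<dots> = 15 * KS * h ^ 4 / s" by (simp add: power2_eq_square power4_eq_xxxx)
    finally show ?thesis by (simp add: s_def)
  qed
qed

lemma y_split: "y x t = R x t + S 0 x t" "yt x t = Rt x t + St x t" "yxx x t = Rxx x t + S 2 x t" "yx x t = Rx x t + S 1 x t"
  by (auto simp: R_def Rt_def Rxx_def Rx_def S_def St_def)

definition CT where "CT = C3 + CSt + C4 + C2 + 2 * (KS * (1 + K))"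

lemma CT: "0 \<le> CT" using A3 KS C4 C2 K_pos by (simp add: CT_def)

lemma y_time_trunc:
  assumes "0 < x" "x < X" "0 < k" "k \<le> 1" "k \<le> t" "t \<le> Th"
  shows "\<bar>yt x t - (y x t - y x (t - k)) / k\<bar> \<le> CT * k * (wgt t * (1 + 1 / (x\<^sup>2 + t)))"
proof -
  define q where "q = 1 + 1 / (x\<^sup>2 + t)"
  have q: "1 \<le> q" using assms by (simp add: q_def add_nonneg_nonneg)
  have "yt x t - (y x t - y x (t - k)) / k
      = (Rt x t - (R x t - R x (t - k)) / k) + (St x t - (S 0 x t - S 0 x (t - k)) / k)"
    by (simp add: y_split diff_divide_distrib add_divide_distrib)
  also have "\<bar>\<dots>\<bar> \<le> C3 * wgt t * k + CSt * k * (exp (- \<beta> * t) * q)"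
    using R_time_trunc[OF assms] S_time_trunc[of x k t] assms unfolding q_def by linarith
  also have "\<dots> \<le> C3 * k * (wgt t * q) + CSt * k * (wgt t * q)"
  proof (rule add_mono)
    have "C3 * k * (wgt t * 1) \<le> C3 * k * (wgt t * q)"
      using A3 assms wgt_pos[of t] q by (intro mult_left_mono) auto
    then show "C3 * wgt t * k \<le> C3 * k * (wgt t * q)" by (simp add: mult_ac)
    show "CSt * k * (exp (- \<beta> * t) * q) \<le> CSt * k * (wgt t * q)"
      using KS assms q by (intro mult_left_mono mult_right_mono) (auto simp: wgt_def)
  qed
  also have "\<dots> = (C3 + CSt) * (k * (wgt t * q))" by (simp add: algebra_simps)
  also have "\<dots> \<le> CT * (k * (wgt t * q))"
    using assms wgt_pos[of t] q C4 C2 KS K_pos by (intro mult_right_mono) (auto simp: CT_def)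
  finally show ?thesis by (simp add: q_def mult_ac)
qed

text \<open>For time steps that are long in scaled time, where truncation is meaningless: the error
  is small only if the weight at the earlier time \<open>t - k\<close> is.\<close>

lemma y_time_crude:
  assumes "0 < x" "x < X" "0 < k" "k \<le> t" "t \<le> Th"
  shows "\<bar>yt x t - (y x t - y x (t - k)) / k\<bar> \<le> CT * wgt (t - k)"
proof -
  let ?w = "wgt (t - k)"
  have w: "0 < ?w" by (rule wgt_pos)
  have 1: "\<bar>Rt x t\<bar> \<le> C4 * ?w"
    using Rt_le[of x t] mult_left_mono[OF wgt_mono[of "t - k" t] C4] assms by linarith
  have "\<bar>R x t - R x (t - k)\<bar> \<le> C2 * k * ?w" using assms by (intro R_diff1) auto
  then have 2: "\<bar>(R x t - R x (t - k)) / k\<bar> \<le> C2 * ?w" using assms by (simp add: abs_divide field_simps)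
  have st: "\<bar>St x v\<bar> \<le> KS * (1 + K) * ?w" if "t - k < v" for v
  proof -
    have "\<bar>St x v\<bar> \<le> KS * (1 + K) * exp (- \<beta> * v)" using that assms by (intro St_le) auto
    also have "\<dots> \<le> KS * (1 + K) * ?w"
    proof (intro mult_left_mono)
      have "exp (- \<beta> * v) \<le> wgt v" by (simp add: wgt_def)
      also have "\<dots> \<le> ?w" using that by (intro wgt_mono) auto
      finally show "exp (- \<beta> * v) \<le> ?w" .
    qed (use KS K_pos in auto)
    finally show ?thesis .
  qed
  obtain z where z: "t - k < z" "z < t" "(S 0 x t - S 0 x (t - k)) / k = St x z"
    by (rule S_time_mvt[OF assms(1,3,4)])
  have "yt x t - (y x t - y x (t - k)) / k = Rt x t - (R x t - R x (t - k)) / k + St x t - St x z"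
    using z(3) by (simp add: y_split diff_divide_distrib add_divide_distrib)
  then have "\<bar>yt x t - (y x t - y x (t - k)) / k\<bar> \<le> C4 * ?w + C2 * ?w + 2 * (KS * (1 + K) * ?w)"
    using 1 2 st[of t] st[of z] z assms by linarith
  also have "\<dots> = (C4 + C2 + 2 * (KS * (1 + K))) * ?w" by (simp add: algebra_simps)
  also have "\<dots> \<le> CT * ?w" using w A3 KS by (intro mult_right_mono) (auto simp: CT_def)
  finally show ?thesis .
qed

definition CX where "CX = C9 + 15 * KS + C5 + KS"

lemma CX: "0 \<le> CX" using C9 KS C5 by (simp add: CX_def)

lemma y_space_trunc:
  assumes "0 < t" "t \<le> Th" "0 < h" "0 \<le> x - h" "x + h \<le> X"
  shows "\<bar>(y (x + h) t - 2 * y x t + y (x - h) t) / h\<^sup>2 - yxx x t\<bar> \<le> CX * h\<^sup>2 * (1 + 1 / (x\<^sup>2 + t))"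
proof -
  define v where "v = 1 / (x\<^sup>2 + t)"
  have v: "0 \<le> v" using assms by (simp add: v_def add_nonneg_nonneg)
  have "y (x + h) t - 2 * y x t + y (x - h) t - h\<^sup>2 * yxx x t
      = (R (x + h) t - 2 * R x t + R (x - h) t - h\<^sup>2 * Rxx x t)
        + (S 0 (x + h) t - 2 * S 0 x t + S 0 (x - h) t - h\<^sup>2 * S 2 x t)"
    by (simp add: y_split algebra_simps)
  also have "\<bar>\<dots>\<bar> \<le> C9 * h ^ 4 + 15 * KS * h ^ 4 * v"
    using R_space_trunc[OF assms] S_space_trunc[of t h x] assms by (simp add: v_def abs_le_iff)
  also have "\<dots> \<le> CX * h ^ 4 * (1 + v)"
  proof -
    have "C9 * h ^ 4 + 15 * KS * h ^ 4 * v \<le> CX * h ^ 4 + CX * h ^ 4 * v"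
      using C9 KS C5 v by (intro add_mono mult_right_mono) (auto simp: CX_def)
    then show ?thesis by (simp add: distrib_left)
  qed
  finally have "\<bar>y (x + h) t - 2 * y x t + y (x - h) t - h\<^sup>2 * yxx x t\<bar> / h\<^sup>2 \<le> CX * h ^ 4 * (1 + v) / h\<^sup>2"
    by (intro divide_right_mono) auto
  moreover have "\<bar>y (x + h) t - 2 * y x t + y (x - h) t - h\<^sup>2 * yxx x t\<bar> / h\<^sup>2
      = \<bar>(y (x + h) t - 2 * y x t + y (x - h) t) / h\<^sup>2 - yxx x t\<bar>"
  proof -
    have "(y (x + h) t - 2 * y x t + y (x - h) t) / h\<^sup>2 - yxx x t
        = (y (x + h) t - 2 * y x t + y (x - h) t - h\<^sup>2 * yxx x t) / h\<^sup>2"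
      using assms by (simp add: diff_divide_distrib)
    then show ?thesis by (simp add: abs_divide)
  qed
  moreover have "CX * h ^ 4 * (1 + v) / h\<^sup>2 = CX * h\<^sup>2 * (1 + v)"
    using assms by (simp add: power2_eq_square power4_eq_xxxx)
  ultimately show ?thesis by (simp add: v_def)
qed

lemma yxx_le:
  assumes "0 < x" "x < X" "0 < t" "t \<le> Th"
  shows "\<bar>yxx x t\<bar> \<le> CX"
proof -
  have "KS * exp (- \<beta> * t) \<le> KS" using KS beta_pos assms by (simp add: mult_left_le)
  then have "\<bar>S 2 x t\<bar> \<le> KS" using S_le(2)[of x t] assms by linarith
  then show ?thesis using Rxx_le[OF assms] C9 KS by (simp add: y_split CX_def)
qed

end

subsection \<open>The scaled problem: localised space differences\<close>

text \<open>Forward differences lean to the right, so the rectangle loses \<open>m * r\<close> on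
  that side only. This is what allows \<open>comparison\<close> to be applied to differences of any
  order.\<close>

lemma reg_fd:
  assumes "reg u ut ux uxx x0 x1 t0 t1" "0 \<le> r"
  shows "reg (\<lambda>x t. fd r m (\<lambda>s. u s t) x) (\<lambda>x t. fd r m (\<lambda>s. ut s t) x) (\<lambda>x t. fd r m (\<lambda>s. ux s t) x)
    (\<lambda>x t. fd r m (\<lambda>s. uxx s t) x) x0 (x1 - real m * r) t0 t1"
proof (induction m)
  case (Suc m)
  have "reg (\<lambda>x t. fd r m (\<lambda>s. u s t) (x + r)) (\<lambda>x t. fd r m (\<lambda>s. ut s t) (x + r))
    (\<lambda>x t. fd r m (\<lambda>s. ux s t) (x + r)) (\<lambda>x t. fd r m (\<lambda>s. uxx s t) (x + r)) x0 (x1 - real (Suc m) * r) t0 t1"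
    by (rule reg_subset[OF reg_shift_x[OF Suc.IH, of r]]) (use assms(2) in \<open>auto simp: algebra_simps\<close>)
  then show ?case
    unfolding fd.simps
    by (rule reg_diff) (rule reg_subset[OF Suc.IH], use assms(2) in \<open>auto simp: algebra_simps\<close>)
qed (use assms in auto)

text \<open>Dyadic telescoping turns third and fourth differences into the truncation errors of the central
  difference quotients.\<close>

lemma central_difference_truncation:
  fixes g :: "real \<Rightarrow> real"
  assumes "(g has_real_derivative D) (at x)" "0 < h"
    and "\<And>r. 0 < r \<Longrightarrow> 2 * r \<le> h \<Longrightarrow> \<bar>fd r 3 g (x - 2 * r)\<bar> \<le> A * r ^ 3 \<and> \<bar>fd r 3 g (x - r)\<bar> \<le> A * r ^ 3"
  shows "\<bar>(g (x + h) - g (x - h)) / (2 * h) - D\<bar> \<le> A * h\<^sup>2"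
proof -
  define s where "s n = (g (x + h / 2 ^ n) - g (x - h / 2 ^ n)) / (2 * (h / 2 ^ n))" for n :: nat
  have "0 \<le> A * (h / 2) ^ 3" using assms(3)[of "h / 2"] assms(2) by (auto intro: order_trans[OF abs_ge_zero])
  then have A: "0 \<le> A" using assms(2) by (simp add: zero_le_mult_iff)
  have "\<bar>s 0 - D\<bar> \<le> (A * h\<^sup>2 / 8) / (1 - 1 / 4)"
  proof (rule geometric_telescoping)
    fix n
    define r where "r = h / 2 ^ Suc n"
    have r: "0 < r" "h / 2 ^ n = 2 * r" "2 * r \<le> h"
      using assms(2) one_le_power[of "2::real" n] by (auto simp: r_def divide_le_eq)
    have "s n - s (Suc n) = (fd r 3 g (x - 2 * r) + fd r 3 g (x - r)) / (4 * r)"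
      unfolding s_def r(2) r_def[symmetric] using r(1)
      by (simp add: numeral_3_eq_3 divide_simps) (simp add: algebra_simps)
    then have "\<bar>s n - s (Suc n)\<bar> = \<bar>fd r 3 g (x - 2 * r) + fd r 3 g (x - r)\<bar> / (4 * r)"
      using r(1) by (simp add: abs_divide)
    also have "\<dots> \<le> (A * r ^ 3 + A * r ^ 3) / (4 * r)"
    proof (rule divide_right_mono)
      show "\<bar>fd r 3 g (x - 2 * r) + fd r 3 g (x - r)\<bar> \<le> A * r ^ 3 + A * r ^ 3"
        using assms(3)[OF r(1,3)] by linarith
    qed (use r in auto)
    also have "\<dots> = A * r\<^sup>2 / 2" using r(1) by (simp add: power2_eq_square power3_eq_cube)
    also have "r\<^sup>2 = h\<^sup>2 / 4 * (1 / 4) ^ n"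
    proof -
      have "(1 / 4 :: real) ^ n = (1 / 2 ^ n)\<^sup>2"
        by (simp add: power_one_over power_mult[symmetric] power2_eq_square power_mult_distrib[symmetric])
      then show ?thesis by (simp add: r_def power_divide power_mult_distrib)
    qed
    finally show "\<bar>s n - s (Suc n)\<bar> \<le> A * h\<^sup>2 / 8 * (1 / 4) ^ n" by simp
    show "s \<longlonglongrightarrow> D" unfolding s_def
      by (rule tendsto_dyadic[OF central_difference_tendsto[OF assms(1)] assms(2)])
  qed auto
  also have "\<dots> \<le> A * h\<^sup>2" using A by simp
  finally show ?thesis by (simp add: s_def)
qed

lemma second_difference_truncation4:
  fixes g :: "real \<Rightarrow> real"
  assumes "0 < \<delta>" "\<And>s. \<bar>s - x\<bar> < \<delta> \<Longrightarrow> (g has_real_derivative g1 s) (at s)"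
    and "(g1 has_real_derivative D) (at x)" "0 < h"
    and "\<And>r. 0 < r \<Longrightarrow> 2 * r \<le> h \<Longrightarrow> \<bar>fd r 4 g (x - 2 * r)\<bar> \<le> A * r ^ 4"
  shows "\<bar>(g (x + h) - 2 * g x + g (x - h)) / h\<^sup>2 - D\<bar> \<le> A * h\<^sup>2"
proof -
  define s where "s n = (g (x + h / 2 ^ n) - 2 * g x + g (x - h / 2 ^ n)) / (h / 2 ^ n)\<^sup>2" for n :: nat
  have "0 \<le> A * (h / 2) ^ 4" using assms(5)[of "h / 2"] assms(4) by (auto intro: order_trans[OF abs_ge_zero])
  then have A: "0 \<le> A" using assms(4) by (simp add: zero_le_mult_iff)
  have "\<bar>s 0 - D\<bar> \<le> (A * h\<^sup>2 / 16) / (1 - 1 / 4)"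
  proof (rule geometric_telescoping)
    fix n
    define r where "r = h / 2 ^ Suc n"
    have r: "0 < r" "h / 2 ^ n = 2 * r" "2 * r \<le> h"
      using assms(4) one_le_power[of "2::real" n] by (auto simp: r_def divide_le_eq)
    have "s n - s (Suc n) = fd r 4 g (x - 2 * r) / (4 * r\<^sup>2)"
      unfolding s_def r(2) r_def[symmetric] using r(1)
      by (simp add: numeral_eq_Suc divide_simps) (simp add: algebra_simps)
    then have "\<bar>s n - s (Suc n)\<bar> = \<bar>fd r 4 g (x - 2 * r)\<bar> / (4 * r\<^sup>2)"
      using r(1) by (simp add: abs_divide)
    also have "\<dots> \<le> (A * r ^ 4) / (4 * r\<^sup>2)"
      using assms(5)[OF r(1,3)] r(1) by (intro divide_right_mono) auto
    also have "\<dots> = A * r\<^sup>2 / 4" using r(1) by (simp add: power2_eq_square power4_eq_xxxx)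
    also have "r\<^sup>2 = h\<^sup>2 / 4 * (1 / 4) ^ n"
    proof -
      have "(1 / 4 :: real) ^ n = (1 / 2 ^ n)\<^sup>2"
        by (simp add: power_one_over power_mult[symmetric] power2_eq_square power_mult_distrib[symmetric])
      then show ?thesis by (simp add: r_def power_divide power_mult_distrib)
    qed
    finally show "\<bar>s n - s (Suc n)\<bar> \<le> A * h\<^sup>2 / 16 * (1 / 4) ^ n" by simp
    show "s \<longlonglongrightarrow> D" unfolding s_def
      by (rule tendsto_dyadic[OF second_difference_tendsto[OF assms(1-3)] assms(4)])
  qed auto
  also have "\<dots> \<le> A * h\<^sup>2" using A by simp
  finally show ?thesis by (simp add: s_def)
qed

text \<open>Each one-sided slope is split into its even and odd part about \<open>x\<close>, that is
  \<open>r / 2\<close> times the central second quotient plus or minus the central first quotient.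
  With different steps the errors of the odd parts no longer cancel and leave the first-order term
  \<open>4 * A * h\<close>.\<close>

lemma nonuniform_truncation:
  fixes g :: "real \<Rightarrow> real"
  assumes h: "0 < h1" "h1 \<le> h" "0 < h2" "h2 \<le> h" "h \<le> h1 + h2"
    and o: "\<And>r. 0 < r \<Longrightarrow> r \<le> h \<Longrightarrow> \<bar>(g (x + r) - g (x - r)) / (2 * r) - D1\<bar> \<le> A * r\<^sup>2"
    and e: "\<And>r. 0 < r \<Longrightarrow> r \<le> h \<Longrightarrow> \<bar>(g (x + r) - 2 * g x + g (x - r)) / r\<^sup>2 - D2\<bar> \<le> B * r\<^sup>2"
  shows "\<bar>((g (x + h2) - g x) / h2 - (g x - g (x - h1)) / h1) / ((h1 + h2) / 2) - D2\<bar> \<le> B * h\<^sup>2 + 4 * A * h"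
proof -
  have h0: "0 < h" using h by linarith
  have "0 \<le> A * h\<^sup>2" "0 \<le> B * h\<^sup>2" using o[of h] e[of h] h0 by (auto intro: order_trans[OF abs_ge_zero])
  then have AB: "0 \<le> A" "0 \<le> B" using h0 by (auto simp: zero_le_mult_iff)
  define T where "T r = (g (x + r) - 2 * g x + g (x - r)) / r\<^sup>2 - D2" for r
  define U where "U r = (g (x + r) - g (x - r)) / (2 * r) - D1" for r
  have sq: "r\<^sup>2 \<le> h\<^sup>2" if "0 < r" "r \<le> h" for r using that by (intro power_mono) auto
  have T: "\<bar>T r\<bar> \<le> B * h\<^sup>2" and U: "\<bar>U r\<bar> \<le> A * h\<^sup>2" if "0 < r" "r \<le> h" for r
    using o[OF that] e[OF that] mult_left_mono[OF sq[OF that]] AB by (fastforce simp: T_def U_def)+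
  have p: "(g (x + r) - g x) / r = r / 2 * (D2 + T r) + (D1 + U r)" if "0 < r" for r
    using that by (simp add: T_def U_def power2_eq_square field_simps)
  have m: "(g x - g (x - r)) / r = (D1 + U r) - r / 2 * (D2 + T r)" if "0 < r" for r
    using that by (simp add: T_def U_def power2_eq_square field_simps)
  have "((g (x + h2) - g x) / h2 - (g x - g (x - h1)) / h1) / ((h1 + h2) / 2) - D2
      = (h2 * T h2 + h1 * T h1 + 2 * (U h2 - U h1)) / (h1 + h2)"
    unfolding p[OF h(3)] m[OF h(1)] using h by (simp add: divide_simps) (simp add: algebra_simps)
  also have "\<bar>\<dots>\<bar> \<le> (h2 * (B * h\<^sup>2) + h1 * (B * h\<^sup>2) + 2 * (2 * (A * h\<^sup>2))) / (h1 + h2)"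
  proof -
    have "\<bar>h2 * T h2\<bar> \<le> h2 * (B * h\<^sup>2)" "\<bar>h1 * T h1\<bar> \<le> h1 * (B * h\<^sup>2)"
      unfolding abs_mult using T[of h1] T[of h2] h by (auto intro!: mult_mono)
    moreover have "\<bar>2 * (U h2 - U h1)\<bar> \<le> 2 * (2 * (A * h\<^sup>2))"
    proof -
      have "\<bar>p\<bar> \<le> v \<Longrightarrow> \<bar>q\<bar> \<le> v \<Longrightarrow> \<bar>2 * (q - p)\<bar> \<le> 2 * (2 * v)" for p q v :: real
        by (simp add: abs_le_iff)
      then show ?thesis using U[OF h(1,2)] U[OF h(3,4)] by blast
    qed
    ultimately have "\<bar>h2 * T h2 + h1 * T h1 + 2 * (U h2 - U h1)\<bar> \<le> h2 * (B * h\<^sup>2) + h1 * (B * h\<^sup>2) + 2 * (2 * (A * h\<^sup>2))"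
      by linarith
    then show ?thesis using h by (simp add: abs_divide divide_right_mono)
  qed
  also have "\<dots> = B * h\<^sup>2 + 4 * A * h * (h / (h1 + h2))"
    using h by (simp add: divide_simps power2_eq_square) (simp add: algebra_simps)
  also have "\<dots> \<le> B * h\<^sup>2 + 4 * A * h * 1"
    using h h0 AB by (intro add_left_mono mult_left_mono) auto
  finally show ?thesis by simp
qed

section \<open>Differences of order at most four between the lateral layers\<close>

context scaled_problem
begin

text \<open>The width of the lateral strips that are left out: at distance \<open>a\<close> the
  layer function \<open>E\<close> has the fixed value \<open>exp (- 1)\<close>.\<close>

definition a where "a = 1 / sqrt \<beta>"
definition E where "E x = exp (- sqrt \<beta> * x)"
definition CZa where "CZa = CW * (2 * K) * (1 + 1 / a) ^ 4"
definition BU where "BU = K\<^sup>2 + K + exp 1 * (C10 + CZa)"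
text \<open>The recursion mirrors the Leibniz sum in \<open>u_fd\<close>: the binomial coefficients
  add up to at most \<open>2 ^ 4 = 16\<close>, one \<open>K\<close> bounds the differences of
  \<open>b\<close>, and the other comes from dividing by the margin \<open>1 / K\<close>.\<close>

primrec CU :: "nat \<Rightarrow> real" where
  "CU 0 = BU"
| "CU (Suc m) = BU + 16 * K\<^sup>2 * CU m"

lemma a_pos: "0 < a" using beta_pos by (simp add: a_def)

lemma E_pos: "0 < E x" by (simp add: E_def)

lemma E_mono: "x \<le> x' \<Longrightarrow> E x' \<le> E x" using beta_pos by (simp add: E_def)

lemma E_a: "E a = exp (- 1)" using beta_pos by (simp add: E_def a_def)

lemma CZa: "0 \<le> CZa" using CW K_pos a_pos by (simp add: CZa_def)

lemma BU: "K \<le> BU" "K\<^sup>2 \<le> BU" "C10 + CZa \<le> exp (- 1) * BU" "C10 + CZa \<le> BU" "0 \<le> BU"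
proof -
  have e: "C10 + CZa \<le> exp 1 * (C10 + CZa)"
    using C10 CZa mult_right_mono[of 1 "exp 1" "C10 + CZa"] by simp
  have n: "0 \<le> C10 + CZa" using C10 CZa by simp
  show "K \<le> BU" "K\<^sup>2 \<le> BU" "C10 + CZa \<le> BU" "0 \<le> BU"
    using e n K_pos zero_le_power2[of K] unfolding BU_def by linarith+
  have "exp (- 1) * (exp 1 * (C10 + CZa)) \<le> exp (- 1) * BU"
    using K_pos by (intro mult_left_mono) (auto simp: BU_def)
  then show "C10 + CZa \<le> exp (- 1) * BU" by (simp add: mult.assoc[symmetric] exp_add[symmetric])
qed

lemma CU: "0 \<le> CU m" "BU \<le> CU m" "CU m \<le> CU (Suc m)"
proof -
  show 0: "0 \<le> CU m" for m using BU(5) by (induction m) auto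
  then show "BU \<le> CU m" by (cases m) (auto intro: mult_nonneg_nonneg)
  have "1 * CU m \<le> 16 * K\<^sup>2 * CU m"
  proof (rule mult_right_mono)
    show "1 \<le> 16 * K\<^sup>2" using one_le_power[OF K(1), of 2] by linarith
  qed (rule 0)
  then show "CU m \<le> CU (Suc m)" using BU(5) by simp
qed

lemma CU_mono: "m \<le> n \<Longrightarrow> CU m \<le> CU n"
  by (rule lift_Suc_mono_le) (rule CU(3))

text \<open>Smooth part, left layer and right layer of a difference of order \<open>m\<close>. The
  stencil reaches from \<open>x\<close> to \<open>x + m * r\<close>, and the right layer is
  evaluated at its right end.\<close>

definition wX where "wX m r x = d ^ m + E x + E (X - x - real m * r)"

lemma wX_pos: "0 < wX m r x" using d E_pos by (simp add: wX_def add_pos_pos)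

lemma E_x:
  "((\<lambda>x. E x) has_real_derivative - sqrt \<beta> * E x) (at x)"
  "((\<lambda>x. E (k - x)) has_real_derivative sqrt \<beta> * E (k - x)) (at x)"
  unfolding E_def by (auto intro!: derivative_eq_intros)

lemma wX_reg: "reg (\<lambda>x t. A * wX m r x) (\<lambda>_ _. 0)
   (\<lambda>x t. A * (- sqrt \<beta> * E x + sqrt \<beta> * E (X - real m * r - x)))
   (\<lambda>x t. A * (\<beta> * (E x + E (X - real m * r - x)))) x0 x1 t0 t1"
proof (rule reg_cmult[where ut = "\<lambda>_ _. 0", simplified], rule regI_smooth)
  have w: "wX m r x = d ^ m + E x + E (X - real m * r - x)" for x
    by (simp add: wX_def algebra_simps)
  have "continuous_on UNIV (\<lambda>x. wX m r x)" unfolding w E_def by (intro continuous_intros)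
  then show "continuous_on ({x0..x1} \<times> {t0..t1}) (\<lambda>(x, t). wX m r x)"
    unfolding case_prod_beta by (rule continuous_on_compose2) (auto intro!: continuous_intros)
  fix x t
  show "((\<lambda>s. wX m r s) has_real_derivative - sqrt \<beta> * E x + sqrt \<beta> * E (X - real m * r - x)) (at x)"
    unfolding w by (rule DERIV_cong[OF DERIV_add[OF DERIV_add[OF DERIV_const E_x(1)] E_x(2)]]) simp
  have "((\<lambda>s. - sqrt \<beta> * E s + sqrt \<beta> * E (X - real m * r - s)) has_real_derivative
      - sqrt \<beta> * (- sqrt \<beta> * E x) + sqrt \<beta> * (sqrt \<beta> * E (X - real m * r - x))) (at x)"
    by (intro DERIV_add DERIV_cmult E_x)
  moreover have "- sqrt \<beta> * (- sqrt \<beta> * E x) + sqrt \<beta> * (sqrt \<beta> * E (X - real m * r - x))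
      = (sqrt \<beta> * sqrt \<beta>) * (E x + E (X - real m * r - x))"
  proof -
    have "- s * (- s * p) + s * (s * q) = (s * s) * (p + q)" for s p q :: real by (simp add: algebra_simps)
    then show ?thesis .
  qed
  moreover have "sqrt \<beta> * sqrt \<beta> = \<beta>" using beta_pos by simp
  ultimately show "((\<lambda>s. - sqrt \<beta> * E s + sqrt \<beta> * E (X - real m * r - s)) has_real_derivative
      \<beta> * (E x + E (X - real m * r - x))) (at x)" by (simp only:)
qed auto

text \<open>Adding the error function part back gives the solution of the original problem:
  discontinuous at the corner, but with the smooth source \<open>f\<close>, whose differences of
  order \<open>m\<close> gain \<open>d ^ m\<close>. It is studied only for \<open>x \<ge> a\<close>,
  out of reach of the corner.\<close>

definition u where "u x t = y x t + W c a0 0 0 x t"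

lemma u_reg: "\<exists>ut ux uxx. reg u ut ux uxx a X 0 Th \<and>
  (\<forall>x t. a < x \<longrightarrow> x < X \<longrightarrow> 0 < t \<longrightarrow> t \<le> Th \<longrightarrow> ut x t - uxx x t = f x t - b x t * u x t)"
proof (intro exI conjI allI impI)
  show "reg u (\<lambda>x t. yt x t + (W c a0 0 2 x t - c * W c a0 0 0 x t)) (\<lambda>x t. yx x t + W c a0 0 1 x t)
      (\<lambda>x t. yxx x t + W c a0 0 2 x t) a X 0 Th"
    unfolding u_def[abs_def]
    by (intro reg_add W_reg reg_subset[OF y_reg]) (use a_pos in auto)
  fix x t assume "a < x" "x < X" "0 < t" "t \<le> Th"
  then show "yt x t + (W c a0 0 2 x t - c * W c a0 0 0 x t) - (yxx x t + W c a0 0 2 x t) = f x t - b x t * u x t"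
    using y_eq[of x t] a_pos by (simp add: u_def algebra_simps)
qed

lemma fd_W_le:
  assumes "a \<le> x" "0 < r" "x + real m * r \<le> X" "m \<le> 4" "0 < t"
  shows "\<bar>fd r m (\<lambda>x. Z 0 x t) x\<bar> \<le> CZa * r ^ m"
    and "\<bar>fd r m (\<lambda>x. W c a0 0 0 x t) x\<bar> \<le> (C * K * (1 + 1 / a) ^ 4 * E x) * r ^ m"
proof -
  show "\<bar>fd r m (\<lambda>x. Z 0 x t) x\<bar> \<le> CZa * r ^ m"
  proof (rule fd_deriv_bound[where D = "\<lambda>n x. Z n x t" and p = x and q = X])
    fix s assume s: "x \<le> s" "s \<le> X"
    have "\<bar>Z m s t\<bar> \<le> CW * (\<bar>a0\<bar> + \<bar>a1\<bar>) * (1 + 1 / a) ^ 4"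
      unfolding Z_def using s assms a_pos by (intro W_away) auto
    also have "\<dots> \<le> CZa" unfolding CZa_def using a_le CW a_pos by (intro mult_right_mono mult_left_mono) auto
    finally show "\<bar>Z m s t\<bar> \<le> CZa" .
    show "i < m \<Longrightarrow> ((\<lambda>x. Z i x t) has_real_derivative Z (Suc i) s t) (at s within {x..X})" for i
      unfolding Z_def using assms by (intro has_field_derivative_at_within[OF W_x]) auto
  qed (use assms in auto)
  show "\<bar>fd r m (\<lambda>x. W c a0 0 0 x t) x\<bar> \<le> (C * K * (1 + 1 / a) ^ 4 * E x) * r ^ m"
  proof (rule fd_deriv_bound[where D = "\<lambda>n x. W c a0 0 n x t" and p = x and q = X])
    fix s assume s: "x \<le> s" "s \<le> X"
    have "\<bar>W c a0 0 m s t\<bar> \<le> C * \<bar>a0\<bar> * (1 + 1 / a) ^ 4 * exp (- sqrt \<beta> * s)"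
      using s assms a_pos by (intro W_layer) auto
    also have "\<dots> \<le> C * K * (1 + 1 / a) ^ 4 * E x"
      using a_le C_nonneg a_pos E_mono[OF s(1)] K_pos unfolding E_def
      by (intro mult_mono mult_right_mono mult_left_mono) auto
    finally show "\<bar>W c a0 0 m s t\<bar> \<le> C * K * (1 + 1 / a) ^ 4 * E x" .
    show "i < m \<Longrightarrow> ((\<lambda>x. W c a0 0 i x t) has_real_derivative W c a0 0 (Suc i) s t) (at s within {x..X})" for i
      using assms by (intro has_field_derivative_at_within[OF W_x]) auto
  qed (use assms in auto)
qed

lemma u_fd_crude:
  assumes "a \<le> x" "0 < r" "x + real m * r < X" "m \<le> 4" "0 < t" "t \<le> Th"
  shows "\<bar>fd r m (\<lambda>x. u x t) x\<bar> \<le> (C10 + CZa) * r ^ m"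
proof -
  have "u x t = R x t + Z 0 x t" for x
    using W_add[of c a0 a1 0 x t] by (simp add: u_def R_def Z_def)
  then have "fd r m (\<lambda>x. u x t) x = fd r m (\<lambda>x. R x t) x + fd r m (\<lambda>x. Z 0 x t) x"
    by (simp add: fd_add)
  moreover have "\<bar>fd r m (\<lambda>x. R x t) x\<bar> \<le> C10 * r ^ m" using assms a_pos by (intro R_fd) auto
  moreover have "\<bar>fd r m (\<lambda>x. Z 0 x t) x\<bar> \<le> CZa * r ^ m" using assms by (intro fd_W_le) auto
  ultimately show ?thesis unfolding distrib_right by linarith
qed

lemma u_init: "0 \<le> x \<Longrightarrow> x \<le> X \<Longrightarrow> u x 0 = ph 0 x"
  by (simp add: u_def y_init W_def)

lemma fd_bf_le:
  assumes "0 < r" "0 \<le> x" "x + real m * r \<le> X" "m \<le> 4" "0 \<le> t" "t \<le> Th"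
  shows "\<bar>fd r m (\<lambda>x. b x t) x\<bar> \<le> K * d ^ m * r ^ m" "\<bar>fd r m (\<lambda>x. f x t) x\<bar> \<le> K * d ^ m * r ^ m"
    "\<bar>fd r m (ph 0) x\<bar> \<le> K * d ^ m * r ^ m"
  using fd_deriv_bound[of r 0 x m X "\<lambda>n x. bX n x t" "K * d ^ m"]
    fd_deriv_bound[of r 0 x m X "\<lambda>n x. fX n x t" "K * d ^ m"]
    fd_deriv_bound[of r 0 x m X ph "K * d ^ m"] assms bX_x bX_le fX_x fX_le ph_x ph_le
  by (auto simp: bX0 fX0)

text \<open>Induction on the order through the equation satisfied by the difference: its source
  consists of a difference of \<open>f\<close> and, by \<open>fd_mult\<close>, of products of a
  difference of \<open>b\<close> of order \<open>j \<ge> 1\<close> with a lower difference of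
  \<open>u\<close>. The factor \<open>d ^ j\<close> from \<open>b\<close> lifts the lower weight to
  the current one. The barrier needs no time dependence, since each layer function is a
  supersolution by itself.\<close>

lemma u_fd:
  assumes "a \<le> x" "0 < r" "x + real m * r \<le> X - a" "m \<le> 4" "0 \<le> t" "t \<le> Th"
  shows "\<bar>fd r m (\<lambda>x. u x t) x\<bar> \<le> CU m * r ^ m * wX m r x"
  using assms
proof (induction m arbitrary: x t rule: less_induct)
  case (less m)
  obtain ut ux uxx where ureg: "reg u ut ux uxx a X 0 Th"
    and ueq: "\<And>x t. a < x \<Longrightarrow> x < X \<Longrightarrow> 0 < t \<Longrightarrow> t \<le> Th \<Longrightarrow> ut x t - uxx x t = f x t - b x t * u x t"
    using u_reg by auto
  have rm: "0 < r ^ m" using less.prems by simp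
  have bd: "\<bar>fd r m (\<lambda>x. u x t) x\<bar> \<le> CU m * r ^ m * wX m r x"
    if x: "a \<le> x" "x + real m * r \<le> X - a" and t: "0 \<le> t" "t \<le> Th"
      and l: "x = a \<or> x = X - a - real m * r \<or> t = 0" for x t
  proof (cases "t = 0")
    case True
    have "fd r m (\<lambda>x. u x 0) x = fd r m (ph 0) x"
    proof (rule fd_cong)
      fix i assume "i \<le> m"
      then have "0 \<le> real i * r" "real i * r \<le> real m * r" using less.prems by (auto intro: mult_right_mono)
      then show "u (x + real i * r) 0 = ph 0 (x + real i * r)" using x a_pos by (intro u_init) auto
    qed
    then have "\<bar>fd r m (\<lambda>x. u x t) x\<bar> \<le> K * d ^ m * r ^ m"
      using True fd_bf_le(3)[of r x m 0] less.prems x a_pos Th_ge by auto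
    also have "\<dots> \<le> CU m * wX m r x * r ^ m"
      using BU CU[of m] d E_pos[of x] E_pos[of "X - x - real m * r"] K_pos rm
      by (intro mult_right_mono mult_mono) (auto simp: wX_def)
    finally show ?thesis by (simp add: mult_ac)
  next
    case False
    \<comment> \<open>On either lateral side one of the two layer functions equals
      \<open>exp (- 1)\<close>, so the bound \<open>u_fd_crude\<close> without any decay is good
      enough there.\<close>
    have "exp (- 1) \<le> wX m r x"
    proof -
      from False l have "x = a \<or> X - x - real m * r = a" by auto
      then show ?thesis
        using E_a E_pos[of x] E_pos[of "X - x - real m * r"] d unfolding wX_def
        by (auto simp: add_increasing add_increasing2)
    qed
    have "\<bar>fd r m (\<lambda>x. u x t) x\<bar> \<le> (C10 + CZa) * r ^ m"
      using x t False less.prems a_pos by (intro u_fd_crude) auto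
    also have "\<dots> \<le> (exp (- 1) * BU) * r ^ m" using BU rm by (intro mult_right_mono) auto
    also have "\<dots> \<le> (wX m r x * CU m) * r ^ m"
      using \<open>exp (- 1) \<le> wX m r x\<close> CU[of m] BU wX_pos[of m r x] rm by (intro mult_right_mono mult_mono) auto
    finally show ?thesis by (simp add: mult_ac)
  qed
  show ?case
  proof (cases m)
    case 0
    show ?thesis
    proof (cases "t = 0")
      case True
      then show ?thesis
        using u_init[of x] ph_le[of 0 x] less.prems a_pos BU E_pos[of x] E_pos[of "X - x"] 0
          mult_left_mono[of 1 "wX 0 r x" BU] by (auto simp: wX_def)
    next
      case False
      have "\<bar>fd r m (\<lambda>x. u x t) x\<bar> \<le> (C10 + CZa) * r ^ m"
        using False less.prems a_pos by (intro u_fd_crude) auto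
      also have "\<dots> \<le> BU * wX 0 r x"
      proof -
        have "(C10 + CZa) * 1 \<le> BU * wX 0 r x"
          using BU E_pos[of x] E_pos[of "X - x"] by (intro mult_mono) (auto simp: wX_def)
        then show ?thesis using 0 by simp
      qed
      finally show ?thesis using 0 by simp
    qed
  next
    case (Suc m')
    define A where "A = CU m * r ^ m"
    have A: "0 \<le> A" using CU rm by (simp add: A_def)
    have "\<bar>fd r m (\<lambda>x. u x t) x\<bar> \<le> A * wX m r x"
    proof (rule comparison[OF _ wX_reg, where u = "\<lambda>x t. fd r m (\<lambda>s. u s t) x" and ?x0.0 = a
          and ?x1.0 = "X - a - real m * r" and ?t0.0 = 0 and ?t1.0 = Th and c = b])
      show "reg (\<lambda>x t. fd r m (\<lambda>s. u s t) x) (\<lambda>x t. fd r m (\<lambda>s. ut s t) x) (\<lambda>x t. fd r m (\<lambda>s. ux s t) x)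
          (\<lambda>x t. fd r m (\<lambda>s. uxx s t) x) a (X - a - real m * r) 0 Th"
        by (rule reg_subset[OF reg_fd[OF ureg, of r m]]) (use less.prems a_pos in auto)
    next
      fix x t assume p: "a < x" "x < X - a - real m * r" "0 < t" "t \<le> Th"
      have ir: "0 \<le> real i * r" "real i * r \<le> real m * r" if "i \<le> m" for i
        using that less.prems by (auto intro: mult_right_mono)
      have xX: "0 \<le> x" "x \<le> X" using p a_pos ir[of m] by auto
      show "0 < b x t" using b_le[of x t] xX p by auto
      let ?w = "wX m r x"
      have "fd r m (\<lambda>s. ut s t) x - fd r m (\<lambda>s. uxx s t) x = fd r m (\<lambda>s. ut s t - uxx s t) x"
        by (simp only: fd_diff)
      also have "\<dots> = fd r m (\<lambda>s. f s t - b s t * u s t) x"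
        by (rule fd_cong, rule ueq) (use ir p a_pos in fastforce)+
      also have "\<dots> = fd r m (\<lambda>s. f s t) x - fd r m (\<lambda>s. b s t * u s t) x"
        by (simp only: fd_diff)
      also have "fd r m (\<lambda>s. b s t * u s t) x = b x t * fd r m (\<lambda>s. u s t) x
          + (\<Sum>i\<le>m'. real (m choose Suc i) * fd r (Suc i) (\<lambda>s. b s t) x * fd r (m - Suc i) (\<lambda>s. u s t) (x + real (Suc i) * r))"
        unfolding fd_mult Suc by (subst sum.atMost_Suc_shift) simp
      finally have L: "fd r m (\<lambda>s. ut s t) x - fd r m (\<lambda>s. uxx s t) x + b x t * fd r m (\<lambda>s. u s t) x
        = fd r m (\<lambda>s. f s t) x
          - (\<Sum>i\<le>m'. real (m choose Suc i) * fd r (Suc i) (\<lambda>s. b s t) x * fd r (m - Suc i) (\<lambda>s. u s t) (x + real (Suc i) * r))"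
        by simp
      have F: "\<bar>fd r m (\<lambda>s. f s t) x\<bar> \<le> K * (r ^ m * ?w)"
      proof -
        have "\<bar>fd r m (\<lambda>s. f s t) x\<bar> \<le> K * d ^ m * r ^ m"
          using p less.prems a_pos by (intro fd_bf_le) auto
        also have "\<dots> \<le> K * ?w * r ^ m"
          using K_pos rm E_pos[of x] E_pos[of "X - x - real m * r"] by (intro mult_right_mono mult_left_mono) (auto simp: wX_def)
        finally show ?thesis by (simp add: mult_ac)
      qed
      have T: "\<bar>fd r (Suc i) (\<lambda>s. b s t) x * fd r (m - Suc i) (\<lambda>s. u s t) (x + real (Suc i) * r)\<bar>
          \<le> K * CU m' * (r ^ m * ?w)" if "i \<le> m'" for i
      proof -
        define j where "j = Suc i"
        have j: "1 \<le> j" "j \<le> m" using that Suc by (auto simp: j_def)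
        have jr: "real (m - j) * r + real j * r = real m * r"
          using j by (simp add: distrib_right[symmetric] of_nat_diff)
        have xj: "a \<le> x + real j * r" "x + real j * r \<le> X" "x + real j * r + real (m - j) * r \<le> X - a"
          using p ir[OF j(2)] a_pos jr by linarith+
        have "\<bar>fd r j (\<lambda>s. b s t) x\<bar> \<le> K * d ^ j * r ^ j"
          using p less.prems a_pos xj j by (intro fd_bf_le) auto
        moreover have "\<bar>fd r (m - j) (\<lambda>s. u s t) (x + real j * r)\<bar> \<le> CU (m - j) * r ^ (m - j) * wX (m - j) r (x + real j * r)"
          using p less.prems xj j by (intro less.IH) auto
        ultimately have "\<bar>fd r j (\<lambda>s. b s t) x * fd r (m - j) (\<lambda>s. u s t) (x + real j * r)\<bar>
            \<le> (K * d ^ j * r ^ j) * (CU (m - j) * r ^ (m - j) * wX (m - j) r (x + real j * r))"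
          unfolding abs_mult using K_pos d less.prems by (intro mult_mono) auto
        also have "\<dots> = K * CU (m - j) * ((r ^ j * r ^ (m - j)) * (d ^ j * wX (m - j) r (x + real j * r)))"
          by (simp only: mult_ac)
        also have "r ^ j * r ^ (m - j) = r ^ m" using j by (simp add: power_add[symmetric])
        also have "K * CU (m - j) * (r ^ m * (d ^ j * wX (m - j) r (x + real j * r))) \<le> K * CU m' * (r ^ m * ?w)"
        proof (intro mult_mono mult_left_mono)
          show "CU (m - j) \<le> CU m'" using j Suc by (intro CU_mono) auto
          \<comment> \<open>The shifted stencil of the lower difference has the same right end, so
            the right layer term is unchanged; the left one only decreases, and
            \<open>d ^ j * d ^ (m - j) = d ^ m\<close>.\<close>
          have "d ^ j * wX (m - j) r (x + real j * r)
              = d ^ j * d ^ (m - j) + d ^ j * E (x + real j * r) + d ^ j * E (X - x - real m * r)"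
          proof -
            have "X - (x + real j * r) - real (m - j) * r = X - x - real m * r" using jr by linarith
            then show ?thesis by (simp only: wX_def distrib_left)
          qed
          also have "\<dots> \<le> d ^ m + 1 * E x + 1 * E (X - x - real m * r)"
          proof (intro add_mono mult_mono)
            show "d ^ j * d ^ (m - j) \<le> d ^ m" using j by (simp add: power_add[symmetric])
            show "E (x + real j * r) \<le> E x" using ir[OF j(2)] by (intro E_mono) auto
          qed (use dn E_pos in \<open>auto simp: less_imp_le\<close>)
          finally show "d ^ j * wX (m - j) r (x + real j * r) \<le> ?w" by (simp add: wX_def)
        qed (use K_pos CU rm d wX_pos[of "m - j" r "x + real j * r"] in auto)
        finally show ?thesis by (simp add: j_def)
      qed
      have "\<bar>fd r m (\<lambda>s. ut s t) x - fd r m (\<lambda>s. uxx s t) x + b x t * fd r m (\<lambda>s. u s t) x\<bar>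
          \<le> K * (r ^ m * ?w) + (\<Sum>i\<le>m'. real (m choose Suc i) * (K * CU m' * (r ^ m * ?w)))"
      proof -
        have "\<bar>\<Sum>i\<le>m'. real (m choose Suc i) * fd r (Suc i) (\<lambda>s. b s t) x * fd r (m - Suc i) (\<lambda>s. u s t) (x + real (Suc i) * r)\<bar>
            \<le> (\<Sum>i\<le>m'. real (m choose Suc i) * (K * CU m' * (r ^ m * ?w)))"
          by (rule order_trans[OF sum_abs], rule sum_mono)
            (use T in \<open>auto simp: abs_mult mult.assoc intro!: mult_left_mono\<close>)
        then show ?thesis unfolding L using F by linarith
      qed
      also have "\<dots> = (K + real (\<Sum>i\<le>m'. m choose Suc i) * K * CU m') * (r ^ m * ?w)"
        by (simp add: sum_distrib_right[symmetric] distrib_right mult.assoc)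
      also have "\<dots> \<le> (K + 16 * K * CU m') * (r ^ m * ?w)"
      proof -
        have "(\<Sum>i\<le>m'. m choose Suc i) + 1 = (\<Sum>i\<le>m. m choose i)"
          unfolding Suc sum.atMost_Suc_shift by simp
        also have "\<dots> = 2 ^ m" by (rule choose_row_sum)
        also have "\<dots> \<le> 2 ^ 4" using less.prems by (intro power_increasing) auto
        finally have "(\<Sum>i\<le>m'. m choose Suc i) \<le> 16" by simp
        then have "real (\<Sum>i\<le>m'. m choose Suc i) \<le> 16" by (metis of_nat_le_iff of_nat_numeral)
        then show ?thesis
          using K_pos CU[of m'] rm wX_pos[of m r x] by (intro mult_right_mono add_left_mono) auto
      qed
      also have "\<dots> \<le> (CU m * (1 / K)) * (r ^ m * ?w)"
      proof (rule mult_right_mono)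
        have "(K + 16 * K * CU m') * K \<le> CU m"
          using BU(2) by (simp add: Suc power2_eq_square algebra_simps)
        then show "K + 16 * K * CU m' \<le> CU m * (1 / K)" using K_pos by (simp add: field_simps)
      qed (use rm wX_pos[of m r x] in auto)
      also have "\<dots> = A * (1 / K * d ^ m + 1 / K * (E x + E (X - real m * r - x)))"
        by (simp add: A_def wX_def algebra_simps)
      also have "\<dots> \<le> A * (b x t * d ^ m + (b x t - \<beta>) * (E x + E (X - real m * r - x)))"
        using b_ge[of x t] xX p inv_K beta_pos eta_pos A d E_pos[of x] E_pos[of "X - real m * r - x"]
        by (intro mult_left_mono add_mono mult_right_mono) auto
      finally show "\<bar>fd r m (\<lambda>s. ut s t) x - fd r m (\<lambda>s. uxx s t) x + b x t * fd r m (\<lambda>s. u s t) x\<bar>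
          \<le> 0 - A * (\<beta> * (E x + E (X - real m * r - x))) + b x t * (A * wX m r x)"
        by (simp add: wX_def algebra_simps)
    next
      fix x t assume "a \<le> x" "x \<le> X - a - real m * r" "0 \<le> t" "t \<le> Th" "x = a \<or> x = X - a - real m * r \<or> t = 0"
      then show "\<bar>fd r m (\<lambda>s. u s t) x\<bar> \<le> A * wX m r x"
        unfolding A_def by (intro bd) auto
    qed (use less.prems Th_ge in auto)
    then show ?thesis by (simp add: A_def)
  qed
qed

definition CY where "CY = CU 4 + C * K * (1 + 1 / a) ^ 4"

lemma CY: "0 \<le> CY" using CU[of 4] C_nonneg K_pos a_pos by (auto simp: CY_def intro!: add_nonneg_nonneg mult_nonneg_nonneg simp del: CU.simps)

lemma y_fd:
  assumes "a \<le> x" "0 < r" "x + real m * r \<le> X - a" "m \<le> 4" "0 < t" "t \<le> Th"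
  shows "\<bar>fd r m (\<lambda>x. y x t) x\<bar> \<le> CY * r ^ m * wX m r x"
proof -
  let ?k = "C * K * (1 + 1 / a) ^ 4"
  have k: "0 \<le> ?k" using C_nonneg K_pos a_pos by (intro mult_nonneg_nonneg) auto
  have rm: "0 < r ^ m" using assms by simp
  have "fd r m (\<lambda>x. y x t) x = fd r m (\<lambda>x. u x t) x - fd r m (\<lambda>x. W c a0 0 0 x t) x"
    unfolding u_def fd_add by simp
  moreover have "\<bar>fd r m (\<lambda>x. u x t) x\<bar> \<le> CU 4 * (r ^ m * wX m r x)"
  proof -
    have "\<bar>fd r m (\<lambda>x. u x t) x\<bar> \<le> CU m * (r ^ m * wX m r x)"
      using u_fd[of x r m t] assms by (simp add: mult.assoc)
    also have "\<dots> \<le> CU 4 * (r ^ m * wX m r x)"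
      using CU_mono[OF assms(4)] rm wX_pos[of m r x] by (intro mult_right_mono) auto
    finally show ?thesis .
  qed
  moreover have "\<bar>fd r m (\<lambda>x. W c a0 0 0 x t) x\<bar> \<le> ?k * (r ^ m * wX m r x)"
  proof -
    have "\<bar>fd r m (\<lambda>x. W c a0 0 0 x t) x\<bar> \<le> (?k * E x) * r ^ m"
      using assms a_pos by (intro fd_W_le) auto
    also have "\<dots> \<le> (?k * wX m r x) * r ^ m"
      using k rm d E_pos[of "X - x - real m * r"] by (intro mult_right_mono mult_left_mono) (auto simp: wX_def)
    finally show ?thesis by (simp add: mult_ac)
  qed
  ultimately have "\<bar>fd r m (\<lambda>x. y x t) x\<bar> \<le> CU 4 * (r ^ m * wX m r x) + ?k * (r ^ m * wX m r x)" by linarith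
  also have "\<dots> = CY * r ^ m * wX m r x" unfolding CY_def by (simp only: distrib_right mult.assoc)
  finally show ?thesis .
qed

text \<open>The weight made uniform over stencils inside \<open>[x, x']\<close>: each exponential is
  taken at the end nearest to its own boundary.\<close>

definition lay where "lay m x x' = d ^ m + E x + E (X - x')"

lemma lay: "0 < lay m x x'" "m \<le> n \<Longrightarrow> lay n x x' \<le> lay m x x'"
  using d E_pos by (auto simp: lay_def add_pos_pos power_decreasing)

lemma wX_le_lay: "p \<le> x \<Longrightarrow> x + real m * r \<le> q \<Longrightarrow> wX m r x \<le> lay m p q"
  unfolding wX_def lay_def by (intro add_mono E_mono order_refl) auto

lemma y_fd_lay:
  assumes "a \<le> p" "p \<le> x" "0 < r" "x + real m * r \<le> q" "q \<le> X - a" "m \<le> 4" "0 < t" "t \<le> Th"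
  shows "\<bar>fd r m (\<lambda>x. y x t) x\<bar> \<le> CY * lay m p q * r ^ m"
proof -
  have "\<bar>fd r m (\<lambda>x. y x t) x\<bar> \<le> CY * r ^ m * wX m r x" using assms by (intro y_fd) auto
  also have "\<dots> \<le> CY * r ^ m * lay m p q"
    using assms CY by (intro mult_left_mono wX_le_lay) auto
  finally show ?thesis by (simp add: mult_ac)
qed

lemma y_derivs:
  assumes "0 < x" "x < X" "0 < t" "t \<le> Th"
  shows "((\<lambda>x. y x t) has_real_derivative yx x t) (at x)" "((\<lambda>x. yx x t) has_real_derivative yxx x t) (at x)"
  using assms by (auto intro: regD(3)[OF y_reg] regD(4)[OF y_reg])

lemma yxx_lay:
  assumes "a \<le> p" "p < x" "x < q" "q \<le> X - a" "0 < t" "t \<le> Th"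
  shows "\<bar>yxx x t\<bar> \<le> CY * lay 2 p q"
proof -
  define \<delta> where "\<delta> = min (x - p) (q - x)"
  have \<delta>: "0 < \<delta>" using assms by (simp add: \<delta>_def)
  have "((\<lambda>s. (y (x + s) t - 2 * y x t + y (x - s) t) / s\<^sup>2) \<longlongrightarrow> yxx x t) (at_right 0)"
    by (rule second_difference_tendsto[OF \<delta>, where ?g1.0 = "\<lambda>x. yx x t"])
      (use assms a_pos in \<open>auto simp: \<delta>_def intro!: y_derivs\<close>)
  then have lim: "((\<lambda>s. \<bar>(y (x + s) t - 2 * y x t + y (x - s) t) / s\<^sup>2\<bar>) \<longlongrightarrow> \<bar>yxx x t\<bar>) (at_right 0)"
    by (rule tendsto_rabs)
  have "\<bar>(y (x + s) t - 2 * y x t + y (x - s) t) / s\<^sup>2\<bar> \<le> CY * lay 2 p q" if "0 < s" "s < \<delta>" for s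
  proof -
    have "\<bar>fd s 2 (\<lambda>x. y x t) (x - s)\<bar> \<le> CY * lay 2 p q * s\<^sup>2"
      using assms that by (intro y_fd_lay) (auto simp: \<delta>_def)
    then have "\<bar>y (x + s) t - 2 * y x t + y (x - s) t\<bar> \<le> CY * lay 2 p q * s\<^sup>2"
      by (simp add: numeral_2_eq_2 algebra_simps)
    then show ?thesis using that by (simp add: abs_divide divide_le_eq)
  qed
  then have "\<forall>\<^sub>F s in at_right 0. \<bar>(y (x + s) t - 2 * y x t + y (x - s) t) / s\<^sup>2\<bar> \<le> CY * lay 2 p q"
    unfolding eventually_at_right_field using \<delta> by (intro exI[of _ \<delta>]) auto
  then show ?thesis by (rule tendsto_upperbound[OF lim]) simp
qed

lemma y_trunc_lay:
  assumes "a \<le> x - h" "x + h \<le> X - a" "0 < h" "0 < t" "t \<le> Th"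
  shows "\<bar>(y (x + h) t - 2 * y x t + y (x - h) t) / h\<^sup>2 - yxx x t\<bar> \<le> CY * lay 4 (x - h) (x + h) * h\<^sup>2"
    and "\<bar>(y (x + h) t - y (x - h) t) / (2 * h) - yx x t\<bar> \<le> CY * lay 3 (x - h) (x + h) * h\<^sup>2"
proof -
  show "\<bar>(y (x + h) t - 2 * y x t + y (x - h) t) / h\<^sup>2 - yxx x t\<bar> \<le> CY * lay 4 (x - h) (x + h) * h\<^sup>2"
  proof (rule second_difference_truncation4[where g = "\<lambda>x. y x t" and ?g1.0 = "\<lambda>x. yx x t" and \<delta> = h])
    fix r assume "0 < r" "2 * r \<le> h"
    then show "\<bar>fd r 4 (\<lambda>x. y x t) (x - 2 * r)\<bar> \<le> CY * lay 4 (x - h) (x + h) * r ^ 4"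
      using assms by (intro y_fd_lay) auto
  qed (use assms a_pos in \<open>auto intro!: y_derivs\<close>)
  show "\<bar>(y (x + h) t - y (x - h) t) / (2 * h) - yx x t\<bar> \<le> CY * lay 3 (x - h) (x + h) * h\<^sup>2"
  proof (rule central_difference_truncation[where g = "\<lambda>x. y x t"])
    fix r assume "0 < r" "2 * r \<le> h"
    then show "\<bar>fd r 3 (\<lambda>x. y x t) (x - 2 * r)\<bar> \<le> CY * lay 3 (x - h) (x + h) * r ^ 3 \<and>
        \<bar>fd r 3 (\<lambda>x. y x t) (x - r)\<bar> \<le> CY * lay 3 (x - h) (x + h) * r ^ 3"
      using assms by (intro conjI y_fd_lay) auto
  qed (use assms a_pos in \<open>auto intro!: y_derivs\<close>)
qed

lemma y_trunc_nonuniform: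
  assumes "a \<le> x - h" "x + h \<le> X - a" "0 < t" "t \<le> Th"
    and h: "0 < h1" "h1 \<le> h" "0 < h2" "h2 \<le> h" "h \<le> h1 + h2"
  shows "\<bar>((y (x + h2) t - y x t) / h2 - (y x t - y (x - h1) t) / h1) / ((h1 + h2) / 2) - yxx x t\<bar>
    \<le> CY * lay 4 (x - h) (x + h) * h\<^sup>2 + 4 * (CY * lay 3 (x - h) (x + h)) * h"
proof (rule nonuniform_truncation[where g = "\<lambda>x. y x t" and ?D1.0 = "yx x t", OF h])
  fix r assume r: "0 < r" "r \<le> h"
  have m: "CY * lay m (x - r) (x + r) * r\<^sup>2 \<le> CY * lay m (x - h) (x + h) * r\<^sup>2" for m
    using r CY unfolding lay_def by (intro mult_right_mono mult_left_mono add_mono E_mono) auto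
  show "\<bar>(y (x + r) t - y (x - r) t) / (2 * r) - yx x t\<bar> \<le> CY * lay 3 (x - h) (x + h) * r\<^sup>2"
    by (rule order_trans[OF y_trunc_lay(2) m]) (use assms r in auto)
  show "\<bar>(y (x + r) t - 2 * y x t + y (x - r) t) / r\<^sup>2 - yxx x t\<bar> \<le> CY * lay 4 (x - h) (x + h) * r\<^sup>2"
    by (rule order_trans[OF y_trunc_lay(1) m]) (use assms r in auto)
qed

end

subsection \<open>The discrete maximum principle and discrete barriers\<close>

lemma delta2_eq:
  assumes "0 < i"
  shows "delta2 X Y i j = ((Y (i + 1) j - Y i j) / (X (i + 1) - X i) - (Y i j - Y (i - 1) j) / (X i - X (i - 1)))
    / (((X i - X (i - 1)) + (X (i + 1) - X i)) / 2)"
  using assms by (simp add: delta2_def dx_plus_def dx_minus_def algebra_simps)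

theorem discrete_max_principle:
  fixes X S :: "nat \<Rightarrow> real" and Y c :: "nat \<Rightarrow> nat \<Rightarrow> real"
  assumes X: "\<And>i. i < N \<Longrightarrow> X i < X (Suc i)" and S: "\<And>j. j < M \<Longrightarrow> S j < S (Suc j)"
    and L: "\<And>i j. 0 < i \<Longrightarrow> i < N \<Longrightarrow> 0 < j \<Longrightarrow> j \<le> M \<Longrightarrow> 0 \<le> dt_minus S Y i j - delta2 X Y i j + c i j * Y i j"
    and c: "\<And>i j. 0 < i \<Longrightarrow> i < N \<Longrightarrow> 0 < j \<Longrightarrow> j \<le> M \<Longrightarrow> 0 < c i j"
    and bd: "\<And>i j. i \<le> N \<Longrightarrow> j \<le> M \<Longrightarrow> i = 0 \<or> i = N \<or> j = 0 \<Longrightarrow> 0 \<le> Y i j"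
    and ij: "i \<le> N" "j \<le> M"
  shows "0 \<le> Y i j"
proof -
  let ?A = "{..N} \<times> {..M}"
  have "finite ?A" "?A \<noteq> {}" by auto
  then obtain p where p: "p \<in> ?A" "\<And>q. q \<in> ?A \<Longrightarrow> (\<lambda>(i, j). Y i j) p \<le> (\<lambda>(i, j). Y i j) q"
    using arg_min_if_finite[of ?A "\<lambda>(i, j). Y i j"] by (metis linorder_not_le)
  obtain m n where mn: "p = (m, n)" "m \<le> N" "n \<le> M" using p(1) by auto
  have min: "Y m n \<le> Y i j" if "i \<le> N" "j \<le> M" for i j
    using p(2)[of "(i, j)"] that by (simp add: mn)
  have "0 \<le> Y m n"
  proof (rule ccontr)
    assume neg: "\<not> 0 \<le> Y m n"
    have "\<not> (m = 0 \<or> m = N \<or> n = 0)"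
    proof
      assume "m = 0 \<or> m = N \<or> n = 0"
      from bd[OF mn(2,3) this] neg show False by (simp only:)
    qed
    then have int: "0 < m" "m < N" "0 < n" using mn by auto
    have S': "S (n - 1) < S n" using S[of "n - 1"] int mn by simp
    have X': "X (m - 1) < X m" "X m < X (m + 1)" using X[of "m - 1"] X[of m] int by auto
    have "dt_minus S Y m n \<le> 0"
      unfolding dt_minus_def using min[of m "n - 1"] mn S' by (intro divide_nonpos_pos) auto
    moreover have "0 \<le> delta2 X Y m n"
      unfolding delta2_eq[OF int(1)]
    proof (rule divide_nonneg_pos)
      have "(Y m n - Y (m - 1) n) / (X m - X (m - 1)) \<le> 0"
        using min[of "m - 1" n] mn X' by (intro divide_nonpos_pos) auto
      moreover have "0 \<le> (Y (m + 1) n - Y m n) / (X (m + 1) - X m)"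
        using min[of "m + 1" n] int mn X' by (intro divide_nonneg_pos) auto
      ultimately show "0 \<le> (Y (m + 1) n - Y m n) / (X (m + 1) - X m) - (Y m n - Y (m - 1) n) / (X m - X (m - 1))"
        by linarith
    qed (use X' in auto)
    moreover have "c m n * Y m n < 0" using c[of m n] int mn neg by (simp add: mult_pos_neg)
    ultimately show False using L[of m n] int mn by linarith
  qed
  then show ?thesis using min[OF ij] by linarith
qed

text \<open>A certificate format for the two quadratic inequalities in
  \<open>discrete_corner_barrier\<close>. The coefficient 4/5 is what remains of
  \<open>w\<^sup>2\<close> after subtracting the \<open>w\<^sup>2 / 5\<close> of the target.\<close>

lemma le_from_squares:
  fixes p q :: real
  assumes "q - p = 4 / 5 * u\<^sup>2 + m * s\<^sup>2" "0 \<le> m"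
  shows "p \<le> q"
proof -
  have "0 \<le> 4 / 5 * u\<^sup>2 + m * s\<^sup>2" using assms(2) by (intro add_nonneg_nonneg mult_nonneg_nonneg) auto
  then show ?thesis using assms(1) by linarith
qed

text \<open>The discrete counterpart \<open>s / (x\<^sup>2 + 6 * s)\<close>, \<open>s = t + h\<^sup>2\<close>, of the corner barrier. The shift by
  \<open>h\<^sup>2\<close> makes it smooth on the scale of the mesh.\<close>

lemma discrete_corner_barrier:
  fixes x s s' h :: real
  assumes h: "0 < h" "h \<le> x" and s: "h\<^sup>2 \<le> s'" "s' < s"
  defines "B \<equiv> \<lambda>x s. s / (x\<^sup>2 + 6 * s)"
  shows "1 / (5 * (x\<^sup>2 + 6 * s))
    \<le> (B x s - B x s') / (s - s') - (B (x + h) s - 2 * B x s + B (x - h) s) / h\<^sup>2"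
proof -
  define p p' where "p = x\<^sup>2 + 6 * s" and "p' = x\<^sup>2 + 6 * s'"
  define u v where "u = (x + h)\<^sup>2 + 6 * s" and "v = (x - h)\<^sup>2 + 6 * s"
  have h2: "0 < h\<^sup>2" using h by simp
  have s0: "0 < s'" "0 < s" "h\<^sup>2 \<le> s" using s h2 by linarith+
  have p: "0 < p" "0 < p'" "p' \<le> p" "0 < u" "0 < v"
    using s0 s by (auto simp: p_def p'_def u_def v_def intro: add_nonneg_pos)
  have uv: "u * v = p\<^sup>2 + 2 * h\<^sup>2 * (6 * s - x\<^sup>2) + h ^ 4"
    by (simp add: u_def v_def p_def power2_eq_square power4_eq_xxxx algebra_simps)
  have time: "(B x s - B x s') / (s - s') = x\<^sup>2 / (p * p')"
  proof -
    have "B x s - B x s' = (s * p' - s' * p) / (p * p')"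
      using p by (simp add: B_def p_def[symmetric] p'_def[symmetric] diff_frac_eq)
    also have "s * p' - s' * p = x\<^sup>2 * (s - s')" by (simp add: p_def p'_def algebra_simps)
    finally show ?thesis using s by simp
  qed
  have "x\<^sup>2 / p\<^sup>2 \<le> x\<^sup>2 / (p * p')"
    using p by (intro divide_left_mono) (auto simp: power2_eq_square)
  moreover have space: "(B (x + h) s - 2 * B x s + B (x - h) s) / h\<^sup>2 = 2 * s * (3 * x\<^sup>2 - 6 * s - h\<^sup>2) / (p * (u * v))"
  proof -
    have "B (x + h) s - 2 * B x s + B (x - h) s = s / u - 2 * (s / p) + s / v"
      by (simp add: B_def p_def u_def v_def)
    also have "\<dots> = s * (v * p - 2 * (u * v) + u * p) / (p * (u * v))"
      using p by (simp add: divide_simps) (simp add: algebra_simps)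
    also have "v * p - 2 * (u * v) + u * p = h\<^sup>2 * (2 * (3 * x\<^sup>2 - 6 * s - h\<^sup>2))"
      unfolding uv by (simp add: u_def v_def p_def power2_eq_square power4_eq_xxxx algebra_simps)
    finally show ?thesis using h by simp
  qed
  moreover have "1 / (5 * p) \<le> x\<^sup>2 / p\<^sup>2 - 2 * s * (3 * x\<^sup>2 - 6 * s - h\<^sup>2) / (p * (u * v))"
  proof -
    have px: "24 * s * x\<^sup>2 \<le> p\<^sup>2"
      using zero_le_power2[of "x\<^sup>2 - 6 * s"] by (simp add: p_def power2_eq_square algebra_simps)
    have ps: "36 * s\<^sup>2 \<le> p\<^sup>2"
    proof -
      have "(6 * s)\<^sup>2 \<le> p\<^sup>2" using s0 by (intro power_mono) (auto simp: p_def)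
      then show ?thesis by (simp add: power_mult_distrib)
    qed
    have target: "1 / (5 * p) \<le> x\<^sup>2 / p\<^sup>2 - Q'"
      if "Q' \<le> q / p ^ 3" "p\<^sup>2 / 5 \<le> x\<^sup>2 * p - q" for Q' q
    proof -
      have "1 / (5 * p) = (p\<^sup>2 / 5) / p ^ 3" using p by (simp add: power2_eq_square power3_eq_cube)
      also have "\<dots> \<le> (x\<^sup>2 * p - q) / p ^ 3" using that(2) p by (intro divide_right_mono) auto
      also have "\<dots> = x\<^sup>2 / p\<^sup>2 - q / p ^ 3" using p by (simp add: diff_divide_distrib power2_eq_square power3_eq_cube)
      finally show ?thesis using that(1) by linarith
    qed
    let ?num = "2 * s * (3 * x\<^sup>2 - 6 * s - h\<^sup>2)"
    \<comment> \<open>The sign of the numerator decides which bound on \<open>u * v\<close> is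
      needed: a lower one where the space term is harmful, none in between, where the time term
      suffices alone, and an upper one where the space term has to help.\<close>
    consider "6 * s + h\<^sup>2 \<le> 3 * x\<^sup>2" | "3 * x\<^sup>2 < 6 * s + h\<^sup>2" "2 * s < x\<^sup>2" | "x\<^sup>2 \<le> 2 * s" by linarith
    then show ?thesis
    proof cases
      case 1
      show ?thesis
      proof (rule target)
        have "h\<^sup>2 * x\<^sup>2 \<le> s * x\<^sup>2" using s0 by (intro mult_right_mono) auto
        moreover have "0 \<le> 2 * h\<^sup>2 * (6 * s) + h ^ 4" using s0 by auto
        \<comment> \<open>The only negative contribution, \<open>2 * h\<^sup>2 * x\<^sup>2\<close>,
          is at most \<open>2 * s * x\<^sup>2\<close>, which is a twelfth of
          \<open>p\<^sup>2\<close> by \<open>px\<close>.\<close>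
        ultimately have D: "11 / 12 * p\<^sup>2 \<le> u * v" unfolding uv using px by (simp add: algebra_simps)
        have "?num / (p * (u * v)) \<le> ?num / (p * (11 / 12 * p\<^sup>2))"
          using D 1 s0 p by (intro divide_left_mono mult_left_mono mult_pos_pos) auto
        also have "\<dots> = (24 / 11 * s * (3 * x\<^sup>2 - 6 * s - h\<^sup>2)) / p ^ 3"
          using p by (simp add: power2_eq_square power3_eq_cube)
        also have "\<dots> \<le> (24 / 11 * s * (3 * x\<^sup>2 - 6 * s)) / p ^ 3"
          using s0 p by (intro divide_right_mono mult_left_mono) auto
        finally show "?num / (p * (u * v)) \<le> (24 / 11 * s * (3 * x\<^sup>2 - 6 * s)) / p ^ 3" .
        \<comment> \<open>The numbers come from completing the square in \<open>w\<close>, here and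
          in the third case.\<close>
        have "(w + 6 * s)\<^sup>2 / 5 \<le> w * (w + 6 * s) - 24 / 11 * s * (3 * w - 6 * s)" for w :: real
          by (rule le_from_squares[where u = "w - 81 / 44 * s" and m = "1539 / 484" and s = s])
            (simp_all add: power2_eq_square field_simps)
        then show "p\<^sup>2 / 5 \<le> x\<^sup>2 * p - 24 / 11 * s * (3 * x\<^sup>2 - 6 * s)"
          unfolding p_def .
      qed
    next
      case 2
      have "?num / (p * (u * v)) \<le> 0"
        using 2 s0 p by (intro divide_nonpos_pos) (auto intro: mult_nonneg_nonpos)
      moreover have "1 / (5 * p) \<le> x\<^sup>2 / p\<^sup>2"
      proof -
        have "p * p \<le> 5 * x\<^sup>2 * p" using 2 p by (intro mult_right_mono) (auto simp: p_def)
        then show ?thesis using p by (simp add: divide_simps power2_eq_square)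
      qed
      ultimately show ?thesis by linarith
    next
      case 3
      show ?thesis
      proof (rule target)
        have "h\<^sup>2 * s \<le> s * s" using s0 by (intro mult_right_mono) auto
        moreover have "h ^ 4 \<le> s * s"
          using mult_mono[OF s0(3) s0(3)] s0 by (simp add: power2_eq_square power4_eq_xxxx)
        moreover have "0 \<le> h\<^sup>2 * x\<^sup>2" by simp
        \<comment> \<open>The positive contributions are at most \<open>13 * s\<^sup>2\<close>,
          hence \<open>13 / 36\<close> of \<open>p\<^sup>2\<close> by \<open>ps\<close>.\<close>
        ultimately have D: "u * v \<le> 49 / 36 * p\<^sup>2" unfolding uv using ps by (simp add: algebra_simps power2_eq_square)
        have "?num \<le> 2 * s * (3 * x\<^sup>2 - 6 * s)" using s0 by (intro mult_left_mono) auto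
        then have "?num / (p * (u * v)) \<le> (2 * s * (3 * x\<^sup>2 - 6 * s)) / (p * (u * v))"
          using p by (intro divide_right_mono) auto
        also have "\<dots> \<le> (2 * s * (3 * x\<^sup>2 - 6 * s)) / (p * (49 / 36 * p\<^sup>2))"
        proof (rule divide_left_mono_neg)
          show "2 * s * (3 * x\<^sup>2 - 6 * s) \<le> 0" using 3 s0 by (intro mult_nonneg_nonpos) auto
        qed (use D p in \<open>auto intro: mult_left_mono\<close>)
        also have "\<dots> = (72 / 49 * s * (3 * x\<^sup>2 - 6 * s)) / p ^ 3"
          using p by (simp add: power2_eq_square power3_eq_cube)
        finally show "?num / (p * (u * v)) \<le> (72 / 49 * s * (3 * x\<^sup>2 - 6 * s)) / p ^ 3" .
        have "(w + 6 * s)\<^sup>2 / 5 \<le> w * (w + 6 * s) - 72 / 49 * s * (3 * w - 6 * s)" for w :: real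
          by (rule le_from_squares[where u = "w - 99 / 196 * s" and m = "13563 / 9604" and s = s])
            (simp_all add: power2_eq_square field_simps)
        then show "p\<^sup>2 / 5 \<le> x\<^sup>2 * p - 72 / 49 * s * (3 * x\<^sup>2 - 6 * s)"
          unfolding p_def .
      qed
    qed
  qed
  ultimately show ?thesis unfolding time space p_def[symmetric] by linarith
qed

lemma corner_barrier_time_mono:
  fixes x s s' :: real
  assumes "0 < s'" "s' \<le> s"
  shows "s' / (x\<^sup>2 + 6 * s') \<le> s / (x\<^sup>2 + 6 * s)"
proof -
  have "0 < x\<^sup>2 + 6 * s'" "0 < x\<^sup>2 + 6 * s" using assms by (auto intro: add_nonneg_pos)
  moreover have "s' * x\<^sup>2 \<le> s * x\<^sup>2" using assms by (intro mult_right_mono) auto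
  ultimately show ?thesis by (simp add: divide_simps) (simp add: algebra_simps)
qed

text \<open>Away from the corner the barrier is not expected to help, only not to harm: its second
  derivative is at most \<open>1 / (v\<^sup>2 + 6 * s)\<close> in absolute value, whatever the mesh
  steps are.\<close>

lemma corner_barrier_coarse:
  fixes x s A :: real
  assumes "0 < s" "0 < h1" "0 < h2" "0 < A" "\<And>v. x - h1 < v \<Longrightarrow> A \<le> v\<^sup>2 + 6 * s"
  defines "B \<equiv> \<lambda>x. s / (x\<^sup>2 + 6 * s)"
  shows "((B (x + h2) - B x) / h2 - (B x - B (x - h1)) / h1) / ((h1 + h2) / 2) \<le> 2 / A"
proof -
  have "\<bar>(B (x + h2) - B x) / h2 - (B x - B (x - h1)) / h1\<bar> \<le> 1 / A * (h1 + h2)"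
  proof (rule nonuniform_second_difference_bound[where ?g1.0 = "\<lambda>x. - (2 * x * s / (x\<^sup>2 + 6 * s)\<^sup>2)"
        and ?g2.0 = "\<lambda>x. s * (6 * x\<^sup>2 - 12 * s) / (x\<^sup>2 + 6 * s) ^ 3"])
    show "continuous_on {x - h1..x + h2} B"
      unfolding B_def using assms(1) by (intro continuous_intros) (auto simp: add_nonneg_eq_0_iff)
    fix v assume v: "x - h1 < v" "v < x + h2"
    show "(B has_real_derivative - (2 * v * s / (v\<^sup>2 + 6 * s)\<^sup>2)) (at v)"
      "((\<lambda>x. - (2 * x * s / (x\<^sup>2 + 6 * s)\<^sup>2)) has_real_derivative
        s * (6 * v\<^sup>2 - 12 * s) / (v\<^sup>2 + 6 * s) ^ 3) (at v)"
      unfolding B_def by (rule corner_barrier[OF assms(1)])+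
    define p where "p = v\<^sup>2 + 6 * s"
    have p: "0 < p" "A \<le> p" using assms(1) assms(5)[OF v(1)] by (auto simp: p_def intro: add_nonneg_pos)
    have "\<bar>s * (6 * v\<^sup>2 - 12 * s)\<bar> \<le> p\<^sup>2"
    proof -
      have "\<bar>6 * v\<^sup>2 - 12 * s\<bar> \<le> 6 * p" using assms(1) by (simp add: p_def abs_le_iff)
      then have "\<bar>s * (6 * v\<^sup>2 - 12 * s)\<bar> \<le> s * (6 * p)"
        unfolding abs_mult using assms(1) by (intro mult_mono) auto
      also have "\<dots> = (6 * s) * p" by simp
      also have "\<dots> \<le> p * p" using p by (intro mult_right_mono) (auto simp: p_def)
      finally show ?thesis by (simp add: power2_eq_square)
    qed
    then have "\<bar>s * (6 * v\<^sup>2 - 12 * s)\<bar> / p ^ 3 \<le> p\<^sup>2 / p ^ 3" using p by (intro divide_right_mono) auto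
    also have "\<dots> = 1 / p" using p by (simp add: power2_eq_square power3_eq_cube)
    also have "\<dots> \<le> 1 / A" using p assms(4) by (intro divide_left_mono) auto
    finally show "\<bar>s * (6 * v\<^sup>2 - 12 * s) / (v\<^sup>2 + 6 * s) ^ 3\<bar> \<le> 1 / A" using p by (simp add: abs_divide p_def)
  qed (use assms in auto)
  then have "(B (x + h2) - B x) / h2 - (B x - B (x - h1)) / h1 \<le> 1 / A * (h1 + h2)" by linarith
  then have "((B (x + h2) - B x) / h2 - (B x - B (x - h1)) / h1) / ((h1 + h2) / 2) \<le> (1 / A * (h1 + h2)) / ((h1 + h2) / 2)"
    using assms by (intro divide_right_mono) auto
  moreover have "(1 / A * (h1 + h2)) / ((h1 + h2) / 2) = 2 / A" using assms(2-4) by (simp add: divide_simps)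
  ultimately show ?thesis by (simp only:)
qed

text \<open>The affine function active at \<open>x\<close> lies above the concave minimum, which
  bounds the second difference by a jump of slopes. At a transition point the slopes are 1 and 0, or
  0 and -1; the result has the size of an inverse mesh step, enough to absorb an error of first
  order.\<close>

lemma kink_barrier:
  fixes x h1 h2 \<sigma> X :: real
  assumes "0 < h1" "0 < h2"
  defines "g \<equiv> \<lambda>x. min (min x \<sigma>) (X - x)"
  shows "((g (x + h2) - g x) / h2 - (g x - g (x - h1)) / h1) / ((h1 + h2) / 2) \<le> 0"
    and "x = \<sigma> \<or> x = X - \<sigma> \<Longrightarrow> 2 * \<sigma> \<le> X \<Longrightarrow>
      ((g (x + h2) - g x) / h2 - (g x - g (x - h1)) / h1) / ((h1 + h2) / 2) \<le> - 2 / (h1 + h2)"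
proof -
  have slope: "((g (x + h2) - g x) / h2 - (g x - g (x - h1)) / h1) / ((h1 + h2) / 2) \<le> 2 * (m2 - m1) / (h1 + h2)"
    if "g (x + h2) \<le> g x + m2 * h2" "g (x - h1) \<le> g x - m1 * h1" for m1 m2
  proof -
    have "(g (x + h2) - g x) / h2 \<le> m2" "m1 \<le> (g x - g (x - h1)) / h1"
      using that assms by (auto simp: pos_divide_le_eq pos_le_divide_eq algebra_simps)
    then have "((g (x + h2) - g x) / h2 - (g x - g (x - h1)) / h1) / ((h1 + h2) / 2) \<le> (m2 - m1) / ((h1 + h2) / 2)"
      using assms by (intro divide_right_mono) auto
    then show ?thesis by (simp add: mult.commute)
  qed
  have "g x = x \<or> g x = \<sigma> \<or> g x = X - x" by (simp add: g_def min_def)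
  then consider "g x = x" | "g x = \<sigma>" | "g x = X - x" by blast
  then show "((g (x + h2) - g x) / h2 - (g x - g (x - h1)) / h1) / ((h1 + h2) / 2) \<le> 0"
  proof cases
    case 1
    then show ?thesis using slope[of 1 1] assms by (simp add: g_def)
  next
    case 2
    then show ?thesis using slope[of 0 0] assms by (simp add: g_def)
  next
    case 3
    then show ?thesis using slope[of "-1" "-1"] assms by (simp add: g_def)
  qed
  assume s: "x = \<sigma> \<or> x = X - \<sigma>" "2 * \<sigma> \<le> X"
  from s(1) show "((g (x + h2) - g x) / h2 - (g x - g (x - h1)) / h1) / ((h1 + h2) / 2) \<le> - 2 / (h1 + h2)"
  proof
    assume "x = \<sigma>"
    then show ?thesis using slope[of 0 1] assms s by (simp add: g_def)
  next
    assume "x = X - \<sigma>"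
    then show ?thesis using slope[of "-1" 0] assms s by (simp add: g_def)
  qed
qed

subsection \<open>The scaled problem: the error of the scheme\<close>

lemma delta2_add: "delta2 X (\<lambda>i j. U i j + V i j) i j = delta2 X U i j + delta2 X V i j"
  by (simp add: delta2_def dx_plus_def dx_minus_def add_divide_distrib diff_divide_distrib algebra_simps)

lemma delta2_steps:
  assumes "0 < i" "X (i + 1) = X i + h2" "X (i - 1) = X i - h1"
  shows "delta2 X V i j = ((V (i + 1) j - V i j) / h2 - (V i j - V (i - 1) j) / h1) / ((h1 + h2) / 2)"
  unfolding delta2_eq[OF assms(1)] assms(2,3) by simp

lemma delta2_cmult: "delta2 X (\<lambda>i j. k * V i j) i j = k * delta2 X V i j"
  by (simp add: delta2_def dx_plus_def dx_minus_def right_diff_distrib diff_divide_distrib)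

lemma delta2_const: "delta2 X (\<lambda>i j. k) i j = 0"
  by (simp add: delta2_def dx_plus_def dx_minus_def)

lemma dt_minus_add: "dt_minus S (\<lambda>i j. U i j + V i j) i j = dt_minus S U i j + dt_minus S V i j"
  by (simp add: dt_minus_def add_divide_distrib diff_divide_distrib algebra_simps)

lemma dt_minus_cmult: "dt_minus S (\<lambda>i j. k * V i j) i j = k * dt_minus S V i j"
  by (simp add: dt_minus_def right_diff_distrib diff_divide_distrib)

lemma dt_minus_const: "dt_minus S (\<lambda>i j. k) i j = 0" "dt_minus S (\<lambda>i j. V i) i j = 0"
  by (simp_all add: dt_minus_def)

lemma ln_le_half: "0 < x \<Longrightarrow> ln x \<le> x / 2" for x :: real
proof -
  assume x: "0 < x"
  have "ln x = 2 * ln (sqrt x)" using x by (simp add: ln_sqrt)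
  also have "\<dots> \<le> 2 * (sqrt x - 1)" using x by (intro mult_left_mono ln_le_minus_one) auto
  also have "\<dots> \<le> x / 2" using zero_le_power2[of "sqrt x - 2"] x by (simp add: power2_diff)
  finally show ?thesis .
qed

lemma ln_nat_ge:
  shows "2 \<le> n \<Longrightarrow> 2 / 3 \<le> ln (real n)" "4 \<le> n \<Longrightarrow> 1 \<le> ln (real n)"
proof -
  assume "2 \<le> n"
  then have "ln 2 \<le> ln (real n)" by simp
  then show "2 / 3 \<le> ln (real n)" using ln2_ge_two_thirds by linarith
next
  assume "4 \<le> n"
  then have "ln (2\<^sup>2) \<le> ln (real n)" by simp
  moreover have "ln (2\<^sup>2 :: real) = 2 * ln 2" by (subst ln_realpow) simp_all
  ultimately show "1 \<le> ln (real n)" using ln2_ge_two_thirds by linarith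
qed

context scaled_problem begin

text \<open>\<open>CE\<close> multiplies the singular factor of the truncation error. The summands
  of \<open>CV\<close> belong to the cases of the space error off uniform fine stencils: four
  intervals only, coarse step above \<open>a\<close>, interior of the coarse part, transition
  points. \<open>Ca\<close> is the height of the constant barrier and \<open>CF\<close> that of all
  barriers together.\<close>

definition CE where "CE = CT * (4 * K + 6) + 64 * K * CX"
definition CV where "CV = 48 * CX + 3 * CY * (4 * \<beta> + 2 * exp 4) + CY * (4 + 2 * a\<^sup>2)
  + CY * (4 + 2 * exp 1 * a\<^sup>2) + 8 * exp 1 * a * CY"
definition Ca where "Ca = (CE * (1 + \<beta>) + CV) / \<beta> + 35 * CE"
definition CF where "CF = Ca + 35 * CE + 4 * CY"

lemma CE: "0 \<le> CE" using CT CX K_pos by (simp add: CE_def)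

lemma CV: "0 \<le> CV" using CX CY a_pos beta_pos by (auto simp: CV_def intro!: add_nonneg_nonneg mult_nonneg_nonneg)

lemma Ca: "0 \<le> Ca" using CE CV beta_pos by (auto simp: Ca_def intro!: add_nonneg_nonneg divide_nonneg_pos)

end

text \<open>\<open>h\<close> and \<open>H\<close> are the fine and coarse space steps and
  \<open>sg\<close> the transition point, all in scaled length. \<open>xs_step\<close> separates the
  uniform mesh (then \<open>H\<close> and \<open>sg\<close> carry no information) from the piecewise
  uniform one. \<open>ts_step\<close> is all that is kept of the time mesh: a step is either short,
  or taken where the initial layer has fallen to \<open>1 / M\<close>.\<close>

locale scaled_scheme = scaled_problem +
  fixes N M n4 :: nat and xs ts :: "nat \<Rightarrow> real" and Y :: "nat \<Rightarrow> nat \<Rightarrow> real" and h H sg \<nu> \<mu> :: real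
  assumes N_eq: "N = 4 * n4" and n4: "0 < n4" and M_ge: "2 \<le> M"
    and \<nu>_eq: "\<nu> = (ln (real N) / real N)\<^sup>2" and \<mu>_eq: "\<mu> = ln (real M) / real M"
    and xs_ends: "xs 0 = 0" "xs N = X" and ts_ends: "ts 0 = 0" "ts M = Th"
    and ts_less: "\<And>j. j < M \<Longrightarrow> ts j < ts (Suc j)"
    and ts_step: "\<And>j. 0 < j \<Longrightarrow> j \<le> M \<Longrightarrow> ts j - ts (j - 1) \<le> 2 * K * \<mu> \<or>
      (ts j - ts (j - 1)) * d\<^sup>2 \<le> 2 / M \<and> exp (- \<beta> * ts (j - 1)) \<le> 1 / M"
    and h: "0 < h" "h\<^sup>2 \<le> 64 * K * \<nu>"
    and xs_step: "(\<forall>i<N. xs (Suc i) - xs i = h) \<or>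
      (sg = 2 * (1 / sqrt \<beta>) * ln (real N) \<and> 4 * sg < X \<and> h = 4 * sg / N \<and> h \<le> H \<and> H \<le> 2 / (d * N) \<and>
        xs n4 = sg \<and> xs (3 * n4) = X - sg \<and>
        (\<forall>i<N. xs (Suc i) - xs i = (if n4 \<le> i \<and> i < 3 * n4 then H else h)))"
    and Y_eq: "\<And>i j. 0 < i \<Longrightarrow> i < N \<Longrightarrow> 0 < j \<Longrightarrow> j \<le> M \<Longrightarrow>
      dt_minus ts Y i j - delta2 xs Y i j + b (xs i) (ts j) * Y i j
        = f (xs i) (ts j) - (b (xs i) (ts j) - c) * W c a0 0 0 (xs i) (ts j)"
    and Y_bd: "\<And>i j. i \<le> N \<Longrightarrow> j \<le> M \<Longrightarrow> i = 0 \<or> i = N \<or> j = 0 \<Longrightarrow> Y i j = y (xs i) (ts j)"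
begin

definition layered where "layered \<longleftrightarrow>
   (sg = 2 * a * ln (real N) \<and> 4 * sg < X \<and> h = 4 * sg / N \<and> h \<le> H \<and> H \<le> 2 / (d * N) \<and>
        xs n4 = sg \<and> xs (3 * n4) = X - sg \<and>
        (\<forall>i<N. xs (Suc i) - xs i = (if n4 \<le> i \<and> i < 3 * n4 then H else h)))"

lemma N_ge: "4 \<le> N" using N_eq n4 by simp

lemma lnN: "1 \<le> ln (real N)" by (rule ln_nat_ge) (rule N_ge)

lemma lnM: "2 / 3 \<le> ln (real M)" by (rule ln_nat_ge) (rule M_ge)

lemma nu_ge: "1 / (real N)\<^sup>2 \<le> \<nu>" "0 < \<nu>"
proof -
  have "(1 / real N)\<^sup>2 \<le> \<nu>" unfolding \<nu>_eq using lnN N_ge by (intro power_mono divide_right_mono) auto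
  then show "1 / (real N)\<^sup>2 \<le> \<nu>" by (simp add: power_divide)
  moreover have "0 < 1 / (real N)\<^sup>2" using N_ge by simp
  ultimately show "0 < \<nu>" by linarith
qed

lemma mu_ge: "1 / real M \<le> 2 * \<mu>" "0 < \<mu>"
proof -
  have "1 / real M \<le> 2 * ln (real M) / real M" using lnM by (intro divide_right_mono) auto
  then show "1 / real M \<le> 2 * \<mu>" by (simp add: \<mu>_eq)
  show "0 < \<mu>" using lnM M_ge by (simp add: \<mu>_eq)
qed

lemma steps: "i < N \<Longrightarrow> xs (Suc i) - xs i = h \<or> xs (Suc i) - xs i = H \<and> layered"
  using xs_step unfolding layered_def a_def by (metis (no_types, lifting))

lemma xs_less: "i < N \<Longrightarrow> xs i < xs (Suc i)"
  using steps[of i] h by (auto simp: layered_def)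

lemma xs_mono: "i \<le> k \<Longrightarrow> k \<le> N \<Longrightarrow> xs i \<le> xs k"
proof (induction k rule: dec_induct)
  case (step k)
  then show ?case using xs_less[of k] by simp
qed simp

lemma ts_mono: "i \<le> k \<Longrightarrow> k \<le> M \<Longrightarrow> ts i \<le> ts k"
proof (induction k rule: dec_induct)
  case (step k)
  then show ?case using ts_less[of k] by simp
qed simp

lemma xs_range: "i \<le> N \<Longrightarrow> 0 \<le> xs i \<and> xs i \<le> X"
  using xs_mono[of 0 i] xs_mono[of i N] xs_ends by simp

lemma ts_range: "j \<le> M \<Longrightarrow> 0 \<le> ts j \<and> ts j \<le> Th"
  using ts_mono[of 0 j] ts_mono[of j M] ts_ends by simp

lemma xs_int: "0 < i \<Longrightarrow> i < N \<Longrightarrow> 0 < xs i \<and> xs i < X"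
  using xs_less[of "i - 1"] xs_less[of i] xs_range[of "i - 1"] xs_range[of "Suc i"] by force

lemma ts_int: "0 < j \<Longrightarrow> j \<le> M \<Longrightarrow> ts (j - 1) < ts j \<and> 0 \<le> ts (j - 1) \<and> 0 < ts j \<and> ts j \<le> Th"
  using ts_less[of "j - 1"] ts_range[of "j - 1"] ts_range[of j] by force

definition yn where "yn i j = y (xs i) (ts j)"
definition Bn where "Bn i j = (ts j + h\<^sup>2) / ((xs i)\<^sup>2 + 6 * (ts j + h\<^sup>2))"
definition g where "g x = min (min x sg) (X - x)"
definition gn where "gn i j = g (xs i)" for j :: nat

text \<open>A short step is estimated by \<open>y_time_trunc\<close> with a bounded weight. A step
  on the coarse part has both \<open>k * d\<^sup>2\<close> and the exponential of order
  \<open>1 / M\<close>, that is, a small product of step and weight.\<close>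

lemma time_error:
  assumes "0 < i" "i < N" "0 < j" "j \<le> M"
  shows "\<bar>dt_minus ts yn i j - yt (xs i) (ts j)\<bar> \<le> CT * (4 * K + 6) * \<mu> * (1 + 1 / ((xs i)\<^sup>2 + ts j))"
proof -
  define k t x q where "k = ts j - ts (j - 1)" and "t = ts j" and "x = xs i" and "q = 1 + 1 / (x\<^sup>2 + t)"
  have x: "0 < x" "x < X" using xs_int assms by (auto simp: x_def)
  have t: "0 < k" "k \<le> t" "t \<le> Th" "t - k = ts (j - 1)" "0 \<le> t - k" "0 < t"
    using ts_int[OF assms(3,4)] by (auto simp: k_def t_def)
  have q: "1 \<le> q" using t by (simp add: q_def add_nonneg_nonneg)
  have eq: "dt_minus ts yn i j - yt x t = - (yt x t - (y x t - y x (t - k)) / k)"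
    by (simp add: dt_minus_def yn_def k_def t_def x_def)
  define e where "e = \<bar>yt x t - (y x t - y x (t - k)) / k\<bar>"
  have crude: "e \<le> CT * wgt (t - k)" unfolding e_def by (rule y_time_crude) (use x t in auto)
  have fine: "e \<le> CT * k * (wgt t * q)" if "k \<le> 1"
    unfolding e_def q_def by (rule y_time_trunc) (use x t that in auto)
  have goal: "e \<le> CT * (4 * K + 6) * \<mu> * q" if "e \<le> CT * s * q" "s \<le> (4 * K + 6) * \<mu>" for s
  proof -
    have "CT * s * q \<le> CT * ((4 * K + 6) * \<mu>) * q"
      using that(2) CT q by (intro mult_right_mono mult_left_mono) auto
    then show ?thesis using that(1) by (simp add: mult.assoc)
  qed
  have kw: "(4 * K + 6) * \<mu> = 4 * K * \<mu> + 6 * \<mu>" by (simp add: distrib_right)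
  have pos: "0 \<le> K * \<mu>" using K_pos mu_ge by simp
  \<comment> \<open>Steps longer than one unit of scaled time are outside the reach of
    \<open>y_time_trunc\<close>, so for them the weight itself has to be small.\<close>
  have bound: "e \<le> CT * (4 * K + 6) * \<mu> * q"
    if w: "k \<le> 1 \<Longrightarrow> k * wgt t \<le> (4 * K + 6) * \<mu>" "1 < k \<Longrightarrow> wgt (t - k) \<le> (4 * K + 6) * \<mu>"
  proof (cases "k \<le> 1")
    case True
    show ?thesis by (rule goal[of "k * wgt t"]) (use fine[OF True] w(1)[OF True] in \<open>auto simp: mult.assoc\<close>)
  next
    case False
    have "CT * wgt (t - k) * 1 \<le> CT * wgt (t - k) * q"
      using q CT wgt_pos[of "t - k"] by (intro mult_left_mono mult_nonneg_nonneg) auto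
    then show ?thesis using goal[of "wgt (t - k)"] w(2) False crude by auto
  qed
  have "e \<le> CT * (4 * K + 6) * \<mu> * q"
    using ts_step[OF assms(3,4)]
  proof
    assume s: "ts j - ts (j - 1) \<le> 2 * K * \<mu>"
    then have s: "k \<le> 2 * K * \<mu>" by (simp add: k_def)
    show ?thesis
    proof (rule bound)
      have "k * wgt t \<le> (2 * K * \<mu>) * 2"
        using s t wgt_le[of t] wgt_pos[of t] pos by (intro mult_mono) auto
      then show "k * wgt t \<le> (4 * K + 6) * \<mu>" using mu_ge unfolding kw by linarith
      \<comment> \<open>Here \<open>\<mu>\<close> is bounded from below, and the trivial bound 2 on
        the weight suffices.\<close>
      assume "1 < k"
      then have "2 \<le> 4 * K * \<mu>" using s by linarith
      then show "wgt (t - k) \<le> (4 * K + 6) * \<mu>" using wgt_le[OF t(5)] mu_ge unfolding kw by linarith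
    qed
  next
    assume s: "(ts j - ts (j - 1)) * d\<^sup>2 \<le> 2 / M \<and> exp (- \<beta> * ts (j - 1)) \<le> 1 / M"
    then have s: "k * d\<^sup>2 \<le> 2 / M" "exp (- \<beta> * (t - k)) \<le> 1 / M" unfolding t(4) k_def[symmetric] by blast+
    have m: "2 / real M \<le> 4 * \<mu>" using mu_ge(1) by simp
    show ?thesis
    proof (rule bound)
      assume "k \<le> 1"
      have "exp (- \<beta> * t) \<le> exp (- \<beta> * (t - k))" using t beta_pos by simp
      then have "exp (- \<beta> * t) \<le> 1 / M" using s(2) by linarith
      then have "k * exp (- \<beta> * t) \<le> 1 * (1 / M)"
        using \<open>k \<le> 1\<close> t by (intro mult_mono) auto
      then have "k * wgt t \<le> 2 / M + 1 / M" using s by (simp add: wgt_def distrib_left)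
      then show "k * wgt t \<le> (4 * K + 6) * \<mu>" using m mu_ge pos unfolding kw by linarith
    next
      assume "1 < k"
      then have "1 * d\<^sup>2 \<le> k * d\<^sup>2" by (intro mult_right_mono) auto
      then have "wgt (t - k) \<le> 2 / M + 1 / M" using s by (simp add: wgt_def)
      then show "wgt (t - k) \<le> (4 * K + 6) * \<mu>" using m mu_ge pos unfolding kw by linarith
    qed
  qed
  then show ?thesis unfolding eq[unfolded x_def t_def] abs_minus_cancel by (simp add: e_def x_def t_def q_def)
qed

definition equi where "equi i \<longleftrightarrow> xs (Suc i) - xs i = h \<and> xs i - xs (i - 1) = h"

lemma not_fine:
  assumes "0 < i" "i < N" "\<not> equi i"
  shows "layered" "n4 \<le> i" "i \<le> 3 * n4"
proof -
  have s1: "xs (Suc i) - xs i = h \<or> layered" and s2: "xs i - xs (i - 1) = h \<or> layered"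
    using steps[of i] steps[of "i - 1"] assms by auto
  show l: "layered" using s1 s2 assms(3) by (auto simp: equi_def)
  have st: "xs (Suc k) - xs k = (if n4 \<le> k \<and> k < 3 * n4 then H else h)" if "k < N" for k
    using l that by (auto simp: layered_def)
  show "n4 \<le> i" "i \<le> 3 * n4" using st[of i] st[of "i - 1"] assms by (auto simp: equi_def split: if_splits)
qed

lemma fine_error:
  assumes "0 < i" "i < N" "0 < j" "j \<le> M" "equi i"
  shows "\<bar>delta2 xs yn i j - yxx (xs i) (ts j)\<bar> \<le> 64 * K * CX * \<nu> * (1 + 1 / ((xs i)\<^sup>2 + ts j))"
proof -
  have e: "xs (i + 1) = xs i + h" "xs (i - 1) = xs i - h" using assms(5) by (auto simp: equi_def)
  have r: "0 \<le> xs i - h" "xs i + h \<le> X" "0 < ts j" "ts j \<le> Th"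
    using e xs_range[of "i - 1"] xs_range[of "i + 1"] ts_int[OF assms(3,4)] assms by auto
  have q: "0 \<le> 1 + 1 / ((xs i)\<^sup>2 + ts j)" using r by (simp add: add_nonneg_nonneg)
  have "delta2 xs yn i j = (y (xs i + h) (ts j) - 2 * y (xs i) (ts j) + y (xs i - h) (ts j)) / h\<^sup>2"
    unfolding delta2_eq[OF assms(1)] yn_def e using h(1) by (simp add: diff_divide_distrib[symmetric] power2_eq_square)
  then have "\<bar>delta2 xs yn i j - yxx (xs i) (ts j)\<bar> \<le> CX * h\<^sup>2 * (1 + 1 / ((xs i)\<^sup>2 + ts j))"
    using y_space_trunc[OF r(3,4) h(1) r(1,2)] by simp
  also have "\<dots> \<le> CX * (64 * K * \<nu>) * (1 + 1 / ((xs i)\<^sup>2 + ts j))"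
    using h CX q by (intro mult_right_mono mult_left_mono) auto
  finally show ?thesis by (simp add: mult_ac)
qed

text \<open>Both neighbours lie on the mesh, so \<open>h \<le> x\<close> and the shift
  \<open>h\<^sup>2\<close> in the barrier can be replaced by \<open>x\<^sup>2\<close>:
  \<open>5 * (x\<^sup>2 + 6 * (t + h\<^sup>2))\<close> is at most
  \<open>35 * (x\<^sup>2 + t)\<close>.\<close>

lemma fine_barrier:
  assumes "0 < i" "i < N" "0 < j" "j \<le> M" "equi i"
  shows "1 / (35 * ((xs i)\<^sup>2 + ts j)) \<le> dt_minus ts Bn i j - delta2 xs Bn i j"
proof -
  define x s s' where "x = xs i" and "s = ts j + h\<^sup>2" and "s' = ts (j - 1) + h\<^sup>2"
  have e: "xs (i + 1) = x + h" "xs (i - 1) = x - h" using assms(5) by (auto simp: equi_def x_def)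
  have hx: "h \<le> x" using e xs_range[of "i - 1"] assms by simp
  have s: "h\<^sup>2 \<le> s'" "s' < s" using ts_int[OF assms(3,4)] by (auto simp: s_def s'_def)
  have t: "0 < ts j" using ts_int assms by auto
  have "h\<^sup>2 \<le> x\<^sup>2" using hx h by (intro power_mono) auto
  then have "5 * (x\<^sup>2 + 6 * s) \<le> 35 * (x\<^sup>2 + ts j)" using t by (simp add: s_def)
  moreover have "0 < x\<^sup>2 + 6 * s" "0 < x\<^sup>2 + ts j" using t s by (auto intro!: add_nonneg_pos le_less_trans[OF _ s(2)] order_trans[OF _ s(1)])
  ultimately have "1 / (35 * (x\<^sup>2 + ts j)) \<le> 1 / (5 * (x\<^sup>2 + 6 * s))" by (intro divide_left_mono) auto
  also note discrete_corner_barrier[OF h(1) hx s]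
  also have "(s / (x\<^sup>2 + 6 * s) - s' / (x\<^sup>2 + 6 * s')) / (s - s') = dt_minus ts Bn i j"
    by (simp add: dt_minus_def Bn_def x_def s_def s'_def)
  also have "(s / ((x + h)\<^sup>2 + 6 * s) - 2 * (s / (x\<^sup>2 + 6 * s)) + s / ((x - h)\<^sup>2 + 6 * s)) / h\<^sup>2 = delta2 xs Bn i j"
    unfolding delta2_eq[OF assms(1)] e Bn_def x_def[symmetric] s_def[symmetric]
    using h(1) by (simp add: diff_divide_distrib[symmetric] power2_eq_square)
  finally show ?thesis by (simp add: x_def)
qed

lemma gn_barrier:
  assumes "0 < i" "i < N"
  shows "delta2 xs gn i j \<le> 0"
proof -
  define h1 h2 where "h1 = xs i - xs (i - 1)" and "h2 = xs (i + 1) - xs i"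
  have p: "0 < h1" "0 < h2" using xs_less[of i] xs_less[of "i - 1"] assms by (auto simp: h1_def h2_def)
  have e: "xs (i + 1) = xs i + h2" "xs (i - 1) = xs i - h1" by (auto simp: h1_def h2_def)
  show ?thesis using kink_barrier(1)[OF p, of "xs i" sg X]
    unfolding delta2_eq[OF assms(1)] gn_def g_def e by simp
qed

lemma gn_kink:
  assumes "0 < i" "i < N" "xs i = sg \<or> xs i = X - sg" "2 * sg \<le> X"
  shows "delta2 xs gn i j \<le> - 2 / (xs (Suc i) - xs (i - 1))"
proof -
  define h1 h2 where "h1 = xs i - xs (i - 1)" and "h2 = xs (i + 1) - xs i"
  have p: "0 < h1" "0 < h2" using xs_less[of i] xs_less[of "i - 1"] assms by (auto simp: h1_def h2_def)
  have e: "xs (i + 1) = xs i + h2" "xs (i - 1) = xs i - h1" by (auto simp: h1_def h2_def)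
  have d: "xs (Suc i) - xs (i - 1) = h1 + h2" by (simp add: h1_def h2_def)
  have "delta2 xs gn i j \<le> - 2 / (h1 + h2)" using kink_barrier(2)[OF p assms(3,4)]
    unfolding delta2_steps[OF assms(1) e] gn_def g_def e by simp
  then show ?thesis by (simp only: d)
qed

text \<open>No cancellation between difference quotient and derivative is used: the former
  contributes \<open>2 * A\<close>, the latter \<open>A\<close>.\<close>

lemma crude_error:
  assumes "0 < i" "i < N" "0 < j" "j \<le> M"
    and A: "\<And>x. xs (i - 1) < x \<Longrightarrow> x < xs (i + 1) \<Longrightarrow> \<bar>yxx x (ts j)\<bar> \<le> A"
  shows "\<bar>delta2 xs yn i j - yxx (xs i) (ts j)\<bar> \<le> 3 * A"
proof -
  define h1 h2 where "h1 = xs i - xs (i - 1)" and "h2 = xs (i + 1) - xs i"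
  have p: "0 < h1" "0 < h2" using xs_less[of i] xs_less[of "i - 1"] assms by (auto simp: h1_def h2_def)
  have e: "xs (i + 1) = xs i + h2" "xs (i - 1) = xs i - h1" by (auto simp: h1_def h2_def)
  have r: "0 \<le> xs i - h1" "xs i + h2 \<le> X" "0 < ts j" "ts j \<le> Th"
    using e xs_range[of "i - 1"] xs_range[of "i + 1"] ts_int[OF assms(3,4)] assms by auto
  define D where "D = (y (xs i + h2) (ts j) - y (xs i) (ts j)) / h2 - (y (xs i) (ts j) - y (xs i - h1) (ts j)) / h1"
  have "\<bar>D\<bar> \<le> A * (h1 + h2)"
    unfolding D_def
  proof (rule nonuniform_second_difference_bound[where ?g1.0 = "\<lambda>x. yx x (ts j)" and ?g2.0 = "\<lambda>x. yxx x (ts j)"])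
    show "continuous_on {xs i - h1..xs i + h2} (\<lambda>x. y x (ts j))"
      by (rule continuous_on_slice_x[OF regD(1)[OF y_reg]]) (use r in auto)
  qed (use p r A[unfolded e] in \<open>auto intro!: y_derivs\<close>)
  then have "\<bar>D\<bar> / ((h1 + h2) / 2) \<le> A * (h1 + h2) / ((h1 + h2) / 2)" using p by (intro divide_right_mono) auto
  moreover have "A * (h1 + h2) / ((h1 + h2) / 2) = 2 * A" using p by (simp add: field_simps)
  moreover have "\<bar>delta2 xs yn i j\<bar> = \<bar>D\<bar> / ((h1 + h2) / 2)"
    unfolding delta2_steps[OF assms(1) e] yn_def e D_def abs_divide using p by (simp only: abs_of_pos) 
  moreover have "\<bar>yxx (xs i) (ts j)\<bar> \<le> A" using A[of "xs i"] p e by simp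
  ultimately show ?thesis by linarith
qed

section \<open>Space errors and barriers on the piecewise uniform mesh\<close>

context
  assumes layered: layered
begin

lemma sg_eq: "sg = 2 * a * ln (real N)" "4 * sg < X" "h = 4 * sg / N" "h \<le> H" "H \<le> 2 / (d * N)" "xs n4 = sg" "xs (3 * n4) = X - sg"
  and step: "i < N \<Longrightarrow> xs (Suc i) - xs i = (if n4 \<le> i \<and> i < 3 * n4 then H else h)"
  using layered by (auto simp: layered_def)

lemma step': "0 < i \<Longrightarrow> i \<le> N \<Longrightarrow> xs i - xs (i - 1) = (if n4 < i \<and> i \<le> 3 * n4 then H else h)"
  using step[of "i - 1"] by (cases i) auto

lemma sg: "2 * a \<le> sg" "h \<le> sg"
proof -
  show *: "2 * a \<le> sg" using sg_eq(1) lnN a_pos mult_left_mono[of 1 "ln (real N)" "2 * a"] by simp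
  have "4 * sg \<le> real N * sg" using N_ge * a_pos by (intro mult_right_mono) auto
  then show "h \<le> sg" unfolding sg_eq(3) using N_ge by (simp add: divide_le_eq mult.commute)
qed

text \<open>The factor 2 in \<open>sigma\<close> is what makes the layer negligible to second order
  at the transition point.\<close>

lemma E_sg: "E sg = 1 / (real N)\<^sup>2"
proof -
  have "sqrt \<beta> * sg = 2 * ln (real N)" using beta_pos by (simp add: sg_eq(1) a_def)
  moreover have "exp (2 * ln (real N)) = (real N)\<^sup>2" using N_ge by (simp add: exp_of_nat_mult[of 2, simplified])
  ultimately show ?thesis by (simp add: E_def exp_minus field_simps)
qed

lemma E_shift: "E (sg - r) = exp (sqrt \<beta> * r) / (real N)\<^sup>2"
proof -
  have "E (sg - r) = E sg * exp (sqrt \<beta> * r)" by (simp add: E_def exp_add[symmetric] algebra_simps)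
  then show ?thesis by (simp add: E_sg)
qed

lemma stencil:
  assumes "n4 \<le> i" "i \<le> 3 * n4"
  shows "0 < i" "i < N" "sg - h \<le> xs (i - 1)" "xs (i + 1) \<le> X - sg + h" "sg \<le> xs i" "xs i \<le> X - sg"
proof -
  show i: "0 < i" "i < N" using assms N_eq n4 by auto
  have "xs (n4 - 1) = sg - h" "xs (3 * n4 + 1) = X - sg + h"
    using step'[of n4] step[of "3 * n4"] n4 N_eq sg_eq(6,7) by simp_all
  then show "sg - h \<le> xs (i - 1)" "xs (i + 1) \<le> X - sg + h"
    using xs_mono[of "n4 - 1" "i - 1"] xs_mono[of "i + 1" "3 * n4 + 1"] assms i N_eq n4 by auto
  show "sg \<le> xs i" "xs i \<le> X - sg"
    using xs_mono[of n4 i] xs_mono[of i "3 * n4"] assms i N_eq sg_eq(6,7) by auto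
qed

text \<open>The time part is nonnegative by monotonicity in \<open>s\<close>. The space part is at
  most \<open>4 / sg\<^sup>2\<close>, because the stencil stays to the right of
  \<open>sg - h\<close>, and \<open>2 * a \<le> sg\<close> turns this into
  \<open>\<beta>\<close>.\<close>

lemma coarse_barrier:
  assumes "n4 \<le> i" "i \<le> 3 * n4" "0 < j" "j \<le> M"
  shows "- \<beta> \<le> dt_minus ts Bn i j - delta2 xs Bn i j"
proof -
  note st = stencil[OF assms(1,2)]
  define h1 h2 s where "h1 = xs i - xs (i - 1)" and "h2 = xs (i + 1) - xs i" and "s = ts j + h\<^sup>2"
  have p: "0 < h1" "0 < h2" using xs_less[of i] xs_less[of "i - 1"] st by (auto simp: h1_def h2_def)
  have e: "xs (i + 1) = xs i + h2" "xs (i - 1) = xs i - h1" by (auto simp: h1_def h2_def)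
  have t: "0 < ts j" "ts (j - 1) < ts j" "0 \<le> ts (j - 1)" using ts_int[OF assms(3,4)] by auto
  have h2pos: "0 < h\<^sup>2" using h by simp
  have "0 \<le> dt_minus ts Bn i j"
    unfolding dt_minus_def Bn_def
  proof (rule divide_nonneg_pos)
    have "(ts (j - 1) + h\<^sup>2) / ((xs i)\<^sup>2 + 6 * (ts (j - 1) + h\<^sup>2)) \<le> (ts j + h\<^sup>2) / ((xs i)\<^sup>2 + 6 * (ts j + h\<^sup>2))"
      by (rule corner_barrier_time_mono) (use t h2pos in linarith)+
    then show "0 \<le> (ts j + h\<^sup>2) / ((xs i)\<^sup>2 + 6 * (ts j + h\<^sup>2)) - (ts (j - 1) + h\<^sup>2) / ((xs i)\<^sup>2 + 6 * (ts (j - 1) + h\<^sup>2))"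
      by simp
  qed (use t in simp)
  moreover have "delta2 xs Bn i j \<le> 2 / (sg\<^sup>2 / 2)"
    unfolding delta2_steps[OF st(1) e] e Bn_def s_def[symmetric]
  proof (rule corner_barrier_coarse)
    fix v assume "xs i - h1 < v"
    then have v: "sg - h \<le> v" using st e by simp
    have "(sg - h)\<^sup>2 \<le> v\<^sup>2" using v sg by (intro power_mono) auto
    moreover have "sg\<^sup>2 / 2 \<le> (sg - h)\<^sup>2 + 6 * h\<^sup>2"
      using zero_le_power2[of "sg - 2 * h"] h2pos by (simp add: power2_eq_square algebra_simps)
    ultimately show "sg\<^sup>2 / 2 \<le> v\<^sup>2 + 6 * s" using t by (simp add: s_def)
  qed (use p t h2pos sg a_pos in \<open>auto simp: s_def intro: add_pos_pos\<close>)
  moreover have "2 / (sg\<^sup>2 / 2) \<le> \<beta>"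
  proof -
    have "(2 * a)\<^sup>2 \<le> sg\<^sup>2" using sg a_pos by (intro power_mono) auto
    moreover have "(2 * a)\<^sup>2 = 4 / \<beta>" using beta_pos by (simp add: a_def power_mult_distrib power_divide)
    ultimately have "4 / \<beta> \<le> sg\<^sup>2" by simp
    then have "4 \<le> sg\<^sup>2 * \<beta>" using beta_pos by (simp add: divide_le_eq)
    moreover have "0 < sg\<^sup>2" using sg a_pos by simp
    ultimately show ?thesis by (simp add: divide_le_eq mult.commute)
  qed
  ultimately show ?thesis by linarith
qed

text \<open>On coarse meshes, \<open>a < H\<close>, second derivatives are already small enough.\<close>

lemma coarse_error_crude:
  assumes "n4 = 1 \<or> a < H" "n4 \<le> i" "i \<le> 3 * n4" "0 < j" "j \<le> M"
  shows "\<bar>delta2 xs yn i j - yxx (xs i) (ts j)\<bar> \<le> CV * \<nu>"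
proof -
  note st = stencil[OF assms(2,3)]
  have t: "0 < ts j" "ts j \<le> Th" using ts_int[OF assms(4,5)] by auto
  show ?thesis
  proof (cases "n4 = 1")
    case True
    \<comment> \<open>With four intervals nothing needs to be small:
      \<open>1 = 16 / N\<^sup>2\<close>, which explains 48.\<close>
    have "\<bar>delta2 xs yn i j - yxx (xs i) (ts j)\<bar> \<le> 3 * CX"
      using xs_range[of "i - 1"] xs_range[of "i + 1"] st t by (intro crude_error[OF st(1,2) assms(4,5)] yxx_le) force+
    also have "\<dots> = 48 * CX * (1 / (real N)\<^sup>2)" using True N_eq by simp
    also have "\<dots> \<le> CV * \<nu>"
      using nu_ge CX CY a_pos beta_pos CV
      by (intro mult_mono) (auto simp: CV_def intro!: add_nonneg_nonneg mult_nonneg_nonneg)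
    finally show ?thesis .
  next
    case False
    then have N8: "8 \<le> N" using N_eq n4 by simp
    have aH: "a < H" using assms(1) False by simp
    have hs: "2 * h \<le> sg"
    proof -
      have "8 * sg \<le> real N * sg" using N8 sg a_pos by (intro mult_right_mono) auto
      then show ?thesis unfolding sg_eq(3) using N_ge by (simp add: divide_le_eq mult.commute)
    qed
    \<comment> \<open>One fine step inside the layer enlarges \<open>E\<close> by a bounded factor
      only, as \<open>sqrt \<beta> * h = 8 * ln N / N\<close>.\<close>
    have eh: "exp (sqrt \<beta> * h) \<le> exp 4"
    proof -
      have "sqrt \<beta> * h = 8 * (ln (real N) / N)"
        using beta_pos by (simp add: sg_eq(1,3) a_def)
      also have "ln (real N) / N \<le> (N / 2) / N" using N_ge by (intro divide_right_mono ln_le_half) auto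
      finally show ?thesis using N_ge by simp
    qed
    \<comment> \<open>A coarse step above \<open>a\<close> means that \<open>d\<close> is small
      compared with \<open>1 / N\<close>, so even the smooth part of the second derivative is
      negligible.\<close>
    have dd: "d\<^sup>2 \<le> 4 * \<beta> / (real N)\<^sup>2"
    proof -
      have "a < 2 / (d * N)" using aH sg_eq(5) by linarith
      then have "d < 2 / (a * N)" using a_pos d N_ge by (simp add: field_simps)
      then have "d\<^sup>2 \<le> (2 / (a * N))\<^sup>2" using d by (intro power_mono) auto
      then show ?thesis using beta_pos by (simp add: a_def power_divide power_mult_distrib)
    qed
    have "\<bar>yxx x (ts j)\<bar> \<le> CY * lay 2 (sg - h) (X - sg + h)" if "xs (i - 1) < x" "x < xs (i + 1)" for x
      by (rule yxx_lay) (use that st hs sg t in auto)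
    then have "\<bar>delta2 xs yn i j - yxx (xs i) (ts j)\<bar> \<le> 3 * (CY * lay 2 (sg - h) (X - sg + h))"
      by (rule crude_error[OF st(1,2) assms(4,5)])
    also have "lay 2 (sg - h) (X - sg + h) \<le> 4 * \<beta> / (real N)\<^sup>2 + exp 4 / (real N)\<^sup>2 + exp 4 / (real N)\<^sup>2"
    proof -
      have "exp (sqrt \<beta> * h) / (real N)\<^sup>2 \<le> exp 4 / (real N)\<^sup>2" using eh by (intro divide_right_mono) auto
      then show ?thesis using dd by (simp add: lay_def E_shift)
    qed
    also have "4 * \<beta> / (real N)\<^sup>2 + exp 4 / (real N)\<^sup>2 + exp 4 / (real N)\<^sup>2 = (4 * \<beta> + 2 * exp 4) * (1 / (real N)\<^sup>2)"
      by (simp add: add_divide_distrib)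
    finally have "\<bar>delta2 xs yn i j - yxx (xs i) (ts j)\<bar> \<le> (3 * CY * (4 * \<beta> + 2 * exp 4)) * (1 / (real N)\<^sup>2)"
      using CY by (simp add: mult_left_mono mult.assoc)
    also have "\<dots> \<le> CV * \<nu>"
      using nu_ge CX CY a_pos beta_pos CV
      by (intro mult_mono) (auto simp: CV_def intro!: add_nonneg_nonneg mult_nonneg_nonneg)
    finally show ?thesis .
  qed
qed

text \<open>Inside the coarse part the mesh is uniform, and fourth differences give
  \<open>d ^ 4 * H\<^sup>2\<close> plus layers already below \<open>1 / N\<^sup>2\<close>. At the
  transition points the term \<open>4 * CY * d ^ 3 * H\<close> of \<open>y_trunc_nonuniform\<close>
  remains; the second difference of the kink barrier is at most \<open>- 1 / H\<close> there, which
  dictates its coefficient. \<open>H \<le> a\<close> keeps the symmetric stencil of half-width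
  \<open>H\<close> at distance \<open>a\<close> from the lateral boundary.\<close>

lemma coarse_error:
  assumes "H \<le> a" "n4 \<le> i" "i \<le> 3 * n4" "0 < j" "j \<le> M"
  shows "\<bar>delta2 xs yn i j - yxx (xs i) (ts j)\<bar> \<le> CV * \<nu> - 4 * CY * d ^ 3 * H\<^sup>2 * delta2 xs gn i j"
proof -
  note st = stencil[OF assms(2,3)]
  have t: "0 < ts j" "ts j \<le> Th" using ts_int[OF assms(4,5)] by auto
  have H: "0 < H" using h sg_eq(4) by linarith
  have dH: "d ^ 4 * H\<^sup>2 \<le> 4 * (1 / (real N)\<^sup>2)"
  proof -
    have "d * H \<le> d * (2 / (d * N))" using d sg_eq(5) by (intro mult_left_mono) auto
    then have "d * H \<le> 2 / N" using d by simp
    then have "(d * H)\<^sup>2 \<le> (2 / N)\<^sup>2" using d H by (intro power_mono) auto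
    then have *: "d\<^sup>2 * H\<^sup>2 \<le> 4 * (1 / (real N)\<^sup>2)" by (simp add: power_mult_distrib power_divide)
    have "d\<^sup>2 * (d\<^sup>2 * H\<^sup>2) \<le> 1 * (4 * (1 / (real N)\<^sup>2))" by (rule mult_mono[OF d2(2) *]) auto
    then show ?thesis by (simp add: power2_eq_square power4_eq_xxxx mult.assoc)
  qed
  have H2: "H\<^sup>2 \<le> a\<^sup>2" using assms(1) H by (intro power_mono) auto
  define n2 where "n2 = 1 / (real N)\<^sup>2"
  have n2: "0 \<le> n2" "n2 \<le> \<nu>" using nu_ge by (auto simp: n2_def)
  have lay_H2: "CY * lay 4 p q * H\<^sup>2 \<le> CY * (4 + 2 * m * a\<^sup>2) * n2"
    if "E p \<le> m * n2" "E (X - q) \<le> m * n2" "0 \<le> m" for p q m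
  proof -
    have "E p * H\<^sup>2 \<le> (m * n2) * a\<^sup>2" "E (X - q) * H\<^sup>2 \<le> (m * n2) * a\<^sup>2"
      using that H2 n2 E_pos by (intro mult_mono; auto)+
    then have "lay 4 p q * H\<^sup>2 \<le> (4 + 2 * m * a\<^sup>2) * n2"
      using dH by (simp add: lay_def n2_def[symmetric] algebra_simps)
    then show ?thesis using CY mult_left_mono[of _ _ CY] by (simp add: mult.assoc)
  qed
  have CGn: "A * n2 \<le> CV * \<nu>" if "A \<le> CV" for A
    using that n2 CV mult_right_mono[of A CV n2] mult_left_mono[of n2 \<nu> CV] by linarith
  have CG1: "CY * (4 + 2 * 1 * a\<^sup>2) \<le> CV" "CY * (4 + 2 * exp 1 * a\<^sup>2) + 8 * exp 1 * a * CY \<le> CV"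
    using CX CY a_pos beta_pos by (auto simp: CV_def intro!: add_nonneg_nonneg mult_nonneg_nonneg)
  have k0: "0 \<le> 4 * CY * d ^ 3 * H\<^sup>2" using CY d by simp
  consider "n4 < i" "i < 3 * n4" | "i = n4 \<or> i = 3 * n4" using assms by linarith
  then show ?thesis
  proof cases
    case 1
    have e: "xs (i + 1) = xs i + H" "xs (i - 1) = xs i - H"
      using step[of i] step'[of i] 1 st by simp_all
    have r: "sg \<le> xs i - H" "xs i + H \<le> X - sg"
      using xs_mono[of n4 "i - 1"] xs_mono[of "i + 1" "3 * n4"] 1 st sg_eq(6,7) e N_eq by auto
    have "delta2 xs yn i j = (y (xs i + H) (ts j) - 2 * y (xs i) (ts j) + y (xs i - H) (ts j)) / H\<^sup>2"
      unfolding delta2_eq[OF st(1)] yn_def e using H by (simp add: diff_divide_distrib[symmetric] power2_eq_square)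
    then have "\<bar>delta2 xs yn i j - yxx (xs i) (ts j)\<bar> \<le> CY * lay 4 (xs i - H) (xs i + H) * H\<^sup>2"
      using y_trunc_lay(1)[of "xs i" H "ts j"] r sg a_pos H t by simp
    also have "\<dots> \<le> CY * (4 + 2 * 1 * a\<^sup>2) * n2"
      by (rule lay_H2) (use r in \<open>auto simp: n2_def E_sg[symmetric] intro!: E_mono\<close>)
    also have "\<dots> \<le> CV * \<nu>" by (rule CGn[OF CG1(1)])
    also have "\<dots> \<le> CV * \<nu> - 4 * CY * d ^ 3 * H\<^sup>2 * delta2 xs gn i j"
      using mult_nonneg_nonpos[OF k0 gn_barrier[OF st(1,2), of j]] by linarith
    finally show ?thesis .
  next
    case 2
    define h1 h2 where "h1 = xs i - xs (i - 1)" and "h2 = xs (i + 1) - xs i"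
    have hh: "h1 = h \<and> h2 = H \<or> h1 = H \<and> h2 = h"
      using 2 step[of i] step'[of i] st n4 by (auto simp: h1_def h2_def)
    have p: "0 < h1" "h1 \<le> H" "0 < h2" "h2 \<le> H" "H \<le> h1 + h2" using hh h sg_eq(4) H by auto
    have e: "xs (i + 1) = xs i + h2" "xs (i - 1) = xs i - h1" by (auto simp: h1_def h2_def)
    have x: "xs i = sg \<or> xs i = X - sg" using 2 sg_eq by auto
    have r: "sg - H \<le> xs i - H" "xs i + H \<le> X - (sg - H)" using x sg_eq(2) sg a_pos by auto
    have ar: "a \<le> xs i - H" "xs i + H \<le> X - a" using r sg assms(1) by auto
    have Es: "E (sg - H) \<le> exp 1 * n2"
    proof -
      have "sqrt \<beta> * H \<le> sqrt \<beta> * a" using assms(1) beta_pos by (intro mult_left_mono) auto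
      then have "exp (sqrt \<beta> * H) \<le> exp 1" using beta_pos by (simp add: a_def)
      then show ?thesis unfolding E_shift by (simp add: n2_def divide_right_mono)
    qed
    have Ep: "E (xs i - H) \<le> exp 1 * n2" "E (X - (xs i + H)) \<le> exp 1 * n2"
      using E_mono[OF r(1)] E_mono[of "sg - H" "X - (xs i + H)"] r(2) Es by linarith+
    have "\<bar>delta2 xs yn i j - yxx (xs i) (ts j)\<bar>
        \<le> CY * lay 4 (xs i - H) (xs i + H) * H\<^sup>2 + 4 * (CY * lay 3 (xs i - H) (xs i + H)) * H"
      unfolding delta2_eq[OF st(1)] yn_def e
      using y_trunc_nonuniform[OF ar t p] p by simp
    also have "\<dots> \<le> CY * (4 + 2 * exp 1 * a\<^sup>2) * n2 + (8 * exp 1 * a * CY * n2 + 4 * CY * d ^ 3 * H)"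
    proof (rule add_mono[OF lay_H2[OF Ep]])
      have "E (xs i - H) * H \<le> (exp 1 * n2) * a" "E (X - (xs i + H)) * H \<le> (exp 1 * n2) * a"
        using Ep H assms(1) n2 E_pos by (intro mult_mono; auto)+
      then have "lay 3 (xs i - H) (xs i + H) * H \<le> 2 * (exp 1 * a * n2) + d ^ 3 * H"
        by (simp add: lay_def algebra_simps)
      then have "4 * CY * (lay 3 (xs i - H) (xs i + H) * H) \<le> 4 * CY * (2 * (exp 1 * a * n2) + d ^ 3 * H)"
        using CY by (intro mult_left_mono) auto
      then show "4 * (CY * lay 3 (xs i - H) (xs i + H)) * H \<le> 8 * exp 1 * a * CY * n2 + 4 * CY * d ^ 3 * H"
        by (simp add: algebra_simps)
    qed auto
    also have "\<dots> = (CY * (4 + 2 * exp 1 * a\<^sup>2) + 8 * exp 1 * a * CY) * n2 + 4 * CY * d ^ 3 * H"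
      by (simp only: distrib_right)
    also have "\<dots> \<le> CV * \<nu> - 4 * CY * d ^ 3 * H\<^sup>2 * delta2 xs gn i j"
    proof (rule order_trans[OF add_mono[OF CGn[OF CG1(2)]]])
      have "delta2 xs gn i j \<le> - 2 / (xs (Suc i) - xs (i - 1))"
        using gn_kink[OF st(1,2) x] sg_eq(2) sg a_pos by simp
      also have "xs (Suc i) - xs (i - 1) = h1 + h2" by (simp add: h1_def h2_def)
      also have "- 2 / (h1 + h2) \<le> - 1 / H" using p H by (simp add: field_simps)
      finally have "4 * CY * d ^ 3 * H\<^sup>2 * delta2 xs gn i j \<le> 4 * CY * d ^ 3 * H\<^sup>2 * (- 1 / H)"
        using k0 by (rule mult_left_mono)
      also have "\<dots> = - (4 * CY * d ^ 3 * H)" using H by (simp add: power2_eq_square)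
      finally show "4 * CY * d ^ 3 * H \<le> - (4 * CY * d ^ 3 * H\<^sup>2 * delta2 xs gn i j)" by linarith
    qed auto
    finally show ?thesis .
  qed
qed

text \<open>The barrier has height \<open>sg\<close>, so its cost is governed by
  \<open>d * sg\<close> times \<open>(d * H)\<^sup>2\<close>. The first factor is the unscaled
  transition point, at most 1/4; the second is at most \<open>4 / N\<^sup>2\<close>.\<close>

lemma kink_coeff: "4 * CY * d ^ 3 * H\<^sup>2 * sg \<le> 4 * CY * \<nu>"
proof -
  have H: "0 < H" using h sg_eq(4) by linarith
  have "d * H \<le> d * (2 / (d * N))" using d sg_eq(5) by (intro mult_left_mono) auto
  then have "d * H \<le> 2 / N" using d by simp
  then have "(d * H)\<^sup>2 \<le> (2 / N)\<^sup>2" using d H by (intro power_mono) auto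
  then have *: "d\<^sup>2 * H\<^sup>2 \<le> 4 * \<nu>" using nu_ge(1) by (simp add: power_mult_distrib power_divide)
  have ds: "d * sg \<le> 1 / 4" "0 \<le> d * sg" using sg_eq(2) d sg a_pos by (simp_all add: X_def field_simps)
  have "(d * sg) * (d\<^sup>2 * H\<^sup>2) \<le> 1 / 4 * (4 * \<nu>)" by (rule mult_mono[OF ds(1) *]) auto
  then have "4 * CY * ((d * sg) * (d\<^sup>2 * H\<^sup>2)) \<le> 4 * CY * \<nu>" using CY by (intro mult_left_mono) auto
  then show ?thesis by (simp add: power2_eq_square power3_eq_cube mult_ac)
qed

end

text \<open>Merges the kinds of mesh: the coefficient is \<open>0\<close> unless the mesh is layered
  with more than four intervals and \<open>H \<le> a\<close>. The alternative on \<open>sg\<close>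
  keeps \<open>k * g\<close> nonnegative on the mesh even where \<open>sg\<close> is
  arbitrary.\<close>

lemma kink_exists:
  "\<exists>k\<ge>0. (\<forall>x. k * g x \<le> 4 * CY * \<nu>) \<and> (k = 0 \<or> 0 \<le> sg) \<and> (\<forall>i j. 0 < i \<longrightarrow> i < N \<longrightarrow> 0 < j \<longrightarrow> j \<le> M \<longrightarrow> \<not> equi i \<longrightarrow>
    \<bar>delta2 xs yn i j - yxx (xs i) (ts j)\<bar> \<le> CV * \<nu> - k * delta2 xs gn i j)"
proof (cases "layered \<and> \<not> (n4 = 1 \<or> a < H)")
  case True
  then have l: layered and Ha: "H \<le> a" by auto
  show ?thesis
  proof (intro exI[of _ "4 * CY * d ^ 3 * H\<^sup>2"] conjI allI impI)
    show k: "0 \<le> 4 * CY * d ^ 3 * H\<^sup>2" using CY d by simp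
    fix x
    have "4 * CY * d ^ 3 * H\<^sup>2 * g x \<le> 4 * CY * d ^ 3 * H\<^sup>2 * sg"
      using k by (intro mult_left_mono) (auto simp: g_def)
    then show "4 * CY * d ^ 3 * H\<^sup>2 * g x \<le> 4 * CY * \<nu>" using kink_coeff[OF l] by linarith
  next
    show "4 * CY * d ^ 3 * H\<^sup>2 = 0 \<or> 0 \<le> sg" using sg(1)[OF l] a_pos by simp
  next
    fix i j assume "0 < i" "i < N" "0 < j" "j \<le> M" "\<not> equi i"
    then show "\<bar>delta2 xs yn i j - yxx (xs i) (ts j)\<bar> \<le> CV * \<nu> - 4 * CY * d ^ 3 * H\<^sup>2 * delta2 xs gn i j"
      using coarse_error[OF l Ha] not_fine by blast
  qed
next
  case False
  show ?thesis
  proof (intro exI[of _ 0] conjI allI impI)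
    fix i j assume *: "0 < i" "i < N" "0 < j" "j \<le> M" "\<not> equi i"
    have l: layered using not_fine(1)[OF *(1,2,5)] .
    have nH: "n4 = 1 \<or> a < H" using False l by blast
    show "\<bar>delta2 xs yn i j - yxx (xs i) (ts j)\<bar> \<le> CV * \<nu> - 0 * delta2 xs gn i j"
      using coarse_error_crude[OF l nH not_fine(2,3)[OF *(1,2,5)] *(3,4)] by simp
  qed (use CY nu_ge in auto)
qed

theorem scheme_error:
  assumes "i \<le> N" "j \<le> M"
  shows "\<bar>y (xs i) (ts j) - Y i j\<bar> \<le> CF * (\<nu> + \<mu>)"
proof -
  obtain k where k: "0 \<le> k" "\<And>x. k * g x \<le> 4 * CY * \<nu>" "k = 0 \<or> 0 \<le> sg"
    and coarse: "\<And>i j. 0 < i \<Longrightarrow> i < N \<Longrightarrow> 0 < j \<Longrightarrow> j \<le> M \<Longrightarrow> \<not> equi i \<Longrightarrow>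
      \<bar>delta2 xs yn i j - yxx (xs i) (ts j)\<bar> \<le> CV * \<nu> - k * delta2 xs gn i j"
    using kink_exists by auto
  define e where "e i j = yn i j - Y i j" for i j
  define E0 where "E0 = \<nu> + \<mu>"
  have E0: "0 < E0" "\<nu> \<le> E0" "\<mu> \<le> E0" using nu_ge mu_ge by (auto simp: E0_def)
  \<comment> \<open>The constant acts through the reaction term, the second summand against the
    singular factor on fine stencils, the third against the first-order error at the transition
    points.\<close>
  define \<Psi> where "\<Psi> i j = Ca * E0 + (35 * CE * E0 * Bn i j + k * gn i j)" for i j
  have Bn: "0 \<le> Bn i j" "Bn i j \<le> 1" if "j \<le> M" for i j
  proof -
    have "0 < ts j + h\<^sup>2" using ts_range[OF that] h by (auto intro: add_nonneg_pos)
    then show "0 \<le> Bn i j" "Bn i j \<le> 1" using corner_barrier(5,6) unfolding Bn_def by blast+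
  qed
  have kg: "0 \<le> k * gn i j" if "i \<le> N" for i j
    using k(1,3) xs_range[OF that] unfolding gn_def g_def by auto
  have lower: "Ca * E0 \<le> \<Psi> i j" if "i \<le> N" "j \<le> M" for i j
    using Bn(1)[OF that(2)] kg[OF that(1)] CE E0 by (simp add: \<Psi>_def)
  have upper: "\<Psi> i j \<le> CF * E0" if "i \<le> N" "j \<le> M" for i j
  proof -
    have "35 * CE * E0 * Bn i j \<le> 35 * CE * E0 * 1" using Bn(2)[OF that(2)] CE E0 by (intro mult_left_mono) auto
    moreover have "k * gn i j \<le> 4 * CY * E0"
      using k(2)[of "xs i"] mult_left_mono[OF E0(2), of "4 * CY"] CY by (simp add: gn_def)
    ultimately show ?thesis by (simp add: \<Psi>_def CF_def algebra_simps)
  qed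
  \<comment> \<open>The constant pays for everything without a singular factor:
    \<open>CE * (1 + \<beta>)\<close> for the regular errors, \<open>CV\<close> for the space error
    off uniform fine stencils, \<open>35 * CE * \<beta>\<close> for the possible negative
    contribution of the corner barrier there.\<close>
  have Ca': "\<beta> * Ca = CE * (1 + \<beta>) + CV + 35 * CE * \<beta>" using beta_pos by (simp add: Ca_def add_divide_distrib algebra_simps)
  have b: "\<beta> < b (xs i) (ts j)" if "i \<le> N" "j \<le> M" for i j
    using b_ge[of "xs i" "ts j"] xs_range[OF that(1)] ts_range[OF that(2)] eta_pos by simp
  have op_e: "dt_minus ts e i j - delta2 xs e i j + b (xs i) (ts j) * e i j
      = (dt_minus ts yn i j - yt (xs i) (ts j)) - (delta2 xs yn i j - yxx (xs i) (ts j))"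
    if "0 < i" "i < N" "0 < j" "j \<le> M" for i j
  proof -
    have e: "e = (\<lambda>i j. yn i j + (-1) * Y i j)" by (intro ext) (simp add: e_def)
    have "yt (xs i) (ts j) - yxx (xs i) (ts j) + b (xs i) (ts j) * yn i j
        = dt_minus ts Y i j - delta2 xs Y i j + b (xs i) (ts j) * Y i j"
      unfolding Y_eq[OF that] yn_def using xs_int ts_int that by (intro y_eq) auto
    then show ?thesis unfolding e delta2_add dt_minus_add delta2_cmult dt_minus_cmult by (simp add: algebra_simps)
  qed
  have op_Psi: "\<bar>dt_minus ts e i j - delta2 xs e i j + b (xs i) (ts j) * e i j\<bar>
      \<le> dt_minus ts \<Psi> i j - delta2 xs \<Psi> i j + b (xs i) (ts j) * \<Psi> i j"
    if ij: "0 < i" "i < N" "0 < j" "j \<le> M" for i j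
  proof -
    define q where "q = 1 / ((xs i)\<^sup>2 + ts j)"
    have t: "0 < ts j" using ts_int ij by auto
    have q: "0 \<le> q" using t by (simp add: q_def add_nonneg_nonneg)
    have "dt_minus ts \<Psi> i j - delta2 xs \<Psi> i j
        = 35 * CE * E0 * (dt_minus ts Bn i j - delta2 xs Bn i j) - k * delta2 xs gn i j"
      unfolding \<Psi>_def[abs_def] delta2_add dt_minus_add delta2_cmult dt_minus_cmult delta2_const dt_minus_const
      by (simp add: gn_def[abs_def] dt_minus_const(2)[where V = "\<lambda>i. g (xs i)"] algebra_simps)
    moreover have "\<beta> * (Ca * E0) \<le> b (xs i) (ts j) * \<Psi> i j"
      using b[of i j] lower[of i j] ij beta_pos Ca E0 by (intro mult_mono) auto
    moreover have "\<beta> * (Ca * E0) = CE * E0 + CE * \<beta> * E0 + CV * E0 + 35 * CE * E0 * \<beta>"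
      unfolding mult.assoc[symmetric] Ca' by (simp add: algebra_simps)
    moreover have te: "\<bar>dt_minus ts yn i j - yt (xs i) (ts j)\<bar> \<le> CT * (4 * K + 6) * E0 * (1 + q)"
    proof (rule order_trans[OF time_error[OF ij, folded q_def]])
      show "CT * (4 * K + 6) * \<mu> * (1 + q) \<le> CT * (4 * K + 6) * E0 * (1 + q)"
        using CT K_pos E0 q by (intro mult_right_mono mult_left_mono) auto
    qed
    moreover have "0 \<le> CV * E0" "0 \<le> CE * E0" "0 \<le> CE * \<beta> * E0" using CV CE E0 beta_pos by auto
    moreover have "\<bar>(dt_minus ts yn i j - yt (xs i) (ts j)) - (delta2 xs yn i j - yxx (xs i) (ts j))\<bar>
      \<le> 35 * CE * E0 * (dt_minus ts Bn i j - delta2 xs Bn i j) - k * delta2 xs gn i j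
        + (CE * E0 + CE * \<beta> * E0 + CV * E0 + 35 * CE * E0 * \<beta>)"
    proof (cases "equi i")
      case True
      have "\<bar>delta2 xs yn i j - yxx (xs i) (ts j)\<bar> \<le> 64 * K * CX * E0 * (1 + q)"
      proof (rule order_trans[OF fine_error[OF ij True, folded q_def]])
        show "64 * K * CX * \<nu> * (1 + q) \<le> 64 * K * CX * E0 * (1 + q)"
          using CX K_pos E0 q by (intro mult_right_mono mult_left_mono) auto
      qed
      moreover have "CT * (4 * K + 6) * E0 * (1 + q) + 64 * K * CX * E0 * (1 + q) = CE * E0 + CE * E0 * q"
        by (simp add: CE_def algebra_simps)
      moreover have "CE * E0 * q \<le> 35 * CE * E0 * (dt_minus ts Bn i j - delta2 xs Bn i j)"
      proof -
        have "35 * CE * E0 * (1 / (35 * ((xs i)\<^sup>2 + ts j))) \<le> 35 * CE * E0 * (dt_minus ts Bn i j - delta2 xs Bn i j)"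
          using CE E0 by (intro mult_left_mono fine_barrier ij True) auto
        moreover have "35 * CE * E0 * (1 / (35 * ((xs i)\<^sup>2 + ts j))) = CE * E0 * q"
          using mult_divide_mult_cancel_left[of 35 "CE * E0" "(xs i)\<^sup>2 + ts j"] by (simp add: q_def mult.assoc)
        ultimately show ?thesis by simp
      qed
      moreover have "k * delta2 xs gn i j \<le> 0" using k(1) gn_barrier[OF ij(1,2)] by (rule mult_nonneg_nonpos)
      moreover have "0 \<le> 35 * CE * E0 * \<beta>" using CE E0 beta_pos by simp
      ultimately show ?thesis using te CV E0 \<open>0 \<le> CV * E0\<close> \<open>0 \<le> CE * \<beta> * E0\<close> by linarith
    next
      case False
      note l = not_fine[OF ij(1,2) False]
      \<comment> \<open>Such nodes lie at distance at least \<open>a\<close> from the left side, and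
        \<open>1 / a\<^sup>2 = \<beta>\<close>; the singular factor in the time error is
        harmless.\<close>
      have q4: "q \<le> \<beta>"
      proof -
        have "a \<le> xs i" using stencil(5)[OF l(1) l(2,3)] sg(1)[OF l(1)] a_pos by linarith
        then have "a\<^sup>2 \<le> (xs i)\<^sup>2" using a_pos by (intro power_mono) auto
        then have "a\<^sup>2 \<le> (xs i)\<^sup>2 + ts j" using t by linarith
        then have "q \<le> 1 / a\<^sup>2" unfolding q_def using a_pos t
          by (intro divide_left_mono mult_pos_pos add_nonneg_pos) auto
        then show ?thesis using beta_pos by (simp add: a_def power_divide)
      qed
      have "CT * (4 * K + 6) * E0 * (1 + q) \<le> CE * E0 * (1 + \<beta>)"
        using q4 q CT K_pos CX E0 by (intro mult_mono) (auto simp: CE_def)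
      moreover have "CE * E0 * (1 + \<beta>) = CE * E0 + CE * \<beta> * E0" by (simp add: algebra_simps)
      moreover have "CV * \<nu> \<le> CV * E0" using CV E0 by (intro mult_left_mono) auto
      moreover have "35 * CE * E0 * (- \<beta>) \<le> 35 * CE * E0 * (dt_minus ts Bn i j - delta2 xs Bn i j)"
        using CE E0 by (intro mult_left_mono coarse_barrier[OF l(1) l(2,3) ij(3,4)]) auto
      moreover have "35 * CE * E0 * (- \<beta>) = - (35 * CE * E0 * \<beta>)" by simp
      ultimately show ?thesis using te coarse[OF ij False] by linarith
    qed
    ultimately show ?thesis unfolding op_e[OF ij] by linarith
  qed
  have main: "0 \<le> \<Psi> i j + s * e i j" if s: "\<bar>s\<bar> = 1" for s
  proof (rule discrete_max_principle[where X = xs and S = ts and N = N and M = M and c = "\<lambda>i j. b (xs i) (ts j)"])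
    fix i j assume ij: "0 < i" "i < N" "0 < j" "j \<le> M"
    have "\<bar>s * (dt_minus ts e i j - delta2 xs e i j + b (xs i) (ts j) * e i j)\<bar>
        \<le> dt_minus ts \<Psi> i j - delta2 xs \<Psi> i j + b (xs i) (ts j) * \<Psi> i j"
      unfolding abs_mult s using op_Psi[OF ij] by simp
    then show "0 \<le> dt_minus ts (\<lambda>i j. \<Psi> i j + s * e i j) i j - delta2 xs (\<lambda>i j. \<Psi> i j + s * e i j) i j
        + b (xs i) (ts j) * (\<Psi> i j + s * e i j)"
      unfolding delta2_add dt_minus_add delta2_cmult dt_minus_cmult by (simp add: abs_le_iff algebra_simps)
    show "0 < b (xs i) (ts j)" using b[of i j] ij beta_pos by simp
  next
    fix i j assume ij: "i \<le> N" "j \<le> M" "i = 0 \<or> i = N \<or> j = 0"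
    have "0 \<le> Ca * E0" using Ca E0 by simp
    then show "0 \<le> \<Psi> i j + s * e i j" using lower[OF ij(1,2)] Y_bd[OF ij] by (simp add: e_def yn_def)
  qed (use xs_less ts_less assms in auto)
  have "\<bar>e i j\<bar> \<le> \<Psi> i j" using main[of 1] main[of "-1"] by (simp add: abs_le_iff)
  then show ?thesis using upper[OF assms] by (simp add: e_def yn_def E0_def)
qed

end

subsection \<open>The Shishkin mesh\<close>

context
  fixes \<beta> \<epsilon> :: real
  assumes pos: "0 < \<beta>" "0 < \<epsilon>"
begin

lemma tau_bounds: "2 \<le> M \<Longrightarrow> 0 < tau \<beta> \<epsilon> M" "tau \<beta> \<epsilon> M \<le> 1 / 2"
proof -
  show "2 \<le> M \<Longrightarrow> 0 < tau \<beta> \<epsilon> M" using pos by (simp add: tau_def)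
  show "tau \<beta> \<epsilon> M \<le> 1 / 2" unfolding tau_def by (rule min.cobounded1)
qed

lemma sigma_bounds: "2 \<le> N \<Longrightarrow> 0 < sigma \<beta> \<epsilon> N" "sigma \<beta> \<epsilon> N \<le> 1 / 4"
proof -
  show "2 \<le> N \<Longrightarrow> 0 < sigma \<beta> \<epsilon> N" using pos by (simp add: sigma_def)
  show "sigma \<beta> \<epsilon> N \<le> 1 / 4" unfolding sigma_def by (rule min.cobounded1)
qed

lemma tmesh_facts:
  assumes "0 < m"
  shows "tmesh \<beta> \<epsilon> (2 * m) 0 = 0" "tmesh \<beta> \<epsilon> (2 * m) (2 * m) = 1" "tmesh \<beta> \<epsilon> (2 * m) m = tau \<beta> \<epsilon> (2 * m)"
    and "tmesh \<beta> \<epsilon> (2 * m) (Suc j) - tmesh \<beta> \<epsilon> (2 * m) j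
      = (if j < m then tau \<beta> \<epsilon> (2 * m) / m else (1 - tau \<beta> \<epsilon> (2 * m)) / m)"
proof -
  consider "Suc j \<le> m" | "j = m" | "m < j" by linarith
  then show "tmesh \<beta> \<epsilon> (2 * m) (Suc j) - tmesh \<beta> \<epsilon> (2 * m) j
      = (if j < m then tau \<beta> \<epsilon> (2 * m) / m else (1 - tau \<beta> \<epsilon> (2 * m)) / m)"
    using assms by cases (simp_all add: tmesh_def Let_def field_simps)
qed (use assms in \<open>simp_all add: tmesh_def Let_def field_simps\<close>)

lemma tmesh_mono: "0 < m \<Longrightarrow> strict_mono (tmesh \<beta> \<epsilon> (2 * m))"
proof (rule strict_monoI_Suc)
  fix j assume "0 < m"
  moreover have "0 < tau \<beta> \<epsilon> (2 * m)" "tau \<beta> \<epsilon> (2 * m) \<le> 1 / 2" using tau_bounds[of "2 * m"] \<open>0 < m\<close> by auto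
  ultimately have "0 < tmesh \<beta> \<epsilon> (2 * m) (Suc j) - tmesh \<beta> \<epsilon> (2 * m) j" unfolding tmesh_facts(4)[OF \<open>0 < m\<close>] by simp
  then show "tmesh \<beta> \<epsilon> (2 * m) j < tmesh \<beta> \<epsilon> (2 * m) (Suc j)" by simp
qed

lemma xmesh_facts:
  assumes "0 < n"
  shows "xmesh \<beta> \<epsilon> (4 * n) 0 = 0" "xmesh \<beta> \<epsilon> (4 * n) (4 * n) = 1" "xmesh \<beta> \<epsilon> (4 * n) n = sigma \<beta> \<epsilon> (4 * n)"
    "xmesh \<beta> \<epsilon> (4 * n) (3 * n) = 1 - sigma \<beta> \<epsilon> (4 * n)"
    and "xmesh \<beta> \<epsilon> (4 * n) (Suc i) - xmesh \<beta> \<epsilon> (4 * n) i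
      = (if n \<le> i \<and> i < 3 * n then (1 - 2 * sigma \<beta> \<epsilon> (4 * n)) / (2 * n) else sigma \<beta> \<epsilon> (4 * n) / n)"
proof -
  consider "Suc i \<le> n" | "i = n" | "n < i" "Suc i \<le> 3 * n" | "i = 3 * n" | "3 * n < i" by linarith
  then show "xmesh \<beta> \<epsilon> (4 * n) (Suc i) - xmesh \<beta> \<epsilon> (4 * n) i
      = (if n \<le> i \<and> i < 3 * n then (1 - 2 * sigma \<beta> \<epsilon> (4 * n)) / (2 * n) else sigma \<beta> \<epsilon> (4 * n) / n)"
    using assms by cases (simp_all add: xmesh_def Let_def field_simps)
qed (use assms in \<open>simp_all add: xmesh_def Let_def field_simps\<close>)

lemma xmesh_mono: "0 < n \<Longrightarrow> strict_mono (xmesh \<beta> \<epsilon> (4 * n))"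
proof (rule strict_monoI_Suc)
  fix i assume "0 < n"
  moreover have "0 < sigma \<beta> \<epsilon> (4 * n)" "sigma \<beta> \<epsilon> (4 * n) \<le> 1 / 4" using sigma_bounds[of "4 * n"] \<open>0 < n\<close> by auto
  ultimately have "0 < xmesh \<beta> \<epsilon> (4 * n) (Suc i) - xmesh \<beta> \<epsilon> (4 * n) i" unfolding xmesh_facts(5)[OF \<open>0 < n\<close>] by simp
  then show "xmesh \<beta> \<epsilon> (4 * n) i < xmesh \<beta> \<epsilon> (4 * n) (Suc i)" by simp
qed

text \<open>Scaling by \<open>\<epsilon>\<close> makes the fine step of order
  \<open>ln M / M\<close>, and \<open>tau\<close>, when not capped, is the time at which
  \<open>exp (- \<beta> * t / \<epsilon>)\<close> equals \<open>1 / M\<close>.\<close>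

lemma tmesh_step:
  assumes m: "0 < m" and K: "1 \<le> K * \<beta>" and j: "0 < j"
  shows "(tmesh \<beta> \<epsilon> (2 * m) j - tmesh \<beta> \<epsilon> (2 * m) (j - 1)) / \<epsilon> \<le> 2 * K * (ln (2 * m) / (2 * m)) \<or>
    tmesh \<beta> \<epsilon> (2 * m) j - tmesh \<beta> \<epsilon> (2 * m) (j - 1) \<le> 2 / (2 * m) \<and>
      exp (- \<beta> * (tmesh \<beta> \<epsilon> (2 * m) (j - 1) / \<epsilon>)) \<le> 1 / (2 * m)"
proof -
  define \<tau> l where "\<tau> = tau \<beta> \<epsilon> (2 * m)" and "l = ln (2 * real m)"
  have l: "0 \<le> l" using m by (simp add: l_def)
  have "1 / \<beta> \<le> K" using K pos by (simp add: divide_le_eq)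
  then have lK: "l / \<beta> \<le> K * l" using mult_right_mono[of "1 / \<beta>" K l] l by simp
  have \<tau>: "\<tau> = min (1 / 2) (\<epsilon> / \<beta> * l)" by (simp add: \<tau>_def tau_def l_def)
  have \<tau>': "0 < \<tau>" using tau_bounds(1)[of "2 * m"] m by (simp add: \<tau>_def)
  have st: "tmesh \<beta> \<epsilon> (2 * m) j - tmesh \<beta> \<epsilon> (2 * m) (j - 1) = (if j \<le> m then \<tau> / m else (1 - \<tau>) / m)"
    using tmesh_facts(4)[OF m, of "j - 1"] j by (auto simp: \<tau>_def)
  have fine: "(\<tau> / m) / \<epsilon> \<le> 2 * K * (l / (2 * m))"
  proof -
    have "\<tau> / \<epsilon> \<le> (\<epsilon> / \<beta> * l) / \<epsilon>" unfolding \<tau> using pos by (intro divide_right_mono min.cobounded2) auto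
    also have "\<dots> \<le> K * l" using lK pos by simp
    finally have "(\<tau> / \<epsilon>) / m \<le> (K * l) / m" by (rule divide_right_mono) simp
    then show ?thesis by (simp add: divide_divide_eq_left mult.commute)
  qed
  \<comment> \<open>For \<open>\<tau> = 1 / 2\<close> the mesh is uniform and each step counts as
    fine. In the other case \<open>m < j\<close> gives \<open>m \<le> j - 1\<close>, so the whole
    step lies beyond \<open>\<tau>\<close>.\<close>
  consider "j \<le> m \<or> \<tau> = 1 / 2" | "m < j" "\<tau> = \<epsilon> / \<beta> * l" unfolding \<tau> by linarith
  then show ?thesis
  proof cases
    case 1
    then have "tmesh \<beta> \<epsilon> (2 * m) j - tmesh \<beta> \<epsilon> (2 * m) (j - 1) = \<tau> / m" using st by auto
    then show ?thesis using fine by (simp add: l_def)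
  next
    case 2
    have "tmesh \<beta> \<epsilon> (2 * m) m \<le> tmesh \<beta> \<epsilon> (2 * m) (j - 1)"
      using 2 strict_mono_less_eq[OF tmesh_mono[OF m]] by simp
    then have "\<epsilon> / \<beta> * l \<le> tmesh \<beta> \<epsilon> (2 * m) (j - 1)" using tmesh_facts(3)[OF m] 2 by (simp add: \<tau>_def)
    then have "l \<le> \<beta> * (tmesh \<beta> \<epsilon> (2 * m) (j - 1) / \<epsilon>)" using pos by (simp add: field_simps)
    then have "exp (- \<beta> * (tmesh \<beta> \<epsilon> (2 * m) (j - 1) / \<epsilon>)) \<le> exp (- l)" by simp
    also have "\<dots> = 1 / (2 * m)" using m by (simp add: l_def exp_minus inverse_eq_divide)
    finally have "exp (- \<beta> * (tmesh \<beta> \<epsilon> (2 * m) (j - 1) / \<epsilon>)) \<le> 1 / (2 * m)" .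
    moreover have "tmesh \<beta> \<epsilon> (2 * m) j - tmesh \<beta> \<epsilon> (2 * m) (j - 1) \<le> 2 / (2 * m)"
      using st 2(1) \<tau>' by (simp add: divide_right_mono)
    ultimately show ?thesis by (simp only: of_nat_mult of_nat_numeral simp_thms)
  qed
qed

end

lemma dt_minus_scale: "dt_minus (\<lambda>j. S j / k) Y i j = k * dt_minus S Y i j"
  by (simp add: dt_minus_def diff_divide_distrib[symmetric])

lemma delta2_scale: "delta2 (\<lambda>i. X i / k) Y i j = k\<^sup>2 * delta2 X Y i j"
proof -
  have "dx_minus (\<lambda>i. X i / k) Y i j = k * dx_minus X Y i j" for i
    by (simp add: dx_minus_def diff_divide_distrib[symmetric])
  then show ?thesis
    by (simp add: delta2_def dx_plus_def diff_divide_distrib[symmetric] add_divide_distrib[symmetric]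
        right_diff_distrib[symmetric] power2_eq_square)
qed

subsection \<open>Bounds for the data\<close>

lemma has_deriv01: "z differentiable (at s within {0..1}) \<Longrightarrow> (z has_real_derivative deriv01 z s) (at s within {0..1})"
  by (simp add: deriv01_def has_real_derivative_iff_has_vector_derivative vector_derivative_works)

lemma Ck_deriv:
  assumes "z \<in> Ck k" "i < k" "0 \<le> s" "s \<le> 1"
  shows "((deriv01 ^^ i) z has_real_derivative (deriv01 ^^ Suc i) z s) (at s within {0..1})"
  using has_deriv01[of "(deriv01 ^^ i) z" s] assms by (auto simp: Ck_def differentiable_on_def)

lemma Ck_bound:
  assumes "z \<in> Ck k"
  shows "\<exists>K\<ge>0. \<forall>i\<le>k. \<forall>s\<in>{0..1}. \<bar>(deriv01 ^^ i) z s\<bar> \<le> K"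
proof -
  have "\<exists>K. \<forall>s\<in>{0..1}. \<bar>(deriv01 ^^ i) z s\<bar> \<le> K" if "i \<le> k" for i
  proof -
    have "compact ((deriv01 ^^ i) z ` {0..1})"
      using assms that by (intro compact_continuous_image) (auto simp: Ck_def)
    from compact_imp_bounded[OF this] show ?thesis unfolding bounded_iff by auto
  qed
  then obtain K where K: "\<And>i s. i \<le> k \<Longrightarrow> s \<in> {0..1} \<Longrightarrow> \<bar>(deriv01 ^^ i) z s\<bar> \<le> K i" by metis
  have "\<bar>(deriv01 ^^ i) z s\<bar> \<le> (\<Sum>i\<le>k. \<bar>K i\<bar>)" if "i \<le> k" "s \<in> {0..1}" for i s
  proof -
    have "\<bar>K i\<bar> \<le> (\<Sum>i\<le>k. \<bar>K i\<bar>)" using that by (intro member_le_sum) auto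
    then show ?thesis using K[OF that] by linarith
  qed
  then show ?thesis by (intro exI[of _ "\<Sum>i\<le>k. \<bar>K i\<bar>"]) (auto intro: sum_nonneg)
qed

lemma C_hoelder_x:
  assumes "z \<in> C_hoelder n \<gamma>" "Suc i + 2 * j \<le> n" "(x, t) \<in> Qbar"
  shows "((\<lambda>s. partial i j z s t) has_real_derivative partial (Suc i) j z x t) (at x within {0..1})"
proof -
  have "(\<lambda>s. partial i j z s t) differentiable (at x within {0..1})"
    using assms unfolding C_hoelder_def x_differentiable_on_def by blast
  from has_deriv01[OF this] show ?thesis by (simp add: partial_def Dx_def)
qed

lemma C_hoelder_t:
  assumes "z \<in> C_hoelder n \<gamma>" "2 * Suc j \<le> n" "(x, t) \<in> Qbar"
  shows "(partial 0 j z x has_real_derivative partial 0 (Suc j) z x t) (at t within {0..1})"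
proof -
  have "(\<lambda>s. partial 0 j z x s) differentiable (at t within {0..1})"
    using assms unfolding C_hoelder_def t_differentiable_on_def by blast
  from has_deriv01[OF this] show ?thesis by (simp add: partial_def Dt_def)
qed

lemma hoelder_bounded:
  assumes "hoelder_on \<gamma> Qbar z" "0 < \<gamma>"
  shows "\<exists>K. \<forall>(x, t)\<in>Qbar. \<bar>z x t\<bar> \<le> K"
proof -
  obtain K where K: "\<And>p q. p \<in> Qbar \<Longrightarrow> q \<in> Qbar \<Longrightarrow> \<bar>z (fst p) (snd p) - z (fst q) (snd q)\<bar> \<le> K * parabolic_dist p q powr \<gamma>"
    using assms(1) unfolding hoelder_on_def by blast
  have "\<bar>z x t\<bar> \<le> \<bar>z 0 0\<bar> + \<bar>K\<bar> * sqrt 2 powr \<gamma>" if "(x, t) \<in> Qbar" for x t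
  proof -
    have xt: "0 \<le> x" "x \<le> 1" "0 \<le> t" "t \<le> 1" using that by (auto simp: Qbar_def)
    have "x\<^sup>2 \<le> 1" using xt by (simp add: power_le_one)
    then have "parabolic_dist (x, t) (0, 0) \<le> sqrt 2" using xt by (simp add: parabolic_dist_def)
    then have "parabolic_dist (x, t) (0, 0) powr \<gamma> \<le> sqrt 2 powr \<gamma>"
      using assms(2) xt by (intro powr_mono2) (auto simp: parabolic_dist_def)
    then have "\<bar>K\<bar> * parabolic_dist (x, t) (0, 0) powr \<gamma> \<le> \<bar>K\<bar> * sqrt 2 powr \<gamma>" by (intro mult_left_mono) auto
    moreover have "K * parabolic_dist (x, t) (0, 0) powr \<gamma> \<le> \<bar>K\<bar> * parabolic_dist (x, t) (0, 0) powr \<gamma>"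
      by (intro mult_right_mono) auto
    moreover have "\<bar>z x t - z 0 0\<bar> \<le> K * parabolic_dist (x, t) (0, 0) powr \<gamma>"
      using K[OF that, of "(0, 0)"] by (simp add: Qbar_def)
    ultimately show ?thesis by linarith
  qed
  then show ?thesis by blast
qed

lemma C_hoelder_bound:
  assumes "z \<in> C_hoelder n \<gamma>" "0 < \<gamma>"
  shows "\<exists>K\<ge>0. \<forall>i j. i + 2 * j \<le> n \<longrightarrow> (\<forall>(x, t)\<in>Qbar. \<bar>partial i j z x t\<bar> \<le> K)"
proof -
  have "\<exists>K. \<forall>(x, t)\<in>Qbar. \<bar>partial i j z x t\<bar> \<le> K" if "i + 2 * j \<le> n" for i j
    using assms that by (intro hoelder_bounded[of \<gamma>]) (auto simp: C_hoelder_def)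
  then obtain K where K: "\<And>i j x t. i + 2 * j \<le> n \<Longrightarrow> (x, t) \<in> Qbar \<Longrightarrow> \<bar>partial i j z x t\<bar> \<le> K i j"
    by (metis (no_types, lifting) case_prodD)
  define B where "B = (\<Sum>p\<in>{..n} \<times> {..n}. \<bar>K (fst p) (snd p)\<bar>)"
  have "\<bar>partial i j z x t\<bar> \<le> B" if "i + 2 * j \<le> n" "(x, t) \<in> Qbar" for i j x t
  proof -
    have "\<bar>K (fst (i, j)) (snd (i, j))\<bar> \<le> B" unfolding B_def using that(1) by (intro member_le_sum) auto
    then show ?thesis using K[OF that] by simp
  qed
  moreover have "0 \<le> B" unfolding B_def by (intro sum_nonneg) auto
  ultimately show ?thesis by blast
qed

lemma abs_diff_le_within:
  fixes g :: "real \<Rightarrow> real"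
  assumes "\<And>s. 0 \<le> s \<Longrightarrow> s \<le> r \<Longrightarrow> (g has_real_derivative g1 s) (at s within {0..r})"
    and "\<And>s. 0 \<le> s \<Longrightarrow> s \<le> r \<Longrightarrow> \<bar>g1 s\<bar> \<le> A" "0 \<le> p" "p \<le> r" "0 \<le> q" "q \<le> r"
  shows "\<bar>g p - g q\<bar> \<le> A * \<bar>p - q\<bar>"
  using field_differentiable_bound[of "{0..r}" g g1 A p q] assms by auto

lemma abs_deriv_le_lipschitz:
  fixes g :: "real \<Rightarrow> real"
  assumes "(g has_real_derivative D) (at x within {0..1})" "0 \<le> x" "x \<le> 1"
    and "\<And>s. 0 \<le> s \<Longrightarrow> s \<le> 1 \<Longrightarrow> \<bar>g s - g x\<bar> \<le> A * \<bar>s - x\<bar>"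
  shows "\<bar>D\<bar> \<le> A"
proof (rule tendsto_upperbound)
  have "((\<lambda>s. (g s - g x) / (s - x)) \<longlongrightarrow> D) (at x within {0..1})"
    using assms(1) by (simp add: has_field_derivative_iff)
  then show "((\<lambda>s. \<bar>(g s - g x) / (s - x)\<bar>) \<longlongrightarrow> \<bar>D\<bar>) (at x within {0..1})" by (rule tendsto_rabs)
  show "\<forall>\<^sub>F s in at x within {0..1}. \<bar>(g s - g x) / (s - x)\<bar> \<le> A"
    unfolding eventually_at_filter
  proof (rule always_eventually, intro allI impI)
    fix s assume s: "s \<noteq> x" "s \<in> {0..1}"
    then show "\<bar>(g s - g x) / (s - x)\<bar> \<le> A"
      using assms(4)[of s] by (simp add: abs_divide divide_le_eq)
  qed
  show "at x within {0..1} \<noteq> bot"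
    using assms(2,3) by (simp add: trivial_limit_within islimpt_Icc)
qed

text \<open>The mixed derivative controls the growth of \<open>Dx b\<close> in time, although \<open>Dx b\<close> itself need not be
  differentiable in time.\<close>

lemma Dx_time_lipschitz:
  assumes z: "z \<in> C_hoelder 4 \<gamma>" and K: "\<And>x t. (x, t) \<in> Qbar \<Longrightarrow> \<bar>partial 1 1 z x t\<bar> \<le> K"
    and xt: "0 \<le> x" "x \<le> 1" "0 \<le> t" "t \<le> 1"
  shows "\<bar>Dx z x t - Dx z x 0\<bar> \<le> K * t"
proof (rule abs_deriv_le_lipschitz[where g = "\<lambda>s. z s t - z s 0"])
  have p: "partial 0 0 z = z" "partial (Suc 0) 0 z = Dx z" "partial 0 (Suc 0) z = Dt z" by (auto simp: partial_def)
  have zx: "((\<lambda>s. z s t) has_real_derivative Dx z x t) (at x within {0..1})" if "0 \<le> t" "t \<le> 1" for t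
    using C_hoelder_x[OF z, of 0 0 x t] that xt by (simp add: p Qbar_def)
  show "((\<lambda>s. z s t - z s 0) has_real_derivative Dx z x t - Dx z x 0) (at x within {0..1})"
    using zx[of t] zx[of 0] xt by (intro DERIV_diff) auto
  fix s :: real assume s: "0 \<le> s" "s \<le> 1"
  have zt: "(z x has_real_derivative Dt z x t) (at t within {0..1})" if "0 \<le> x" "x \<le> 1" "0 \<le> t" "t \<le> 1" for x t
    using C_hoelder_t[OF z, of 0 x t] that by (simp add: p Qbar_def)
  have "\<bar>(z s t - z x t) - (z s 0 - z x 0)\<bar> \<le> (K * \<bar>s - x\<bar>) * \<bar>t - 0\<bar>"
  proof (rule abs_diff_le_within[where r = 1 and g = "\<lambda>t. z s t - z x t" and ?g1.0 = "\<lambda>t. Dt z s t - Dt z x t"])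
    fix t :: real assume t: "0 \<le> t" "t \<le> 1"
    show "((\<lambda>t. z s t - z x t) has_real_derivative Dt z s t - Dt z x t) (at t within {0..1})"
      using zt s xt t by (intro DERIV_diff) auto
    show "\<bar>Dt z s t - Dt z x t\<bar> \<le> K * \<bar>s - x\<bar>"
      by (rule abs_diff_le_within[where r = 1 and g = "\<lambda>s. Dt z s t" and ?g1.0 = "\<lambda>s. partial 1 1 z s t"])
        (use C_hoelder_x[OF z, of 0 1 _ t] K s xt t in \<open>auto simp: p Qbar_def\<close>)
  qed (use xt in auto)
  then show "\<bar>(z s t - z s 0) - (z x t - z x 0)\<bar> \<le> K * t * \<bar>s - x\<bar>"
    using xt by (simp add: algebra_simps)
qed (use xt in auto)

text \<open>The path from the corner first follows the initial line and then goes up in time. On the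
  initial line \<open>Dx z\<close> starts at 0 and is Lipschitz, so it is at most
  \<open>K * s\<close> and contributes only \<open>K * x\<^sup>2\<close> to
  \<open>z\<close>.\<close>

lemma corner_growth:
  assumes z: "z \<in> C_hoelder 4 \<gamma>" and K: "\<And>i j x t. i + 2 * j \<le> 4 \<Longrightarrow> (x, t) \<in> Qbar \<Longrightarrow> \<bar>partial i j z x t\<bar> \<le> K"
    and corner: "Dx z 0 0 = 0" and xt: "0 \<le> x" "x \<le> 1" "0 \<le> t" "t \<le> 1"
  shows "\<bar>Dx z x t\<bar> \<le> K * (x + t)" and "\<bar>z x t - z 0 0\<bar> \<le> K * (x\<^sup>2 + t)"
proof -
  have p: "partial 0 0 z = z" "partial (Suc 0) 0 z = Dx z" "partial 0 (Suc 0) z = Dt z" by (auto simp: partial_def)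
  have K0: "0 \<le> K" using K[of 0 0 0 0] by (auto simp: Qbar_def intro: order_trans[OF abs_ge_zero])
  have x0: "\<bar>Dx z x 0\<bar> \<le> K * x" if "0 \<le> x" "x \<le> 1" for x
  proof -
    have "\<bar>Dx z x 0 - Dx z 0 0\<bar> \<le> K * \<bar>x - 0\<bar>"
      by (rule abs_diff_le_within[where r = 1 and g = "\<lambda>s. Dx z s 0" and ?g1.0 = "\<lambda>s. partial 2 0 z s 0"])
        (use C_hoelder_x[OF z, of 1 0 _ 0] K that in \<open>auto simp: p Qbar_def numeral_2_eq_2\<close>)
    then show ?thesis using that corner by simp
  qed
  have "\<bar>Dx z x t - Dx z x 0\<bar> \<le> K * t" by (rule Dx_time_lipschitz[OF z _ xt]) (rule K, auto)
  then show "\<bar>Dx z x t\<bar> \<le> K * (x + t)" using x0[of x] xt by (simp add: distrib_left)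
  have 1: "\<bar>z x t - z x 0\<bar> \<le> K * \<bar>t - 0\<bar>"
    by (rule abs_diff_le_within[where r = 1 and g = "z x" and ?g1.0 = "\<lambda>s. partial 0 1 z x s"])
      (use C_hoelder_t[OF z, of 0 x] K[of 0 1] xt in \<open>auto simp: p Qbar_def\<close>)
  have 2: "\<bar>z x 0 - z 0 0\<bar> \<le> K * x * \<bar>x - 0\<bar>"
  proof (rule abs_diff_le_within[where r = x and g = "\<lambda>s. z s 0" and ?g1.0 = "\<lambda>s. Dx z s 0"])
    fix s assume s: "0 \<le> s" "s \<le> x"
    have "((\<lambda>s. z s 0) has_real_derivative Dx z s 0) (at s within {0..1})"
      using C_hoelder_x[OF z, of 0 0 s 0] s xt by (simp add: p Qbar_def)
    then show "((\<lambda>s. z s 0) has_real_derivative Dx z s 0) (at s within {0..x})"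
      by (rule DERIV_subset) (use xt in auto)
    have "K * s \<le> K * x" using s K0 by (intro mult_left_mono) auto
    then show "\<bar>Dx z s 0\<bar> \<le> K * x" using x0[of s] s xt by simp
  qed (use xt in auto)
  show "\<bar>z x t - z 0 0\<bar> \<le> K * (x\<^sup>2 + t)" using 1 2 xt by (simp add: distrib_left power2_eq_square)
qed

text \<open>Bounded first derivatives make \<open>z\<close> Lipschitz in each variable; this avoids
  comparing the parabolic with the Euclidean distance.\<close>

lemma C_hoelder_continuous:
  assumes z: "z \<in> C_hoelder 4 \<gamma>" and "0 < \<gamma>"
  shows "continuous_on Qbar (\<lambda>(x, t). z x t)"
proof -
  have p: "partial 0 0 z = z" by (auto simp: partial_def)
  obtain K where K: "0 \<le> K" "\<And>i j x t. i + 2 * j \<le> 4 \<Longrightarrow> (x, t) \<in> Qbar \<Longrightarrow> \<bar>partial i j z x t\<bar> \<le> K"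
    using C_hoelder_bound[OF assms] by blast
  have "(2 * K)-lipschitz_on Qbar (\<lambda>(x, t). z x t)"
  proof (rule lipschitz_onI)
    fix p q assume pq: "p \<in> Qbar" "q \<in> Qbar"
    obtain x t x' t' where e: "p = (x, t)" "q = (x', t')" by fastforce
    have r: "0 \<le> x" "x \<le> 1" "0 \<le> t" "t \<le> 1" "0 \<le> x'" "x' \<le> 1" "0 \<le> t'" "t' \<le> 1"
      using pq by (auto simp: e Qbar_def)
    have "\<bar>z x t - z x' t\<bar> \<le> K * \<bar>x - x'\<bar>"
      by (rule abs_diff_le_within[where r = 1 and g = "\<lambda>s. z s t" and ?g1.0 = "\<lambda>s. partial 1 0 z s t"])
        (use C_hoelder_x[OF z, of 0 0 _ t] K r in \<open>auto simp: p Qbar_def\<close>)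
    moreover have "\<bar>z x' t - z x' t'\<bar> \<le> K * \<bar>t - t'\<bar>"
      by (rule abs_diff_le_within[where r = 1 and g = "z x'" and ?g1.0 = "\<lambda>s. partial 0 1 z x' s"])
        (use C_hoelder_t[OF z, of 0 x'] K r in \<open>auto simp: p Qbar_def\<close>)
    moreover have "K * \<bar>x - x'\<bar> \<le> K * dist p q" "K * \<bar>t - t'\<bar> \<le> K * dist p q"
      using dist_fst_le[of p q] dist_snd_le[of p q] K(1) by (auto intro!: mult_left_mono simp: e dist_real_def)
    ultimately show "dist (case p of (x, t) \<Rightarrow> z x t) (case q of (x, t) \<Rightarrow> z x t) \<le> 2 * K * dist p q"
      by (simp add: e dist_real_def)
  qed (use K in simp)
  then show ?thesis by (rule lipschitz_on_continuous_on)
qed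


subsection \<open>From the singularly perturbed to the scaled problem\<close>

lemma scale_deriv:
  assumes "(z has_real_derivative D) (at (k * x) within {0..1})" "0 < k"
  shows "((\<lambda>s. z (k * s)) has_real_derivative k * D) (at x within {0..1 / k})"
proof -
  have im: "(\<lambda>s. k * s) ` {0..1 / k} \<subseteq> {0..1}" using assms(2) by (auto simp: field_simps)
  have "(z \<circ> (\<lambda>s. k * s) has_real_derivative D * k) (at x within {0..1 / k})"
    by (rule DERIV_image_chain[OF DERIV_subset[OF assms(1) im]]) (auto intro!: derivative_eq_intros)
  then show ?thesis by (simp add: o_def mult.commute)
qed

text \<open>Collects everything that is fixed before \<open>\<epsilon>\<close>, \<open>N\<close> and
  \<open>M\<close> are chosen: one bound \<open>K0\<close> for all derivatives of the data, the
  margin \<open>\<eta>\<close> and the kernel constants.\<close>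

locale problem_data =
  fixes b f :: "real \<Rightarrow> real \<Rightarrow> real" and gL gR \<phi> :: "real \<Rightarrow> real" and \<beta> \<gamma> K0 \<eta> \<kappa> C :: real
  assumes \<gamma>: "0 < \<gamma>" and f: "f \<in> C_hoelder 4 \<gamma>" and b: "b \<in> C_hoelder 4 \<gamma>"
    and gL: "gL \<in> Ck 2" and gR: "gR \<in> Ck 2" and \<phi>: "\<phi> \<in> Ck 4" and \<beta>: "0 < \<beta>"
    and corner: "Dx b 0 0 = 0" and \<phi>0: "Lim (at_right 0) \<phi> = \<phi> 0" and \<phi>1: "\<phi> 1 = gR 0"
    and K0: "1 \<le> K0"
    and b_bound: "\<And>i j x t. i + 2 * j \<le> 4 \<Longrightarrow> (x, t) \<in> Qbar \<Longrightarrow> \<bar>partial i j b x t\<bar> \<le> K0"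
    and f_bound: "\<And>i j x t. i + 2 * j \<le> 4 \<Longrightarrow> (x, t) \<in> Qbar \<Longrightarrow> \<bar>partial i j f x t\<bar> \<le> K0"
    and gL_bound: "\<And>i s. i \<le> 2 \<Longrightarrow> s \<in> {0..1} \<Longrightarrow> \<bar>(deriv01 ^^ i) gL s\<bar> \<le> K0"
    and gR_bound: "\<And>i s. i \<le> 2 \<Longrightarrow> s \<in> {0..1} \<Longrightarrow> \<bar>(deriv01 ^^ i) gR s\<bar> \<le> K0"
    and \<phi>_bound: "\<And>i s. i \<le> 4 \<Longrightarrow> s \<in> {0..1} \<Longrightarrow> \<bar>(deriv01 ^^ i) \<phi> s\<bar> \<le> K0"
    and \<eta>: "0 < \<eta>" and b_ge: "\<And>x t. (x, t) \<in> Qbar \<Longrightarrow> \<beta> + \<eta> \<le> b x t"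
    and kernel: "kernel_bounds (b 0 0) \<beta> \<eta> \<kappa> C"
begin

text \<open>A bound for \<open>a1 * erfc 0\<close>: three terms of size \<open>K0\<close>, using
  \<open>d \<le> 1\<close>, and the products of \<open>b 0 0\<close> with
  \<open>A0 gL \<phi>\<close> and with \<open>\<phi> 0\<close>, of sizes
  \<open>2 * K0\<^sup>2\<close> and \<open>K0\<^sup>2\<close>.\<close>

definition B where "B = 3 * K0 + 3 * K0\<^sup>2"
definition K where "K = B + B / erfc 0 + 1 / \<beta> + 1 / \<eta>"

lemma K: "K0 \<le> K" "B \<le> K" "B / erfc 0 \<le> K" "1 \<le> K" "1 \<le> K * \<beta>" "1 \<le> K * \<eta>"
proof -
  have B: "0 \<le> B" "K0 \<le> B" using K0 by (auto simp: B_def)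
  moreover have "0 \<le> B / erfc 0" using B erfc_0_pos by simp
  moreover have "0 < 1 / \<beta>" "0 < 1 / \<eta>" using \<beta> \<eta> by auto
  ultimately have k: "K0 \<le> K" "B \<le> K" "B / erfc 0 \<le> K" "1 \<le> K" "1 / \<beta> \<le> K" "1 / \<eta> \<le> K"
    using K0 unfolding K_def by linarith+
  then show "K0 \<le> K" "B \<le> K" "B / erfc 0 \<le> K" "1 \<le> K" by blast+
  show "1 \<le> K * \<beta>" "1 \<le> K * \<eta>" using k \<beta> \<eta> by (auto simp: divide_le_eq)
qed

definition a1 where "a1 d = (d\<^sup>2 * deriv01 gL 0 + b 0 0 * A0 gL \<phi>
  - (d\<^sup>2 * (deriv01 ^^ 2) \<phi> 0 + f 0 0 - b 0 0 * \<phi> 0)) / erfc 0"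

context
  fixes d :: real and y :: "real \<Rightarrow> real \<Rightarrow> real"
  assumes d: "0 < d" "d \<le> 1" and comp: "compatible b f gR \<phi> (d\<^sup>2)"
    and y: "solves_Y b f gL gR \<phi> (d\<^sup>2) y"
begin

text \<open>The argument of the error function is invariant under parabolic scaling, and scaling
  time by \<open>\<epsilon>\<close> removes \<open>\<epsilon>\<close> from the exponent.\<close>

lemma W_eq: "W (b 0 0) (A0 gL \<phi>) 0 0 x t = A0 gL \<phi> * z0 b (d\<^sup>2) (d * x) (d\<^sup>2 * t)"
  using d by (simp add: W_def z0_def th_def real_sqrt_mult)

text \<open>By the chain rule a space derivative gains the factor \<open>d\<close> and a time
  derivative \<open>d\<^sup>2\<close>; the operator \<open>L\<close> with
  \<open>\<epsilon> = d\<^sup>2\<close> loses its small parameter.\<close>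

lemma scaled: "scaled_problem (b 0 0) \<beta> \<eta> \<kappa> C K d (1 / d) (1 / d\<^sup>2)
  (\<lambda>x t. b (d * x) (d\<^sup>2 * t)) (\<lambda>x t. d\<^sup>2 * partial 0 1 b (d * x) (d\<^sup>2 * t))
  (\<lambda>x t. d ^ 4 * partial 0 2 b (d * x) (d\<^sup>2 * t)) (\<lambda>n x t. d ^ n * partial n 0 b (d * x) (d\<^sup>2 * t))
  (\<lambda>x t. f (d * x) (d\<^sup>2 * t)) (\<lambda>x t. d\<^sup>2 * partial 0 1 f (d * x) (d\<^sup>2 * t))
  (\<lambda>x t. d ^ 4 * partial 0 2 f (d * x) (d\<^sup>2 * t)) (\<lambda>n x t. d ^ n * partial n 0 f (d * x) (d\<^sup>2 * t))
  (\<lambda>n x. d ^ n * (deriv01 ^^ n) \<phi> (d * x))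
  (\<lambda>t. gL (d\<^sup>2 * t)) (\<lambda>t. d\<^sup>2 * (deriv01 ^^ 1) gL (d\<^sup>2 * t)) (\<lambda>t. d ^ 4 * (deriv01 ^^ 2) gL (d\<^sup>2 * t))
  (\<lambda>t. gR (d\<^sup>2 * t)) (\<lambda>t. d\<^sup>2 * (deriv01 ^^ 1) gR (d\<^sup>2 * t)) (\<lambda>t. d ^ 4 * (deriv01 ^^ 2) gR (d\<^sup>2 * t))
  (A0 gL \<phi>) (a1 d)
  (\<lambda>x t. y (d * x) (d\<^sup>2 * t)) (\<lambda>x t. d\<^sup>2 * Dt y (d * x) (d\<^sup>2 * t)) (\<lambda>x t. d * Dx y (d * x) (d\<^sup>2 * t))
  (\<lambda>x t. d\<^sup>2 * (Dx ^^ 2) y (d * x) (d\<^sup>2 * t))"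
proof -
  have d2: "0 < d\<^sup>2" "d\<^sup>2 \<le> 1" using d by (auto simp: power_le_one)
  have dn: "0 \<le> d ^ n" "d ^ n \<le> 1" for n using d by (auto simp: power_le_one)
  have d4: "d ^ 4 \<le> d\<^sup>2" using d by (intro power_decreasing) auto
  have d4': "d ^ 4 = d\<^sup>2 * d\<^sup>2" by (simp add: power2_eq_square power4_eq_xxxx)
  have x01: "0 \<le> d * x \<and> d * x \<le> 1" if "0 \<le> x" "x \<le> 1 / d" for x using that d by (simp add: field_simps)
  have t01: "0 \<le> d\<^sup>2 * t \<and> d\<^sup>2 * t \<le> 1" if "0 \<le> t" "t \<le> 1 / d\<^sup>2" for t using that d2 by (simp add: field_simps)
  have Qb: "(d * x, d\<^sup>2 * t) \<in> Qbar" if "0 \<le> x" "x \<le> 1 / d" "0 \<le> t" "t \<le> 1 / d\<^sup>2" for x t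
    using x01[OF that(1,2)] t01[OF that(3,4)] by (simp add: Qbar_def)
  have Qi: "(d * x, d\<^sup>2 * t) \<in> Q" if "0 < x" "x < 1 / d" "0 < t" "t \<le> 1 / d\<^sup>2" for x t
    using that d d2 t01[of t] by (simp add: Q_def field_simps)
  have p0: "partial 0 0 z = z" for z by (simp add: partial_def)
  have mono: "\<bar>v\<bar> \<le> K" if "\<bar>v\<bar> \<le> K0" for v using that K(1) by linarith
  have scale_le: "\<bar>d ^ n * v\<bar> \<le> K * d ^ n" if "\<bar>v\<bar> \<le> K0" for n v
    using mult_left_mono[OF mono[OF that] dn(1)[of n]] dn(1)[of n] by (simp add: abs_mult mult.commute)
  have scale_le4: "\<bar>d ^ 4 * v\<bar> \<le> K * d\<^sup>2" if "\<bar>v\<bar> \<le> K0" for v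
    using scale_le[OF that, of 4] mult_left_mono[OF d4, of K] K(4) by linarith
  have sx: "((\<lambda>x. d ^ n * g (d * x)) has_real_derivative d ^ Suc n * D) (at x within {0..1 / d})"
    if "(g has_real_derivative D) (at (d * x) within {0..1})" for n D and g :: "real \<Rightarrow> real" and x
    using DERIV_cmult[OF scale_deriv[OF that d(1)], of "d ^ n"] by (simp add: mult_ac)
  have st: "((\<lambda>t. g (d\<^sup>2 * t)) has_real_derivative d\<^sup>2 * D) (at t within {0..1 / d\<^sup>2})"
    "((\<lambda>t. d\<^sup>2 * g (d\<^sup>2 * t)) has_real_derivative d ^ 4 * D) (at t within {0..1 / d\<^sup>2})"
    if "(g has_real_derivative D) (at (d\<^sup>2 * t) within {0..1})" for D and g :: "real \<Rightarrow> real" and t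
    using scale_deriv[OF that d2(1)] DERIV_cmult[OF scale_deriv[OF that d2(1)], of "d\<^sup>2"]
    unfolding d4' mult.assoc by blast+
  have A0: "A0 gL \<phi> = gL 0 - \<phi> 0" by (simp add: A0_def \<phi>0)
  have A0_le: "\<bar>A0 gL \<phi>\<bar> \<le> 2 * K0"
    using gL_bound[of 0 0] \<phi>_bound[of 0 0] by (simp add: A0)
  have c_le: "\<bar>b 0 0\<bar> \<le> K0" using b_bound[of 0 0 0 0] by (simp add: p0 Qbar_def)
  have K02: "K0 \<le> K0\<^sup>2" using K0 by (simp add: power2_eq_square)
  have a1_eq: "a1 d * erfc 0 = d\<^sup>2 * deriv01 gL 0 + b 0 0 * A0 gL \<phi>
      - (d\<^sup>2 * (deriv01 ^^ 2) \<phi> 0 + f 0 0 - b 0 0 * \<phi> 0)"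
    using erfc_0_pos by (simp add: a1_def)
  have a1_le: "\<bar>a1 d * erfc 0\<bar> \<le> B"
  proof -
    have "\<bar>d\<^sup>2 * v\<bar> \<le> K0" if "\<bar>v\<bar> \<le> K0" for v
      using mult_mono[OF d2(2) that] d2 K0 by (simp add: abs_mult)
    from this[of "deriv01 gL 0"] this[of "(deriv01 ^^ 2) \<phi> 0"]
    have 1: "\<bar>d\<^sup>2 * deriv01 gL 0\<bar> \<le> K0" "\<bar>d\<^sup>2 * (deriv01 ^^ 2) \<phi> 0\<bar> \<le> K0"
      using gL_bound[of 1 0] \<phi>_bound[of 2 0] by auto
    have 2: "\<bar>b 0 0 * A0 gL \<phi>\<bar> \<le> K0 * (2 * K0)"
      unfolding abs_mult using c_le A0_le K0 by (intro mult_mono) auto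
    have 3: "\<bar>b 0 0 * \<phi> 0\<bar> \<le> K0 * K0"
      unfolding abs_mult using c_le \<phi>_bound[of 0 0] K0 by (intro mult_mono) auto
    have 4: "\<bar>f 0 0\<bar> \<le> K0" using f_bound[of 0 0 0 0] by (simp add: p0 Qbar_def)
    have "\<bar>p + q - (r + s - u)\<bar> \<le> 3 * K0 + 3 * e"
      if "\<bar>p\<bar> \<le> K0" "\<bar>q\<bar> \<le> 2 * e" "\<bar>r\<bar> \<le> K0" "\<bar>s\<bar> \<le> K0" "\<bar>u\<bar> \<le> e" for p q r s u e :: real
      using that by linarith
    from this[OF 1(1) _ 1(2) 4, of "b 0 0 * A0 gL \<phi>" "K0\<^sup>2" "b 0 0 * \<phi> 0"] 2 3
    show ?thesis unfolding a1_eq B_def by (simp add: power2_eq_square)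
  qed
  show ?thesis
  proof (intro scaled_problem.intro kernel scaled_problem_axioms.intro)
    show "\<bar>A0 gL \<phi>\<bar> \<le> K" using A0_le K(2) K0 K02 unfolding B_def by linarith
    show "\<bar>a1 d * erfc 0\<bar> \<le> K" using a1_le K(2) by linarith
    have "\<bar>a1 d\<bar> \<le> B / erfc 0" using a1_le erfc_0_pos by (simp add: abs_mult pos_le_divide_eq)
    then show "\<bar>a1 d\<bar> \<le> K" using K(3) by linarith
    show "a1 d * erfc 0 = d\<^sup>2 * (deriv01 ^^ 1) gL (d\<^sup>2 * 0) + b 0 0 * A0 gL \<phi>
      - (d\<^sup>2 * (deriv01 ^^ 2) \<phi> (d * 0) + f (d * 0) (d\<^sup>2 * 0) - b (d * 0) (d\<^sup>2 * 0) * (d ^ 0 * (deriv01 ^^ 0) \<phi> (d * 0)))"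
      using a1_eq by simp
    show "gL (d\<^sup>2 * 0) - A0 gL \<phi> = d ^ 0 * (deriv01 ^^ 0) \<phi> (d * 0)" by (simp add: A0)
    show "gR (d\<^sup>2 * 0) = d ^ 0 * (deriv01 ^^ 0) \<phi> (d * (1 / d))" using d \<phi>1 by simp
    \<comment> \<open>This is the first condition in \<open>compatible\<close>, solved for the
      boundary slope.\<close>
    show "d\<^sup>2 * (deriv01 ^^ 1) gR (d\<^sup>2 * 0) = d\<^sup>2 * (deriv01 ^^ 2) \<phi> (d * (1 / d)) + f (d * (1 / d)) (d\<^sup>2 * 0)
      - b (d * (1 / d)) (d\<^sup>2 * 0) * (d ^ 0 * (deriv01 ^^ 0) \<phi> (d * (1 / d)))"
      using comp d \<phi>1 by (simp add: compatible_def algebra_simps)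
  next
    fix x t assume xt: "0 \<le> x" "x \<le> 1 / d" "0 \<le> t" "t \<le> 1 / d\<^sup>2"
    note xt01 = conjunct1[OF x01[OF xt(1,2)]] conjunct2[OF x01[OF xt(1,2)]] conjunct1[OF t01[OF xt(3,4)]] conjunct2[OF t01[OF xt(3,4)]]
    note Q1 = Qb[OF xt]
    show "\<beta> + \<eta> \<le> b (d * x) (d\<^sup>2 * t)" by (rule b_ge[OF Q1])
    show "((\<lambda>t. b (d * x) (d\<^sup>2 * t)) has_real_derivative d\<^sup>2 * partial 0 1 b (d * x) (d\<^sup>2 * t)) (at t within {0..1 / d\<^sup>2})"
      using st(1)[of "b (d * x)"] C_hoelder_t[OF b, of 0, OF _ Q1] by (simp add: p0)
    show "((\<lambda>t. d\<^sup>2 * partial 0 1 b (d * x) (d\<^sup>2 * t)) has_real_derivative d ^ 4 * partial 0 2 b (d * x) (d\<^sup>2 * t)) (at t within {0..1 / d\<^sup>2})"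
      using C_hoelder_t[OF b, of 1, OF _ Q1] by (intro st(2)) (simp add: numeral_2_eq_2)
    show "((\<lambda>t. f (d * x) (d\<^sup>2 * t)) has_real_derivative d\<^sup>2 * partial 0 1 f (d * x) (d\<^sup>2 * t)) (at t within {0..1 / d\<^sup>2})"
      using st(1)[of "f (d * x)"] C_hoelder_t[OF f, of 0, OF _ Q1] by (simp add: p0)
    show "((\<lambda>t. d\<^sup>2 * partial 0 1 f (d * x) (d\<^sup>2 * t)) has_real_derivative d ^ 4 * partial 0 2 f (d * x) (d\<^sup>2 * t)) (at t within {0..1 / d\<^sup>2})"
      using C_hoelder_t[OF f, of 1, OF _ Q1] by (intro st(2)) (simp add: numeral_2_eq_2)
    show "\<bar>d\<^sup>2 * partial 0 1 b (d * x) (d\<^sup>2 * t)\<bar> \<le> K * d\<^sup>2 \<and> \<bar>d ^ 4 * partial 0 2 b (d * x) (d\<^sup>2 * t)\<bar> \<le> K * d\<^sup>2 \<and>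
      \<bar>d\<^sup>2 * partial 0 1 f (d * x) (d\<^sup>2 * t)\<bar> \<le> K * d\<^sup>2 \<and> \<bar>d ^ 4 * partial 0 2 f (d * x) (d\<^sup>2 * t)\<bar> \<le> K * d\<^sup>2"
      by (intro conjI scale_le scale_le4 b_bound[OF _ Q1] f_bound[OF _ Q1]) auto
    note cg = corner_growth[OF b b_bound corner xt01]
    show "\<bar>b (d * x) (d\<^sup>2 * t) - b 0 0\<bar> \<le> K * (x\<^sup>2 + t)"
    proof (rule order_trans[OF cg(2)])
      have "d\<^sup>2 * (x\<^sup>2 + t) \<le> 1 * (x\<^sup>2 + t)" using d2 xt by (intro mult_right_mono) auto
      then have "(d * x)\<^sup>2 + d\<^sup>2 * t \<le> x\<^sup>2 + t" by (simp add: power_mult_distrib distrib_left)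
      then show "K0 * ((d * x)\<^sup>2 + d\<^sup>2 * t) \<le> K * (x\<^sup>2 + t)"
        using K(1) K0 xt01 by (intro mult_mono) auto
    qed auto
    show "\<bar>d ^ 1 * partial 1 0 b (d * x) (d\<^sup>2 * t)\<bar> \<le> K * (x + t)"
    proof -
      have "\<bar>partial 1 0 b (d * x) (d\<^sup>2 * t)\<bar> \<le> K0 * (d * x + d\<^sup>2 * t)" using cg(1) by (simp add: partial_def)
      also have "\<dots> \<le> K * (1 * x + 1 * t)"
        using K(1) K0 xt xt01 d d2 by (intro mult_mono add_mono mult_right_mono) auto
      finally have "d ^ 1 * \<bar>partial 1 0 b (d * x) (d\<^sup>2 * t)\<bar> \<le> 1 * (K * (x + t))"
        using d dn[of 1] by (intro mult_mono) auto
      then show ?thesis using d by (simp add: abs_mult)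
    qed
    fix n :: nat assume n: "n \<le> 4"
    show "\<bar>d ^ n * partial n 0 b (d * x) (d\<^sup>2 * t)\<bar> \<le> K * d ^ n" "\<bar>d ^ n * partial n 0 f (d * x) (d\<^sup>2 * t)\<bar> \<le> K * d ^ n"
      using n by (auto intro!: scale_le b_bound[OF _ Q1] f_bound[OF _ Q1])
  next
    fix n :: nat and x t assume n: "n < 4" and xt: "0 \<le> x" "x \<le> 1 / d" "0 \<le> t" "t \<le> 1 / d\<^sup>2"
    show "((\<lambda>x. d ^ n * partial n 0 b (d * x) (d\<^sup>2 * t)) has_real_derivative d ^ Suc n * partial (Suc n) 0 b (d * x) (d\<^sup>2 * t)) (at x within {0..1 / d})"
      using C_hoelder_x[OF b, of n 0, OF _ Qb[OF xt]] n by (intro sx[where g = "\<lambda>s. partial n 0 b s (d\<^sup>2 * t)"]) auto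
    show "((\<lambda>x. d ^ n * partial n 0 f (d * x) (d\<^sup>2 * t)) has_real_derivative d ^ Suc n * partial (Suc n) 0 f (d * x) (d\<^sup>2 * t)) (at x within {0..1 / d})"
      using C_hoelder_x[OF f, of n 0, OF _ Qb[OF xt]] n by (intro sx[where g = "\<lambda>s. partial n 0 f s (d\<^sup>2 * t)"]) auto
  next
    fix n :: nat and x assume n: "n \<le> 4" and x: "0 \<le> x" "x \<le> 1 / d"
    show "\<bar>d ^ n * (deriv01 ^^ n) \<phi> (d * x)\<bar> \<le> K * d ^ n"
      using n x01[OF x] by (intro scale_le \<phi>_bound) auto
  next
    fix n :: nat and x assume n: "n < 4" and x: "0 \<le> x" "x \<le> 1 / d"
    show "((\<lambda>x. d ^ n * (deriv01 ^^ n) \<phi> (d * x)) has_real_derivative d ^ Suc n * (deriv01 ^^ Suc n) \<phi> (d * x)) (at x within {0..1 / d})"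
      using n x01[OF x] by (intro sx Ck_deriv[OF \<phi>]) auto
  next
    fix t assume t: "0 \<le> t" "t \<le> 1 / d\<^sup>2"
    note t' = t01[OF t]
    show "\<bar>gL (d\<^sup>2 * t)\<bar> \<le> K \<and> \<bar>gR (d\<^sup>2 * t)\<bar> \<le> K \<and>
        \<bar>d\<^sup>2 * (deriv01 ^^ 1) gL (d\<^sup>2 * t)\<bar> \<le> K * d\<^sup>2 \<and> \<bar>d ^ 4 * (deriv01 ^^ 2) gL (d\<^sup>2 * t)\<bar> \<le> K * d\<^sup>2 \<and>
        \<bar>d\<^sup>2 * (deriv01 ^^ 1) gR (d\<^sup>2 * t)\<bar> \<le> K * d\<^sup>2 \<and> \<bar>d ^ 4 * (deriv01 ^^ 2) gR (d\<^sup>2 * t)\<bar> \<le> K * d\<^sup>2"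
    proof (intro conjI scale_le scale_le4)
      show "\<bar>gL (d\<^sup>2 * t)\<bar> \<le> K" "\<bar>gR (d\<^sup>2 * t)\<bar> \<le> K"
        using gL_bound[of 0 "d\<^sup>2 * t"] gR_bound[of 0 "d\<^sup>2 * t"] t' by (auto intro!: mono)
    qed (use t' in \<open>auto intro!: gL_bound gR_bound simp del: One_nat_def\<close>)
    show "((\<lambda>t. gL (d\<^sup>2 * t)) has_real_derivative d\<^sup>2 * (deriv01 ^^ 1) gL (d\<^sup>2 * t)) (at t within {0..1 / d\<^sup>2})"
      "((\<lambda>t. gR (d\<^sup>2 * t)) has_real_derivative d\<^sup>2 * (deriv01 ^^ 1) gR (d\<^sup>2 * t)) (at t within {0..1 / d\<^sup>2})"
      using Ck_deriv[OF gL, of 0 "d\<^sup>2 * t"] Ck_deriv[OF gR, of 0 "d\<^sup>2 * t"] t' by (auto intro!: st(1))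
    show "((\<lambda>t. d\<^sup>2 * (deriv01 ^^ 1) gL (d\<^sup>2 * t)) has_real_derivative d ^ 4 * (deriv01 ^^ 2) gL (d\<^sup>2 * t)) (at t within {0..1 / d\<^sup>2})"
      "((\<lambda>t. d\<^sup>2 * (deriv01 ^^ 1) gR (d\<^sup>2 * t)) has_real_derivative d ^ 4 * (deriv01 ^^ 2) gR (d\<^sup>2 * t)) (at t within {0..1 / d\<^sup>2})"
      by (intro st(2) Ck_deriv[OF gL, of 1, unfolded Suc_1] Ck_deriv[OF gR, of 1, unfolded Suc_1]; use t' in simp)+
    show "y (d * 0) (d\<^sup>2 * t) = gL (d\<^sup>2 * t) - A0 gL \<phi> * exp (- b 0 0 * t)"
      using y t' d by (simp add: solves_Y_def)
    show "y (d * (1 / d)) (d\<^sup>2 * t) = gR (d\<^sup>2 * t) - W (b 0 0) (A0 gL \<phi>) 0 0 (1 / d) t"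
      using y t' d unfolding W_eq by (simp add: solves_Y_def)
  next
    fix x assume x: "0 \<le> x" "x \<le> 1 / d"
    \<comment> \<open>\<open>solves_Y\<close> prescribes initial values on the open interval only.
      At the end points they come from the boundary conditions at \<open>t = 0\<close>: on the left
      \<open>A0\<close> is the jump, on the right \<open>z0\<close> vanishes.\<close>
    have "y x' 0 = \<phi> x'" if x': "0 \<le> x'" "x' \<le> 1" for x'
    proof -
      consider "x' = 0" | "x' = 1" | "x' \<in> {0<..<1}" using x' by force
      then show ?thesis
      proof cases
        case 1
        then show ?thesis using y by (simp add: solves_Y_def A0)
      next
        case 2
        then show ?thesis using y \<phi>1 by (simp add: solves_Y_def z0_def)
      next
        case 3
        then show ?thesis using y by (simp add: solves_Y_def)
      qed
    qed
    then show "y (d * x) (d\<^sup>2 * 0) = d ^ 0 * (deriv01 ^^ 0) \<phi> (d * x)" using x01[OF x] by simp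
  next
    fix x t assume xt: "0 < x" "x < 1 / d" "0 < t" "t \<le> 1 / d\<^sup>2"
    have "L b (d\<^sup>2) y (d * x) (d\<^sup>2 * t) = rhs_Y b f gL \<phi> (d\<^sup>2) (d * x) (d\<^sup>2 * t)"
      using y Qi[OF xt] unfolding solves_Y_def by blast
    then show "d\<^sup>2 * Dt y (d * x) (d\<^sup>2 * t) - d\<^sup>2 * (Dx ^^ 2) y (d * x) (d\<^sup>2 * t) + b (d * x) (d\<^sup>2 * t) * y (d * x) (d\<^sup>2 * t)
      = f (d * x) (d\<^sup>2 * t) - (b (d * x) (d\<^sup>2 * t) - b 0 0) * W (b 0 0) (A0 gL \<phi>) 0 0 x t"
      unfolding W_eq by (simp add: L_def rhs_Y_def algebra_simps)
  next
    show "reg (\<lambda>x t. y (d * x) (d\<^sup>2 * t)) (\<lambda>x t. d\<^sup>2 * Dt y (d * x) (d\<^sup>2 * t)) (\<lambda>x t. d * Dx y (d * x) (d\<^sup>2 * t))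
      (\<lambda>x t. d\<^sup>2 * (Dx ^^ 2) y (d * x) (d\<^sup>2 * t)) 0 (1 / d) 0 (1 / d\<^sup>2)"
      unfolding reg_def
    proof (intro conjI allI impI)
      have "continuous_on ({0..1 / d} \<times> {0..1 / d\<^sup>2}) (\<lambda>p. (\<lambda>(x, t). y x t) (d * fst p, d\<^sup>2 * snd p))"
        by (rule continuous_on_compose2[of Qbar "\<lambda>(x, t). y x t"])
          (use y Qb in \<open>auto simp: solves_Y_def intro!: continuous_intros\<close>)
      then show "continuous_on ({0..1 / d} \<times> {0..1 / d\<^sup>2}) (\<lambda>(x, t). y (d * x) (d\<^sup>2 * t))"
        by (simp add: case_prod_unfold)
      fix x t assume xt: "0 < x" "x < 1 / d" "0 < t" "t \<le> 1 / d\<^sup>2"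
      have diff: "(\<lambda>s. y (d * x) s) differentiable (at (d\<^sup>2 * t) within {0..1})"
        "(\<lambda>s. y s (d\<^sup>2 * t)) differentiable (at (d * x) within {0..1})"
        "(\<lambda>s. Dx y s (d\<^sup>2 * t)) differentiable (at (d * x) within {0..1})"
        using y Qi[OF xt] unfolding solves_Y_def t_differentiable_on_def x_differentiable_on_def by blast+
      have "((\<lambda>t. y (d * x) (d\<^sup>2 * t)) has_real_derivative d\<^sup>2 * Dt y (d * x) (d\<^sup>2 * t)) (at t within {0..1 / d\<^sup>2})"
        using has_deriv01[OF diff(1)] by (intro st(1)) (simp add: Dt_def)
      then have "((\<lambda>t. y (d * x) (d\<^sup>2 * t)) has_real_derivative d\<^sup>2 * Dt y (d * x) (d\<^sup>2 * t)) (at t within {0..t})"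
        by (rule DERIV_subset) (use xt in auto)
      then show "((\<lambda>t. y (d * x) (d\<^sup>2 * t)) has_real_derivative d\<^sup>2 * Dt y (d * x) (d\<^sup>2 * t)) (at_left t)"
        using xt by (simp add: at_within_Icc_at_left)
      have at: "at x within {0..1 / d} = at x" using xt by (intro at_within_Icc_at) auto
      show "((\<lambda>s. y (d * s) (d\<^sup>2 * t)) has_real_derivative d * Dx y (d * x) (d\<^sup>2 * t)) (at x)"
        using sx[where n = 0 and g = "\<lambda>s. y s (d\<^sup>2 * t)" and x = x, OF has_deriv01[OF diff(2)]] by (simp add: at Dx_def)
      show "((\<lambda>s. d * Dx y (d * s) (d\<^sup>2 * t)) has_real_derivative d\<^sup>2 * (Dx ^^ 2) y (d * x) (d\<^sup>2 * t)) (at x)"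
        using sx[where n = 1 and g = "\<lambda>s. Dx y s (d\<^sup>2 * t)" and x = x, OF has_deriv01[OF diff(3)]]
        by (simp add: at numeral_2_eq_2 Dx_def[of "Dx y"])
    qed
  qed (use K d in \<open>auto simp: p0\<close>)
qed

lemma scheme_error_original:
  assumes N: "0 < N" "4 dvd N" and M: "0 < M" "even M"
    and Y: "solves_D b f gL \<phi> \<beta> (d\<^sup>2) N M y Y" and ij: "i \<le> N" "j \<le> M"
  shows "\<bar>y (xmesh \<beta> (d\<^sup>2) N i) (tmesh \<beta> (d\<^sup>2) M j) - Y i j\<bar>
    \<le> scaled_problem.CF \<beta> \<eta> \<kappa> C K * ((ln (real N) / real N)\<^sup>2 + ln (real M) / real M)"
proof -
  obtain n m where nm: "N = 4 * n" "M = 2 * m" "0 < n" "0 < m" using N M by (auto elim!: dvdE)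
  have e: "0 < d\<^sup>2" using d by simp
  define X S where "X = xmesh \<beta> (d\<^sup>2) N" and "S = tmesh \<beta> (d\<^sup>2) M"
  define \<sigma> l where "\<sigma> = sigma \<beta> (d\<^sup>2) N" and "l = ln (real N)"
  have X: "X 0 = 0" "X N = 1" "X n = \<sigma>" "X (3 * n) = 1 - \<sigma>" "strict_mono X"
    "X (Suc i) - X i = (if n \<le> i \<and> i < 3 * n then (1 - 2 * \<sigma>) / (2 * n) else \<sigma> / n)" for i
    using xmesh_facts[OF \<beta> e nm(3)] xmesh_mono[OF \<beta> e nm(3)] by (simp_all add: X_def \<sigma>_def nm(1))
  have S: "S 0 = 0" "S M = 1" "strict_mono S"
    using tmesh_facts[OF \<beta> e nm(4)] tmesh_mono[OF \<beta> e nm(4)] by (simp_all add: S_def nm(2))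
  have \<sigma>: "0 < \<sigma>" "\<sigma> \<le> 1 / 4" using sigma_bounds[OF \<beta> e, of N] nm by (simp_all add: \<sigma>_def)
  have l: "0 \<le> l" using nm by (simp add: l_def)
  have \<sigma>_eq: "\<sigma> = min (1 / 4) (2 * (d / sqrt \<beta>) * l)"
    using d by (simp add: \<sigma>_def sigma_def l_def real_sqrt_divide)
  have inQ: "(X i, S j) \<in> Q \<longleftrightarrow> 0 < i \<and> i < N \<and> 0 < j" if "i \<le> N" "j \<le> M" for i j
  proof -
    have "0 < X i \<longleftrightarrow> 0 < i" "X i < 1 \<longleftrightarrow> i < N" using strict_mono_less[OF X(5)] X(1,2) by metis+
    moreover have "0 < S j \<longleftrightarrow> 0 < j" "S j \<le> 1" using strict_mono_less[OF S(3)] strict_mono_less_eq[OF S(3)] S(1,2) that by metis+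
    ultimately show ?thesis by (auto simp: Q_def)
  qed
  have D: "if (X i, S j) \<in> Q
      then d\<^sup>2 * dt_minus S Y i j - d\<^sup>2 * delta2 X Y i j + b (X i) (S j) * Y i j = rhs_Y b f gL \<phi> (d\<^sup>2) (X i) (S j)
      else Y i j = y (X i) (S j)" if "i \<le> N" "j \<le> M" for i j
    using Y that unfolding solves_D_def Let_def X_def S_def by blast
  define xs ts where "xs i = X i / d" and "ts j = S j / d\<^sup>2" for i j
  have dx: "d * xs i = X i" "d\<^sup>2 * ts j = S j" for i j using d by (simp_all add: xs_def ts_def)
  have "\<bar>y (d * xs i) (d\<^sup>2 * ts j) - Y i j\<bar> \<le> scaled_problem.CF \<beta> \<eta> \<kappa> C K * ((ln (real N) / real N)\<^sup>2 + ln (real M) / real M)"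
  proof (rule scaled_scheme.scheme_error[OF scaled_scheme.intro[OF scaled scaled_scheme_axioms.intro],
        where N = N and M = M and ?n4.0 = n and xs = xs and ts = ts and Y = Y
          and h = "\<sigma> / n / d" and H = "(1 - 2 * \<sigma>) / (2 * n) / d" and sg = "\<sigma> / d"])
    show "xs 0 = 0" "xs N = 1 / d" "ts 0 = 0" "ts M = 1 / d\<^sup>2" using X S by (simp_all add: xs_def ts_def)
    show "ts j < ts (Suc j)" for j using strict_monoD[OF S(3), of j "Suc j"] e by (simp add: ts_def divide_strict_right_mono)
  next
    fix j assume "0 < j" "j \<le> M"
    from tmesh_step[OF \<beta> e nm(4) K(5) this(1)]
    show "ts j - ts (j - 1) \<le> 2 * K * (ln (real M) / real M) \<or>
      (ts j - ts (j - 1)) * d\<^sup>2 \<le> 2 / real M \<and> exp (- \<beta> * ts (j - 1)) \<le> 1 / real M"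
      using e by (simp add: ts_def S_def nm(2) diff_divide_distrib[symmetric])
  next
    show "0 < \<sigma> / n / d" using \<sigma> nm d by simp
    \<comment> \<open>With \<open>n = N / 4\<close> the scaled fine step is at most
      \<open>8 / sqrt \<beta> * (l / N)\<close>; its square, with
      \<open>1 / \<beta> \<le> K\<close>, gives the factor \<open>64 * K\<close>.\<close>
    have "\<sigma> \<le> 2 * (d / sqrt \<beta>) * l" unfolding \<sigma>_eq by (rule min.cobounded2)
    then have "\<sigma> / n / d \<le> (2 * (d / sqrt \<beta>) * l) / n / d" using d by (intro divide_right_mono) auto
    also have "\<dots> = 8 / sqrt \<beta> * (l / N)" using d by (simp add: nm)
    finally have "(\<sigma> / n / d)\<^sup>2 \<le> (8 / sqrt \<beta> * (l / N))\<^sup>2" using \<sigma> d by (intro power_mono) auto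
    also have "\<dots> = 64 * (1 / \<beta>) * (l / N)\<^sup>2" using \<beta> by (simp add: power_mult_distrib power_divide)
    also have "\<dots> \<le> 64 * K * (l / N)\<^sup>2"
      using K(5) \<beta> by (intro mult_right_mono mult_left_mono) (auto simp: divide_le_eq)
    finally show "(\<sigma> / n / d)\<^sup>2 \<le> 64 * K * (ln (real N) / real N)\<^sup>2" by (simp add: l_def)
    have st: "xs (Suc i) - xs i = (if n \<le> i \<and> i < 3 * n then (1 - 2 * \<sigma>) / (2 * n) / d else \<sigma> / n / d)" for i
      using X(6)[of i] by (simp add: xs_def diff_divide_distrib[symmetric])
    consider "\<sigma> = 1 / 4" | "\<sigma> = 2 * (d / sqrt \<beta>) * l" "\<sigma> < 1 / 4" unfolding \<sigma>_eq by linarith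
    then show "(\<forall>i<N. xs (Suc i) - xs i = \<sigma> / n / d) \<or>
      \<sigma> / d = 2 * (1 / sqrt \<beta>) * ln (real N) \<and> 4 * (\<sigma> / d) < 1 / d \<and> \<sigma> / n / d = 4 * (\<sigma> / d) / N \<and>
      \<sigma> / n / d \<le> (1 - 2 * \<sigma>) / (2 * n) / d \<and> (1 - 2 * \<sigma>) / (2 * n) / d \<le> 2 / (d * N) \<and>
      xs n = \<sigma> / d \<and> xs (3 * n) = 1 / d - \<sigma> / d \<and>
      (\<forall>i<N. xs (Suc i) - xs i = (if n \<le> i \<and> i < 3 * n then (1 - 2 * \<sigma>) / (2 * n) / d else \<sigma> / n / d))"
    proof cases
      case 1
      \<comment> \<open>When \<open>\<sigma>\<close> is capped at 1/4, coarse and fine steps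
        coincide.\<close>
      have "(1 - 2 * \<sigma>) / (2 * n) = \<sigma> / n" unfolding 1 by simp
      then show ?thesis using st by (simp only: if_cancel simp_thms)
    next
      case 2
      have "\<sigma> / d = 2 * (1 / sqrt \<beta>) * ln (real N)" using 2(1) d by (simp add: l_def)
      moreover have "4 * (\<sigma> / d) < 1 / d" using 2(2) d by (simp add: divide_strict_right_mono)
      moreover have "\<sigma> / n / d = 4 * (\<sigma> / d) / N" by (simp add: nm mult.commute)
      moreover have "\<sigma> / n / d \<le> (1 - 2 * \<sigma>) / (2 * n) / d"
      proof -
        have "(2 * \<sigma>) / (2 * n) / d \<le> (1 - 2 * \<sigma>) / (2 * n) / d" using 2(2) d by (intro divide_right_mono) auto
        then show ?thesis by simp
      qed
      moreover have "(1 - 2 * \<sigma>) / (2 * n) / d \<le> 2 / (d * N)"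
      proof -
        have "(1 - 2 * \<sigma>) / (2 * n) / d \<le> 1 / (2 * n) / d" using \<sigma> d by (intro divide_right_mono) auto
        then show ?thesis using d nm(3) by (simp add: nm(1) field_simps)
      qed
      moreover have "xs n = \<sigma> / d" "xs (3 * n) = 1 / d - \<sigma> / d"
        using X(3,4) by (simp_all add: xs_def diff_divide_distrib)
      ultimately show ?thesis using st by blast
    qed
  next
    fix i j assume ij: "0 < i" "i < N" "0 < j" "j \<le> M"
    then have "d\<^sup>2 * dt_minus S Y i j - d\<^sup>2 * delta2 X Y i j + b (X i) (S j) * Y i j = rhs_Y b f gL \<phi> (d\<^sup>2) (X i) (S j)"
      using D[of i j] inQ[of i j] by simp
    moreover have "dt_minus ts Y i j = d\<^sup>2 * dt_minus S Y i j" "delta2 xs Y i j = d\<^sup>2 * delta2 X Y i j"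
      unfolding ts_def[abs_def] xs_def[abs_def] by (rule dt_minus_scale, rule delta2_scale)
    ultimately show "dt_minus ts Y i j - delta2 xs Y i j + b (d * xs i) (d\<^sup>2 * ts j) * Y i j
      = f (d * xs i) (d\<^sup>2 * ts j) - (b (d * xs i) (d\<^sup>2 * ts j) - b 0 0) * W (b 0 0) (A0 gL \<phi>) 0 0 (xs i) (ts j)"
      unfolding W_eq dx by (simp add: rhs_Y_def mult_ac)
  next
    fix i j assume ij: "i \<le> N" "j \<le> M" "i = 0 \<or> i = N \<or> j = 0"
    then show "Y i j = y (d * xs i) (d\<^sup>2 * ts j)" using D[OF ij(1,2)] inQ[OF ij(1,2)] unfolding dx by auto
  qed (use nm ij in auto)
  then show ?thesis unfolding dx X_def S_def .
qed

end

end

theorem theorem4: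
  fixes b f :: "real \<Rightarrow> real \<Rightarrow> real"
    and gL gR \<phi> :: "real \<Rightarrow> real"
    and \<beta> \<gamma> :: real
  assumes "\<gamma> > 0"
    and "f \<in> C_hoelder 4 \<gamma>" and "b \<in> C_hoelder 4 \<gamma>"
    and "gL \<in> Ck 2" and "gR \<in> Ck 2" and "\<phi> \<in> Ck 4"
    and "\<beta> > 0" and "\<forall>(x, t) \<in> Qbar. b x t > \<beta>"
    and "Dx b 0 0 = 0"
    and "Lim (at_right 0) \<phi> \<noteq> gL 0"
    and "Lim (at_left 1) \<phi> = gR 0"
  shows "\<exists>C. \<forall>\<epsilon> N M y Y.
    0 < \<epsilon> \<and> \<epsilon> \<le> 1 \<and> compatible b f gR \<phi> \<epsilon> \<and>
    N > 0 \<and> 4 dvd N \<and> M > 0 \<and> even M \<and>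
    solves_Y b f gL gR \<phi> \<epsilon> y \<and> solves_D b f gL \<phi> \<beta> \<epsilon> N M y Y \<longrightarrow>
    Max ((\<lambda>(i, j). \<bar>y (xmesh \<beta> \<epsilon> N i) (tmesh \<beta> \<epsilon> M j) - Y i j\<bar>) ` ({..N} \<times> {..M}))
      \<le> C * ((real N) powi (-2) * max ((ln (real N))\<^sup>2) (ln (real M))
             + (real M) powi (-1) * (ln (real M))\<^sup>2)"
proof -
  have \<phi>_cont: "continuous_on {0..1} \<phi>" using assms(6) by (auto simp: Ck_def)
  have \<phi>0: "Lim (at_right 0) \<phi> = \<phi> 0"
    by (rule tendsto_Lim[OF _ continuous_on_Icc_at_rightD[OF \<phi>_cont]]) auto
  have \<phi>1: "\<phi> 1 = gR 0"
    using assms(11) tendsto_Lim[OF _ continuous_on_Icc_at_leftD[OF \<phi>_cont]] by simp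
  obtain Kb where Kb: "\<And>i j x t. i + 2 * j \<le> 4 \<Longrightarrow> (x, t) \<in> Qbar \<Longrightarrow> \<bar>partial i j b x t\<bar> \<le> Kb"
    using C_hoelder_bound[OF assms(3,1)] by blast
  obtain Kf where Kf: "\<And>i j x t. i + 2 * j \<le> 4 \<Longrightarrow> (x, t) \<in> Qbar \<Longrightarrow> \<bar>partial i j f x t\<bar> \<le> Kf"
    using C_hoelder_bound[OF assms(2,1)] by blast
  obtain KL where KL: "\<And>i s. i \<le> 2 \<Longrightarrow> s \<in> {0..1} \<Longrightarrow> \<bar>(deriv01 ^^ i) gL s\<bar> \<le> KL"
    using Ck_bound[OF assms(4)] by blast
  obtain KR where KR: "\<And>i s. i \<le> 2 \<Longrightarrow> s \<in> {0..1} \<Longrightarrow> \<bar>(deriv01 ^^ i) gR s\<bar> \<le> KR"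
    using Ck_bound[OF assms(5)] by blast
  obtain Kp where Kp: "\<And>i s. i \<le> 4 \<Longrightarrow> s \<in> {0..1} \<Longrightarrow> \<bar>(deriv01 ^^ i) \<phi> s\<bar> \<le> Kp"
    using Ck_bound[OF assms(6)] by blast
  define K0 where "K0 = Max {1, Kb, Kf, KL, KR, Kp}"
  have K0: "1 \<le> K0" "Kb \<le> K0" "Kf \<le> K0" "KL \<le> K0" "KR \<le> K0" "Kp \<le> K0"
    by (simp_all add: K0_def)
  \<comment> \<open>The strict inequality \<open>b > \<beta>\<close> becomes a uniform gap, since
    \<open>b\<close> attains its minimum on the compact square.\<close>
  obtain \<eta> where \<eta>: "0 < \<eta>" "\<And>x t. (x, t) \<in> Qbar \<Longrightarrow> \<beta> + \<eta> \<le> b x t"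
  proof -
    have "compact Qbar" "Qbar \<noteq> {}" by (auto simp: Qbar_def intro: compact_Times)
    then obtain p where p: "p \<in> Qbar" "\<And>q. q \<in> Qbar \<Longrightarrow> (case p of (x, t) \<Rightarrow> b x t) \<le> (case q of (x, t) \<Rightarrow> b x t)"
      using continuous_attains_inf[OF _ _ C_hoelder_continuous[OF assms(3,1)]] by blast
    show ?thesis
    proof (rule that[of "(case p of (x, t) \<Rightarrow> b x t) - \<beta>"])
      show "0 < (case p of (x, t) \<Rightarrow> b x t) - \<beta>" using assms(8) p(1) by auto
      show "\<beta> + ((case p of (x, t) \<Rightarrow> b x t) - \<beta>) \<le> b x t" if "(x, t) \<in> Qbar" for x t using p(2)[OF that] by simp
    qed
  qed
  define \<kappa> where "\<kappa> = \<beta> / (4 * b 0 0)"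
  have c: "\<beta> + \<eta> \<le> b 0 0" by (rule \<eta>(2)) (simp add: Qbar_def)
  \<comment> \<open>Strictness comes from the margin in \<open>b 0 0\<close>; it is what lets
    \<open>th_bound\<close> trade Gaussian decay for polynomial factors.\<close>
  have "\<kappa> < 1 / 4" using c \<eta>(1) assms(7) by (simp add: \<kappa>_def divide_less_eq)
  then obtain C where C: "0 \<le> C" "\<forall>x\<ge>0. \<forall>t>0.
    (\<forall>n\<le>4. \<bar>th n x t\<bar> \<le> C * exp (- \<kappa> * x\<^sup>2 / t) / sqrt (x\<^sup>2 + t) ^ n) \<and>
    \<bar>zeta x t\<bar> \<le> C * exp (- \<kappa> * x\<^sup>2 / t) * t \<and>
    \<bar>zeta1 x t\<bar> \<le> C * exp (- \<kappa> * x\<^sup>2 / t) * sqrt t"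
    using th_bound by blast
  have kernel: "kernel_bounds (b 0 0) \<beta> \<eta> \<kappa> C"
    by (rule kernel_bounds.intro) (use assms(7) \<eta>(1) c C in \<open>auto simp: \<kappa>_def\<close>)
  interpret problem_data b f gL gR \<phi> \<beta> \<gamma> K0 \<eta> \<kappa> C
  proof (rule problem_data.intro)
    show "\<bar>partial i j b x t\<bar> \<le> K0" "\<bar>partial i j f x t\<bar> \<le> K0" if "i + 2 * j \<le> 4" "(x, t) \<in> Qbar" for i j x t
      using Kb[OF that] Kf[OF that] K0 by linarith+
    show "\<bar>(deriv01 ^^ i) gL s\<bar> \<le> K0" "\<bar>(deriv01 ^^ i) gR s\<bar> \<le> K0" if "i \<le> 2" "s \<in> {0..1}" for i s
      using KL[OF that] KR[OF that] K0 by linarith+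
    show "\<bar>(deriv01 ^^ i) \<phi> s\<bar> \<le> K0" if "i \<le> 4" "s \<in> {0..1}" for i s using Kp[OF that] K0 by linarith
  qed (use assms \<phi>0 \<phi>1 K0 \<eta> kernel in auto)
  \<comment> \<open>The parameters of \<open>CF\<close> are fixed by the data, before
    \<open>\<epsilon>\<close>, \<open>N\<close>, \<open>M\<close>, \<open>y\<close> and
    \<open>Y\<close> appear. The absolute value spares a proof that it is nonnegative.\<close>
  define C' where "C' = \<bar>scaled_problem.CF \<beta> \<eta> \<kappa> C K\<bar>"
  show ?thesis
  \<comment> \<open>The error bound obtained has \<open>ln M / M\<close> in time. Since
    \<open>M \<ge> 2\<close> gives \<open>ln M \<ge> 2 / 3\<close>, it is at most
    \<open>3 / 2\<close> times \<open>ln\<^sup>2 M / M\<close>.\<close>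
  proof (intro exI[of _ "C' * (3 / 2)"] allI impI)
    fix \<epsilon> N M y Y
    assume A: "0 < \<epsilon> \<and> \<epsilon> \<le> 1 \<and> compatible b f gR \<phi> \<epsilon> \<and>
      N > 0 \<and> 4 dvd N \<and> M > 0 \<and> even M \<and>
      solves_Y b f gL gR \<phi> \<epsilon> y \<and> solves_D b f gL \<phi> \<beta> \<epsilon> N M y Y"
    define d where "d = sqrt \<epsilon>"
    have d: "0 < d" "d \<le> 1" "\<epsilon> = d\<^sup>2" using A by (auto simp: d_def)
    define \<nu> \<mu> where "\<nu> = (ln (real N) / real N)\<^sup>2" and "\<mu> = ln (real M) / real M"
    define P where "P = real N powi (-2) * max ((ln (real N))\<^sup>2) (ln (real M)) + real M powi (-1) * (ln (real M))\<^sup>2"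
    have "2 \<le> M" using A by (auto elim!: evenE)
    then have lM: "2 / 3 \<le> ln (real M)" by (rule ln_nat_ge)
    have "\<nu> + \<mu> \<le> 3 / 2 * P"
    proof -
      have "\<nu> = real N powi (-2) * (ln (real N))\<^sup>2"
        by (simp add: \<nu>_def power_int_minus power_mult_distrib power_inverse divide_inverse mult.commute)
      also have "\<dots> \<le> real N powi (-2) * max ((ln (real N))\<^sup>2) (ln (real M))"
        by (intro mult_left_mono) (auto simp: power_int_minus)
      finally have 1: "\<nu> \<le> real N powi (-2) * max ((ln (real N))\<^sup>2) (ln (real M))" .
      have "ln (real M) * (2 / 3) \<le> ln (real M) * ln (real M)" using lM by (intro mult_left_mono) auto
      then have "ln (real M) * (2 / 3) / real M \<le> ln (real M) * ln (real M) / real M" by (rule divide_right_mono) simp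
      then have "\<mu> * (2 / 3) \<le> (ln (real M))\<^sup>2 / real M" by (simp add: \<mu>_def power2_eq_square)
      also have "\<dots> = real M powi (-1) * (ln (real M))\<^sup>2"
        by (simp add: power_int_minus divide_inverse mult.commute)
      finally have 2: "\<mu> \<le> 3 / 2 * (real M powi (-1) * (ln (real M))\<^sup>2)" by simp
      have "0 \<le> \<nu>" by (simp add: \<nu>_def)
      moreover have "\<nu> + \<mu> \<le> 3 / 2 * (p + q)" if "0 \<le> \<nu>" "\<nu> \<le> p" "\<mu> \<le> 3 / 2 * q" for p q
        using that by simp
      ultimately show ?thesis unfolding P_def using 1 2 by blast
    qed
    then have P: "C' * (\<nu> + \<mu>) \<le> C' * (3 / 2) * P"
      using mult_left_mono[of "\<nu> + \<mu>" "3 / 2 * P" C'] by (simp add: C'_def mult.assoc)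
    have "\<bar>y (xmesh \<beta> \<epsilon> N i) (tmesh \<beta> \<epsilon> M j) - Y i j\<bar> \<le> C' * (3 / 2) * P" if "i \<le> N" "j \<le> M" for i j
    proof -
      have "\<bar>y (xmesh \<beta> \<epsilon> N i) (tmesh \<beta> \<epsilon> M j) - Y i j\<bar> \<le> scaled_problem.CF \<beta> \<eta> \<kappa> C K * (\<nu> + \<mu>)"
        unfolding d(3) \<nu>_def \<mu>_def by (rule scheme_error_original) (use A d that in auto)
      also have "\<dots> \<le> C' * (\<nu> + \<mu>)"
        using lM unfolding C'_def by (intro mult_right_mono) (auto simp: \<nu>_def \<mu>_def)
      finally show ?thesis using P by linarith
    qed
    then show "Max ((\<lambda>(i, j). \<bar>y (xmesh \<beta> \<epsilon> N i) (tmesh \<beta> \<epsilon> M j) - Y i j\<bar>) ` ({..N} \<times> {..M}))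
      \<le> C' * (3 / 2) * (real N powi (-2) * max ((ln (real N))\<^sup>2) (ln (real M)) + real M powi (-1) * (ln (real M))\<^sup>2)"
      unfolding P_def[symmetric] by (intro Max.boundedI) auto
  qed
qed


end
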